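(* Let $k\ge 0$, and let $\mathcal{E}$ be a stringent category. Then the $k$-dimensional Waldhausen construction $S^{\langle k\rangle}(\mathcal{E})$ is a fully $2k$-Segal category.
   Context: **Higher Segal conditions.** Let $[n]=\{0,1,\dots,n\}$ and $I\subseteq [n]$. A gap of $I$ is an element $j\in[n]\setminus I$; it is even (resp. odd) if $\#\{i\in I\mid i>j\}$ is even (resp. odd). $I$ is called even (resp. odd) if all its gaps are even (resp. odd). For $n\ge d\ge 0$, let $\mathcal{L}([n],d)$ (resp. $\mathcal{U}([n],d)$) be the poset, under inclusion, of all nonempty subsets $J\subseteq[n]$ contained in some even (resp. odd) subset $I\subseteq[n]$ with $\#I=d+1$. For a simplicial object $X$ and a nonempty finite linearly ordered set $I$, write $X_I$ for the value of $X$ on $I$ (so $X_I\cong X_{\#I-1}$). $X$ is lower $d$-Segal if for every $n\ge d$ the natural map $X_n\to\varprojlim_{I\in\mathcal{L}([n],d)}X_I$ is an equivalence; upper $d$-Segal if for every $n\ge d$ the natural map $X_n\to\varprojlim_{I\in\mathcal{U}([n],d)}X_I$ is an equivalence; fully $d$-Segal if both hold. A fully $d$-Segal category is a simplicial object in small categories with this property, where equivalence means equivalence of categories and limits are taken in the homotopy-invariant sense (pseudo-limits of categories). **Proto-exact and stringent categories.** A proto-exact category is a pointed category with two classes of morphisms, admissible monomorphisms ($\rightarrowtail$) and admissible epimorphisms ($\twoheadrightarrow$), such that: all $0\to A$ are admissible monos and all $A\to0$ admissible epis; both classes contain all isomorphisms and are closed under composition; a commutative square with two parallel sides admissible monos and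 the other two parallel sides admissible epis is cartesian if and only if it is cocartesian; every $A'\rightarrowtail B'\twoheadleftarrow B$ and every $A'\twoheadleftarrow A\rightarrowtail B$ can be completed to a bicartesian square of this type. A short exact sequence $A\rightarrowtail B\twoheadrightarrow C$ is such a bicartesian square with fourth vertex $0$. A morphism is admissible if it factors as an admissible epimorphism followed by an admissible monomorphism. A pointed category is stringent if it carries a proto-exact structure in which every morphism that admits a kernel or a cokernel is admissible; this structure is then given by the class of all kernel-cokernel pairs, and it is the one used. **Waldhausen construction.** Let $\mathcal{E}$ be proto-exact. A sequence of admissible morphisms $A_{r}\to A_{r-1}\to\cdots\to A_0$ with factorizations $A_i\twoheadrightarrow C_i\rightarrowtail A_{i-1}$ ($1\le i\le r$) is acyclic if $C_{i+1}\rightarrowtail A_i\twoheadrightarrow C_i$ is a short exact sequence for all $0<i<r$; it is exact if in addition $A_r\to A_{r-1}$ is an admissible monomorphism and $A_1\to A_0$ is an admissible epimorphism. Let $\mathrm{Fun}([k],[n])$ be the poset of monotone maps $[k]\to[n]$ with pointwise order (its objects are the $k$-simplices of $\Delta^n$). $S^{\langle k\rangle}_n(\mathcal{E})$ is the full subcategory of $\mathrm{Fun}(\mathrm{Fun}([k],[n]),\mathcal{E})$ on the diagrams $A$ such that: (a) $A_\beta=0$ for every degenerate $k$-simplex $\beta$ of $\Delta^n$ (an empty condition if $k=0$); (b) for every $(k+1)$-simplex $\gamma$ of $\Delta^n$, the sequence $A_{d_{k+1}^*\gamma}\to A_{d_k^*\gamma}\to\cdots\to A_{d_0^*\gamma}$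 is exact, where $d_i^*\gamma$ is $\gamma$ with its $i$-th vertex omitted. By functoriality in $[n]$ this gives a simplicial category $S^{\langle k\rangle}(\mathcal{E})$. *)

theory Defs
  imports "HOL-Library.FuncSet"
begin

section \<open>Categories\<close>

text \<open>
  Small categories with object set \<open>Obj\<close> and arrow set \<open>Arr\<close>;
  \<open>g \<cdot> f\<close> is "first \<open>f\<close>, then \<open>g\<close>".
\<close>

record ('o, 'm) cat =
  Obj :: "'o set"
  Arr :: "'m set"
  Dom :: "'m \<Rightarrow> 'o"
  Cod :: "'m \<Rightarrow> 'o"
  Id :: "'o \<Rightarrow> 'm"
  Comp :: "'m \<Rightarrow> 'm \<Rightarrow> 'm"  (infixr "\<cdot>\<index>" 70)

definition hom :: "('o, 'm) cat \<Rightarrow> 'o \<Rightarrow> 'o \<Rightarrow> 'm set" where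
  "hom C a b = {f \<in> Arr C. Dom C f = a \<and> Cod C f = b}"

locale category =
  fixes C :: "('o, 'm) cat" (structure)
  assumes dom_closed: "f \<in> Arr C \<Longrightarrow> Dom C f \<in> Obj C"
    and cod_closed: "f \<in> Arr C \<Longrightarrow> Cod C f \<in> Obj C"
    and id_closed: "a \<in> Obj C \<Longrightarrow> Id C a \<in> hom C a a"
    and comp_closed: "\<lbrakk>f \<in> hom C a b; g \<in> hom C b c\<rbrakk> \<Longrightarrow> g \<cdot> f \<in> hom C a c"
    and id_left: "f \<in> hom C a b \<Longrightarrow> Id C b \<cdot> f = f"
    and id_right: "f \<in> hom C a b \<Longrightarrow> f \<cdot> Id C a = f"
    and assoc: "\<lbrakk>f \<in> hom C a b; g \<in> hom C b c; h \<in> hom C c d\<rbrakk> \<Longrightarrow> (h \<cdot> g) \<cdot> f = h \<cdot> (g \<cdot> f)"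

definition iso_arr :: "('o, 'm) cat \<Rightarrow> 'm \<Rightarrow> bool" where
  "iso_arr C f \<longleftrightarrow> f \<in> Arr C \<and>
     (\<exists>g \<in> hom C (Cod C f) (Dom C f).
        g \<cdot>\<^bsub>C\<^esub> f = Id C (Dom C f) \<and> f \<cdot>\<^bsub>C\<^esub> g = Id C (Cod C f))"

definition full_subcategory :: "('o, 'm) cat \<Rightarrow> ('o \<Rightarrow> bool) \<Rightarrow> ('o, 'm) cat" where
  "full_subcategory C P =
     C\<lparr>Obj := {a \<in> Obj C. P a}, Arr := {f \<in> Arr C. P (Dom C f) \<and> P (Cod C f)}\<rparr>"

definition poset_cat :: "'a set \<Rightarrow> ('a \<Rightarrow> 'a \<Rightarrow> bool) \<Rightarrow> ('a, 'a \<times> 'a) cat" where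
  "poset_cat S le =
     \<lparr>Obj = S, Arr = {(a, b). a \<in> S \<and> b \<in> S \<and> le a b}, Dom = fst, Cod = snd,
      Id = (\<lambda>a. (a, a)), Comp = (\<lambda>g f. (fst f, snd g))\<rparr>"

subsection \<open>Functors, natural transformations, equivalences\<close>

record ('o, 'm, 'p, 'q) ftr =
  obj_map :: "'o \<Rightarrow> 'p"
  arr_map :: "'m \<Rightarrow> 'q"

definition is_functor :: "('o, 'm) cat \<Rightarrow> ('p, 'q) cat \<Rightarrow> ('o, 'm, 'p, 'q) ftr \<Rightarrow> bool" where
  "is_functor C D F \<longleftrightarrow>
     (\<forall>a \<in> Obj C. obj_map F a \<in> Obj D) \<and>
     (\<forall>f \<in> Arr C. arr_map F f \<in> hom D (obj_map F (Dom C f)) (obj_map F (Cod C f))) \<and>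
     (\<forall>a \<in> Obj C. arr_map F (Id C a) = Id D (obj_map F a)) \<and>
     (\<forall>f \<in> Arr C. \<forall>g \<in> Arr C. Dom C g = Cod C f \<longrightarrow>
        arr_map F (g \<cdot>\<^bsub>C\<^esub> f) = arr_map F g \<cdot>\<^bsub>D\<^esub> arr_map F f)"

definition id_ftr :: "('o, 'm, 'o, 'm) ftr" where
  "id_ftr = \<lparr>obj_map = (\<lambda>a. a), arr_map = (\<lambda>f. f)\<rparr>"

definition comp_ftr ::
  "('p, 'q, 'r, 's) ftr \<Rightarrow> ('o, 'm, 'p, 'q) ftr \<Rightarrow> ('o, 'm, 'r, 's) ftr" where
  "comp_ftr G F = \<lparr>obj_map = obj_map G \<circ> obj_map F, arr_map = arr_map G \<circ> arr_map F\<rparr>"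

definition natural ::
  "('o, 'm) cat \<Rightarrow> ('p, 'q) cat \<Rightarrow> ('o, 'm, 'p, 'q) ftr \<Rightarrow> ('o, 'm, 'p, 'q) ftr
    \<Rightarrow> ('o \<Rightarrow> 'q) \<Rightarrow> bool" where
  "natural C D F G \<eta> \<longleftrightarrow>
     (\<forall>a \<in> Obj C. \<eta> a \<in> hom D (obj_map F a) (obj_map G a)) \<and>
     (\<forall>f \<in> Arr C. \<eta> (Cod C f) \<cdot>\<^bsub>D\<^esub> arr_map F f = arr_map G f \<cdot>\<^bsub>D\<^esub> \<eta> (Dom C f))"

definition naturally_isomorphic ::
  "('o, 'm) cat \<Rightarrow> ('p, 'q) cat \<Rightarrow> ('o, 'm, 'p, 'q) ftr \<Rightarrow> ('o, 'm, 'p, 'q) ftr \<Rightarrow> bool" where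
  "naturally_isomorphic C D F G \<longleftrightarrow>
     (\<exists>\<eta>. natural C D F G \<eta> \<and> (\<forall>a \<in> Obj C. iso_arr D (\<eta> a)))"

definition is_equivalence ::
  "('o, 'm) cat \<Rightarrow> ('p, 'q) cat \<Rightarrow> ('o, 'm, 'p, 'q) ftr \<Rightarrow> bool" where
  "is_equivalence C D F \<longleftrightarrow> is_functor C D F \<and>
     (\<exists>G. is_functor D C G \<and>
        naturally_isomorphic C C (comp_ftr G F) id_ftr \<and>
        naturally_isomorphic D D (comp_ftr F G) id_ftr)"

subsection \<open>Functor categories\<close>

text \<open>
  Objects and components are required to be \<open>undefined\<close> outside the relevant sets, so that
  equality of functors and of natural transformations is the intended one. An arrow carries its
  source and target functor.
\<close>

record ('o, 'm, 'p, 'q) nat_trans =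
  nt_src :: "('o, 'm, 'p, 'q) ftr"
  nt_tgt :: "('o, 'm, 'p, 'q) ftr"
  nt_comp :: "'o \<Rightarrow> 'q"

definition extensional_ftr :: "('o, 'm) cat \<Rightarrow> ('o, 'm, 'p, 'q) ftr \<Rightarrow> bool" where
  "extensional_ftr C F \<longleftrightarrow>
     obj_map F \<in> extensional (Obj C) \<and> arr_map F \<in> extensional (Arr C)"

definition functor_cat ::
  "('o, 'm) cat \<Rightarrow> ('p, 'q) cat
    \<Rightarrow> (('o, 'm, 'p, 'q) ftr, ('o, 'm, 'p, 'q) nat_trans) cat" where
  "functor_cat C D =
     \<lparr>Obj = {F. is_functor C D F \<and> extensional_ftr C F},
      Arr = {\<sigma>. is_functor C D (nt_src \<sigma>) \<and> extensional_ftr C (nt_src \<sigma>) \<and>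
                 is_functor C D (nt_tgt \<sigma>) \<and> extensional_ftr C (nt_tgt \<sigma>) \<and>
                 natural C D (nt_src \<sigma>) (nt_tgt \<sigma>) (nt_comp \<sigma>) \<and>
                 nt_comp \<sigma> \<in> extensional (Obj C)},
      Dom = nt_src,
      Cod = nt_tgt,
      Id = (\<lambda>F. \<lparr>nt_src = F, nt_tgt = F, nt_comp = (\<lambda>a \<in> Obj C. Id D (obj_map F a))\<rparr>),
      Comp = (\<lambda>\<tau> \<sigma>. \<lparr>nt_src = nt_src \<sigma>, nt_tgt = nt_tgt \<tau>,
                       nt_comp = (\<lambda>a \<in> Obj C. nt_comp \<tau> a \<cdot>\<^bsub>D\<^esub> nt_comp \<sigma> a)\<rparr>)\<rparr>"

definition pullback_ftr ::
  "('a, 'b) cat \<Rightarrow> ('a, 'b, 'o, 'm) ftr \<Rightarrow> ('o, 'm, 'p, 'q) ftr \<Rightarrow> ('a, 'b, 'p, 'q) ftr" where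
  "pullback_ftr B U F =
     \<lparr>obj_map = restrict (obj_map F \<circ> obj_map U) (Obj B),
      arr_map = restrict (arr_map F \<circ> arr_map U) (Arr B)\<rparr>"

text \<open>For \<open>U : B \<rightarrow> C\<close>, precomposition with \<open>U\<close> as a functor from
  \<open>functor_cat C D\<close> to \<open>functor_cat B D\<close>.\<close>

definition precomp_ftr ::
  "('a, 'b) cat \<Rightarrow> ('a, 'b, 'o, 'm) ftr
    \<Rightarrow> (('o, 'm, 'p, 'q) ftr, ('o, 'm, 'p, 'q) nat_trans,
        ('a, 'b, 'p, 'q) ftr, ('a, 'b, 'p, 'q) nat_trans) ftr" where
  "precomp_ftr B U =
     \<lparr>obj_map = pullback_ftr B U,
      arr_map = (\<lambda>\<sigma>. \<lparr>nt_src = pullback_ftr B U (nt_src \<sigma>),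
                      nt_tgt = pullback_ftr B U (nt_tgt \<sigma>),
                      nt_comp = restrict (nt_comp \<sigma> \<circ> obj_map U) (Obj B)\<rparr>)\<rparr>"

section \<open>Pseudo-limits of categories over posets\<close>

text \<open>
  Let \<open>P\<close> be a set of indices, \<open>D i\<close> a category for \<open>i \<in> P\<close>, and \<open>R j i : D i \<rightarrow> D j\<close> for
  \<open>j \<le> i\<close> strictly functorial restriction functors. An object of the pseudo-limit consists of
  objects \<open>x i\<close> and isomorphisms \<open>\<phi> j i : R j i (x i) \<rightarrow> x j\<close> that are normalised and satisfy
  the cocycle condition; an arrow is a family of arrows compatible with these isomorphisms.
\<close>

record ('i, 'o, 'm) pl_obj =
  pl_val :: "'i \<Rightarrow> 'o"
  pl_iso :: "'i \<Rightarrow> 'i \<Rightarrow> 'm"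

record ('i, 'o, 'm) pl_arr =
  pl_src :: "('i, 'o, 'm) pl_obj"
  pl_tgt :: "('i, 'o, 'm) pl_obj"
  pl_comp :: "'i \<Rightarrow> 'm"

definition pl_objects ::
  "'i::order set \<Rightarrow> ('i \<Rightarrow> ('o, 'm) cat) \<Rightarrow> ('i \<Rightarrow> 'i \<Rightarrow> ('o, 'm, 'o, 'm) ftr)
    \<Rightarrow> ('i, 'o, 'm) pl_obj set" where
  "pl_objects P D R = {x.
     pl_val x \<in> (\<Pi>\<^sub>E i \<in> P. Obj (D i)) \<and>
     (\<forall>i \<in> P. \<forall>j \<in> P. j \<le> i \<longrightarrow>
        pl_iso x j i \<in> hom (D j) (obj_map (R j i) (pl_val x i)) (pl_val x j) \<and>
        iso_arr (D j) (pl_iso x j i)) \<and>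
     (\<forall>i j. \<not> (i \<in> P \<and> j \<in> P \<and> j \<le> i) \<longrightarrow> pl_iso x j i = undefined) \<and>
     (\<forall>i \<in> P. pl_iso x i i = Id (D i) (pl_val x i)) \<and>
     (\<forall>i \<in> P. \<forall>j \<in> P. \<forall>l \<in> P. l \<le> j \<and> j \<le> i \<longrightarrow>
        pl_iso x l i = pl_iso x l j \<cdot>\<^bsub>D l\<^esub> arr_map (R l j) (pl_iso x j i))}"

definition pl_arrows ::
  "'i::order set \<Rightarrow> ('i \<Rightarrow> ('o, 'm) cat) \<Rightarrow> ('i \<Rightarrow> 'i \<Rightarrow> ('o, 'm, 'o, 'm) ftr)
    \<Rightarrow> ('i, 'o, 'm) pl_arr set" where
  "pl_arrows P D R = {f.
     pl_src f \<in> pl_objects P D R \<and> pl_tgt f \<in> pl_objects P D R \<and>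
     pl_comp f \<in> (\<Pi>\<^sub>E i \<in> P. hom (D i) (pl_val (pl_src f) i) (pl_val (pl_tgt f) i)) \<and>
     (\<forall>i \<in> P. \<forall>j \<in> P. j \<le> i \<longrightarrow>
        pl_comp f j \<cdot>\<^bsub>D j\<^esub> pl_iso (pl_src f) j i =
        pl_iso (pl_tgt f) j i \<cdot>\<^bsub>D j\<^esub> arr_map (R j i) (pl_comp f i))}"

definition pseudo_limit ::
  "'i::order set \<Rightarrow> ('i \<Rightarrow> ('o, 'm) cat) \<Rightarrow> ('i \<Rightarrow> 'i \<Rightarrow> ('o, 'm, 'o, 'm) ftr)
    \<Rightarrow> (('i, 'o, 'm) pl_obj, ('i, 'o, 'm) pl_arr) cat" where
  "pseudo_limit P D R =
     \<lparr>Obj = pl_objects P D R,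
      Arr = pl_arrows P D R,
      Dom = pl_src,
      Cod = pl_tgt,
      Id = (\<lambda>x. \<lparr>pl_src = x, pl_tgt = x, pl_comp = (\<lambda>i \<in> P. Id (D i) (pl_val x i))\<rparr>),
      Comp = (\<lambda>g f. \<lparr>pl_src = pl_src f, pl_tgt = pl_tgt g,
                      pl_comp = (\<lambda>i \<in> P. pl_comp g i \<cdot>\<^bsub>D i\<^esub> pl_comp f i)\<rparr>)\<rparr>"

text \<open>The functor into the pseudo-limit induced by functors \<open>Q i\<close> to \<open>D i\<close> which satisfy
  \<open>R j i \<circ> Q i = Q j\<close> strictly; hence the comparison isomorphisms are identities.\<close>

definition pl_obj_of ::
  "'i::order set \<Rightarrow> ('i \<Rightarrow> ('o, 'm) cat) \<Rightarrow> ('i \<Rightarrow> ('a, 'b, 'o, 'm) ftr) \<Rightarrow> 'a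
    \<Rightarrow> ('i, 'o, 'm) pl_obj" where
  "pl_obj_of P D Q x =
     \<lparr>pl_val = (\<lambda>i \<in> P. obj_map (Q i) x),
      pl_iso = (\<lambda>j i. if i \<in> P \<and> j \<in> P \<and> j \<le> i then Id (D j) (obj_map (Q j) x)
                      else undefined)\<rparr>"

definition pl_induced ::
  "('a, 'b) cat \<Rightarrow> 'i::order set \<Rightarrow> ('i \<Rightarrow> ('o, 'm) cat) \<Rightarrow> ('i \<Rightarrow> ('a, 'b, 'o, 'm) ftr)
    \<Rightarrow> ('a, 'b, ('i, 'o, 'm) pl_obj, ('i, 'o, 'm) pl_arr) ftr" where
  "pl_induced A P D Q =
     \<lparr>obj_map = pl_obj_of P D Q,
      arr_map = (\<lambda>f. \<lparr>pl_src = pl_obj_of P D Q (Dom A f), pl_tgt = pl_obj_of P D Q (Cod A f),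
                      pl_comp = (\<lambda>i \<in> P. arr_map (Q i) f)\<rparr>)\<rparr>"

section \<open>Simplicial categories and higher Segal conditions\<close>

text \<open>A monotone map \<open>\<theta> : [k] \<rightarrow> [n]\<close>, equivalently a \<open>k\<close>-simplex of \<open>\<Delta>\<^sup>n\<close>, is encoded as
  the list of its values \<open>[\<theta> 0, \<dots>, \<theta> k]\<close>.\<close>

definition simplices :: "nat \<Rightarrow> nat \<Rightarrow> nat list set" where
  "simplices k n = {\<beta>. length \<beta> = Suc k \<and> sorted \<beta> \<and> set \<beta> \<subseteq> {0..n}}"

definition comp_mono :: "nat list \<Rightarrow> nat list \<Rightarrow> nat list" where
  "comp_mono \<theta> \<beta> = map (\<lambda>i. \<theta> ! i) \<beta>"

text \<open>\<open>sact X m n \<theta> : X\<^sub>n \<rightarrow> X\<^sub>m\<close> is the action of \<open>\<theta> : [m] \<rightarrow> [n]\<close>.\<close>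

record ('o, 'm) simplicial_cat =
  scat :: "nat \<Rightarrow> ('o, 'm) cat"
  sact :: "nat \<Rightarrow> nat \<Rightarrow> nat list \<Rightarrow> ('o, 'm, 'o, 'm) ftr"

definition functor_eq_on ::
  "('o, 'm) cat \<Rightarrow> ('o, 'm, 'p, 'q) ftr \<Rightarrow> ('o, 'm, 'p, 'q) ftr \<Rightarrow> bool" where
  "functor_eq_on C F G \<longleftrightarrow>
     (\<forall>a \<in> Obj C. obj_map F a = obj_map G a) \<and> (\<forall>f \<in> Arr C. arr_map F f = arr_map G f)"

definition is_simplicial_cat :: "('o, 'm) simplicial_cat \<Rightarrow> bool" where
  "is_simplicial_cat X \<longleftrightarrow>
     (\<forall>n. category (scat X n)) \<and>
     (\<forall>m n. \<forall>\<theta> \<in> simplices m n. is_functor (scat X n) (scat X m) (sact X m n \<theta>)) \<and>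
     (\<forall>n. functor_eq_on (scat X n) (sact X n n [0..<Suc n]) id_ftr) \<and>
     (\<forall>l m n. \<forall>\<theta> \<in> simplices m n. \<forall>\<phi> \<in> simplices l m.
        functor_eq_on (scat X n) (sact X l n (comp_mono \<theta> \<phi>))
          (comp_ftr (sact X l m \<phi>) (sact X m n \<theta>)))"

definition gaps :: "nat \<Rightarrow> nat set \<Rightarrow> nat set" where
  "gaps n I = {0..n} - I"

definition even_subset :: "nat \<Rightarrow> nat set \<Rightarrow> bool" where
  "even_subset n I \<longleftrightarrow> I \<subseteq> {0..n} \<and> (\<forall>j \<in> gaps n I. even (card {i \<in> I. i > j}))"

definition odd_subset :: "nat \<Rightarrow> nat set \<Rightarrow> bool" where
  "odd_subset n I \<longleftrightarrow> I \<subseteq> {0..n} \<and> (\<forall>j \<in> gaps n I. odd (card {i \<in> I. i > j}))"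

definition lower_poset :: "nat \<Rightarrow> nat \<Rightarrow> nat set set" where
  "lower_poset n d =
     {J. J \<noteq> {} \<and> J \<subseteq> {0..n} \<and> (\<exists>I. even_subset n I \<and> card I = d + 1 \<and> J \<subseteq> I)}"

definition upper_poset :: "nat \<Rightarrow> nat \<Rightarrow> nat set set" where
  "upper_poset n d =
     {J. J \<noteq> {} \<and> J \<subseteq> {0..n} \<and> (\<exists>I. odd_subset n I \<and> card I = d + 1 \<and> J \<subseteq> I)}"

text \<open>
  For a nonempty finite set \<open>I\<close> of naturals, \<open>X\<^sub>I\<close> is \<open>X\<^sub>p\<close> with \<open>p = card I - 1\<close>, via the unique
  order isomorphism between \<open>[p]\<close> and \<open>I\<close>. Under these identifications an inclusion \<open>J \<subseteq> I\<close>
  becomes the monotone map \<open>incl J I\<close>, sending the position of an element in \<open>J\<close> to its position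
  in \<open>I\<close>.
\<close>

definition set_dim :: "nat set \<Rightarrow> nat" where
  "set_dim I = card I - 1"

definition incl :: "nat set \<Rightarrow> nat set \<Rightarrow> nat list" where
  "incl J I = map (\<lambda>x. card {y \<in> I. y < x}) (sorted_list_of_set J)"

definition val_at :: "('o, 'm) simplicial_cat \<Rightarrow> nat set \<Rightarrow> ('o, 'm) cat" where
  "val_at X I = scat X (set_dim I)"

definition restr_at ::
  "('o, 'm) simplicial_cat \<Rightarrow> nat set \<Rightarrow> nat set \<Rightarrow> ('o, 'm, 'o, 'm) ftr" where
  "restr_at X J I = sact X (set_dim J) (set_dim I) (incl J I)"

definition segal_for :: "('o, 'm) simplicial_cat \<Rightarrow> nat \<Rightarrow> nat set set \<Rightarrow> bool" where
  "segal_for X n P \<longleftrightarrow>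
     is_equivalence (scat X n) (pseudo_limit P (val_at X) (restr_at X))
       (pl_induced (scat X n) P (val_at X) (\<lambda>I. restr_at X I {0..n}))"

definition lower_segal :: "nat \<Rightarrow> ('o, 'm) simplicial_cat \<Rightarrow> bool" where
  "lower_segal d X \<longleftrightarrow> (\<forall>n \<ge> d. segal_for X n (lower_poset n d))"

definition upper_segal :: "nat \<Rightarrow> ('o, 'm) simplicial_cat \<Rightarrow> bool" where
  "upper_segal d X \<longleftrightarrow> (\<forall>n \<ge> d. segal_for X n (upper_poset n d))"

definition fully_segal_category :: "nat \<Rightarrow> ('o, 'm) simplicial_cat \<Rightarrow> bool" where
  "fully_segal_category d X \<longleftrightarrow> is_simplicial_cat X \<and> lower_segal d X \<and> upper_segal d X"

section \<open>Proto-exact and stringent categories\<close>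

definition is_zero :: "('o, 'm) cat \<Rightarrow> 'o \<Rightarrow> bool" where
  "is_zero C z \<longleftrightarrow> z \<in> Obj C \<and>
     (\<forall>a \<in> Obj C. (\<exists>!f. f \<in> hom C z a) \<and> (\<exists>!f. f \<in> hom C a z))"

definition pointed_category :: "('o, 'm) cat \<Rightarrow> bool" where
  "pointed_category C \<longleftrightarrow> category C \<and> (\<exists>z. is_zero C z)"

definition zero_arr :: "('o, 'm) cat \<Rightarrow> 'm \<Rightarrow> bool" where
  "zero_arr C f \<longleftrightarrow> f \<in> Arr C \<and>
     (\<exists>z g h. is_zero C z \<and> g \<in> hom C (Dom C f) z \<and> h \<in> hom C z (Cod C f) \<and> f = h \<cdot>\<^bsub>C\<^esub> g)"

definition is_kernel :: "('o, 'm) cat \<Rightarrow> 'm \<Rightarrow> 'm \<Rightarrow> bool" where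
  "is_kernel C f m \<longleftrightarrow> f \<in> Arr C \<and> m \<in> Arr C \<and> Cod C m = Dom C f \<and> zero_arr C (f \<cdot>\<^bsub>C\<^esub> m) \<and>
     (\<forall>h \<in> Arr C. Cod C h = Dom C f \<and> zero_arr C (f \<cdot>\<^bsub>C\<^esub> h) \<longrightarrow>
        (\<exists>!u. u \<in> hom C (Dom C h) (Dom C m) \<and> m \<cdot>\<^bsub>C\<^esub> u = h))"

definition is_cokernel :: "('o, 'm) cat \<Rightarrow> 'm \<Rightarrow> 'm \<Rightarrow> bool" where
  "is_cokernel C f e \<longleftrightarrow> f \<in> Arr C \<and> e \<in> Arr C \<and> Dom C e = Cod C f \<and> zero_arr C (e \<cdot>\<^bsub>C\<^esub> f) \<and>
     (\<forall>h \<in> Arr C. Dom C h = Cod C f \<and> zero_arr C (h \<cdot>\<^bsub>C\<^esub> f) \<longrightarrow>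
        (\<exists>!u. u \<in> hom C (Cod C e) (Cod C h) \<and> u \<cdot>\<^bsub>C\<^esub> e = h))"

text \<open>In the following three definitions the square is
  \<open>f : a \<rightarrow> b\<close> (top), \<open>g : a \<rightarrow> c\<close> (left), \<open>h : b \<rightarrow> d\<close> (right), \<open>k : c \<rightarrow> d\<close> (bottom).\<close>

definition comm_square :: "('o, 'm) cat \<Rightarrow> 'm \<Rightarrow> 'm \<Rightarrow> 'm \<Rightarrow> 'm \<Rightarrow> bool" where
  "comm_square C f g h k \<longleftrightarrow> f \<in> Arr C \<and> g \<in> Arr C \<and> h \<in> Arr C \<and> k \<in> Arr C \<and>
     Dom C f = Dom C g \<and> Cod C f = Dom C h \<and> Cod C g = Dom C k \<and> Cod C h = Cod C k \<and>
     h \<cdot>\<^bsub>C\<^esub> f = k \<cdot>\<^bsub>C\<^esub> g"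

definition cartesian :: "('o, 'm) cat \<Rightarrow> 'm \<Rightarrow> 'm \<Rightarrow> 'm \<Rightarrow> 'm \<Rightarrow> bool" where
  "cartesian C f g h k \<longleftrightarrow> comm_square C f g h k \<and>
     (\<forall>u v. comm_square C u v h k \<longrightarrow>
        (\<exists>!w. w \<in> hom C (Dom C u) (Dom C f) \<and> f \<cdot>\<^bsub>C\<^esub> w = u \<and> g \<cdot>\<^bsub>C\<^esub> w = v))"

definition cocartesian :: "('o, 'm) cat \<Rightarrow> 'm \<Rightarrow> 'm \<Rightarrow> 'm \<Rightarrow> 'm \<Rightarrow> bool" where
  "cocartesian C f g h k \<longleftrightarrow> comm_square C f g h k \<and>
     (\<forall>u v. comm_square C f g u v \<longrightarrow>
        (\<exists>!w. w \<in> hom C (Cod C h) (Cod C u) \<and> w \<cdot>\<^bsub>C\<^esub> h = u \<and> w \<cdot>\<^bsub>C\<^esub> k = v))"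

definition bicartesian :: "('o, 'm) cat \<Rightarrow> 'm \<Rightarrow> 'm \<Rightarrow> 'm \<Rightarrow> 'm \<Rightarrow> bool" where
  "bicartesian C f g h k \<longleftrightarrow> cartesian C f g h k \<and> cocartesian C f g h k"

text \<open>\<open>M\<close> and \<open>E\<close> are the classes of admissible monomorphisms and epimorphisms.\<close>

locale proto_exact =
  fixes C :: "('o, 'm) cat" (structure) and M :: "'m set" and E :: "'m set"
  assumes pointed: "pointed_category C"
    and M_arr: "M \<subseteq> Arr C"
    and E_arr: "E \<subseteq> Arr C"
    and zero_in_M: "\<lbrakk>is_zero C z; f \<in> Arr C; Dom C f = z\<rbrakk> \<Longrightarrow> f \<in> M"
    and zero_in_E: "\<lbrakk>is_zero C z; f \<in> Arr C; Cod C f = z\<rbrakk> \<Longrightarrow> f \<in> E"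
    and iso_in_M: "iso_arr C f \<Longrightarrow> f \<in> M"
    and iso_in_E: "iso_arr C f \<Longrightarrow> f \<in> E"
    and M_comp: "\<lbrakk>f \<in> M; g \<in> M; Dom C g = Cod C f\<rbrakk> \<Longrightarrow> g \<cdot> f \<in> M"
    and E_comp: "\<lbrakk>f \<in> E; g \<in> E; Dom C g = Cod C f\<rbrakk> \<Longrightarrow> g \<cdot> f \<in> E"
    and cart_iff_cocart: "\<lbrakk>comm_square C f g h k; f \<in> M; k \<in> M; g \<in> E; h \<in> E\<rbrakk>
          \<Longrightarrow> cartesian C f g h k \<longleftrightarrow> cocartesian C f g h k"
    and complete_cospan: "\<lbrakk>k \<in> M; h \<in> E; Cod C k = Cod C h\<rbrakk>
          \<Longrightarrow> \<exists>f \<in> M. \<exists>g \<in> E. bicartesian C f g h k"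
    and complete_span: "\<lbrakk>f \<in> M; g \<in> E; Dom C f = Dom C g\<rbrakk>
          \<Longrightarrow> \<exists>h \<in> E. \<exists>k \<in> M. bicartesian C f g h k"

definition short_exact :: "('o, 'm) cat \<Rightarrow> 'm set \<Rightarrow> 'm set \<Rightarrow> 'm \<Rightarrow> 'm \<Rightarrow> bool" where
  "short_exact C M E m e \<longleftrightarrow> m \<in> M \<and> e \<in> E \<and>
     (\<exists>g \<in> E. \<exists>k \<in> M. is_zero C (Cod C g) \<and> bicartesian C m g e k)"

definition admissible :: "('o, 'm) cat \<Rightarrow> 'm set \<Rightarrow> 'm set \<Rightarrow> 'm \<Rightarrow> bool" where
  "admissible C M E f \<longleftrightarrow> (\<exists>e \<in> E. \<exists>m \<in> M. Dom C m = Cod C e \<and> f = m \<cdot>\<^bsub>C\<^esub> e)"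

definition stringent :: "('o, 'm) cat \<Rightarrow> bool" where
  "stringent C \<longleftrightarrow>
     (\<exists>M E. proto_exact C M E \<and>
        (\<forall>f \<in> Arr C. (\<exists>m. is_kernel C f m) \<or> (\<exists>e. is_cokernel C f e) \<longrightarrow> admissible C M E f))"

text \<open>The proto-exact structure of a stringent category, given by all kernel-cokernel pairs.\<close>

definition kernel_cokernel_pair :: "('o, 'm) cat \<Rightarrow> 'm \<Rightarrow> 'm \<Rightarrow> bool" where
  "kernel_cokernel_pair C m e \<longleftrightarrow> is_kernel C e m \<and> is_cokernel C m e"

definition kc_monos :: "('o, 'm) cat \<Rightarrow> 'm set" where
  "kc_monos C = {m. \<exists>e. kernel_cokernel_pair C m e}"

definition kc_epis :: "('o, 'm) cat \<Rightarrow> 'm set" where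
  "kc_epis C = {e. \<exists>m. kernel_cokernel_pair C m e}"

section \<open>The higher Waldhausen construction\<close>

text \<open>A sequence \<open>A\<^sub>r \<rightarrow> \<dots> \<rightarrow> A\<^sub>0\<close> is given by its arrows \<open>f i : A\<^sub>i \<rightarrow> A\<^sub>i\<^sub>-\<^sub>1\<close>, \<open>1 \<le> i \<le> r\<close>,
  with factorizations \<open>f i = m i \<cdot> e i\<close>.\<close>

definition acyclic_seq ::
  "('o, 'm) cat \<Rightarrow> 'm set \<Rightarrow> 'm set \<Rightarrow> nat \<Rightarrow> (nat \<Rightarrow> 'm) \<Rightarrow> bool" where
  "acyclic_seq C M E r f \<longleftrightarrow>
     (\<exists>e m. (\<forall>i \<in> {1..r}. e i \<in> E \<and> m i \<in> M \<and> Dom C (m i) = Cod C (e i) \<and>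
                          f i = m i \<cdot>\<^bsub>C\<^esub> e i) \<and>
            (\<forall>i. 0 < i \<and> i < r \<longrightarrow> short_exact C M E (m (i + 1)) (e i)))"

definition exact_seq ::
  "('o, 'm) cat \<Rightarrow> 'm set \<Rightarrow> 'm set \<Rightarrow> nat \<Rightarrow> (nat \<Rightarrow> 'm) \<Rightarrow> bool" where
  "exact_seq C M E r f \<longleftrightarrow> acyclic_seq C M E r f \<and> f r \<in> M \<and> f 1 \<in> E"

definition simplex_cat :: "nat \<Rightarrow> nat \<Rightarrow> (nat list, nat list \<times> nat list) cat" where
  "simplex_cat k n = poset_cat (simplices k n) (list_all2 (\<le>))"

definition degenerate :: "nat list \<Rightarrow> bool" where
  "degenerate \<beta> \<longleftrightarrow> (\<exists>i. Suc i < length \<beta> \<and> \<beta> ! i = \<beta> ! Suc i)"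

definition face :: "nat \<Rightarrow> nat list \<Rightarrow> nat list" where
  "face i \<gamma> = take i \<gamma> @ drop (Suc i) \<gamma>"

definition waldhausen_diagram ::
  "('o, 'm) cat \<Rightarrow> 'm set \<Rightarrow> 'm set \<Rightarrow> nat \<Rightarrow> nat
    \<Rightarrow> (nat list, nat list \<times> nat list, 'o, 'm) ftr \<Rightarrow> bool" where
  "waldhausen_diagram C M E k n A \<longleftrightarrow>
     (\<forall>\<beta> \<in> simplices k n. degenerate \<beta> \<longrightarrow> is_zero C (obj_map A \<beta>)) \<and>
     (\<forall>\<gamma> \<in> simplices (k + 1) n.
        exact_seq C M E (k + 1) (\<lambda>i. arr_map A (face i \<gamma>, face (i - 1) \<gamma>)))"

text \<open>The functor \<open>Fun([k],[m]) \<rightarrow> Fun([k],[n])\<close> given by composition with \<open>\<theta> : [m] \<rightarrow> [n]\<close>.\<close>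

definition postcomp_ftr ::
  "nat list \<Rightarrow> (nat list, nat list \<times> nat list, nat list, nat list \<times> nat list) ftr" where
  "postcomp_ftr \<theta> =
     \<lparr>obj_map = comp_mono \<theta>, arr_map = (\<lambda>(\<alpha>, \<beta>). (comp_mono \<theta> \<alpha>, comp_mono \<theta> \<beta>))\<rparr>"

definition waldhausen ::
  "nat \<Rightarrow> ('o, 'm) cat \<Rightarrow> 'm set \<Rightarrow> 'm set
    \<Rightarrow> ((nat list, nat list \<times> nat list, 'o, 'm) ftr,
        (nat list, nat list \<times> nat list, 'o, 'm) nat_trans) simplicial_cat" where
  "waldhausen k C M E =
     \<lparr>scat = (\<lambda>n. full_subcategory (functor_cat (simplex_cat k n) C)
                    (waldhausen_diagram C M E k n)),
      sact = (\<lambda>m n \<theta>. precomp_ftr (simplex_cat k m) (postcomp_ftr \<theta>))\<rparr>"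

end

theory Submission
  imports Defs
begin

text \<open>
  Identify all zero arrows of the stringent category. Its arrows then form a monoid with zero, exactness
  becomes a statement about this monoid, and an object of the Waldhausen construction is a diagram on
  sorted lists of length \<open>k + 1\<close>. The key point is that exactness is local: a diagram of dimension
  \<open>k - 1\<close> is exact at every \<open>k\<close>-simplex as soon as it is exact at those covered by \<open>k\<close> pairs \<open>{w, w + 1}\<close>.
  The lower poset consists of the nonempty \<open>J\<close> such that \<open>J - {0}\<close> is covered by \<open>k\<close> such pairs. Hence this
  applies to \<open>x \<mapsto> A(0, x)\<close> for a diagram \<open>A\<close> given on the lower poset, once it is glued along unit steps,
  and \<open>A\<close> extends: its value at \<open>(x\<^sub>0, x\<^sub>1, \<dots>, x\<^sub>k)\<close> must be the cokernel of
  \<open>A(0, x\<^sub>0, x\<^sub>2, \<dots>, x\<^sub>k) \<rightarrow> A(0, x\<^sub>1, x\<^sub>2, \<dots>, x\<^sub>k)\<close>. The same description determines natural transformations.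
  The upper poset is handled by reversing both the order of the vertices and the direction of the arrows.
\<close>

text \<open>Arrows cannot be added or subtracted, so there is no element-style diagram chase: all
  steps are cancellations and factorizations through kernels and cokernels. Stringency supplies what
  is missing: an arrow with trivial kernel is a kernel, and an arrow that has a kernel or a cokernel
  has an image. Since all zero objects become one element, reversing the multiplication is a perfect
  duality.

  The \<open>k\<close> pairs come from parity: read from the top, an even subset with
  \<open>2k + 1\<close> elements consists of \<open>k\<close> disjoint pairs of neighbours and of
  \<open>0\<close>. So each list \<open>(0, x)\<close> with \<open>x\<close> of length
  \<open>k\<close> is visible on the lower poset, as are unit steps of \<open>x\<close> and squares
  of two different unit steps, but not all longer moves. The objects \<open>A(0, x)\<close> are thus
  all given, while their arrows must be reassembled and exactness at distant vertices must be
  proved. One pair \<open>{r, r + 1}\<close> is the price of one cokernel in the first vertex, which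
  makes an induction on \<open>k\<close> possible. The cokernel formula is the right end of the
  exact sequence of the simplex \<open>(0, x\<^sub>0, ..., x\<^sub>k)\<close>.\<close>

abbreviation list_le :: "nat list \<Rightarrow> nat list \<Rightarrow> bool" (infix "\<preceq>" 50) where
  "x \<preceq> y \<equiv> list_all2 (\<le>) x y"

section \<open>Categories as monoids with zero\<close>

text \<open>Arrows of a pointed category with all zero arrows identified with \<open>\<zero>\<close>, which also serves as the value of
  non-composable products. Objects are represented by their identity arrows, zero objects by \<open>\<zero>\<close>;
  \<open>H a b x\<close> says that \<open>x\<close> is an arrow from \<open>a\<close> to \<open>b\<close>, so \<open>\<zero>\<close> lies in every hom set.\<close>

locale zero_cat =
  fixes mul :: "'a \<Rightarrow> 'a \<Rightarrow> 'a" (infixr "\<bullet>" 70)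
    and zz :: 'a ("\<zero>")
    and Ob :: "'a \<Rightarrow> bool"
  assumes mul_assoc: "(x \<bullet> y) \<bullet> z = x \<bullet> (y \<bullet> z)"
    and zero_left [simp]: "\<zero> \<bullet> x = \<zero>"
    and zero_right [simp]: "x \<bullet> \<zero> = \<zero>"
    and Ob_zero [simp]: "Ob \<zero>"
    and Ob_idem: "Ob i \<Longrightarrow> i \<bullet> i = i"
begin

definition H :: "'a \<Rightarrow> 'a \<Rightarrow> 'a \<Rightarrow> bool" where
  "H a b x \<longleftrightarrow> Ob a \<and> Ob b \<and> x \<bullet> a = x \<and> b \<bullet> x = x"

text \<open>Cancellation is tested on all \<open>u\<close> and \<open>v\<close> with target
  \<open>a\<close>, whatever their sources, because an element of the monoid carries no hom set with
  it. Taking \<open>v = \<zero>\<close> shows that this contains the trivial-kernel condition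
  \<open>kz\<close>.\<close>

definition mon :: "'a \<Rightarrow> 'a \<Rightarrow> bool" where
  "mon a x \<longleftrightarrow> (\<forall>u v. a \<bullet> u = u \<longrightarrow> a \<bullet> v = v \<longrightarrow> x \<bullet> u = x \<bullet> v \<longrightarrow> u = v)"

definition epi :: "'a \<Rightarrow> 'a \<Rightarrow> bool" where
  "epi b x \<longleftrightarrow> (\<forall>u v. u \<bullet> b = u \<longrightarrow> v \<bullet> b = v \<longrightarrow> u \<bullet> x = v \<bullet> x \<longrightarrow> u = v)"

definition kz :: "'a \<Rightarrow> 'a \<Rightarrow> bool" where
  "kz a x \<longleftrightarrow> (\<forall>u. a \<bullet> u = u \<longrightarrow> x \<bullet> u = \<zero> \<longrightarrow> u = \<zero>)"

definition ez :: "'a \<Rightarrow> 'a \<Rightarrow> bool" where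
  "ez b x \<longleftrightarrow> (\<forall>u. u \<bullet> b = u \<longrightarrow> u \<bullet> x = \<zero> \<longrightarrow> u = \<zero>)"

definition ker :: "'a \<Rightarrow> 'a \<Rightarrow> 'a \<Rightarrow> 'a \<Rightarrow> bool" where
  "ker a g c m \<longleftrightarrow> H c a m \<and> g \<bullet> m = \<zero> \<and> mon c m \<and>
     (\<forall>h. a \<bullet> h = h \<longrightarrow> g \<bullet> h = \<zero> \<longrightarrow> (\<exists>u. c \<bullet> u = u \<and> m \<bullet> u = h))"

definition coker :: "'a \<Rightarrow> 'a \<Rightarrow> 'a \<Rightarrow> 'a \<Rightarrow> bool" where
  "coker b f c e \<longleftrightarrow> H b c e \<and> e \<bullet> f = \<zero> \<and> epi c e \<and>
     (\<forall>h. h \<bullet> b = h \<longrightarrow> h \<bullet> f = \<zero> \<longrightarrow> (\<exists>u. u \<bullet> c = u \<and> u \<bullet> e = h))"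

lemma H_comp: "H a b x \<Longrightarrow> H b c y \<Longrightarrow> H a c (y \<bullet> x)"
  unfolding H_def by (metis mul_assoc)

lemma HD:
  assumes "H a b x"
  shows "Ob a" "Ob b" "x \<bullet> a = x" "b \<bullet> x = x" "b \<bullet> (x \<bullet> y) = x \<bullet> y" "x \<bullet> (a \<bullet> y) = x \<bullet> y"
  using assms unfolding H_def by (auto simp flip: mul_assoc)

lemma H_zero [simp]: "Ob a \<Longrightarrow> Ob b \<Longrightarrow> H a b \<zero>"
  unfolding H_def by simp

lemma H_id: "Ob a \<Longrightarrow> H a a a"
  unfolding H_def by (simp add: Ob_idem)

lemma kerD:
  assumes "ker a g c m"
  shows "H c a m" "g \<bullet> m = \<zero>" "g \<bullet> (m \<bullet> x) = \<zero>"
  using assms unfolding ker_def by (auto simp flip: mul_assoc)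

lemma ker_ex: "ker a g c m \<Longrightarrow> a \<bullet> h = h \<Longrightarrow> g \<bullet> h = \<zero> \<Longrightarrow> \<exists>u. c \<bullet> u = u \<and> m \<bullet> u = h"
  unfolding ker_def by blast

text \<open>The factorization \<open>u\<close> is at first only known to end at \<open>c\<close>;
  that it starts at \<open>d\<close> follows by cancelling \<open>m\<close> in
  \<open>m \<bullet> (u \<bullet> d) = m \<bullet> u\<close>.\<close>

lemma ker_exH:
  assumes "ker a g c m" "H d a h" "g \<bullet> h = \<zero>"
  obtains u where "H d c u" "m \<bullet> u = h"
proof -
  obtain u where u: "c \<bullet> u = u" "m \<bullet> u = h"
    using ker_ex[OF assms(1), of h] assms(2,3) by (auto simp: H_def)
  have "c \<bullet> (u \<bullet> d) = u \<bullet> d" "m \<bullet> (u \<bullet> d) = m \<bullet> u"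
    using u assms(2) by (simp_all flip: mul_assoc add: H_def)
  hence "u \<bullet> d = u" using assms(1) u(1) unfolding ker_def mon_def by blast
  thus ?thesis using that u assms by (auto simp: H_def ker_def)
qed

lemma ker_mon: "ker a g c m \<Longrightarrow> mon c m"
  unfolding ker_def by blast

lemma mon_kz: "mon a x \<Longrightarrow> kz a x"
  unfolding mon_def kz_def by (metis zero_right)

lemma monD: "mon a x \<Longrightarrow> H c a u \<Longrightarrow> H d a v \<Longrightarrow> x \<bullet> u = x \<bullet> v \<Longrightarrow> u = v"
  unfolding mon_def H_def by blast

lemma kzD: "kz a x \<Longrightarrow> H c a u \<Longrightarrow> x \<bullet> u = \<zero> \<Longrightarrow> u = \<zero>"
  unfolding kz_def H_def by blast

lemma kerI:
  assumes "H c a m" "g \<bullet> m = \<zero>" "mon c m" "\<And>h. a \<bullet> h = h \<Longrightarrow> g \<bullet> h = \<zero> \<Longrightarrow> \<exists>u. c \<bullet> u = u \<and> m \<bullet> u = h"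
  shows "ker a g c m"
  using assms unfolding ker_def by blast

lemma mon_comp: "H a b x \<Longrightarrow> mon a x \<Longrightarrow> mon b y \<Longrightarrow> mon a (y \<bullet> x)"
  unfolding mon_def H_def by (metis mul_assoc)

lemma kz_comp: "H a b x \<Longrightarrow> kz a x \<Longrightarrow> kz b y \<Longrightarrow> kz a (y \<bullet> x)"
  unfolding kz_def H_def by (metis mul_assoc)

lemma mon_cancel: "H a b x \<Longrightarrow> mon a (y \<bullet> x) \<Longrightarrow> mon a x"
  unfolding mon_def H_def by (metis mul_assoc)

lemma kz_cancel: "H a b x \<Longrightarrow> kz a (y \<bullet> x) \<Longrightarrow> kz a x"
  unfolding kz_def H_def by (metis mul_assoc zero_right)

lemma ker_mono_comp:
  assumes "ker a g c m" "H a b g" "kz b h"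
  shows "ker a (h \<bullet> g) c m"
proof (rule kerI)
  show "H c a m" "mon c m" using assms(1) by (auto simp: ker_def)
  show "(h \<bullet> g) \<bullet> m = \<zero>" using assms(1) by (simp add: mul_assoc ker_def)
  fix u assume u: "a \<bullet> u = u" "(h \<bullet> g) \<bullet> u = \<zero>"
  have "b \<bullet> (g \<bullet> u) = g \<bullet> u" using HD[OF assms(2)] by simp
  hence "g \<bullet> u = \<zero>" using u(2) assms(3) unfolding kz_def by (simp add: mul_assoc)
  thus "\<exists>v. c \<bullet> v = v \<and> m \<bullet> v = u" using ker_ex[OF assms(1) u(1)] by blast
qed

lemma ker_mono_cancel:
  assumes "ker a (h \<bullet> g) c m" "H a b g" "kz b h"
  shows "ker a g c m"
proof (rule kerI)
  show "H c a m" "mon c m" using assms(1) by (auto simp: ker_def)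
  have "h \<bullet> (g \<bullet> m) = \<zero>" using assms(1) by (simp add: mul_assoc ker_def)
  thus "g \<bullet> m = \<zero>" using assms(2,3) unfolding kz_def by (simp add: HD)
  fix u assume u: "a \<bullet> u = u" "g \<bullet> u = \<zero>"
  thus "\<exists>v. c \<bullet> v = v \<and> m \<bullet> v = u" using ker_ex[OF assms(1) u(1)] by (simp add: mul_assoc)
qed

end

text \<open>The opposite multiplication exchanges kernels and cokernels, so that the dual of a lemma
  is an instance of it and not a second proof.\<close>

lemma zero_cat_dual:
  assumes "zero_cat mul zz Ob"
  shows "zero_cat (\<lambda>x y. mul y x) zz Ob"
proof -
  interpret zero_cat mul zz Ob by fact
  show ?thesis by unfold_locales (auto simp: mul_assoc Ob_idem)
qed

context zero_cat begin

lemmas dual_zero_cat = zero_cat_dual[OF zero_cat_axioms]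

lemma dual_H: "zero_cat.H (\<lambda>x y. y \<bullet> x) Ob a b x \<longleftrightarrow> H b a x"
  by (auto simp: zero_cat.H_def[OF dual_zero_cat] H_def)
lemma dual_mon: "zero_cat.mon (\<lambda>x y. y \<bullet> x) a x \<longleftrightarrow> epi a x"
  by (simp add: zero_cat.mon_def[OF dual_zero_cat] epi_def)
lemma dual_epi: "zero_cat.epi (\<lambda>x y. y \<bullet> x) a x \<longleftrightarrow> mon a x"
  by (simp add: zero_cat.epi_def[OF dual_zero_cat] mon_def)
lemma dual_kz: "zero_cat.kz (\<lambda>x y. y \<bullet> x) \<zero> a x \<longleftrightarrow> ez a x"
  by (simp add: zero_cat.kz_def[OF dual_zero_cat] ez_def)
lemma dual_ez: "zero_cat.ez (\<lambda>x y. y \<bullet> x) \<zero> a x \<longleftrightarrow> kz a x"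
  by (simp add: zero_cat.ez_def[OF dual_zero_cat] kz_def)
lemma dual_ker: "zero_cat.ker (\<lambda>x y. y \<bullet> x) \<zero> Ob a g c m \<longleftrightarrow> coker a g c m"
  by (simp add: zero_cat.ker_def[OF dual_zero_cat] coker_def dual_H dual_mon)
lemma dual_coker: "zero_cat.coker (\<lambda>x y. y \<bullet> x) \<zero> Ob a g c m \<longleftrightarrow> ker a g c m"
  by (simp add: zero_cat.coker_def[OF dual_zero_cat] ker_def dual_H dual_epi)

lemmas dual_simps = dual_H dual_mon dual_epi dual_kz dual_ez dual_ker dual_coker

lemma coker_exH:
  assumes "coker b f c e" "H b d h" "h \<bullet> f = \<zero>"
  obtains u where "H c d u" "u \<bullet> e = h"
  using zero_cat.ker_exH[OF dual_zero_cat, unfolded dual_simps, OF assms] by blast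

lemmas coker_ex = zero_cat.ker_ex[OF dual_zero_cat, unfolded dual_simps]
lemmas cokerD = zero_cat.kerD[OF dual_zero_cat, unfolded dual_simps]
lemmas coker_epi = zero_cat.ker_mon[OF dual_zero_cat, unfolded dual_simps]
lemmas epi_ez = zero_cat.mon_kz[OF dual_zero_cat, unfolded dual_simps]
lemmas epiD = zero_cat.monD[OF dual_zero_cat, unfolded dual_simps]
lemmas ezD = zero_cat.kzD[OF dual_zero_cat, unfolded dual_simps]
lemmas cokerI = zero_cat.kerI[OF dual_zero_cat, unfolded dual_simps]
lemmas epi_comp = zero_cat.mon_comp[OF dual_zero_cat, unfolded dual_simps]
lemmas ez_comp = zero_cat.kz_comp[OF dual_zero_cat, unfolded dual_simps]
lemmas ez_cancel = zero_cat.kz_cancel[OF dual_zero_cat, unfolded dual_simps]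
lemmas epi_cancel = zero_cat.mon_cancel[OF dual_zero_cat, unfolded dual_simps]
lemmas coker_epi_comp = zero_cat.ker_mono_comp[OF dual_zero_cat, unfolded dual_simps]
lemmas coker_epi_cancel = zero_cat.ker_mono_cancel[OF dual_zero_cat, unfolded dual_simps]

end

section \<open>Exact rows in stringent monoids\<close>

text \<open>In the factorization \<open>f = m \<bullet> e\<close> the arrow \<open>m\<close> is the
  kernel of its cokernel \<open>g\<close>, and \<open>e\<close> is the cokernel of its kernel
  \<open>l\<close>. Kernels and cokernels enter symmetrically, both in the premise and in the
  conclusion, so the axiom passes to the opposite monoid.\<close>

locale strin = zero_cat +
  assumes strin_ax: "H a b f \<Longrightarrow> (\<exists>c m. ker a f c m) \<or> (\<exists>c e. coker b f c e) \<Longrightarrow>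
    \<exists>c m e d g d' l. f = m \<bullet> e \<and> ker b g c m \<and> coker b m d g \<and> ker a e d' l \<and> coker a l c e"

lemma strin_dual:
  assumes "strin mul zz Ob"
  shows "strin (\<lambda>x y. mul y x) zz Ob"
proof -
  interpret strin mul zz Ob by fact
  interpret d: zero_cat "\<lambda>x y. mul y x" zz Ob by (rule dual_zero_cat)
  show ?thesis
  proof (unfold_locales, unfold dual_simps)
    fix a b f
    assume "H b a f" "(\<exists>c m. coker a f c m) \<or> (\<exists>c e. ker b f c e)"
    from strin_ax[OF this(1)] this(2)
    show "\<exists>c m e d g d' l. f = mul e m \<and> coker b g c m \<and> ker b m d g \<and> coker a e d' l \<and> ker a l c e"
      by blast
  qed
qed

context strin begin

lemmas dual_strin = strin_dual[OF strin_axioms]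

text \<open>Exactness of \<open>x \<rightarrow> y \<rightarrow> z\<close> at \<open>y\<close>; the notion is self-dual by \<open>dual_ex\<close> below.\<close>

definition ex :: "'a \<Rightarrow> 'a \<Rightarrow> 'a \<Rightarrow> bool" where
  "ex y f g \<longleftrightarrow> (\<exists>c m e. ker y g c m \<and> c \<bullet> e = e \<and> epi c e \<and> f = m \<bullet> e)"

text \<open>A trivial kernel is a kernel, namely \<open>\<zero>\<close>, so the axiom applies and
  gives \<open>f = m \<bullet> e\<close>. Here \<open>e\<close> is the cokernel of an arrow
  \<open>l\<close> that \<open>f\<close> kills; hence \<open>l = \<zero>\<close>, \<open>e\<close>
  is invertible, and \<open>f\<close> inherits from \<open>m\<close> that it is the kernel of its
  cokernel.\<close>

lemma kz_strong:
  assumes f: "H a b f" and k: "kz a f"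
  shows "mon a f \<and> (\<exists>d g. coker b f d g \<and> ker b g a f)"
proof -
  have Oa: "Ob a" using f by (auto simp: H_def)
  have "ker a f \<zero> \<zero>"
    by (rule kerI) (use Oa k in \<open>auto simp: kz_def mon_def\<close>)
  from strin_ax[OF f] this obtain c m e d g d' l where
    fe: "f = m \<bullet> e" and km: "ker b g c m" and cm: "coker b m d g" and ke: "ker a e d' l" and ce: "coker a l c e"
    by blast
  note He = cokerD(1)[OF ce] and Hm = kerD(1)[OF km] and Hl = kerD(1)[OF ke]
  have "f \<bullet> l = \<zero>" using kerD(2)[OF ke] by (simp add: fe mul_assoc)
  hence l0: "l = \<zero>" using kzD[OF k Hl] by blast
  obtain u where u: "H c a u" "u \<bullet> e = a"
    using coker_exH[OF ce H_id[OF Oa]] l0 by auto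
  have "(e \<bullet> u) \<bullet> e = c \<bullet> e" by (simp add: mul_assoc u HD[OF He])
  hence eu: "e \<bullet> u = c"
    using epiD[OF coker_epi[OF ce], of c "e \<bullet> u" c c] H_comp[OF u(1) He] H_id HD(2)[OF He] by blast
  have m: "m = f \<bullet> u" using eu HD(3)[OF Hm] by (simp add: fe mul_assoc)
  have "mon a e" unfolding mon_def by (metis mul_assoc u(2))
  hence me: "mon a f" using mon_comp[OF He _ ker_mon[OF km]] fe by simp
  moreover have "coker b f d g"
  proof (rule cokerI)
    show "H b d g" "epi d g" using cm by (auto simp: coker_def)
    show "g \<bullet> f = \<zero>" using cm by (simp add: fe coker_def flip: mul_assoc)
    fix h assume h: "h \<bullet> b = h" "h \<bullet> f = \<zero>"
    hence "h \<bullet> m = \<zero>" by (simp add: m flip: mul_assoc)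
    thus "\<exists>u. u \<bullet> d = u \<and> u \<bullet> g = h" using coker_ex[OF cm h(1)] by blast
  qed
  moreover have "ker b g a f"
  proof (rule kerI)
    show "H a b f" "mon a f" by fact+
    show "g \<bullet> f = \<zero>" using km by (simp add: fe ker_def flip: mul_assoc)
    fix h assume h: "b \<bullet> h = h" "g \<bullet> h = \<zero>"
    from ker_ex[OF km h] obtain v where v: "c \<bullet> v = v" "m \<bullet> v = h" by blast
    show "\<exists>u. a \<bullet> u = u \<and> f \<bullet> u = h"
      by (rule exI[of _ "u \<bullet> v"]) (use v m HD[OF u(1)] in \<open>simp add: mul_assoc\<close>)
  qed
  ultimately show ?thesis by blast
qed

lemma kz_mon: "H a b f \<Longrightarrow> kz a f \<Longrightarrow> mon a f"
  using kz_strong by blast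

lemma kz_coker:
  assumes "H a b f" "kz a f"
  obtains d g where "H b d g" "coker b f d g" "ker b g a f"
  using kz_strong[OF assms] by (auto simp: coker_def)

lemma ez_strong:
  assumes f: "H a b f" and k: "ez b f"
  shows "epi b f \<and> (\<exists>d g. ker a f d g \<and> coker a g b f)"
  using strin.kz_strong[OF dual_strin, unfolded dual_simps, OF assms] .

lemma ez_epi: "H a b f \<Longrightarrow> ez b f \<Longrightarrow> epi b f"
  using ez_strong by blast

lemma ez_ker:
  assumes "H a b f" "ez b f"
  obtains d g where "H d a g" "ker a f d g" "coker a g b f"
  using ez_strong[OF assms] by (auto simp: ker_def)

text \<open>\<open>f\<close> is already the cokernel of one of its kernels, \<open>g\<close>. Since
  \<open>g\<close> factors through \<open>m\<close>, whatever kills \<open>m\<close> also kills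
  \<open>g\<close>.\<close>

lemma coker_of_ker:
  assumes k: "ker a f c m" and f: "H a b f" and e: "ez b f"
  shows "coker a m b f"
proof -
  obtain d g where g: "H d a g" "ker a f d g" "coker a g b f" using ez_ker[OF f e] .
  obtain u where u: "H d c u" "m \<bullet> u = g" using ker_exH[OF k g(1)] kerD[OF g(2)] by auto
  show ?thesis
  proof (rule cokerI)
    show "H a b f" "f \<bullet> m = \<zero>" using f k by (auto simp: ker_def)
    show "epi b f" using ez_epi[OF f e] .
    fix h assume h: "h \<bullet> a = h" "h \<bullet> m = \<zero>"
    have "h \<bullet> g = \<zero>" using h(2) by (simp flip: u(2) mul_assoc)
    thus "\<exists>u. u \<bullet> b = u \<and> u \<bullet> f = h" using coker_ex[OF g(3) h(1)] by blast
  qed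
qed

lemma ker_of_coker:
  assumes "coker b f c e" "H a b f" "kz a f"
  shows "ker b e a f"
  using strin.coker_of_ker[OF dual_strin, unfolded dual_simps, OF assms] .

section \<open>Admissible arrows and the two descriptions of exactness\<close>

definition adm :: "'a \<Rightarrow> 'a \<Rightarrow> 'a \<Rightarrow> bool" where
  "adm a b f \<longleftrightarrow> (\<exists>c m e. H a c e \<and> ez c e \<and> H c b m \<and> kz c m \<and> f = m \<bullet> e)"

lemma adm_ker: "H a b f \<Longrightarrow> ker a f c m \<Longrightarrow> adm a b f"
  using strin_ax[of a b f] unfolding adm_def
  by (metis coker_epi cokerD(1) epi_ez kerD(1) ker_mon mon_kz)

lemma adm_coker: "H a b f \<Longrightarrow> coker b f c m \<Longrightarrow> adm a b f"
  using strin_ax[of a b f] unfolding adm_def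
  by (metis coker_epi cokerD(1) epi_ez kerD(1) ker_mon mon_kz)

text \<open>Having a kernel, \<open>g\<close> is admissible: \<open>g = n \<bullet> p\<close>. The
  arrow \<open>p\<close> has the same kernel \<open>m\<close> as \<open>g\<close> and a trivial
  cokernel, so it is the cokernel of \<open>m\<close>; composing \<open>m\<close> with the
  epimorphism \<open>e\<close> does not change that. This turns the definition through the image of
  \<open>f\<close> into the one through the coimage of \<open>g\<close>.\<close>

lemma ex_coker:
  assumes f: "H x y f" and g: "H y z g" and e: "ex y f g"
  shows "\<exists>c m e. coker y f c e \<and> m \<bullet> c = m \<and> mon c m \<and> g = m \<bullet> e"
proof -
  from e obtain c m e where c: "ker y g c m" "c \<bullet> e = e" "epi c e" "f = m \<bullet> e" by (auto simp: ex_def)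
  obtain d n p where d: "H y d p" "ez d p" "H d z n" "kz d n" "g = n \<bullet> p"
    using adm_ker[OF g c(1)] by (auto simp: adm_def)
  have "ker y p c m" using ker_mono_cancel[of y n p c m d] c(1) d by simp
  hence cm: "coker y m d p" using coker_of_ker d by blast
  have "coker y (m \<bullet> e) d p"
  proof (rule cokerI)
    show "H y d p" "epi d p" using cm by (auto simp: coker_def)
    show "p \<bullet> m \<bullet> e = \<zero>" using cm by (simp add: coker_def flip: mul_assoc)
    fix h assume h: "h \<bullet> y = h" "h \<bullet> m \<bullet> e = \<zero>"
    have "(h \<bullet> m) \<bullet> c = h \<bullet> m" using kerD(1)[OF c(1)] by (simp add: mul_assoc HD)
    hence "h \<bullet> m = \<zero>" using epi_ez[OF c(3)] h(2) by (simp add: ez_def flip: mul_assoc)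
    thus "\<exists>u. u \<bullet> d = u \<and> u \<bullet> p = h" using coker_ex[OF cm h(1)] by blast
  qed
  thus ?thesis using c(4) d kz_mon[OF d(3,4)] HD[OF d(3)] by blast
qed

lemma ex_cokerE:
  assumes f: "H x y f" and g: "H y z g" and e: "ex y f g"
  obtains c m e where "coker y f c e" "H c z m" "H y c e" "mon c m" "epi c e" "g = m \<bullet> e"
proof -
  obtain c m e where c: "coker y f c e" "m \<bullet> c = m" "mon c m" "g = m \<bullet> e"
    using ex_coker[OF assms] by blast
  have "(z \<bullet> m) \<bullet> e = m \<bullet> e" using c(4) HD[OF g] by (simp add: mul_assoc)
  hence "z \<bullet> m = m" using coker_epi[OF c(1)] c(2) unfolding epi_def by (metis mul_assoc)
  moreover have "Ob z" "Ob c" using HD[OF g] HD[OF cokerD(1)[OF c(1)]] by auto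
  ultimately have "H c z m" using c(2) by (simp add: H_def)
  thus ?thesis using that c cokerD(1)[OF c(1)] coker_epi[OF c(1)] by blast
qed

lemma dual_ex_raw:
  "strin.ex (\<lambda>x y. y \<bullet> x) \<zero> Ob y g f \<longleftrightarrow>
    (\<exists>c m e. coker y f c e \<and> m \<bullet> c = m \<and> mon c m \<and> g = m \<bullet> e)"
  unfolding strin.ex_def[OF dual_strin] dual_simps by blast

lemma dual_ex:
  assumes f: "H x y f" and g: "H y z g"
  shows "strin.ex (\<lambda>x y. y \<bullet> x) \<zero> Ob y g f \<longleftrightarrow> ex y f g"
proof
  assume "ex y f g"
  thus "strin.ex (\<lambda>x y. y \<bullet> x) \<zero> Ob y g f" using ex_coker[OF f g] dual_ex_raw by blast
next
  assume *: "strin.ex (\<lambda>x y. y \<bullet> x) \<zero> Ob y g f"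
  show "ex y f g"
    using strin.ex_coker[OF dual_strin, unfolded dual_simps, OF g f *] unfolding ex_def by blast
qed

lemma exI_coker:
  assumes f: "H x y f" and g: "H y z g" and "coker y f c e" "m \<bullet> c = m" "mon c m" "g = m \<bullet> e"
  shows "ex y f g"
  using dual_ex[OF f g] dual_ex_raw assms by blast

lemma exI_ker: "ker y g c m \<Longrightarrow> c \<bullet> e = e \<Longrightarrow> epi c e \<Longrightarrow> f = m \<bullet> e \<Longrightarrow> ex y f g"
  unfolding ex_def by blast

lemma ex_kerE:
  assumes f: "H x y f" and g: "H y z g" and e: "ex y f g"
  obtains c m e where "ker y g c m" "H x c e" "H c y m" "mon c m" "epi c e" "f = m \<bullet> e"
proof -
  have e': "strin.ex (\<lambda>x y. y \<bullet> x) \<zero> Ob y g f" using dual_ex[OF f g] e by blast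
  show ?thesis
    using strin.ex_cokerE[OF dual_strin, unfolded dual_simps, OF g f e'] that by blast
qed

lemma ex_zero: "ex y f g \<Longrightarrow> g \<bullet> f = \<zero>"
  unfolding ex_def by (auto dest: kerD(3))

lemma ex_mono: "H y z g \<Longrightarrow> kz z h \<Longrightarrow> ex y f g \<Longrightarrow> ex y f (h \<bullet> g)"
  unfolding ex_def using ker_mono_comp by blast

lemma ex_epi: 
  assumes "H w x e" "H x y f" "ez x e" "ex y f g" "H y z g"
  shows "ex y (f \<bullet> e) g"
proof -
  have "strin.ex (\<lambda>x y. y \<bullet> x) \<zero> Ob y g (f \<bullet> e)"
    using strin.ex_mono[OF dual_strin, unfolded dual_simps, of x y f e g] assms
    dual_ex by blast
  thus ?thesis using dual_ex assms H_comp by blast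
qed

text \<open>If \<open>\<zero>\<close> factors as the kernel \<open>m\<close> of \<open>g\<close>
  after an epimorphism \<open>e\<close>, then \<open>e\<close> vanishes, and so does its target
  \<open>c\<close>. In this way a monomorphism at the left end of a sequence becomes an instance of
  \<open>ex\<close>.\<close>

lemma ex_zero_left: 
  assumes "H y z g" shows "ex y \<zero> g \<longleftrightarrow> kz y g"
proof
  assume "ex y \<zero> g"
  then obtain c m e where c: "ker y g c m" "c \<bullet> e = e" "epi c e" "\<zero> = m \<bullet> e" by (auto simp: ex_def)
  have "Ob c" using HD[OF kerD(1)[OF c(1)]] by auto
  have "e = \<zero>" using c(1,2,4) mon_kz[OF ker_mon] unfolding kz_def by metis
  hence "c = \<zero>" using epi_ez[OF c(3)] \<open>Ob c\<close> unfolding ez_def by (auto simp: Ob_idem)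
  show "kz y g" unfolding kz_def
    using ker_ex[OF c(1)] \<open>c = \<zero>\<close> by (metis zero_left zero_right)
next
  assume k: "kz y g"
  have "ker y g \<zero> \<zero>"
    by (rule kerI) (use HD[OF assms] k in \<open>auto simp: kz_def mon_def\<close>)
  thus "ex y \<zero> g" unfolding ex_def by (rule_tac exI[of _ "\<zero>"], rule_tac exI[of _ "\<zero>"], rule_tac exI[of _ "\<zero>"]) (auto simp: epi_def)
qed

lemma ex_zero_right:
  assumes "H x y f" shows "ex y f \<zero> \<longleftrightarrow> ez y f"
proof -
  have h: "H y \<zero> \<zero>" using HD[OF assms] by simp
  show ?thesis
    using strin.ex_zero_left[OF dual_strin, unfolded dual_simps, OF assms] dual_ex[OF assms h] by blast
qed

lemma ex_coker_ez:
  assumes "H x y f" "H y z g" "ex y f g" "ez z g"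
  shows "coker y f z g"
proof -
  obtain c m e where c: "ker y g c m" "H x c e" "H c y m" "mon c m" "epi c e" "f = m \<bullet> e"
    using ex_kerE[OF assms(1-3)] .
  have "coker y m z g" using coker_of_ker[OF c(1) assms(2,4)] .
  thus ?thesis using coker_epi_comp[OF _ c(3) epi_ez[OF c(5)]] c(6) by blast
qed

lemma coker_ex_ez:
  assumes "coker y f z g" "H x y f"
  shows "ex y f g"
  by (rule exI_coker[OF assms(2) cokerD(1)[OF assms(1)] assms(1), of z]) 
    (use HD[OF cokerD(1)[OF assms(1)]] in \<open>auto simp: mon_def Ob_idem\<close>)

text \<open>The two exactness conditions give two factorizations of \<open>g\<close>, one through
  the kernel of \<open>h\<close> and one through the cokernel of \<open>f\<close>. The kernel
  \<open>l\<close> of the first epimorphism \<open>e\<close> is killed by the second one,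
  \<open>p\<close>, because \<open>n\<close> is a monomorphism; hence \<open>e\<close> has the
  universal property of the cokernel of \<open>f\<close> as well.\<close>

lemma ex_ex_image:
  assumes H: "H a b f" "H b c g" "H c d h" and e: "ex b f g" "ex c g h"
  obtains i m e where "coker b f i e" "ker c h i m" "g = m \<bullet> e" "H b i e" "H i c m"
proof -
  obtain i m e where i: "ker c h i m" "H b i e" "H i c m" "mon i m" "epi i e" "g = m \<bullet> e"
    using ex_kerE[OF H(2,3) e(2)] .
  obtain j n p where j: "coker b f j p" "H j c n" "H b j p" "mon j n" "epi j p" "g = n \<bullet> p"
    using ex_cokerE[OF H(1,2) e(1)] .
  obtain k l where l: "H k b l" "ker b e k l" "coker b l i e" using ez_ker[OF i(2) epi_ez[OF i(5)]] .
  have "n \<bullet> p \<bullet> l = \<zero>" using j(6) i(6) kerD(2)[OF l(2)] by (metis mul_assoc zero_right)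
  hence pl: "p \<bullet> l = \<zero>" using kzD[OF mon_kz[OF j(4)] H_comp[OF l(1) j(3)]] by simp
  have "coker b f i e"
  proof (rule cokerI)
    show "H b i e" "epi i e" by fact+
    have "m \<bullet> e \<bullet> f = \<zero>" using ex_zero[OF e(1)] i(6) by (simp add: mul_assoc)
    thus "e \<bullet> f = \<zero>" using kzD[OF mon_kz[OF i(4)] H_comp[OF H(1) i(2)]] by simp
    fix u assume u: "u \<bullet> b = u" "u \<bullet> f = \<zero>"
    obtain v where "v \<bullet> p = u" using coker_ex[OF j(1) u] by blast
    hence "u \<bullet> l = \<zero>" using pl by (metis mul_assoc zero_right)
    thus "\<exists>w. w \<bullet> i = w \<and> w \<bullet> e = u" using coker_ex[OF l(3) u(1)] by blast
  qed
  thus ?thesis using that i by blast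
qed

section \<open>Rows of kernels, of cokernels and of extensions\<close>

text \<open>Everything is compared on images: \<open>c\<close> and \<open>c0\<close> are the
  cokernels of \<open>\<alpha>1\<close> and of \<open>vb \<bullet> \<alpha>1\<close>, that is, the
  images of \<open>\<beta>1\<close> and of \<open>\<beta>0\<close>, and the induced \<open>v\<close>
  from \<open>c\<close> to \<open>c0\<close> is the cokernel of \<open>s\<close> from
  \<open>Ib\<close> to \<open>c\<close>. Having a cokernel, \<open>s\<close> is admissible; here
  stringency replaces the chase. The image \<open>d\<close> of \<open>s\<close> is the kernel of
  \<open>v\<close>, and since \<open>m0\<close> is a monomorphism, \<open>\<kappa>\<close> makes
  \<open>d\<close> the kernel of \<open>\<gamma>1 \<bullet> ic\<close>.\<close>

lemma kernel_row:
  assumes H: "H A1 B1 \<alpha>1" "H B1 C1 \<beta>1" "H C1 D1 \<gamma>1" "H B1 B0 vb" "H B0 C0 \<beta>0" "H C1 C0 vc"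
    and comm: "vc \<bullet> \<beta>1 = \<beta>0 \<bullet> vb" and vb: "ez B0 vb"
    and e: "ex B1 \<alpha>1 \<beta>1" "ex C1 \<beta>1 \<gamma>1" "ex B0 (vb \<bullet> \<alpha>1) \<beta>0"
    and k: "ker B1 vb Ib ib" "ker C1 vc Ic ic" and t: "H Ib Ic t" "ic \<bullet> t = \<beta>1 \<bullet> ib"
  shows "ex Ic t (\<gamma>1 \<bullet> ic)"
proof -
  note Hib = kerD(1)[OF k(1)] and Hic = kerD(1)[OF k(2)]
  obtain c m e where c: "coker B1 \<alpha>1 c e" "ker C1 \<gamma>1 c m" "\<beta>1 = m \<bullet> e" "H B1 c e" "H c C1 m"
    using ex_ex_image[OF H(1-3) e(1,2)] .
  have Hva: "H A1 B0 (vb \<bullet> \<alpha>1)" using H_comp[OF H(1,4)] .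
  obtain c0 m0 e0 where c0: "coker B0 (vb \<bullet> \<alpha>1) c0 e0" "H c0 C0 m0" "H B0 c0 e0" "mon c0 m0" "epi c0 e0" "\<beta>0 = m0 \<bullet> e0"
    using ex_cokerE[OF Hva H(5) e(3)] .
  have "(e0 \<bullet> vb) \<bullet> \<alpha>1 = \<zero>" using cokerD(2)[OF c0(1)] by (simp add: mul_assoc)
  then obtain v where v: "H c c0 v" "v \<bullet> e = e0 \<bullet> vb"
    using coker_exH[OF c(1) H_comp[OF H(4) c0(3)]] by blast
  have epv: "epi c0 v"
    using epi_cancel[OF v(1), of e] epi_comp[OF c0(3,5) ez_epi[OF H(4) vb]] v(2) by simp
  have "(vc \<bullet> m) \<bullet> e = (m0 \<bullet> v) \<bullet> e" using comm c(3) c0(6) v(2) by (simp add: mul_assoc)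
  hence vm: "vc \<bullet> m = m0 \<bullet> v"
    using epiD[OF coker_epi[OF c(1)] H_comp[OF c(5) H(6)] H_comp[OF v(1) c0(2)]] by blast
  define s where "s = e \<bullet> ib"
  have Hs: "H Ib c s" unfolding s_def using H_comp[OF Hib c(4)] .
  have vib: "coker B1 ib B0 vb" using coker_of_ker[OF k(1) H(4) vb] .
  \<comment> \<open>Both sides are \<open>B1\<close> divided by the images of \<open>Ib\<close> and
    of \<open>A1\<close>, in the two possible orders.\<close>
  have cs: "coker c s c0 v"
  proof (rule cokerI)
    show "H c c0 v" "epi c0 v" by fact+
    show "v \<bullet> s = \<zero>" unfolding s_def using v(2) kerD(2)[OF k(1)] by (metis mul_assoc zero_right)
    fix u assume u: "u \<bullet> c = u" "u \<bullet> s = \<zero>"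
    have "(u \<bullet> e) \<bullet> B1 = u \<bullet> e" "(u \<bullet> e) \<bullet> ib = \<zero>" using u(2) HD[OF c(4)] by (auto simp: s_def mul_assoc)
    then obtain w where w: "w \<bullet> B0 = w" "w \<bullet> vb = u \<bullet> e" using coker_ex[OF vib] by blast
    have "w \<bullet> vb \<bullet> \<alpha>1 = \<zero>" using w(2) cokerD(2)[OF c(1)] by (metis mul_assoc zero_right)
    then obtain x where x: "x \<bullet> c0 = x" "x \<bullet> e0 = w" using coker_ex[OF c0(1) w(1)] by blast
    have "(x \<bullet> v) \<bullet> e = u \<bullet> e" using x w v(2) by (metis mul_assoc)
    moreover have "(x \<bullet> v) \<bullet> c = x \<bullet> v" using HD[OF v(1)] by (simp add: mul_assoc)
    ultimately have "x \<bullet> v = u" using coker_epi[OF c(1)] u(1) unfolding epi_def by blast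
    thus "\<exists>x. x \<bullet> c0 = x \<and> x \<bullet> v = u" using x by blast
  qed
  obtain d ms es where d: "H Ib d es" "ez d es" "H d c ms" "kz d ms" "s = ms \<bullet> es"
    using adm_coker[OF Hs cs] by (auto simp: adm_def)
  have "coker c ms c0 v" using coker_epi_cancel[of c ms es c0 v d] cs d by simp
  hence kv: "ker c v d ms" using ker_of_coker d by blast
  have vmm: "vc \<bullet> (m \<bullet> ms) = \<zero>" using vm kerD(2)[OF kv] by (metis mul_assoc zero_right)
  then obtain \<kappa> where \<kappa>: "H d Ic \<kappa>" "ic \<bullet> \<kappa> = m \<bullet> ms"
    using ker_exH[OF k(2) H_comp[OF d(3) c(5)]] by blast
  have mm: "mon d (m \<bullet> ms)" using mon_comp[OF d(3) kz_mon[OF d(3,4)] ker_mon[OF c(2)]] .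
  have "ker Ic (\<gamma>1 \<bullet> ic) d \<kappa>"
  proof (rule kerI)
    show "H d Ic \<kappa>" by fact
    show "mon d \<kappa>" using mon_cancel[OF \<kappa>(1), of ic] mm \<kappa>(2) by simp
    show "(\<gamma>1 \<bullet> ic) \<bullet> \<kappa> = \<zero>" using \<kappa>(2) kerD(3)[OF c(2)] by (simp add: mul_assoc)
    fix h assume h: "Ic \<bullet> h = h" "(\<gamma>1 \<bullet> ic) \<bullet> h = \<zero>"
    have "C1 \<bullet> (ic \<bullet> h) = ic \<bullet> h" "\<gamma>1 \<bullet> (ic \<bullet> h) = \<zero>" using h HD[OF Hic] by (auto simp: mul_assoc)
    then obtain h' where h': "c \<bullet> h' = h'" "m \<bullet> h' = ic \<bullet> h" using ker_ex[OF c(2)] by blast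
    have "m0 \<bullet> (v \<bullet> h') = \<zero>" using vm h' kerD(3)[OF k(2)] by (metis mul_assoc)
    hence "v \<bullet> h' = \<zero>" using mon_kz[OF c0(4)] HD[OF v(1)] by (simp add: kz_def)
    then obtain h'' where h'': "d \<bullet> h'' = h''" "ms \<bullet> h'' = h'" using ker_ex[OF kv h'(1)] by blast
    have "ic \<bullet> (\<kappa> \<bullet> h'') = ic \<bullet> h" using \<kappa>(2) h' h'' by (metis mul_assoc)
    moreover have "Ic \<bullet> (\<kappa> \<bullet> h'') = \<kappa> \<bullet> h''" using HD[OF \<kappa>(1)] by simp
    ultimately have "\<kappa> \<bullet> h'' = h" using ker_mon[OF k(2)] h(1) unfolding mon_def by blast
    thus "\<exists>u. d \<bullet> u = u \<and> \<kappa> \<bullet> u = h" using h''(1) by blast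
  qed
  moreover have "t = \<kappa> \<bullet> es"
  proof (rule monD[OF ker_mon[OF k(2)] t(1) H_comp[OF d(1) \<kappa>(1)]])
    show "ic \<bullet> t = ic \<bullet> \<kappa> \<bullet> es" using t(2) c(3) d(5) \<kappa>(2) unfolding s_def by (metis mul_assoc)
  qed
  ultimately show ?thesis using exI_ker[of Ic _ d \<kappa> es t] ez_epi[OF d(1,2)] HD[OF d(1)] by blast
qed

lemma cokernel_row:
  assumes H: "H D1 C1 \<gamma>1" "H C1 B1 \<beta>1" "H B1 A1 \<alpha>1" "H B0 B1 vb" "H C0 B0 \<beta>0" "H C0 C1 vc"
    and comm: "\<beta>1 \<bullet> vc = vb \<bullet> \<beta>0" and vb: "kz B0 vb"
    and e: "ex C1 \<gamma>1 \<beta>1" "ex B1 \<beta>1 \<alpha>1" "ex B0 \<beta>0 (\<alpha>1 \<bullet> vb)"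
    and k: "coker B1 vb Qb qb" "coker C1 vc Qc qc" and t: "H Qc Qb t" "t \<bullet> qc = qb \<bullet> \<beta>1"
  shows "ex Qc (qc \<bullet> \<gamma>1) t"
proof -
  note d = strin.kernel_row[OF dual_strin, unfolded dual_simps]
  have "strin.ex (\<lambda>x y. y \<bullet> x) \<zero> Ob Qc t (qc \<bullet> \<gamma>1)"
  proof (rule d[OF H(3,2,1) H(4,5,6) comm vb _ _ _ k t])
    show "strin.ex (\<lambda>x y. y \<bullet> x) \<zero> Ob B1 \<alpha>1 \<beta>1" using dual_ex[OF H(2,3)] e by blast
    show "strin.ex (\<lambda>x y. y \<bullet> x) \<zero> Ob C1 \<beta>1 \<gamma>1" using dual_ex[OF H(1,2)] e by blast
    show "strin.ex (\<lambda>x y. y \<bullet> x) \<zero> Ob B0 (\<alpha>1 \<bullet> vb) \<beta>0" using dual_ex[OF H(5) H_comp[OF H(4,3)]] e by blast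
  qed
  thus ?thesis using dual_ex[OF H_comp[OF H(1) cokerD(1)[OF k(2)]] t(1)] by blast
qed

text \<open>\<open>x\<close> is the kernel of its cokernel, and that cokernel is
  \<open>\<zero>\<close>; so the identity of \<open>b\<close> factors through
  \<open>x\<close>.\<close>

lemma iso_if:
  assumes "H a b x" "kz a x" "ez b x"
  obtains y where "H b a y" "x \<bullet> y = b" "y \<bullet> x = a"
proof -
  obtain d g where d: "H b d g" "coker b x d g" "ker b g a x" using kz_coker[OF assms(1,2)] .
  have Ob: "Ob a" "Ob b" using HD[OF assms(1)] by auto
  have "g = \<zero>" using ezD[OF assms(3) d(1)] cokerD(2)[OF d(2)] by simp
  hence "\<exists>y. H b a y \<and> x \<bullet> y = b" using ker_exH[OF d(3) H_id[OF Ob(2)]] by auto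
  then obtain y where y: "H b a y" "x \<bullet> y = b" by blast
  have "x \<bullet> (y \<bullet> x) = x \<bullet> a" using y HD[OF assms(1)] by (metis mul_assoc)
  hence "y \<bullet> x = a" using monD[OF kz_mon[OF assms(1,2)] H_comp[OF assms(1) y(1)] H_id[OF Ob(1)]] by simp
  thus ?thesis using that y by blast
qed

text \<open>A splitting argument. After division by the image \<open>c'\<close> of
  \<open>k2\<close>, the quotient \<open>W2\<close> of \<open>W\<close> is an extension of
  \<open>V\<close> by \<open>U\<close>, the image of \<open>g \<bullet> \<kappa>\<close>. The arrow
  \<open>\<tau>\<close> from \<open>Q2\<close> to \<open>W2\<close> induced by \<open>t\<close>
  kills the kernel of \<open>ev\<close> and so descends to a section \<open>\<sigma>\<close> of
  \<open>p2\<close>. Division of \<open>W2\<close> by this section leaves a copy of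
  \<open>U\<close>, which \<open>g\<close> embeds into \<open>Z\<close>; this exhibits
  \<open>g\<close> as the cokernel of \<open>t\<close> followed by a monomorphism.\<close>

lemma ext_core:
  assumes H: "H T2 W t" "H W Z g" "H W V p" "H K W \<kappa>" "H Q2 V ev" "H K2 K k2"
    and z: "g \<bullet> t = \<zero>" and kp: "ker W p K \<kappa>" and p: "ez V p" and ek: "ex K k2 (g \<bullet> \<kappa>)"
    and kk: "\<kappa> \<bullet> k2 = t \<bullet> \<kappa>2" and q2: "coker T2 \<kappa>2 Q2 q2" and pt: "p \<bullet> t = ev \<bullet> q2" and ev: "ez V ev"
  shows "ex W t g"
proof -
  have Hgk: "H K Z (g \<bullet> \<kappa>)" using H_comp[OF H(4,2)] .
  obtain c' m' e' where k': "ker K (g \<bullet> \<kappa>) c' m'" "H K2 c' e'" "H c' K m'" "mon c' m'" "epi c' e'" "k2 = m' \<bullet> e'"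
    using ex_kerE[OF H(6) Hgk ek] .
  obtain U mU eU where U: "coker K k2 U eU" "H U Z mU" "H K U eU" "mon U mU" "epi U eU" "g \<bullet> \<kappa> = mU \<bullet> eU"
    using ex_cokerE[OF H(6) Hgk ek] .
  have Hkm: "H c' W (\<kappa> \<bullet> m')" using H_comp[OF k'(3) H(4)] .
  have mkm: "kz c' (\<kappa> \<bullet> m')" using mon_kz[OF mon_comp[OF k'(3,4) ker_mon[OF kp]]] .
  obtain W2 d where d: "H W W2 d" "coker W (\<kappa> \<bullet> m') W2 d" "ker W d c' (\<kappa> \<bullet> m')"
    using kz_coker[OF Hkm mkm] .
  have cokp: "coker W \<kappa> V p" using coker_of_ker[OF kp H(3) p] .
  note epid = coker_epi[OF d(2)]
  have "p \<bullet> (\<kappa> \<bullet> m') = \<zero>" using kerD(3)[OF kp] by simp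
  then obtain p2 where p2: "H W2 V p2" "p2 \<bullet> d = p" using coker_exH[OF d(2) H(3)] by blast
  have "g \<bullet> (\<kappa> \<bullet> m') = \<zero>" using kerD(2)[OF k'(1)] by (simp add: mul_assoc)
  then obtain g2 where g2: "H W2 Z g2" "g2 \<bullet> d = g" using coker_exH[OF d(2) H(2)] by blast
  have dk2: "d \<bullet> \<kappa> \<bullet> k2 = \<zero>" using cokerD(2)[OF d(2)] k'(6) by (metis mul_assoc zero_left)
  then obtain \<nu> where \<nu>: "H U W2 \<nu>" "\<nu> \<bullet> eU = d \<bullet> \<kappa>"
    using coker_exH[OF U(1) H_comp[OF H(4) d(1)]] by (auto simp: mul_assoc)
  have "(g2 \<bullet> \<nu>) \<bullet> eU = mU \<bullet> eU" using \<nu>(2) g2(2) U(6) by (metis mul_assoc)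
  hence g2\<nu>: "g2 \<bullet> \<nu> = mU" using epiD[OF U(5) H_comp[OF \<nu>(1) g2(1)] U(2)] by blast
  have kz\<nu>: "kz U \<nu>" using kz_cancel[OF \<nu>(1), of g2] g2\<nu> mon_kz[OF U(4)] by simp
  have HT: "H T2 W2 (d \<bullet> t)" using H_comp[OF H(1) d(1)] .
  have "(d \<bullet> t) \<bullet> \<kappa>2 = \<zero>" using dk2 kk by (simp add: mul_assoc)
  then obtain \<tau> where \<tau>: "H Q2 W2 \<tau>" "\<tau> \<bullet> q2 = d \<bullet> t" using coker_exH[OF q2 HT] by blast
  note epq = coker_epi[OF q2]
  have "(p2 \<bullet> \<tau>) \<bullet> q2 = ev \<bullet> q2" using \<tau>(2) p2(2) pt by (metis mul_assoc)
  hence p2\<tau>: "p2 \<bullet> \<tau> = ev" using epiD[OF epq H_comp[OF \<tau>(1) p2(1)] H(5)] by blast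
  have "(g2 \<bullet> \<tau>) \<bullet> q2 = \<zero>" using \<tau>(2) g2(2) z by (metis mul_assoc)
  hence g2\<tau>: "g2 \<bullet> \<tau> = \<zero>" using ezD[OF epi_ez[OF epq] H_comp[OF \<tau>(1) g2(1)]] by simp
  obtain Nn n where n: "H Nn Q2 n" "ker Q2 ev Nn n" "coker Q2 n V ev" using ez_ker[OF H(5) ev] .
  have cp2: "coker W2 \<nu> V p2"
  proof (rule cokerI)
    show "H W2 V p2" by fact
    show "epi V p2" using epi_cancel[OF p2(1), of d] ez_epi[OF H(3) p] p2(2) by simp
    have "(p2 \<bullet> \<nu>) \<bullet> eU = \<zero>" using \<nu>(2) p2(2) kerD(2)[OF kp] by (metis mul_assoc)
    thus "p2 \<bullet> \<nu> = \<zero>" using ezD[OF epi_ez[OF U(5)] H_comp[OF \<nu>(1) p2(1)]] by simp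
    fix y assume y: "y \<bullet> W2 = y" "y \<bullet> \<nu> = \<zero>"
    have "(y \<bullet> d) \<bullet> \<kappa> = \<zero>" "(y \<bullet> d) \<bullet> W = y \<bullet> d" using y \<nu>(2) HD[OF d(1)] by (metis mul_assoc zero_left)+
    then obtain y' where y': "y' \<bullet> V = y'" "y' \<bullet> p = y \<bullet> d" using coker_ex[OF cokp] by blast
    have "(y' \<bullet> p2) \<bullet> d = y \<bullet> d" "(y' \<bullet> p2) \<bullet> W2 = y' \<bullet> p2" using y' p2(2) HD[OF p2(1)] by (simp_all add: mul_assoc)
    hence "y' \<bullet> p2 = y" using epid y(1) unfolding epi_def by blast
    thus "\<exists>u. u \<bullet> V = u \<and> u \<bullet> p2 = y" using y'(1) by blast
  qed
  have kp2: "ker W2 p2 U \<nu>" using ker_of_coker[OF cp2 \<nu>(1) kz\<nu>] .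
  \<comment> \<open>\<open>\<tau>\<close> maps the kernel \<open>n\<close> of \<open>ev\<close> into
    the kernel \<open>U\<close> of \<open>p2\<close>. On \<open>U\<close> the arrow
    \<open>g2\<close> is the monomorphism \<open>mU\<close>, but on the image of
    \<open>\<tau>\<close> it vanishes.\<close>
  have "p2 \<bullet> (\<tau> \<bullet> n) = \<zero>" using p2\<tau> kerD(2)[OF n(2)] by (metis mul_assoc)
  then obtain zz' where zz: "H Nn U zz'" "\<nu> \<bullet> zz' = \<tau> \<bullet> n" using ker_exH[OF kp2 H_comp[OF n(1) \<tau>(1)]] by blast
  have "mU \<bullet> zz' = \<zero>" using g2\<nu> zz(2) g2\<tau> by (metis mul_assoc zero_left)
  hence "zz' = \<zero>" using kzD[OF mon_kz[OF U(4)] zz(1)] by blast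
  hence \<tau>n: "\<tau> \<bullet> n = \<zero>" using zz(2) by simp
  then obtain \<sigma> where \<sigma>: "H V W2 \<sigma>" "\<sigma> \<bullet> ev = \<tau>" using coker_exH[OF n(3) \<tau>(1)] by blast
  have ObV: "Ob V" using HD[OF \<sigma>(1)] by blast
  have "(p2 \<bullet> \<sigma>) \<bullet> ev = V \<bullet> ev" using \<sigma>(2) p2\<tau> HD[OF H(5)] by (simp add: mul_assoc)
  hence p2\<sigma>: "p2 \<bullet> \<sigma> = V" using epiD[OF coker_epi[OF n(3)] H_comp[OF \<sigma>(1) p2(1)] H_id[OF ObV]] by blast
  have "(g2 \<bullet> \<sigma>) \<bullet> ev = \<zero>" using \<sigma>(2) g2\<tau> by (simp add: mul_assoc)
  hence g2\<sigma>: "g2 \<bullet> \<sigma> = \<zero>" using ezD[OF ev H_comp[OF \<sigma>(1) g2(1)]] by simp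
  have "kz V \<sigma>" unfolding kz_def using p2\<sigma> by (metis mul_assoc zero_right)
  then obtain U' c where c: "H W2 U' c" "coker W2 \<sigma> U' c" "ker W2 c V \<sigma>" using kz_coker[OF \<sigma>(1)] by blast
  have Hcn: "H U U' (c \<bullet> \<nu>)" using H_comp[OF \<nu>(1) c(1)] .
  \<comment> \<open>The kernel \<open>U\<close> of \<open>p2\<close> meets the section trivially and
    generates \<open>W2\<close> together with it, so the passage from \<open>U\<close> to the
    quotient \<open>U'\<close> by the section is invertible. Without addition this is shown as
    trivial kernel plus trivial cokernel.\<close>
  have kcn: "kz U (c \<bullet> \<nu>)" unfolding kz_def
  proof (intro allI impI)
    fix h assume h: "U \<bullet> h = h" "(c \<bullet> \<nu>) \<bullet> h = \<zero>"
    have "W2 \<bullet> (\<nu> \<bullet> h) = \<nu> \<bullet> h" "c \<bullet> (\<nu> \<bullet> h) = \<zero>" using h HD[OF \<nu>(1)] by (auto simp: mul_assoc)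
    then obtain h' where h': "V \<bullet> h' = h'" "\<sigma> \<bullet> h' = \<nu> \<bullet> h" using ker_ex[OF c(3)] by blast
    have "h' = p2 \<bullet> (\<sigma> \<bullet> h')" using p2\<sigma> h'(1) by (metis mul_assoc)
    also have "\<dots> = \<zero>" using h'(2) kerD(3)[OF kp2] by simp
    finally have "\<nu> \<bullet> h = \<zero>" using h'(2) by simp
    thus "h = \<zero>" using kz\<nu> h(1) unfolding kz_def by blast
  qed
  have ecn: "ez U' (c \<bullet> \<nu>)" unfolding ez_def
  proof (intro allI impI)
    fix y assume y: "y \<bullet> U' = y" "y \<bullet> c \<bullet> \<nu> = \<zero>"
    have "(y \<bullet> c) \<bullet> W2 = y \<bullet> c" "(y \<bullet> c) \<bullet> \<nu> = \<zero>" using y HD[OF c(1)] by (auto simp: mul_assoc)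
    then obtain y' where y': "y' \<bullet> V = y'" "y' \<bullet> p2 = y \<bullet> c" using coker_ex[OF cp2] by blast
    have "y' = (y' \<bullet> p2) \<bullet> \<sigma>" using y'(1) p2\<sigma> by (simp add: mul_assoc)
    also have "\<dots> = \<zero>" unfolding y'(2) using cokerD(2)[OF c(2)] by (simp add: mul_assoc)
    finally have "y \<bullet> c = \<zero>" using y'(2) by simp
    thus "y = \<zero>" using epi_ez[OF coker_epi[OF c(2)]] y(1) unfolding ez_def by blast
  qed
  obtain w where w: "H U' U w" "(c \<bullet> \<nu>) \<bullet> w = U'" "w \<bullet> (c \<bullet> \<nu>) = U" using iso_if[OF Hcn kcn ecn] .
  obtain y where y: "H U' Z y" "y \<bullet> c = g2" using coker_exH[OF c(2) g2(1) g2\<sigma>] by blast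
  have "y = y \<bullet> ((c \<bullet> \<nu>) \<bullet> w)" using w(2) HD[OF y(1)] by simp
  also have "\<dots> = mU \<bullet> w" using y(2) g2\<nu> by (metis mul_assoc)
  finally have y': "y = mU \<bullet> w" .
  have "mon U' w" unfolding mon_def using w(2) by (metis mul_assoc)
  hence my: "mon U' y" unfolding y' using mon_comp[OF w(1) _ U(4)] by blast
  have "coker W t U' (c \<bullet> d)"
  proof (rule cokerI)
    show "H W U' (c \<bullet> d)" using H_comp[OF d(1) c(1)] .
    show "epi U' (c \<bullet> d)" using epi_comp[OF c(1) coker_epi[OF c(2)] epid] .
    have "c \<bullet> \<tau> = \<zero>" using \<sigma>(2) cokerD(2)[OF c(2)] by (metis mul_assoc zero_left)
    thus "(c \<bullet> d) \<bullet> t = \<zero>" using \<tau>(2) by (metis mul_assoc zero_left)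
    fix x assume x: "x \<bullet> W = x" "x \<bullet> t = \<zero>"
    have xk: "x \<bullet> \<kappa> \<bullet> k2 = \<zero>" using kk x(2) by (metis mul_assoc zero_left)
    have "(x \<bullet> \<kappa> \<bullet> m') \<bullet> c' = x \<bullet> \<kappa> \<bullet> m'" using HD[OF k'(3)] by (simp add: mul_assoc)
    hence "x \<bullet> \<kappa> \<bullet> m' = \<zero>"
      using xk epi_ez[OF k'(5)] unfolding k'(6) ez_def by (metis mul_assoc)
    then obtain x1 where x1: "x1 \<bullet> W2 = x1" "x1 \<bullet> d = x" using coker_ex[OF d(2) x(1)] by blast
    have "(x1 \<bullet> \<tau>) \<bullet> q2 = \<zero>" using \<tau>(2) x1(2) x(2) by (metis mul_assoc)
    moreover have "(x1 \<bullet> \<tau>) \<bullet> Q2 = x1 \<bullet> \<tau>" using HD[OF \<tau>(1)] by (simp add: mul_assoc)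
    ultimately have "x1 \<bullet> \<tau> = \<zero>" using epi_ez[OF epq] unfolding ez_def by blast
    hence "(x1 \<bullet> \<sigma>) \<bullet> ev = \<zero>" using \<sigma>(2) by (simp add: mul_assoc)
    moreover have "(x1 \<bullet> \<sigma>) \<bullet> V = x1 \<bullet> \<sigma>" using HD[OF \<sigma>(1)] by (simp add: mul_assoc)
    ultimately have "x1 \<bullet> \<sigma> = \<zero>" using ev unfolding ez_def by blast
    then obtain x2 where x2: "x2 \<bullet> U' = x2" "x2 \<bullet> c = x1" using coker_ex[OF c(2) x1(1)] by blast
    thus "\<exists>u. u \<bullet> U' = u \<and> u \<bullet> c \<bullet> d = x" using x1(2) by (metis mul_assoc)
  qed
  moreover have "g = y \<bullet> (c \<bullet> d)" using y(2) g2(2) by (metis mul_assoc)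
  ultimately show ?thesis using exI_coker[OF H(1,2) _ _ my] HD[OF y(1)] by blast
qed

text \<open>\<open>T1\<close> is cut down to the preimage \<open>W\<close> of the kernel
  \<open>V\<close> of \<open>s1\<close>. Over \<open>V\<close> the arrow from \<open>Q2\<close>
  becomes the epimorphism that \<open>ext_core\<close> demands, and the kernel of \<open>t1\<close>
  lies in \<open>W\<close> because \<open>s1 \<bullet> q1 = q0 \<bullet> t1\<close>.\<close>

lemma extension_row:
  assumes H: "H T2 T1 t2" "H T1 T0 t1" "H T1 Q1 q1" "H K2 K1 k2" "H Q2 Q1 s2" "H Q1 Q0 s1" "H T0 Q0 q0"
    and z: "t1 \<bullet> t2 = \<zero>" and k1: "ker T1 q1 K1 \<kappa>1" and kk: "\<kappa>1 \<bullet> k2 = t2 \<bullet> \<kappa>2"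
    and q2: "coker T2 \<kappa>2 Q2 q2" and c2: "q1 \<bullet> t2 = s2 \<bullet> q2" and c1: "q0 \<bullet> t1 = s1 \<bullet> q1"
    and ek: "ex K1 k2 (t1 \<bullet> \<kappa>1)" and es: "ex Q1 s2 s1" and q1: "ez Q1 q1"
  shows "ex T1 t2 t1"
proof -
  obtain V v ev where v: "ker Q1 s1 V v" "H Q2 V ev" "H V Q1 v" "mon V v" "epi V ev" "s2 = v \<bullet> ev"
    using ex_kerE[OF H(5,6) es] .
  obtain d c where c: "H Q1 d c" "coker Q1 v d c" "ker Q1 c V v" using kz_coker[OF v(3) mon_kz[OF v(4)]] .
  have Hcq: "H T1 d (c \<bullet> q1)" using H_comp[OF H(3) c(1)] .
  obtain W w where w: "H W T1 w" "ker T1 (c \<bullet> q1) W w"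
    using ez_ker[OF Hcq ez_comp[OF c(1) epi_ez[OF coker_epi[OF c(2)]] q1]] by blast
  have "(c \<bullet> q1) \<bullet> \<kappa>1 = \<zero>" using kerD(2)[OF k1] by (simp add: mul_assoc)
  then obtain \<kappa> where \<kappa>: "H K1 W \<kappa>" "w \<bullet> \<kappa> = \<kappa>1" using ker_exH[OF w(2) kerD(1)[OF k1]] by blast
  have "c \<bullet> (q1 \<bullet> w) = \<zero>" using kerD(2)[OF w(2)] by (simp add: mul_assoc)
  then obtain p where p: "H W V p" "v \<bullet> p = q1 \<bullet> w" using ker_exH[OF c(3) H_comp[OF w(1) H(3)]] by blast
  have "(c \<bullet> q1) \<bullet> t2 = \<zero>" using c2 v(6) kerD(3)[OF c(3)] by (simp add: mul_assoc)
  then obtain t where t: "H T2 W t" "w \<bullet> t = t2" using ker_exH[OF w(2) H(1)] by blast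
  note Hq2 = cokerD(1)[OF q2]
  have "v \<bullet> (p \<bullet> t) = v \<bullet> (ev \<bullet> q2)" using p(2) t(2) c2 v(6) by (metis mul_assoc)
  hence pt: "p \<bullet> t = ev \<bullet> q2" using monD[OF v(4) H_comp[OF t(1) p(1)] H_comp[OF Hq2 v(2)]] by blast
  have ezp: "ez V p"
    using ez_cancel[OF p(1), of t] ez_comp[OF v(2) epi_ez[OF v(5)] epi_ez[OF coker_epi[OF q2]]] pt by simp
  have kp: "ker W p K1 \<kappa>"
  proof (rule kerI)
    show "H K1 W \<kappa>" by fact
    show "mon K1 \<kappa>" using mon_cancel[OF \<kappa>(1), of w] ker_mon[OF k1] \<kappa>(2) by simp
    have "v \<bullet> (p \<bullet> \<kappa>) = \<zero>" using p(2) \<kappa>(2) kerD(2)[OF k1] by (metis mul_assoc)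
    thus "p \<bullet> \<kappa> = \<zero>" using kzD[OF mon_kz[OF v(4)] H_comp[OF \<kappa>(1) p(1)]] by blast
    fix h assume h: "W \<bullet> h = h" "p \<bullet> h = \<zero>"
    have "q1 \<bullet> (w \<bullet> h) = \<zero>" "T1 \<bullet> (w \<bullet> h) = w \<bullet> h" using p(2) h HD[OF w(1)] by (metis mul_assoc zero_right)+
    then obtain u where u: "K1 \<bullet> u = u" "\<kappa>1 \<bullet> u = w \<bullet> h" using ker_ex[OF k1] by blast
    have "w \<bullet> (\<kappa> \<bullet> u) = w \<bullet> h" "W \<bullet> (\<kappa> \<bullet> u) = \<kappa> \<bullet> u" using u(2) \<kappa>(2) HD[OF \<kappa>(1)] by (metis mul_assoc)+
    hence "\<kappa> \<bullet> u = h" using ker_mon[OF w(2)] h(1) unfolding mon_def by blast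
    thus "\<exists>u. K1 \<bullet> u = u \<and> \<kappa> \<bullet> u = h" using u(1) by blast
  qed
  have Hg: "H W T0 (t1 \<bullet> w)" using H_comp[OF w(1) H(2)] .
  have kk': "\<kappa> \<bullet> k2 = t \<bullet> \<kappa>2"
  proof -
    have "w \<bullet> (\<kappa> \<bullet> k2) = w \<bullet> (t \<bullet> \<kappa>2)" using \<kappa>(2) t(2) kk by (metis mul_assoc)
    moreover have "W \<bullet> (\<kappa> \<bullet> k2) = \<kappa> \<bullet> k2" "W \<bullet> (t \<bullet> \<kappa>2) = t \<bullet> \<kappa>2" using HD[OF \<kappa>(1)] HD[OF t(1)] by auto
    ultimately show ?thesis using ker_mon[OF w(2)] unfolding mon_def by blast
  qed
  have ek': "ex K1 k2 ((t1 \<bullet> w) \<bullet> \<kappa>)" using ek \<kappa>(2) by (simp add: mul_assoc)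
  have z': "(t1 \<bullet> w) \<bullet> t = \<zero>" using z t(2) by (simp add: mul_assoc)
  have exW: "ex W t (t1 \<bullet> w)"
    using ext_core[OF t(1) Hg p(1) \<kappa>(1) v(2) H(4) z' kp ezp ek' kk' q2 pt epi_ez[OF v(5)]] .
  obtain X x e where x: "ker W (t1 \<bullet> w) X x" "H T2 X e" "H X W x" "mon X x" "epi X e" "t = x \<bullet> e"
    using ex_kerE[OF t(1) Hg exW] .
  have "ker T1 t1 X (w \<bullet> x)"
  proof (rule kerI)
    show "H X T1 (w \<bullet> x)" using H_comp[OF x(3) w(1)] .
    show "mon X (w \<bullet> x)" using mon_comp[OF x(3,4) ker_mon[OF w(2)]] .
    show "t1 \<bullet> w \<bullet> x = \<zero>" using kerD(2)[OF x(1)] by (simp add: mul_assoc)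
    fix h assume h: "T1 \<bullet> h = h" "t1 \<bullet> h = \<zero>"
    have "s1 \<bullet> (q1 \<bullet> h) = \<zero>" "Q1 \<bullet> (q1 \<bullet> h) = q1 \<bullet> h" using c1 h HD[OF H(3)] by (metis mul_assoc zero_right)+
    then obtain u where "v \<bullet> u = q1 \<bullet> h" using ker_ex[OF v(1)] by blast
    hence "(c \<bullet> q1) \<bullet> h = \<zero>" using kerD(3)[OF c(3)] by (metis mul_assoc)
    then obtain h' where h': "W \<bullet> h' = h'" "w \<bullet> h' = h" using ker_ex[OF w(2) h(1)] by blast
    hence "(t1 \<bullet> w) \<bullet> h' = \<zero>" using h(2) by (simp add: mul_assoc)
    then obtain h'' where "X \<bullet> h'' = h''" "x \<bullet> h'' = h'" using ker_ex[OF x(1) h'(1)] by blast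
    thus "\<exists>u. X \<bullet> u = u \<and> (w \<bullet> x) \<bullet> u = h" using h'(2) by (metis mul_assoc)
  qed
  moreover have "t2 = (w \<bullet> x) \<bullet> e" using t(2) x(6) by (simp add: mul_assoc)
  ultimately show ?thesis using exI_ker x(2,5) HD(4) by blast
qed

text \<open>The row obtained from \<open>S \<rightarrow> T \<rightarrow> Z\<close> by replacing \<open>T\<close> with the image \<open>K\<close> of \<open>f\<close> is exact at \<open>K\<close>.\<close>

definition imex :: "'a \<Rightarrow> 'a \<Rightarrow> 'a \<Rightarrow> 'a \<Rightarrow> 'a \<Rightarrow> bool" where
  "imex S T s f g \<longleftrightarrow> (\<exists>K m e. H S K e \<and> ez K e \<and> H K T m \<and> kz K m \<and> f = m \<bullet> e \<and> ex K (e \<bullet> s) (g \<bullet> m))"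

text \<open>The kernel \<open>l\<close> of the epimorphism from \<open>S\<close> onto the image
  \<open>K\<close> is killed by \<open>g \<bullet> f\<close>, hence by its coimage
  \<open>e'\<close>. So \<open>e'\<close> factors through \<open>K\<close>, with the same
  monomorphism \<open>m'\<close> behind it.\<close>

lemma imex_base:
  assumes H: "H S2 S s" "H S T f" "H T Z g" and ad: "adm S T f" and e: "ex S s (g \<bullet> f)"
  shows "imex S T s f g"
proof -
  obtain K m e where K: "H S K e" "ez K e" "H K T m" "kz K m" "f = m \<bullet> e" using ad by (auto simp: adm_def)
  have Hgf: "H S Z (g \<bullet> f)" using H_comp[OF H(2,3)] .
  obtain c m' e' where c: "coker S s c e'" "H c Z m'" "H S c e'" "mon c m'" "epi c e'" "g \<bullet> f = m' \<bullet> e'"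
    using ex_cokerE[OF H(1) Hgf e] .
  obtain N l where l: "H N S l" "ker S e N l" "coker S l K e" using ez_ker[OF K(1,2)] .
  have "m' \<bullet> (e' \<bullet> l) = \<zero>" using c(6) K(5) kerD(2)[OF l(2)] by (metis mul_assoc zero_right)
  hence "e' \<bullet> l = \<zero>" using kzD[OF mon_kz[OF c(4)] H_comp[OF l(1) c(3)]] by blast
  then obtain e2 where e2: "H K c e2" "e2 \<bullet> e = e'" using coker_exH[OF l(3) c(3)] by blast
  have "(g \<bullet> m) \<bullet> e = (m' \<bullet> e2) \<bullet> e" using c(6) K(5) e2(2) by (simp add: mul_assoc)
  hence gm: "g \<bullet> m = m' \<bullet> e2"
    using epiD[OF coker_epi[OF l(3)] H_comp[OF K(3) H(3)] H_comp[OF e2(1) c(2)]] by blast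
  have "coker K (e \<bullet> s) c e2"
  proof (rule cokerI)
    show "H K c e2" by fact
    show "epi c e2" using epi_cancel[OF e2(1), of e] c(5) e2(2) by simp
    show "e2 \<bullet> e \<bullet> s = \<zero>" using e2(2) cokerD(2)[OF c(1)] by (metis mul_assoc)
    fix u assume u: "u \<bullet> K = u" "u \<bullet> e \<bullet> s = \<zero>"
    have "(u \<bullet> e) \<bullet> S = u \<bullet> e" "(u \<bullet> e) \<bullet> s = \<zero>" using u HD[OF K(1)] by (simp_all add: mul_assoc)
    then obtain v where v: "v \<bullet> c = v" "v \<bullet> e' = u \<bullet> e" using coker_ex[OF c(1)] by blast
    have "(v \<bullet> e2) \<bullet> e = u \<bullet> e" "(v \<bullet> e2) \<bullet> K = v \<bullet> e2" using v(2) e2(2) HD[OF e2(1)] by (simp_all add: mul_assoc)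
    hence "v \<bullet> e2 = u" using coker_epi[OF l(3)] u(1) unfolding epi_def by blast
    thus "\<exists>x. x \<bullet> c = x \<and> x \<bullet> e2 = u" using v(1) by blast
  qed
  hence "ex K (e \<bullet> s) (g \<bullet> m)"
    using exI_coker[OF H_comp[OF H(1) K(1)] H_comp[OF K(3) H(3)] _ _ c(4) gm] HD[OF c(2)] by blast
  thus ?thesis using K unfolding imex_def by blast
qed

text \<open>The cokernel of \<open>\<kappa>0\<close> is that of the monomorphism \<open>m\<close>
  from its image \<open>K\<close>, so \<open>cokernel_row\<close> applies with \<open>K\<close> in
  place of \<open>S0\<close>.\<close>

lemma imex_coker:
  assumes H: "H T2 T1 \<gamma>" "H T1 T0 \<beta>" "H T0 A1 \<alpha>" "H S1 S0 s1" "H S1 T1 \<kappa>1"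
    and comm: "\<beta> \<bullet> \<kappa>1 = \<kappa>0 \<bullet> s1"
    and e: "ex T1 \<gamma> \<beta>" "ex T0 \<beta> \<alpha>" and i: "imex S0 T0 s1 \<kappa>0 \<alpha>"
    and q: "coker T1 \<kappa>1 Q1 q1" "coker T0 \<kappa>0 Q0 q0" and t: "H Q1 Q0 t" "t \<bullet> q1 = q0 \<bullet> \<beta>"
  shows "ex Q1 (q1 \<bullet> \<gamma>) t"
proof -
  obtain K m e0 where K: "H S0 K e0" "ez K e0" "H K T0 m" "kz K m" "\<kappa>0 = m \<bullet> e0" "ex K (e0 \<bullet> s1) (\<alpha> \<bullet> m)"
    using i by (auto simp: imex_def)
  have cm: "coker T0 m Q0 q0" using coker_epi_cancel[of T0 m e0 Q0 q0 K] q(2) K by simp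
  have "\<beta> \<bullet> \<kappa>1 = m \<bullet> e0 \<bullet> s1" using comm K(5) by (simp add: mul_assoc)
  from cokernel_row[OF H(1,2,3) K(3) H_comp[OF H(4) K(1)] H(5) this K(4) e K(6) cm q(1) t]
  show ?thesis .
qed

text \<open>By exactness of the columns the image of \<open>f1\<close> is the cokernel of
  \<open>\<kappa>1\<close>, and that of \<open>f0\<close> the cokernel of \<open>\<kappa>0\<close>.
  A row of images is therefore a row of cokernels taken one place earlier in the columns, and the
  image row required for it is that of \<open>\<kappa>0\<close>.\<close>

lemma imex_step:
  assumes H: "H T2 T1 \<gamma>" "H T1 T0 \<beta>" "H T0 A1 \<alpha>" "H S1 S0 s1" "H S1 T1 \<kappa>1" "H S0 T0 \<kappa>0"
    "H T1 R1 f1" "H T0 R0 f0" "H R1 R0 g"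
    and comm: "\<beta> \<bullet> \<kappa>1 = \<kappa>0 \<bullet> s1" "g \<bullet> f1 = f0 \<bullet> \<beta>"
    and e: "ex T1 \<kappa>1 f1" "ex T0 \<kappa>0 f0" "ex T1 \<gamma> \<beta>" "ex T0 \<beta> \<alpha>" and i: "imex S0 T0 s1 \<kappa>0 \<alpha>"
  shows "imex T1 R1 \<gamma> f1 g"
proof -
  obtain Q1 m1 q1 where q1: "coker T1 \<kappa>1 Q1 q1" "H Q1 R1 m1" "H T1 Q1 q1" "mon Q1 m1" "epi Q1 q1" "f1 = m1 \<bullet> q1"
    using ex_cokerE[OF H(5,7) e(1)] .
  obtain Q0 m0 q0 where q0: "coker T0 \<kappa>0 Q0 q0" "H Q0 R0 m0" "H T0 Q0 q0" "mon Q0 m0" "epi Q0 q0" "f0 = m0 \<bullet> q0"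
    using ex_cokerE[OF H(6,8) e(2)] .
  have "(q0 \<bullet> \<beta>) \<bullet> \<kappa>1 = \<zero>" using comm(1) cokerD(2)[OF q0(1)] by (metis mul_assoc zero_left)
  then obtain t where t: "H Q1 Q0 t" "t \<bullet> q1 = q0 \<bullet> \<beta>" using coker_exH[OF q1(1) H_comp[OF H(2) q0(3)]] by blast
  have "ex Q1 (q1 \<bullet> \<gamma>) t" by (rule imex_coker[OF H(1-5) comm(1) e(3,4) i q1(1) q0(1) t])
  hence "ex Q1 (q1 \<bullet> \<gamma>) (m0 \<bullet> t)" using ex_mono[OF t(1) mon_kz[OF q0(4)]] by blast
  moreover have "m0 \<bullet> t = g \<bullet> m1"
  proof -
    have "(m0 \<bullet> t) \<bullet> q1 = (g \<bullet> m1) \<bullet> q1" using t(2) q0(6) q1(6) comm(2) by (simp add: mul_assoc)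
    thus ?thesis using epiD[OF q1(5) H_comp[OF t(1) q0(2)] H_comp[OF q1(2) H(9)]] by blast
  qed
  ultimately show ?thesis
    unfolding imex_def using q1 epi_ez[OF q1(5)] mon_kz[OF q1(4)] by auto
qed

lemma ex_adm: "H x y f \<Longrightarrow> H y z g \<Longrightarrow> ex y f g \<Longrightarrow> adm x y f"
  using ex_kerE[of x y f z g] epi_ez mon_kz unfolding adm_def by metis

lemma ex_adm2: "H x y f \<Longrightarrow> H y z g \<Longrightarrow> ex y f g \<Longrightarrow> adm y z g"
  using ex_cokerE[of x y f z g] epi_ez mon_kz unfolding adm_def by metis

lemma adm_cokerE:
  assumes "adm a b f"
  obtains d p where "coker b f d p"
proof -
  obtain c m e where c: "H a c e" "ez c e" "H c b m" "kz c m" "f = m \<bullet> e" using assms by (auto simp: adm_def)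
  obtain d p where "coker b m d p" using kz_coker[OF c(3,4)] by blast
  thus ?thesis using that coker_epi_comp[of b m d p c e] c by blast
qed

text \<open>Cancelling \<open>e\<close> shows that \<open>f\<close> is killed by \<open>g\<close>
  and so factors through the kernel of \<open>g\<close>; the factor is an epimorphism because its
  composite with \<open>e\<close> is one.\<close>

lemma ex_epi_cancel:
  assumes "H w x e" "H x y f" "H y z g" "ez x e" "ex y (f \<bullet> e) g"
  shows "ex y f g"
proof -
  obtain c m e' where c: "ker y g c m" "H w c e'" "H c y m" "mon c m" "epi c e'" "f \<bullet> e = m \<bullet> e'"
    using ex_kerE[OF H_comp[OF assms(1,2)] assms(3,5)] .
  have "(g \<bullet> f) \<bullet> e = \<zero>" using c(6) kerD(3)[OF c(1)] by (simp add: mul_assoc)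
  hence "g \<bullet> f = \<zero>" using ezD[OF assms(4) H_comp[OF assms(2,3)]] by blast
  then obtain f' where f': "H x c f'" "m \<bullet> f' = f" using ker_exH[OF c(1) assms(2)] by blast
  have "m \<bullet> (f' \<bullet> e) = m \<bullet> e'" using f'(2) c(6) by (metis mul_assoc)
  hence "f' \<bullet> e = e'" using monD[OF c(4) H_comp[OF assms(1) f'(1)] c(2)] by blast
  hence "epi c f'" using epi_cancel[OF f'(1), of e] c(5) by simp
  thus ?thesis using exI_ker[OF c(1)] f' HD(4) by metis
qed

lemma ez_id: "Ob a \<Longrightarrow> ez a a" and kz_id: "Ob a \<Longrightarrow> kz a a"
  unfolding ez_def kz_def by auto

lemma ex_000: "ex \<zero> \<zero> \<zero>"
  by (subst ex_zero_left[of _ "\<zero>"]) (auto simp: kz_def)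

lemma imex_0:
  assumes "H T Z g" shows "imex \<zero> T \<zero> \<zero> g"
  unfolding imex_def
  by (intro exI[of _ "\<zero>"]) (use HD[OF assms] ex_000 in \<open>auto simp: kz_def ez_def\<close>)

text \<open>The columns from \<open>S\<close> through \<open>T\<close> and \<open>R\<close> to
  \<open>A\<close> are exact at \<open>T\<close> and \<open>R\<close>, so \<open>T1\<close> is an
  extension of the image of \<open>v1\<close> by the image of \<open>\<kappa>1\<close>. The former
  is the kernel of \<open>\<pi>1\<close>, where \<open>kernel_row\<close> gives exactness; for the
  latter exactness is the hypothesis \<open>imex\<close>; \<open>extension_row\<close> combines the
  two.\<close>

lemma row_step:
  assumes HT: "H T2 T1 t2" "H T1 T0 t1" and HR: "H R3 R2 \<rho>3" "H R2 R1 \<rho>2" "H R1 R0 \<rho>1"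
    and HA: "H A2 A1 \<alpha>2" and Hv: "H T2 R2 v2" "H T1 R1 v1" "H T0 R0 v0"
    and H\<pi>: "H R2 A2 \<pi>2" "H R1 A1 \<pi>1"
    and HS: "H S2 S1 s2" "H S2 T2 \<kappa>2" "H S1 T1 \<kappa>1"
    and z: "t1 \<bullet> t2 = \<zero>"
    and comm: "v1 \<bullet> t2 = \<rho>2 \<bullet> v2" "v0 \<bullet> t1 = \<rho>1 \<bullet> v1" "\<pi>1 \<bullet> \<rho>2 = \<alpha>2 \<bullet> \<pi>2" "\<kappa>1 \<bullet> s2 = t2 \<bullet> \<kappa>2"
    and e: "ex R2 \<rho>3 \<rho>2" "ex R1 \<rho>2 \<rho>1" "ex A2 (\<pi>2 \<bullet> \<rho>3) \<alpha>2" "ez A2 \<pi>2"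
    and c: "ex R2 v2 \<pi>2" "ex R1 v1 \<pi>1" "ex T2 \<kappa>2 v2" "ex T1 \<kappa>1 v1"
    and i: "imex S1 T1 s2 \<kappa>1 t1"
  shows "ex T1 t2 t1"
proof -
  obtain I2 e2 i2 where I2: "coker T2 \<kappa>2 I2 e2" "ker R2 \<pi>2 I2 i2" "v2 = i2 \<bullet> e2" "H T2 I2 e2" "H I2 R2 i2"
    using ex_ex_image[OF HS(2) Hv(1) H\<pi>(1) c(3,1)] .
  obtain I1 e1 i1 where I1: "coker T1 \<kappa>1 I1 e1" "ker R1 \<pi>1 I1 i1" "v1 = i1 \<bullet> e1" "H T1 I1 e1" "H I1 R1 i1"
    using ex_ex_image[OF HS(3) Hv(2) H\<pi>(2) c(4,2)] .
  have "\<pi>1 \<bullet> (\<rho>2 \<bullet> i2) = \<zero>" using comm(3) kerD(2)[OF I2(2)] by (metis mul_assoc zero_right)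
  then obtain s where s: "H I2 I1 s" "i1 \<bullet> s = \<rho>2 \<bullet> i2" using ker_exH[OF I1(2) H_comp[OF I2(5) HR(2)]] by blast
  have es: "ex I1 s (\<rho>1 \<bullet> i1)"
    by (rule kernel_row[OF HR H\<pi>(1) HA H\<pi>(2) comm(3) e(4,1,2,3) I2(2) I1(2) s])
  obtain K1 m1 d1 where K1: "H S1 K1 d1" "ez K1 d1" "H K1 T1 m1" "kz K1 m1" "\<kappa>1 = m1 \<bullet> d1" "ex K1 (d1 \<bullet> s2) (t1 \<bullet> m1)"
    using i by (auto simp: imex_def)
  have "coker T1 m1 I1 e1" using coker_epi_cancel[of T1 m1 d1 I1 e1 K1] I1(1) K1 by simp
  hence km: "ker T1 e1 K1 m1" using ker_of_coker K1(3,4) by blast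
  have "m1 \<bullet> d1 \<bullet> s2 = t2 \<bullet> \<kappa>2" using comm(4) K1(5) by (simp add: mul_assoc)
  moreover have "e1 \<bullet> t2 = s \<bullet> e2"
  proof (rule monD[OF ker_mon[OF I1(2)] H_comp[OF HT(1) I1(4)] H_comp[OF I2(4) s(1)]])
    show "i1 \<bullet> e1 \<bullet> t2 = i1 \<bullet> s \<bullet> e2" using comm(1) I1(3) I2(3) s(2) by (metis mul_assoc)
  qed
  moreover have "v0 \<bullet> t1 = (\<rho>1 \<bullet> i1) \<bullet> e1" using comm(2) I1(3) by (simp add: mul_assoc)
  ultimately show ?thesis
    using extension_row[OF HT I1(4) H_comp[OF HS(1) K1(1)] s(1) H_comp[OF I1(5) HR(3)] Hv(3) z km _ I2(1) _ _ K1(6) es epi_ez[OF coker_epi[OF I1(1)]]]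
    by blast
qed

end

lemma list_le_refl [simp]: "p \<preceq> p"
  by (simp add: list_all2_refl)

lemma list_le_append [simp]: "p @ x \<preceq> p @ y \<longleftrightarrow> x \<preceq> y"
  by (simp add: list_all2_append)

section \<open>Diagrams on sorted lists\<close>

definition sl :: "nat \<Rightarrow> nat list \<Rightarrow> bool" where
  "sl k x \<longleftrightarrow> length x = k \<and> sorted x"

definition cov :: "nat \<Rightarrow> nat set \<Rightarrow> bool" where
  "cov k S \<longleftrightarrow> (\<exists>W. finite W \<and> card W \<le> k \<and> S \<subseteq> W \<union> Suc ` W)"

lemma cov_pair: "cov k S \<Longrightarrow> T \<subseteq> insert r (insert (Suc r) S) \<Longrightarrow> cov (Suc k) T"
  unfolding cov_def
  by (elim exE, rule_tac x="insert r W" in exI) (auto simp: card_insert_if)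

lemma cov_card: "finite S \<Longrightarrow> card S \<le> k \<Longrightarrow> cov k S"
  unfolding cov_def by blast

lemma cov_set: "length e \<le> k \<Longrightarrow> cov k (set e)"
  using cov_card[of "set e"] card_length[of e] by simp

text \<open>The cokernels may be chosen object by object: the induced arrows compose strictly
  because the epimorphisms \<open>\<pi>\<close> can be cancelled.\<close>

lemma (in zero_cat) coker_functor:
  fixes X :: "'i set"
  assumes refl: "\<And>x. x \<in> X \<Longrightarrow> le x x"
    and u: "\<And>x y. x \<in> X \<Longrightarrow> y \<in> X \<Longrightarrow> le x y \<Longrightarrow> H (u x x) (u y y) (u x y)"
    and uu: "\<And>x y z. x \<in> X \<Longrightarrow> y \<in> X \<Longrightarrow> z \<in> X \<Longrightarrow> le x y \<Longrightarrow> le y z \<Longrightarrow> le x z \<and> u y z \<bullet> u x y = u x z"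
    and f: "\<And>x y. x \<in> X \<Longrightarrow> y \<in> X \<Longrightarrow> le x y \<Longrightarrow> \<exists>g. u x y \<bullet> f x = f y \<bullet> g"
    and c: "\<And>x. x \<in> X \<Longrightarrow> coker (u x x) (f x) (c x) (\<pi> x)"
  obtains w where "\<And>x y. x \<in> X \<Longrightarrow> y \<in> X \<Longrightarrow> le x y \<Longrightarrow> H (c x) (c y) (w x y) \<and> w x y \<bullet> \<pi> x = \<pi> y \<bullet> u x y"
    "\<And>x y z. x \<in> X \<Longrightarrow> y \<in> X \<Longrightarrow> z \<in> X \<Longrightarrow> le x y \<Longrightarrow> le y z \<Longrightarrow> w y z \<bullet> w x y = w x z"
    "\<And>x. x \<in> X \<Longrightarrow> w x x = c x"
proof -
  have "\<exists>w. H (c x) (c y) w \<and> w \<bullet> \<pi> x = \<pi> y \<bullet> u x y" if xy: "x \<in> X" "y \<in> X" "le x y" for x y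
  proof -
    obtain g where "u x y \<bullet> f x = f y \<bullet> g" using f[OF xy] by blast
    hence "(\<pi> y \<bullet> u x y) \<bullet> f x = \<zero>" using cokerD(2)[OF c[OF xy(2)]] by (metis mul_assoc zero_left)
    thus ?thesis using coker_exH[OF c[OF xy(1)] H_comp[OF u[OF xy] cokerD(1)[OF c[OF xy(2)]]]] by blast
  qed
  then obtain w where w: "\<And>x y. x \<in> X \<Longrightarrow> y \<in> X \<Longrightarrow> le x y \<Longrightarrow> H (c x) (c y) (w x y) \<and> w x y \<bullet> \<pi> x = \<pi> y \<bullet> u x y"
    by metis
  have uniq: "a = b" if "x \<in> X" "H (c x) d a" "H (c x) d b" "a \<bullet> \<pi> x = b \<bullet> \<pi> x" for x a b d
    using epiD[OF coker_epi[OF c[OF that(1)]] that(2,3,4)] .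
  have 2: "w y z \<bullet> w x y = w x z" if "x \<in> X" "y \<in> X" "z \<in> X" "le x y" "le y z" for x y z
  proof (rule uniq[OF that(1)])
    show "H (c x) (c z) (w y z \<bullet> w x y)" using H_comp w that by blast
    show "H (c x) (c z) (w x z)" using w uu that by blast
    show "(w y z \<bullet> w x y) \<bullet> \<pi> x = w x z \<bullet> \<pi> x" using w uu that by (metis mul_assoc)
  qed
  have 3: "w x x = c x" if x: "x \<in> X" for x
  proof (rule uniq[OF x])
    show "H (c x) (c x) (w x x)" using w refl x by blast
    show "H (c x) (c x) (c x)" using H_id cokerD(1)[OF c[OF x]] HD by blast
    show "w x x \<bullet> \<pi> x = c x \<bullet> \<pi> x"
      using w[OF x x refl[OF x]] HD[OF cokerD(1)[OF c[OF x]]] by simp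
  qed
  show ?thesis using that w 2 3 by blast
qed

context strin begin

text \<open>A diagram is encoded by its arrows \<open>u x y\<close> for \<open>x \<preceq> y\<close>; its object at \<open>x\<close> is \<open>u x x\<close>. Only simplices whose
  vertices together satisfy \<open>P\<close> are constrained.\<close>

definition diag :: "nat \<Rightarrow> (nat set \<Rightarrow> bool) \<Rightarrow> (nat list \<Rightarrow> nat list \<Rightarrow> 'a) \<Rightarrow> bool" where
  "diag k P u \<longleftrightarrow>
    (\<forall>x y. sl k x \<longrightarrow> sl k y \<longrightarrow> x \<preceq> y \<longrightarrow> P (set x \<union> set y) \<longrightarrow> H (u x x) (u y y) (u x y)) \<and>
    (\<forall>x y z. sl k x \<longrightarrow> sl k y \<longrightarrow> sl k z \<longrightarrow> x \<preceq> y \<longrightarrow> y \<preceq> z \<longrightarrow>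
       P (set x \<union> set y \<union> set z) \<longrightarrow> u y z \<bullet> u x y = u x z) \<and>
    (\<forall>x. sl k x \<longrightarrow> \<not> distinct x \<longrightarrow> P (set x) \<longrightarrow> u x x = \<zero>)"

text \<open>For a simplex \<open>p @ a # b # q\<close>, the arrow into the face \<open>p @ a # q\<close> comes from the face omitting \<open>hd q\<close>. For
  \<open>q = []\<close> there is no such face, and exactness against \<open>\<zero>\<close> says that the outgoing arrow is a monomorphism.\<close>

definition inc :: "(nat list \<Rightarrow> nat list \<Rightarrow> 'a) \<Rightarrow> nat list \<Rightarrow> nat \<Rightarrow> nat \<Rightarrow> nat list \<Rightarrow> 'a" where
  "inc u p a b q = (if q = [] then \<zero> else u (p @ a # b # tl q) (p @ a # q))"

definition io :: "(nat list \<Rightarrow> nat list \<Rightarrow> 'a) \<Rightarrow> nat list \<Rightarrow> nat \<Rightarrow> nat \<Rightarrow> nat list \<Rightarrow> 'a" where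
  "io u p a b q = (if q = [] then \<zero> else u (p @ a # b # tl q) (p @ a # b # tl q))"

text \<open>Exactness at all terms of the sequence attached to \<open>c\<close> except the last one,
  where the epimorphism condition is kept apart as \<open>FEt\<close>. This one-sided notion is the
  one that passes to cokernels in the first vertex and that propagates from covered lists to all
  lists.\<close>

definition LEt :: "(nat list \<Rightarrow> nat list \<Rightarrow> 'a) \<Rightarrow> nat list \<Rightarrow> bool" where
  "LEt u c \<longleftrightarrow> (\<forall>p a b q. c = p @ a # b # q \<longrightarrow>
     ex (u (p @ a # q) (p @ a # q)) (inc u p a b q) (u (p @ a # q) (p @ b # q)))"

lemma inc_simps [simp]:
  "inc u p a b [] = \<zero>" "inc u p a b (z # q) = u (p @ a # b # q) (p @ a # z # q)"
  "inc u p a b (s @ z # q) = u (p @ a # b # tl (s @ z # q)) (p @ a # s @ z # q)"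
  "io u p a b [] = \<zero>" "io u p a b (z # q) = u (p @ a # b # q) (p @ a # b # q)"
  by (simp_all add: inc_def io_def)

lemma LEtD: "LEt u c \<Longrightarrow> c = p @ a # b # q \<Longrightarrow>
  ex (u (p @ a # q) (p @ a # q)) (inc u p a b q) (u (p @ a # q) (p @ b # q))"
  unfolding LEt_def by blast

lemma diagH: "diag k (\<lambda>S. S \<subseteq> D) u \<Longrightarrow> x \<preceq> y \<Longrightarrow> sl k x \<Longrightarrow> sl k y \<Longrightarrow> set x \<subseteq> D \<Longrightarrow> set y \<subseteq> D \<Longrightarrow>
  H (u x x) (u y y) (u x y)"
  unfolding diag_def by (elim conjE) simp

lemma diagC: "diag k (\<lambda>S. S \<subseteq> D) u \<Longrightarrow> x \<preceq> y \<Longrightarrow> y \<preceq> z \<Longrightarrow> sl k x \<Longrightarrow> sl k y \<Longrightarrow> sl k z \<Longrightarrow>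
  set x \<subseteq> D \<Longrightarrow> set y \<subseteq> D \<Longrightarrow> set z \<subseteq> D \<Longrightarrow> u y z \<bullet> u x y = u x z"
  unfolding diag_def by (elim conjE) simp

lemma diag0: "diag k (\<lambda>S. S \<subseteq> D) u \<Longrightarrow> sl k x \<Longrightarrow> \<not> distinct x \<Longrightarrow> set x \<subseteq> D \<Longrightarrow> u x x = \<zero>"
  unfolding diag_def by blast

lemma diag_through_0:
  assumes u: "diag k (\<lambda>S. S \<subseteq> D) u" and z: "\<not> distinct z"
    and "x \<preceq> z" "z \<preceq> y" "sl k x" "sl k z" "sl k y" "set x \<subseteq> D" "set y \<subseteq> D" "set z \<subseteq> D"
  shows "u x y = \<zero>"
proof -
  have "H (u x x) (u z z) (u x z)" "u z z = \<zero>" using diagH[OF u] diag0[OF u] assms by auto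
  hence "u x z = \<zero>" by (metis HD(4) zero_left)
  thus ?thesis using diagC[OF u, of x z y] assms by auto
qed

lemma inc_H:
  assumes u: "diag k (\<lambda>S. S \<subseteq> D) u" and "sorted (p @ a # b # q)" "set (p @ a # b # q) \<subseteq> D" "length (p @ a # b # q) = Suc k"
  shows "H (io u p a b q) (u (p @ a # q) (p @ a # q)) (inc u p a b q)"
proof (cases q)
  case Nil
  have "H (u (p @ a # q) (p @ a # q)) (u (p @ a # q) (p @ a # q)) (u (p @ a # q) (p @ a # q))"
    by (rule diagH[OF u]) (use assms in \<open>auto simp: sl_def sorted_append\<close>)
  thus ?thesis using Nil HD by auto
next
  case (Cons z q')
  show ?thesis unfolding Cons inc_simps
    by (rule diagH[OF u]) (use assms Cons in \<open>auto simp: sl_def sorted_append\<close>)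
qed

section \<open>Images and cokernels along a move of one vertex\<close>

text \<open>Two entries move, \<open>a\<close> to \<open>b\<close> and \<open>x\<close> to
  \<open>y\<close>, and exactness for the second move is wanted on the image of the first. By
  \<open>imex_step\<close> the first move may be replaced by the one that precedes it in its exact
  sequence, from \<open>b\<close> to the head of \<open>s\<close>, and the second by the one that
  follows it, from the last entry of \<open>s\<close> to \<open>x\<close>. The moves approach each
  other and \<open>s\<close> loses both ends, until at most one entry remains.\<close>

lemma image_row:
  assumes u: "diag k (\<lambda>S. S \<subseteq> D) u"
    and "sorted (p @ a # b # s @ x # y # q)" "set (p @ a # b # s @ x # y # q) \<subseteq> D"
      "length (p @ a # b # s @ x # y # q) = k + 2"
    and "\<And>c z d. b # s @ x # y # q = c @ z # d \<Longrightarrow> LEt u (p @ a # c @ d)"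
  shows "imex (u (p @ a # s @ x # q) (p @ a # s @ x # q)) (u (p @ b # s @ x # q) (p @ b # s @ x # q))
    (inc u (p @ a # s) x y q) (u (p @ a # s @ x # q) (p @ b # s @ x # q)) (u (p @ b # s @ x # q) (p @ b # s @ y # q))"
  using assms(2-)
proof (induction "length s" arbitrary: p a b s x y q rule: less_induct)
  case less
  note t = less.prems(1-3) and le = less.prems(4)
  have dh: "H (u x x) (u y y) (u x y)" if "x \<preceq> y" "sl k x" "sl k y" "set x \<subseteq> D" "set y \<subseteq> D" for x y
    using diagH[OF u] that by blast
  have dc: "u y z \<bullet> u x y = u x z" if "x \<preceq> y" "y \<preceq> z" "sl k x" "sl k y" "sl k z"
      "set x \<subseteq> D" "set y \<subseteq> D" "set z \<subseteq> D" for x y z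
    using diagC[OF u] that by blast
  have Ha: "H (u (p @ a # s @ x # q) (p @ a # s @ x # q)) (u (p @ a # s @ y # q) (p @ a # s @ y # q)) (u (p @ a # s @ x # q) (p @ a # s @ y # q))"
    by (rule dh) (use t in \<open>auto simp: sl_def sorted_append\<close>)
  have Hb: "H (u (p @ b # s @ x # q) (p @ b # s @ x # q)) (u (p @ b # s @ y # q) (p @ b # s @ y # q)) (u (p @ b # s @ x # q) (p @ b # s @ y # q))"
    by (rule dh) (use t in \<open>auto simp: sl_def sorted_append\<close>)
  have H1: "H (u (p @ a # s @ x # q) (p @ a # s @ x # q)) (u (p @ b # s @ x # q) (p @ b # s @ x # q)) (u (p @ a # s @ x # q) (p @ b # s @ x # q))"
    by (rule dh) (use t in \<open>auto simp: sl_def sorted_append\<close>)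
  have H0: "H (u (p @ a # s @ y # q) (p @ a # s @ y # q)) (u (p @ b # s @ y # q) (p @ b # s @ y # q)) (u (p @ a # s @ y # q) (p @ b # s @ y # q))"
    by (rule dh) (use t in \<open>auto simp: sl_def sorted_append\<close>)
  have H\<gamma>: "H (io u (p @ a # s) x y q) (u (p @ a # s @ x # q) (p @ a # s @ x # q)) (inc u (p @ a # s) x y q)"
    using inc_H[OF u, of "p @ a # s" x y q] t by (auto simp: sorted_append)
  have H\<kappa>1: "H (io u p a b (s @ x # q)) (u (p @ a # s @ x # q) (p @ a # s @ x # q)) (inc u p a b (s @ x # q))"
    by (rule inc_H[OF u]) (use t in \<open>auto simp: sorted_append\<close>)
  have H\<kappa>0: "H (io u p a b (s @ y # q)) (u (p @ a # s @ y # q) (p @ a # s @ y # q)) (inc u p a b (s @ y # q))"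
    by (rule inc_H[OF u]) (use t in \<open>auto simp: sorted_append\<close>)
  have c2: "u (p @ b # s @ x # q) (p @ b # s @ y # q) \<bullet> u (p @ a # s @ x # q) (p @ b # s @ x # q) =
    u (p @ a # s @ y # q) (p @ b # s @ y # q) \<bullet> u (p @ a # s @ x # q) (p @ a # s @ y # q)"
    by (subst dc, (use t in \<open>auto simp: sl_def sorted_append\<close>)[8], subst dc, (use t in \<open>auto simp: sl_def sorted_append\<close>)[8], rule refl)
  have e1: "ex (u (p @ a # s @ x # q) (p @ a # s @ x # q)) (inc u p a b (s @ x # q)) (u (p @ a # s @ x # q) (p @ b # s @ x # q))"
    by (rule LEtD[OF le[of "b # s @ [x]" y q]]) simp_all
  have e0: "ex (u (p @ a # s @ y # q) (p @ a # s @ y # q)) (inc u p a b (s @ y # q)) (u (p @ a # s @ y # q) (p @ b # s @ y # q))"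
    by (rule LEtD[OF le[of "b # s" x "y # q"]]) simp_all
  have lt: "LEt u (p @ a # s @ x # y # q)" using le[of "[]" b "s @ x # y # q"] by simp
  have e\<gamma>: "ex (u (p @ a # s @ x # q) (p @ a # s @ x # q)) (inc u (p @ a # s) x y q) (u (p @ a # s @ x # q) (p @ a # s @ y # q))"
    using LEtD[OF lt, of "p @ a # s" x y q] by simp
  consider (0) "s = []" | (1) v where "s = [v]" | (2) v s' w where "s = v # s' @ [w]"
    by (metis neq_Nil_conv rev_exhaust)
  then show ?case
  proof cases
    \<comment> \<open>The two moves now cross: their composite passes through the degenerate list
      \<open>p @ b # b # q\<close> and vanishes. The image row therefore comes from the identity of
      \<open>?S\<close> followed by \<open>\<zero>\<close>.\<close>
    case 0
    let ?S = "u (p @ a # b # q) (p @ a # b # q)"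
    have H\<alpha>: "H (u (p @ a # y # q) (p @ a # y # q)) (u (p @ x # y # q) (p @ x # y # q)) (u (p @ a # y # q) (p @ x # y # q))"
      by (rule dh) (use t 0 in \<open>auto simp: sl_def sorted_append\<close>)
    have OS: "Ob ?S" using HD[OF H\<kappa>0] 0 by simp
    have z: "u (p @ a # y # q) (p @ x # y # q) \<bullet> u (p @ a # b # q) (p @ a # y # q) = \<zero>"
      apply (subst dc, (use t 0 in \<open>auto simp: sl_def sorted_append\<close>)[8])
      by (rule diag_through_0[OF u, of "p @ b # b # q"]) (use t 0 in \<open>auto simp: sl_def sorted_append\<close>)
    have "imex ?S (u (p @ a # s @ y # q) (p @ a # s @ y # q)) ?S (inc u p a b (s @ y # q)) (u (p @ a # y # q) (p @ x # y # q))"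
      using imex_base[OF H_id[OF OS] _ H\<alpha>, of "u (p @ a # b # q) (p @ a # y # q)"]
        H\<kappa>0 ex_adm[OF H\<kappa>0 H0 e0] z ex_zero_right[OF H_id[OF OS]] ez_id[OF OS] 0 by simp
    moreover have "ex (u (p @ a # y # q) (p @ a # y # q)) (u (p @ a # x # q) (p @ a # y # q)) (u (p @ a # y # q) (p @ x # y # q))"
      using LEtD[OF lt, of p a x "y # q"] 0 by simp
    moreover have "u (p @ a # x # q) (p @ a # y # q) \<bullet> u (p @ a # b # q) (p @ a # x # q) = u (p @ a # b # q) (p @ a # y # q) \<bullet> ?S"
      using HD(3)[OF H\<kappa>0] dc[of "p @ a # b # q" "p @ a # x # q" "p @ a # y # q"] t 0 by (auto simp: sl_def sorted_append)
    ultimately show ?thesis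
      using imex_step[OF H\<gamma> Ha _ H_id[OF OS] _ _ H1 H0 Hb _ c2 e1 e0 e\<gamma>, of _ "u (p @ a # y # q) (p @ x # y # q)"] 0 H\<alpha> H\<kappa>1 H\<kappa>0
      by simp
  next
    \<comment> \<open>The moves \<open>b\<close> to \<open>v\<close> and \<open>v\<close> to
      \<open>x\<close> compose to the single move \<open>b\<close> to \<open>x\<close>, and its
      exactness is the hypothesis for the list without \<open>v\<close>.\<close>
    case (1 v)
    have H\<alpha>: "H (u (p @ a # s @ y # q) (p @ a # s @ y # q)) (u (p @ a # x # y # q) (p @ a # x # y # q)) (u (p @ a # s @ y # q) (p @ a # x # y # q))"
      by (rule dh) (use t 1 in \<open>auto simp: sl_def sorted_append\<close>)
    have Hs: "H (io u p a b (s @ x # q)) (io u p a b (s @ y # q)) (u (p @ a # b # x # q) (p @ a # b # y # q))"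
      unfolding 1 append_Cons append_Nil inc_simps
      by (rule dh) (use t 1 in \<open>auto simp: sl_def sorted_append\<close>)
    have c: "u (p @ a # s @ y # q) (p @ a # x # y # q) \<bullet> u (p @ a # b # y # q) (p @ a # s @ y # q) = u (p @ a # b # y # q) (p @ a # x # y # q)"
      by (rule dc) (use t 1 in \<open>auto simp: sl_def sorted_append\<close>)
    have "ex (u (p @ a # b # y # q) (p @ a # b # y # q)) (u (p @ a # b # x # q) (p @ a # b # y # q)) (u (p @ a # b # y # q) (p @ a # x # y # q))"
      using LEtD[OF le[of "[b]" v "x # y # q"], of "p @ [a]" b x "y # q"] 1 by simp
    hence "imex (io u p a b (s @ y # q)) (u (p @ a # s @ y # q) (p @ a # s @ y # q)) (u (p @ a # b # x # q) (p @ a # b # y # q)) (inc u p a b (s @ y # q)) (u (p @ a # s @ y # q) (p @ a # x # y # q))"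
      using imex_base[OF Hs H\<kappa>0 H\<alpha> ex_adm[OF H\<kappa>0 H0 e0]] c 1 by simp
    moreover have "ex (u (p @ a # s @ y # q) (p @ a # s @ y # q)) (u (p @ a # s @ x # q) (p @ a # s @ y # q)) (u (p @ a # s @ y # q) (p @ a # x # y # q))"
      using LEtD[OF lt, of "p @ [a]" v x "y # q"] 1 by simp
    moreover have "u (p @ a # s @ x # q) (p @ a # s @ y # q) \<bullet> u (p @ a # b # x # q) (p @ a # s @ x # q) = u (p @ a # b # y # q) (p @ a # s @ y # q) \<bullet> u (p @ a # b # x # q) (p @ a # b # y # q)"
      by (subst dc, (use t 1 in \<open>auto simp: sl_def sorted_append\<close>)[8], subst dc, (use t 1 in \<open>auto simp: sl_def sorted_append\<close>)[8], rule refl)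
    ultimately show ?thesis
      using imex_step[OF H\<gamma> Ha H\<alpha> Hs H\<kappa>1 H\<kappa>0 H1 H0 Hb _ c2 e1 e0 e\<gamma>] 1
      by simp
  next
    case (2 v s' w)
    have H\<alpha>: "H (u (p @ a # s @ y # q) (p @ a # s @ y # q)) (u (p @ a # v # s' @ x # y # q) (p @ a # v # s' @ x # y # q)) (u (p @ a # s @ y # q) (p @ a # v # s' @ x # y # q))"
      by (rule dh) (use t 2 in \<open>auto simp: sl_def sorted_append\<close>)
    have Hs: "H (io u p a b (s @ x # q)) (io u p a b (s @ y # q)) (u (p @ a # b # s' @ w # x # q) (p @ a # b # s' @ w # y # q))"
      unfolding 2 append_Cons append_Nil inc_simps append_assoc
      by (rule dh) (use t 2 in \<open>auto simp: sl_def sorted_append\<close>)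
    have "imex (u ((p @ [a]) @ b # s' @ w # y # q) ((p @ [a]) @ b # s' @ w # y # q)) (u ((p @ [a]) @ v # s' @ w # y # q) ((p @ [a]) @ v # s' @ w # y # q))
      (inc u ((p @ [a]) @ b # s') w x (y # q)) (u ((p @ [a]) @ b # s' @ w # y # q) ((p @ [a]) @ v # s' @ w # y # q)) (u ((p @ [a]) @ v # s' @ w # y # q) ((p @ [a]) @ v # s' @ x # y # q))"
    proof (rule less.hyps)
      show "length s' < length s" using 2 by simp
      show "sorted ((p @ [a]) @ b # v # s' @ w # x # y # q)" "set ((p @ [a]) @ b # v # s' @ w # x # y # q) \<subseteq> D"
        "length ((p @ [a]) @ b # v # s' @ w # x # y # q) = k + 2" using t 2 by auto
      fix c z d assume "v # s' @ w # x # y # q = c @ z # d"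
      thus "LEt u ((p @ [a]) @ b # c @ d)" using le[of "b # c" z d] 2 by simp
    qed
    hence "imex (io u p a b (s @ y # q)) (u (p @ a # s @ y # q) (p @ a # s @ y # q)) (u (p @ a # b # s' @ w # x # q) (p @ a # b # s' @ w # y # q)) (inc u p a b (s @ y # q)) (u (p @ a # s @ y # q) (p @ a # v # s' @ x # y # q))"
      using 2 by simp
    moreover have "ex (u (p @ a # s @ y # q) (p @ a # s @ y # q)) (u (p @ a # s @ x # q) (p @ a # s @ y # q)) (u (p @ a # s @ y # q) (p @ a # v # s' @ x # y # q))"
      using LEtD[OF lt, of "p @ a # v # s'" w x "y # q"] 2 by simp
    moreover have "u (p @ a # s @ x # q) (p @ a # s @ y # q) \<bullet> u (p @ a # b # s' @ w # x # q) (p @ a # s @ x # q) = u (p @ a # b # s' @ w # y # q) (p @ a # s @ y # q) \<bullet> u (p @ a # b # s' @ w # x # q) (p @ a # b # s' @ w # y # q)"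
      by (subst dc, (use t 2 in \<open>auto simp: sl_def sorted_append\<close>)[8], subst dc, (use t 2 in \<open>auto simp: sl_def sorted_append\<close>)[8], rule refl)
    ultimately show ?thesis
      using imex_step[OF H\<gamma> Ha H\<alpha> Hs H\<kappa>1 H\<kappa>0 H1 H0 Hb _ c2 e1 e0 e\<gamma>] 2
      by simp
  qed
qed

text \<open>\<open>imex_coker\<close> needs exactness on the image of the move \<open>r\<close> to
  \<open>w\<close> at the next term \<open>s @ y # q\<close>. For empty \<open>s\<close> this is
  exactness of the list without \<open>w\<close>, otherwise it is \<open>image_row\<close>. What
  results is exactness against \<open>\<pi> \<bullet> inc u\<close>; cancelling the projection of
  the preceding term turns this into exactness against \<open>inc v\<close>.\<close>

lemma coker_row:
  assumes u: "diag k (\<lambda>S. S \<subseteq> D) u"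
    and t: "sorted (r # w # s @ x # y # q)" "set (r # w # s @ x # y # q) \<subseteq> D" "length (r # w # s @ x # y # q) = k + 2"
    and le: "\<And>c z d. w # s @ x # y # q = c @ z # d \<Longrightarrow> LEt u (r # c @ d)"
    and lt: "LEt u (w # s @ x # y # q)"
    and c: "\<And>e. sl (length (s @ x # q)) e \<Longrightarrow> set e \<subseteq> set (s @ x # y # q) \<Longrightarrow> coker (u (w # e) (w # e)) (u (r # e) (w # e)) (v e e) (\<pi> e)"
    and v: "\<And>e f. sl (length (s @ x # q)) e \<Longrightarrow> sl (length (s @ x # q)) f \<Longrightarrow> set e \<subseteq> set (s @ x # y # q) \<Longrightarrow> set f \<subseteq> set (s @ x # y # q) \<Longrightarrow>
      e \<preceq> f \<Longrightarrow> H (v e e) (v f f) (v e f) \<and> v e f \<bullet> \<pi> e = \<pi> f \<bullet> u (w # e) (w # f)"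
  shows "ex (v (s @ x # q) (s @ x # q)) (inc v s x y q) (v (s @ x # q) (s @ y # q))"
proof -
  have dh: "H (u x x) (u y y) (u x y)" if "x \<preceq> y" "sl k x" "sl k y" "set x \<subseteq> D" "set y \<subseteq> D" for x y
    using diagH[OF u] that by blast
  have dc: "u y z \<bullet> u x y = u x z" if "x \<preceq> y" "y \<preceq> z" "sl k x" "sl k y" "sl k z"
      "set x \<subseteq> D" "set y \<subseteq> D" "set z \<subseteq> D" for x y z
    using diagC[OF u] that by blast
  have H\<beta>: "H (u (w # s @ x # q) (w # s @ x # q)) (u (w # s @ y # q) (w # s @ y # q)) (u (w # s @ x # q) (w # s @ y # q))"
    by (rule dh) (use t in \<open>auto simp: sl_def sorted_append\<close>)
  have H\<gamma>: "H (io u (w # s) x y q) (u (w # s @ x # q) (w # s @ x # q)) (inc u (w # s) x y q)"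
    using inc_H[OF u, of "w # s" x y q] t by (auto simp: sorted_append)
  have H1: "H (u (r # s @ x # q) (r # s @ x # q)) (u (w # s @ x # q) (w # s @ x # q)) (u (r # s @ x # q) (w # s @ x # q))"
    by (rule dh) (use t in \<open>auto simp: sl_def sorted_append\<close>)
  have Hs1: "H (u (r # s @ x # q) (r # s @ x # q)) (u (r # s @ y # q) (r # s @ y # q)) (u (r # s @ x # q) (r # s @ y # q))"
    by (rule dh) (use t in \<open>auto simp: sl_def sorted_append\<close>)
  have H0: "H (u (r # s @ y # q) (r # s @ y # q)) (u (w # s @ y # q) (w # s @ y # q)) (u (r # s @ y # q) (w # s @ y # q))"
    by (rule dh) (use t in \<open>auto simp: sl_def sorted_append\<close>)
  have comm: "u (w # s @ x # q) (w # s @ y # q) \<bullet> u (r # s @ x # q) (w # s @ x # q) = u (r # s @ y # q) (w # s @ y # q) \<bullet> u (r # s @ x # q) (r # s @ y # q)"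
    by (subst dc, (use t in \<open>auto simp: sl_def sorted_append\<close>)[8], subst dc, (use t in \<open>auto simp: sl_def sorted_append\<close>)[8], rule refl)
  have e\<gamma>: "ex (u (w # s @ x # q) (w # s @ x # q)) (inc u (w # s) x y q) (u (w # s @ x # q) (w # s @ y # q))"
    using LEtD[OF lt, of "w # s" x y q] by simp
  have e0: "ex (u (r # s @ y # q) (r # s @ y # q)) (inc u [] r w (s @ y # q)) (u (r # s @ y # q) (w # s @ y # q))"
    using LEtD[OF le[of "w # s" x "y # q"], of "[]" r w "s @ y # q"] by simp
  have ad: "adm (u (r # s @ y # q) (r # s @ y # q)) (u (w # s @ y # q) (w # s @ y # q)) (u (r # s @ y # q) (w # s @ y # q))"
  proof -
    have "H (io u [] r w (s @ y # q)) (u (r # s @ y # q) (r # s @ y # q)) (inc u [] r w (s @ y # q))"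
      using inc_H[OF u, of "[]" r w "s @ y # q"] t by (auto simp: sorted_append)
    from ex_adm2[OF this H0 e0] show ?thesis .
  qed
  have c1: "coker (u (w # s @ x # q) (w # s @ x # q)) (u (r # s @ x # q) (w # s @ x # q)) (v (s @ x # q) (s @ x # q)) (\<pi> (s @ x # q))"
    by (rule c) (use t in \<open>auto simp: sl_def sorted_append\<close>)
  have c0: "coker (u (w # s @ y # q) (w # s @ y # q)) (u (r # s @ y # q) (w # s @ y # q)) (v (s @ y # q) (s @ y # q)) (\<pi> (s @ y # q))"
    by (rule c) (use t in \<open>auto simp: sl_def sorted_append\<close>)
  have tt: "H (v (s @ x # q) (s @ x # q)) (v (s @ y # q) (s @ y # q)) (v (s @ x # q) (s @ y # q)) \<and>
     v (s @ x # q) (s @ y # q) \<bullet> \<pi> (s @ x # q) = \<pi> (s @ y # q) \<bullet> u (w # s @ x # q) (w # s @ y # q)"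
    by (rule v) (use t in \<open>auto simp: sl_def sorted_append\<close>)
  have "\<exists>A1 \<alpha>. H (u (w # s @ y # q) (w # s @ y # q)) A1 \<alpha> \<and> ex (u (w # s @ y # q) (w # s @ y # q)) (u (w # s @ x # q) (w # s @ y # q)) \<alpha> \<and>
    imex (u (r # s @ y # q) (r # s @ y # q)) (u (w # s @ y # q) (w # s @ y # q)) (u (r # s @ x # q) (r # s @ y # q)) (u (r # s @ y # q) (w # s @ y # q)) \<alpha>"
  proof (cases s rule: rev_cases)
    case Nil
    have H\<alpha>: "H (u (w # y # q) (w # y # q)) (u (x # y # q) (x # y # q)) (u (w # y # q) (x # y # q))"
      by (rule dh) (use t Nil in \<open>auto simp: sl_def sorted_append\<close>)
    have "u (w # y # q) (x # y # q) \<bullet> u (r # y # q) (w # y # q) = u (r # y # q) (x # y # q)"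
      by (rule dc) (use t Nil in \<open>auto simp: sl_def sorted_append\<close>)
    moreover have "ex (u (r # y # q) (r # y # q)) (u (r # x # q) (r # y # q)) (u (r # y # q) (x # y # q))"
      using LEtD[OF le[of "[]" w "x # y # q"], of "[]" r x "y # q"] Nil by simp
    ultimately have "imex (u (r # s @ y # q) (r # s @ y # q)) (u (w # s @ y # q) (w # s @ y # q)) (u (r # s @ x # q) (r # s @ y # q)) (u (r # s @ y # q) (w # s @ y # q)) (u (w # y # q) (x # y # q))"
      using imex_base[OF Hs1 H0 _ ad] H\<alpha> Nil by simp
    moreover have "ex (u (w # y # q) (w # y # q)) (u (w # x # q) (w # y # q)) (u (w # y # q) (x # y # q))"
      using LEtD[OF lt, of "[]" w x "y # q"] Nil by simp
    ultimately show ?thesis using H\<alpha> Nil by auto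
  next
    case (snoc s' z)
    have H\<alpha>: "H (u (w # s' @ z # y # q) (w # s' @ z # y # q)) (u (w # s' @ x # y # q) (w # s' @ x # y # q)) (u (w # s' @ z # y # q) (w # s' @ x # y # q))"
      by (rule dh) (use t snoc in \<open>auto simp: sl_def sorted_append\<close>)
    have "imex (u ([] @ r # s' @ z # y # q) ([] @ r # s' @ z # y # q)) (u ([] @ w # s' @ z # y # q) ([] @ w # s' @ z # y # q))
       (inc u ([] @ r # s') z x (y # q)) (u ([] @ r # s' @ z # y # q) ([] @ w # s' @ z # y # q)) (u ([] @ w # s' @ z # y # q) ([] @ w # s' @ x # y # q))"
      by (rule image_row[OF u]) (use t snoc le in \<open>auto\<close>)
    moreover have "ex (u (w # s' @ z # y # q) (w # s' @ z # y # q)) (u (w # s' @ z # x # q) (w # s' @ z # y # q)) (u (w # s' @ z # y # q) (w # s' @ x # y # q))"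
      using LEtD[OF lt, of "w # s'" z x "y # q"] snoc by simp
    ultimately show ?thesis using H\<alpha> snoc by auto
  qed
  then obtain A1 \<alpha> where \<alpha>: "H (u (w # s @ y # q) (w # s @ y # q)) A1 \<alpha>" "ex (u (w # s @ y # q) (w # s @ y # q)) (u (w # s @ x # q) (w # s @ y # q)) \<alpha>"
    "imex (u (r # s @ y # q) (r # s @ y # q)) (u (w # s @ y # q) (w # s @ y # q)) (u (r # s @ x # q) (r # s @ y # q)) (u (r # s @ y # q) (w # s @ y # q)) \<alpha>"
    by blast
  have main: "ex (v (s @ x # q) (s @ x # q)) (\<pi> (s @ x # q) \<bullet> inc u (w # s) x y q) (v (s @ x # q) (s @ y # q))"
    using imex_coker[OF H\<gamma> H\<beta> \<alpha>(1) Hs1 H1 comm e\<gamma> \<alpha>(2,3) c1 c0] tt by blast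
  show ?thesis
  proof (cases q)
    case Nil
    thus ?thesis using main by simp
  next
    case (Cons z q')
    have ce: "coker (u (w # s @ x # y # q') (w # s @ x # y # q')) (u (r # s @ x # y # q') (w # s @ x # y # q')) (v (s @ x # y # q') (s @ x # y # q')) (\<pi> (s @ x # y # q'))"
      by (rule c) (use t Cons in \<open>auto simp: sl_def sorted_append\<close>)
    have te: "H (v (s @ x # y # q') (s @ x # y # q')) (v (s @ x # q) (s @ x # q)) (v (s @ x # y # q') (s @ x # q)) \<and>
       v (s @ x # y # q') (s @ x # q) \<bullet> \<pi> (s @ x # y # q') = \<pi> (s @ x # q) \<bullet> u (w # s @ x # y # q') (w # s @ x # q)"
      by (rule v) (use t Cons in \<open>auto simp: sl_def sorted_append\<close>)
    show ?thesis
      using ex_epi_cancel[OF cokerD(1)[OF ce] te[THEN conjunct1] tt[THEN conjunct1] epi_ez[OF coker_epi[OF ce]]] main te Cons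
      by simp
  qed
qed

lemma coker_zero_ob: "coker \<zero> f c e \<Longrightarrow> c = \<zero>"
  unfolding coker_def H_def epi_def by (metis zero_right zero_left Ob_idem)

text \<open>Induction on \<open>k\<close>: the cokernels of \<open>u (r # x) \<rightarrow> u (Suc r # x)\<close> form a diagram of one dimension less. An inner
  induction on the distance of the first two vertices of \<open>c\<close> moves the first vertex from \<open>r\<close> to \<open>Suc r\<close>.\<close>

lemma LE_local_global:
  assumes "diag k (\<lambda>S. S \<subseteq> {lo..hi}) u"
    and "\<And>c. sl (Suc k) c \<Longrightarrow> set c \<subseteq> {lo..hi} \<Longrightarrow> cov k (set c) \<Longrightarrow> LEt u c"
    and "sl (Suc k) c" "set c \<subseteq> {lo..hi}"
  shows "LEt u c"
  using assms
proof (induction k arbitrary: lo u c)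
  case 0
  then obtain x where "c = [x]" by (auto simp: sl_def length_Suc_conv)
  thus ?case by (auto simp: LEt_def)
next
  case (Suc k)
  note u = Suc.prems(1) and loc = Suc.prems(2)
  let ?D = "{lo..hi}"
  show ?case using Suc.prems(3,4)
  proof (induction "hd (tl c) - hd c" arbitrary: c rule: less_induct)
    case (less c)
    obtain r d1 d' where cd: "c = r # d1 # d'" "length d' = k" using less.prems(1) by (auto simp: sl_def length_Suc_conv)
    have srt: "r \<le> d1" "sorted (d1 # d')" "set (d1 # d') \<subseteq> ?D" "r \<in> ?D" using less.prems cd by (auto simp: sl_def)
    show ?case
    proof (cases "d1 \<le> Suc r")
      case True
      \<comment> \<open>The first two entries share the pair \<open>{r, Suc r}\<close>, and each of
        the \<open>k\<close> others has a pair of its own.\<close>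
      have "cov (Suc k) (set c)"
        by (rule cov_pair[OF cov_set[of d' k, OF eq_refl[OF cd(2)]], of _ r]) (use True srt(1) cd in auto)
      thus ?thesis using loc less.prems by blast
    next
      case False
      \<comment> \<open>As a neighbour of \<open>r\<close>, the vertex \<open>w\<close> shares a
        pair with it. This leaves \<open>k\<close> pairs, exactly what an arbitrary list
        \<open>e\<close> of length \<open>k\<close> may need; so \<open>u\<close> is exact at every
        \<open>r # w # e\<close>.\<close>
      define w where "w = Suc r"
      define d where "d = d1 # d'"
      have c: "c = r # d" and sd: "sl (Suc k) d" using cd srt by (auto simp: sl_def d_def)
      have dD: "set d \<subseteq> {w..hi}" and wD: "w \<in> ?D" "r \<in> ?D" "r \<le> w" "{w..hi} \<subseteq> ?D"
      proof -
        have "Suc r \<le> d1" "d1 \<le> hi" "lo \<le> r" "r \<le> hi" using False srt by auto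
        moreover have "x \<le> hi" "d1 \<le> x" if "x \<in> set d'" for x using srt that by auto
        ultimately show "set d \<subseteq> {w..hi}" "w \<in> ?D" "r \<in> ?D" "r \<le> w" "{w..hi} \<subseteq> ?D"
          unfolding w_def d_def by fastforce+
      qed
      have srd: "\<forall>x\<in>set d. w \<le> x \<and> r \<le> x" "sorted (r # w # d)" "set d \<subseteq> ?D"
      proof -
        show 1: "\<forall>x\<in>set d. w \<le> x \<and> r \<le> x" using dD wD(3) by (meson atLeastAtMost_iff order.trans subsetD)
        show "sorted (r # w # d)" using 1 wD(3) sd by (auto simp: sl_def)
        show "set d \<subseteq> ?D" using dD wD(4) by (rule order.trans)
      qed
      have LEw: "LEt u (w # d)"
        by (rule less.hyps) (use cd c False less.prems dD wD in \<open>auto simp: w_def d_def sl_def\<close>)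
      have LErw: "LEt u (r # w # e)" if "sl k e" "set e \<subseteq> {w..hi}" for e
      proof (rule loc)
        show "sl (Suc (Suc k)) (r # w # e)" using that wD by (auto simp: sl_def)
        show "set (r # w # e) \<subseteq> ?D" using that wD by auto
        have "length e \<le> k" using that by (simp add: sl_def)
        thus "cov (Suc k) (set (r # w # e))"
          using cov_pair[OF cov_set[of e k], of "set (r # w # e)" r] that by (auto simp: w_def)
      qed
      have dh: "H (u x x) (u y y) (u x y)" if "x \<preceq> y" "sl (Suc k) x" "sl (Suc k) y" "set x \<subseteq> ?D" "set y \<subseteq> ?D" for x y
        using diagH[OF u] that by blast
      have dc: "u y z \<bullet> u x y = u x z" if "x \<preceq> y" "y \<preceq> z" "sl (Suc k) x" "sl (Suc k) y" "sl (Suc k) z"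
          "set x \<subseteq> ?D" "set y \<subseteq> ?D" "set z \<subseteq> ?D" for x y z
        using diagC[OF u] that by blast
      let ?X = "{e. sl k e \<and> set e \<subseteq> {w..hi}}"
      have XD: "sl (Suc k) (r # e) \<and> sl (Suc k) (w # e) \<and> set (r # e) \<subseteq> ?D \<and> set (w # e) \<subseteq> ?D" if "e \<in> ?X" for e
        using that wD by (auto simp: sl_def)
      have exr: "ex (u (r # e) (r # e)) (inc u [] r w e) (u (r # e) (w # e))" if "e \<in> ?X" for e
        using LEtD[OF LErw, of e "[]" r w e] that by simp
      have Hr: "H (u (r # e) (r # e)) (u (w # e) (w # e)) (u (r # e) (w # e))" if "e \<in> ?X" for e
        by (rule dh) (use XD[OF that] wD in auto)
      have Hinc: "H (io u [] r w e) (u (r # e) (r # e)) (inc u [] r w e)" if "e \<in> ?X" for e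
        using inc_H[OF u, of "[]" r w e] XD[OF that] that wD by (simp add: sl_def)
      have "\<exists>a p. coker (u (w # e) (w # e)) (u (r # e) (w # e)) a p" if "e \<in> ?X" for e
        using adm_cokerE[OF ex_adm2[OF Hinc[OF that] Hr[OF that] exr[OF that]]] by metis
      then obtain cc \<pi> where coke: "\<And>e. e \<in> ?X \<Longrightarrow> coker (u (w # e) (w # e)) (u (r # e) (w # e)) (cc e) (\<pi> e)"
        by metis
      obtain v where v0: "\<And>x y. x \<in> ?X \<Longrightarrow> y \<in> ?X \<Longrightarrow> x \<preceq> y \<Longrightarrow> H (cc x) (cc y) (v x y) \<and> v x y \<bullet> \<pi> x = \<pi> y \<bullet> u (w # x) (w # y)"
        and vv: "\<And>x y z. x \<in> ?X \<Longrightarrow> y \<in> ?X \<Longrightarrow> z \<in> ?X \<Longrightarrow> x \<preceq> y \<Longrightarrow> y \<preceq> z \<Longrightarrow> v y z \<bullet> v x y = v x z"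
        and vcc: "\<And>x. x \<in> ?X \<Longrightarrow> v x x = cc x"
      proof (rule coker_functor[of ?X "list_all2 (\<le>)" "\<lambda>x y. u (w # x) (w # y)" "\<lambda>x. u (r # x) (w # x)" cc \<pi>])
        fix x y assume xy: "x \<in> ?X" "y \<in> ?X" "x \<preceq> y"
        show "H (u (w # x) (w # x)) (u (w # y) (w # y)) (u (w # x) (w # y))"
          by (rule dh) (use XD[OF xy(1)] XD[OF xy(2)] xy(3) in auto)
        show "\<exists>g. u (w # x) (w # y) \<bullet> u (r # x) (w # x) = u (r # y) (w # y) \<bullet> g"
          by (rule exI[of _ "u (r # x) (r # y)"], subst dc, (use XD[OF xy(1)] XD[OF xy(2)] xy(3) wD in auto)[8],
              subst dc, (use XD[OF xy(1)] XD[OF xy(2)] xy(3) wD in auto)[8], rule refl)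
        fix z assume z: "z \<in> ?X" "y \<preceq> z"
        have "x \<preceq> z" using list_all2_trans[OF order.trans xy(3) z(2)] .
        moreover have "u (w # y) (w # z) \<bullet> u (w # x) (w # y) = u (w # x) (w # z)"
          by (rule dc) (use XD[OF xy(1)] XD[OF xy(2)] XD[OF z(1)] xy(3) z(2) in auto)
        ultimately show "x \<preceq> z \<and> u (w # y) (w # z) \<bullet> u (w # x) (w # y) = u (w # x) (w # z)" ..
      qed (use coke in auto)
      have coke': "coker (u (w # e) (w # e)) (u (r # e) (w # e)) (v e e) (\<pi> e)" if "e \<in> ?X" for e
        using coke[OF that] vcc[OF that] by simp
      have v: "H (v x x) (v y y) (v x y) \<and> v x y \<bullet> \<pi> x = \<pi> y \<bullet> u (w # x) (w # y)" if "x \<in> ?X" "y \<in> ?X" "x \<preceq> y" for x y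
        using v0[OF that] vcc that by simp
      have dv: "diag k (\<lambda>S. S \<subseteq> {w..hi}) v"
        unfolding diag_def
      proof (intro conjI allI impI)
        fix x assume x: "sl k x" "\<not> distinct x" "set x \<subseteq> {w..hi}"
        have "u (w # x) (w # x) = \<zero>" by (rule diag0[OF u]) (use x wD in \<open>auto simp: sl_def\<close>)
        thus "v x x = \<zero>" using coker_zero_ob coke'[of x] x by auto
      qed (use v vv in auto)
      \<comment> \<open>The outer induction asks for exactness of \<open>v\<close> only at lists
        \<open>e\<close> covered by \<open>k\<close> pairs. Together with the pair
        \<open>{r, w}\<close> this covers every face of \<open>r # w # e\<close>, so
        \<open>u\<close> is exact at these faces by hypothesis.\<close>
      have LEv: "LEt v e" if e: "sl (Suc k) e" "set e \<subseteq> {w..hi}" for e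
      proof (rule Suc.IH[OF dv _ e])
        fix e assume e: "sl (Suc k) e" "set e \<subseteq> {w..hi}" "cov k (set e)"
        show "LEt v e" unfolding LEt_def
        proof (intro allI impI)
          fix p a b q assume eq: "e = p @ a # b # q"
          show "ex (v (p @ a # q) (p @ a # q)) (inc v p a b q) (v (p @ a # q) (p @ b # q))"
          proof (rule coker_row[OF u, of r w p a b q])
            show "sorted (r # w # p @ a # b # q)" using e wD unfolding eq sl_def by fastforce
            show "set (r # w # p @ a # b # q) \<subseteq> ?D" using e wD unfolding eq by auto
            show "length (r # w # p @ a # b # q) = Suc k + 2" using e unfolding eq sl_def by simp
            fix c z d assume "w # p @ a # b # q = c @ z # d"
            hence "w # e = c @ z # d" by (simp add: eq)
            hence st: "sorted (c @ d)" "set (c @ d) \<subseteq> insert w (set e)" "length (c @ d) = Suc k"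
            proof -
              assume h: "w # e = c @ z # d"
              have "sorted (w # e)" using e unfolding sl_def by fastforce
              thus "sorted (c @ d)" unfolding h by (auto simp: sorted_append)
              have "set (w # e) = set (c @ z # d)" using h by simp
              thus "set (c @ d) \<subseteq> insert w (set e)" by auto
              have "length (w # e) = length (c @ z # d)" using h by simp
              thus "length (c @ d) = Suc k" using e by (simp add: sl_def)
            qed
            show "LEt u (r # c @ d)"
            proof (rule loc)
              have sub: "set (c @ d) \<subseteq> {w..hi}" using st(2) e(2) wD(1) by auto
              hence "\<forall>x\<in>set (c @ d). r \<le> x" using wD(3) by (meson atLeastAtMost_iff order.trans subsetD)
              thus "sl (Suc (Suc k)) (r # c @ d)" using st(1,3) by (simp add: sl_def)
              show "set (r # c @ d) \<subseteq> ?D" using sub wD(2,4) by auto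
              show "cov (Suc k) (set (r # c @ d))" by (rule cov_pair[OF e(3), of _ r]) (use st(2) in \<open>auto simp: w_def\<close>)
            qed
          next
            have "LEt u (w # e)"
            proof (rule loc)
              show "sl (Suc (Suc k)) (w # e)" using e by (auto simp: sl_def)
              show "set (w # e) \<subseteq> ?D" using e wD by auto
              show "cov (Suc k) (set (w # e))" by (rule cov_pair[OF e(3), of _ r]) (auto simp: w_def)
            qed
            thus "LEt u (w # p @ a # b # q)" by (simp add: eq)
          next
            have l: "length (p @ a # q) = k" using e unfolding eq sl_def by simp
            fix x assume x: "sl (length (p @ a # q)) x" "set x \<subseteq> set (p @ a # b # q)"
            have x': "x \<in> ?X" using x e unfolding l eq by auto
            show "coker (u (w # x) (w # x)) (u (r # x) (w # x)) (v x x) (\<pi> x)" by (rule coke'[OF x'])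
            fix y assume y: "sl (length (p @ a # q)) y" "set y \<subseteq> set (p @ a # b # q)" "x \<preceq> y"
            have y': "y \<in> ?X" using y e unfolding l eq by auto
            show "H (v x x) (v y y) (v x y) \<and> v x y \<bullet> \<pi> x = \<pi> y \<bullet> u (w # x) (w # y)" by (rule v[OF x' y' y(3)])
          qed
        qed
      qed
      have LEd: "LEt v d" using LEv[OF sd dD] .
      have ex\<pi>: "ex (u (w # e) (w # e)) (u (r # e) (w # e)) (\<pi> e)" if "e \<in> ?X" for e
        using coker_ex_ez[OF coke'[OF that] Hr[OF that]] .
      have H\<pi>: "H (u (w # e) (w # e)) (v e e) (\<pi> e)" and e\<pi>: "ez (v e e) (\<pi> e)" if "e \<in> ?X" for e
        using cokerD(1)[OF coke'[OF that]] epi_ez[OF coker_epi[OF coke'[OF that]]] by auto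
      \<comment> \<open>Four rows are stacked: \<open>u\<close> at lists
        \<open>r # w # tl X\<close>, \<open>u\<close> at \<open>r # X\<close>, \<open>u\<close> at
        \<open>w # X\<close>, and \<open>v\<close> at \<open>X\<close>; the columns are the
        beginnings of the exact sequences read from the right end of \<open>r # w # X\<close>.
        Exactness in the second row is deduced by \<open>row_step\<close> from the third, given by
        \<open>LEw\<close>, from the fourth, given by \<open>LEd\<close>, and from the image of the
        first.\<close>
      show ?thesis unfolding LEt_def
      proof (intro allI impI)
        fix p a b q assume eq: "c = p @ a # b # q"
        show "ex (u (p @ a # q) (p @ a # q)) (inc u p a b q) (u (p @ a # q) (p @ b # q))"
        proof (cases p)
          case (Cons r' p')
          have rp: "p = r # p'" and dp: "d = p' @ a # b # q" using eq Cons c by auto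
          define X1 X0 where X1_def: "X1 = p' @ a # q" and X0_def: "X0 = p' @ b # q"
          note sdp = sd[unfolded dp sl_def] srd(1,2)[unfolded dp] and dDp = dD[unfolded dp] srd(3)[unfolded dp]
          have X: "X1 \<in> ?X" "X0 \<in> ?X" "X1 \<preceq> X0" using sdp dDp by (auto simp: X1_def X0_def sl_def sorted_append)
          note XD1 = XD[OF X(1)] and XD0 = XD[OF X(2)]
          have HT1: "H (u (r # X1) (r # X1)) (u (r # X0) (r # X0)) (u (r # X1) (r # X0))"
            by (rule dh) (use XD1 XD0 X(3) in auto)
          have HR1: "H (u (w # X1) (w # X1)) (u (w # X0) (w # X0)) (u (w # X1) (w # X0))"
            by (rule dh) (use XD1 XD0 X(3) in auto)
          have c1: "u (r # X0) (w # X0) \<bullet> u (r # X1) (r # X0) = u (w # X1) (w # X0) \<bullet> u (r # X1) (w # X1)"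
            by (subst dc, (use XD1 XD0 X(3) wD in auto)[8], subst dc, (use XD1 XD0 X(3) wD in auto)[8], rule refl)
          have e1: "ex (u (w # X1) (w # X1)) (inc u (w # p') a b q) (u (w # X1) (w # X0))"
            using LEtD[OF LEw, of "w # p'" a b q] by (simp add: dp X1_def X0_def)
          \<comment> \<open>In both cases this is the arrow from
            \<open>r # w # tl (p' @ a # b # tl q)\<close> to \<open>r # w # tl X1\<close>. The
            formulas differ because the entry before \<open>b\<close> is \<open>w\<close> when
            \<open>p'\<close> is empty and \<open>a\<close> otherwise. For \<open>q = []\<close>
            both give \<open>\<zero>\<close>.\<close>
          define s2 S2 where "s2 = (if p' = [] then inc u [r] w b q else inc u (r # w # tl p') a b q)"
            and "S2 = (if p' = [] then io u [r] w b q else io u (r # w # tl p') a b q)"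
          have Hs2: "H S2 (io u [] r w X1) s2"
          proof (cases p')
            case Nil
            have "\<forall>x\<in>set q. w \<le> x" "set q \<subseteq> ?D" using dDp wD(4) by auto
            hence "\<forall>x\<in>set q. r \<le> x \<and> w \<le> x" "set q \<subseteq> ?D" using wD(3) by auto
            thus ?thesis using inc_H[OF u, of "[r]" w b q] Nil sdp dDp wD by (auto simp: s2_def S2_def X1_def)
          next
            case (Cons s1 p'')
            have "H (io u (r # w # p'') a b q) (u ((r # w # p'') @ a # q) ((r # w # p'') @ a # q)) (inc u (r # w # p'') a b q)"
              by (rule inc_H[OF u]) (use Cons sdp dDp wD in \<open>auto simp: sorted_append\<close>)
            thus ?thesis using Cons by (simp add: s2_def S2_def X1_def)
          qed
          \<comment> \<open>The image in question is that of the move from \<open>w\<close> to the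
            head of \<open>X1\<close>. If this head is the entry that moves next, the two moves
            compose to one and \<open>imex_base\<close> applies; otherwise the moving entries are
            different and \<open>image_row\<close> applies.\<close>
          have im: "imex (io u [] r w X1) (u (r # X1) (r # X1)) s2 (inc u [] r w X1) (u (r # X1) (r # X0))"
          proof (cases p')
            case Nil
            have "LEt u (r # w # b # q)" by (rule LErw) (use Nil sdp dDp in \<open>auto simp: sl_def\<close>)
            from LEtD[OF this, of "[r]" w b q]
            have "ex (u (r # w # q) (r # w # q)) (inc u [r] w b q) (u (r # w # q) (r # b # q))" by simp
            hence "ex (u (r # w # q) (r # w # q)) s2 (u (r # w # q) (r # b # q))" using Nil by (simp only: s2_def if_True simp_thms)
            moreover have "u (r # a # q) (r # b # q) \<bullet> u (r # w # q) (r # a # q) = u (r # w # q) (r # b # q)"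
              by (rule dc) (use Nil sdp dDp wD in \<open>auto simp: sl_def\<close>)
            ultimately show ?thesis
              using imex_base[OF Hs2 Hinc[OF X(1)] HT1 ex_adm[OF Hinc[OF X(1)] Hr[OF X(1)] exr[OF X(1)]]] Nil
              by (simp add: X1_def X0_def)
          next
            case (Cons s1 p'')
            have "imex (u ([r] @ w # p'' @ a # q) ([r] @ w # p'' @ a # q)) (u ([r] @ s1 # p'' @ a # q) ([r] @ s1 # p'' @ a # q))
              (inc u ([r] @ w # p'') a b q) (u ([r] @ w # p'' @ a # q) ([r] @ s1 # p'' @ a # q)) (u ([r] @ s1 # p'' @ a # q) ([r] @ s1 # p'' @ b # q))"
            proof (rule image_row[OF u])
              show "sorted ([r] @ w # s1 # p'' @ a # b # q)" 
              proof -
                have "d = s1 # p'' @ a # b # q" using dp Cons by simp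
                thus ?thesis using srd(2) by simp
              qed
              show "set ([r] @ w # s1 # p'' @ a # b # q) \<subseteq> ?D" using Cons dDp wD by auto
              show "length ([r] @ w # s1 # p'' @ a # b # q) = Suc k + 2" using Cons sdp by simp
              fix c z e assume "s1 # p'' @ a # b # q = c @ z # e"
              hence d: "d = c @ z # e" using Cons dp by simp
              have "LEt u (r # w # c @ e)" by (rule LErw) (use sd dD in \<open>auto simp: d sl_def sorted_append\<close>)
              thus "LEt u ([r] @ w # c @ e)" by simp
            qed
            thus ?thesis using Cons by (simp add: s2_def X1_def X0_def)
          qed
          have "ex (u (r # X1) (r # X1)) (inc u (r # p') a b q) (u (r # X1) (r # X0))"
          proof (cases q)
            case Nil
            have s2z: "s2 = \<zero>" "S2 = \<zero>" by (auto simp: s2_def S2_def Nil)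
            \<comment> \<open>For \<open>q = []\<close> the term \<open>T1\<close> is the first of
              its row, so everything to its left is \<open>\<zero>\<close>.\<close>
            show ?thesis unfolding Nil inc_simps
            proof (rule row_step[where ?R3.0="\<zero>" and ?R2.0="\<zero>" and ?A2.0="\<zero>" and ?T2.0="\<zero>" and ?S2.0="\<zero>" and ?\<rho>3.0="\<zero>" and ?\<rho>2.0="\<zero>" and ?\<alpha>2.0="\<zero>" and ?v2.0="\<zero>"
                  and ?\<pi>2.0="\<zero>" and ?\<kappa>2.0="\<zero>" and ?s2.0="\<zero>"])
              show "H (u (r # X1) (r # X1)) (u (r # X0) (r # X0)) (u (r # X1) (r # X0))" by (rule HT1)
              show "H (u (w # X1) (w # X1)) (u (w # X0) (w # X0)) (u (w # X1) (w # X0))" by (rule HR1)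
              show "H (u (r # X1) (r # X1)) (u (w # X1) (w # X1)) (u (r # X1) (w # X1))" using Hr X by blast
              show "H (u (r # X0) (r # X0)) (u (w # X0) (w # X0)) (u (r # X0) (w # X0))" using Hr X by blast
              show "H (u (w # X1) (w # X1)) (v X1 X1) (\<pi> X1)" using H\<pi> X by blast
              show "H (io u [] r w X1) (u (r # X1) (r # X1)) (inc u [] r w X1)" using Hinc X by blast
              show "u (r # X0) (w # X0) \<bullet> u (r # X1) (r # X0) = u (w # X1) (w # X0) \<bullet> u (r # X1) (w # X1)" by (rule c1)
              show "ex (u (w # X1) (w # X1)) \<zero> (u (w # X1) (w # X0))" using e1 Nil by simp
              show "ex (u (w # X1) (w # X1)) (u (r # X1) (w # X1)) (\<pi> X1)" using ex\<pi> X by blast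
              show "ex (u (r # X1) (r # X1)) (inc u [] r w X1) (u (r # X1) (w # X1))" using exr X by blast
              show "imex (io u [] r w X1) (u (r # X1) (r # X1)) \<zero> (inc u [] r w X1) (u (r # X1) (r # X0))" using im s2z by simp
            qed (use HD[OF HT1] HD[OF HR1] HD[OF H\<pi>[OF X(1)]] HD[OF Hinc[OF X(1)]] ex_000 in \<open>auto simp: ez_def\<close>)
          next
            case (Cons z q')
            define X2 where "X2 = p' @ a # b # q'"
            have X2: "X2 \<in> ?X" "X2 \<preceq> X1" "X2 \<preceq> X0" using sdp dDp Cons by (auto simp: X2_def X1_def X0_def sl_def sorted_append)
            note XD2 = XD[OF X2(1)]
            have i2: "inc u (r # p') a b q = u (r # X2) (r # X1)" "inc u (w # p') a b q = u (w # X2) (w # X1)" "io u (r # p') a b q = u (r # X2) (r # X2)" "io u (w # p') a b q = u (w # X2) (w # X2)"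
              "inc v p' a b q = v X2 X1"
              by (simp_all add: Cons X2_def X1_def)
            have H\<rho>3: "H (io u (w # p' @ [a]) b z q') (u (w # X2) (w # X2)) (inc u (w # p' @ [a]) b z q')"
              using inc_H[OF u, of "w # p' @ [a]" b z q'] sdp dDp wD Cons by (auto simp: X2_def sorted_append)
            have z0: "u (r # X1) (r # X0) \<bullet> u (r # X2) (r # X1) = \<zero>"
              apply (subst dc, (use XD1 XD0 XD2 X X2 in auto)[8])
              by (rule diag_through_0[OF u, of "r # p' @ b # b # q'"]) (use sdp dDp wD Cons in \<open>auto simp: X2_def X0_def sl_def sorted_append\<close>)
            show ?thesis unfolding i2
            proof (rule row_step[OF _ HT1 H\<rho>3 _ HR1])
              show "H (u (r # X2) (r # X2)) (u (r # X1) (r # X1)) (u (r # X2) (r # X1))" by (rule dh) (use XD1 XD2 X2 in auto)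
              show "H (u (w # X2) (w # X2)) (u (w # X1) (w # X1)) (u (w # X2) (w # X1))" by (rule dh) (use XD1 XD2 X2 in auto)
              show "H (v X2 X2) (v X1 X1) (v X2 X1)" using v X X2 by blast
              show "H (u (r # X2) (r # X2)) (u (w # X2) (w # X2)) (u (r # X2) (w # X2))" using Hr X2 by blast
              show "H (u (r # X1) (r # X1)) (u (w # X1) (w # X1)) (u (r # X1) (w # X1))" using Hr X by blast
              show "H (u (r # X0) (r # X0)) (u (w # X0) (w # X0)) (u (r # X0) (w # X0))" using Hr X by blast
              show "H (u (w # X2) (w # X2)) (v X2 X2) (\<pi> X2)" "H (u (w # X1) (w # X1)) (v X1 X1) (\<pi> X1)" using H\<pi> X X2 by blast+
              show "H S2 (io u [] r w X1) s2" by (rule Hs2)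
              show "H S2 (u (r # X2) (r # X2)) (inc u [] r w X2)"
              proof -
                have "S2 = io u [] r w X2" by (cases p') (auto simp: S2_def X2_def io_def Cons)
                thus ?thesis using Hinc X2 by simp
              qed
              show "H (io u [] r w X1) (u (r # X1) (r # X1)) (inc u [] r w X1)" using Hinc X by blast
              show "u (r # X1) (r # X0) \<bullet> u (r # X2) (r # X1) = \<zero>" by (rule z0)
              show "u (r # X1) (w # X1) \<bullet> u (r # X2) (r # X1) = u (w # X2) (w # X1) \<bullet> u (r # X2) (w # X2)"
                by (subst dc, (use XD1 XD2 X2 wD in auto)[8], subst dc, (use XD1 XD2 X2 wD in auto)[8], rule refl)
              show "u (r # X0) (w # X0) \<bullet> u (r # X1) (r # X0) = u (w # X1) (w # X0) \<bullet> u (r # X1) (w # X1)" by (rule c1)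
              show "\<pi> X1 \<bullet> u (w # X2) (w # X1) = v X2 X1 \<bullet> \<pi> X2" using v X X2 by simp
              show "inc u [] r w X1 \<bullet> s2 = u (r # X2) (r # X1) \<bullet> inc u [] r w X2"
              proof (cases p')
                case Nil
                have [simp]: "inc u [] r w X1 = u (r # w # q) (r # a # q)" "s2 = u (r # w # b # q') (r # w # q)" "inc u [] r w X2 = u (r # w # b # q') (r # a # b # q')"
                  using Nil Cons by (auto simp: X1_def X2_def s2_def)
                have 1: "u (r # w # q) (r # a # q) \<bullet> u (r # w # b # q') (r # w # q) = u (r # w # b # q') (r # a # q)"
                  by (rule dc) (use sdp dDp wD Cons Nil in \<open>auto simp: sl_def\<close>)
                have 2: "u (r # a # b # q') (r # a # q) \<bullet> u (r # w # b # q') (r # a # b # q') = u (r # w # b # q') (r # a # q)"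
                  by (rule dc) (use sdp dDp wD Cons Nil in \<open>auto simp: sl_def\<close>)
                have [simp]: "X1 = a # q" "X2 = a # b # q'" by (auto simp: X1_def X2_def Nil)
                show ?thesis using 1 2 by simp
              next
                case (Cons s1 p'')
                have [simp]: "inc u [] r w X1 = u (r # w # p'' @ a # q) (r # X1)" "s2 = u (r # w # p'' @ a # b # q') (r # w # p'' @ a # q)" "inc u [] r w X2 = u (r # w # p'' @ a # b # q') (r # X2)"
                  using Cons \<open>q = z # q'\<close> by (auto simp: X1_def X2_def s2_def inc_def)
                show ?thesis
                  by (simp, subst dc, (use sdp dDp wD Cons \<open>q = z # q'\<close> in \<open>auto simp: X2_def X1_def sl_def sorted_append\<close>)[8],
                    subst dc, (use sdp dDp wD Cons \<open>q = z # q'\<close> in \<open>auto simp: X2_def X1_def sl_def sorted_append\<close>)[8], simp add: X1_def Cons)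
              qed
              show "ex (u (w # X2) (w # X2)) (inc u (w # p' @ [a]) b z q') (u (w # X2) (w # X1))"
                using LEtD[OF LEw, of "w # p' @ [a]" b z q'] Cons by (simp add: dp X2_def X1_def)
              show "ex (u (w # X1) (w # X1)) (u (w # X2) (w # X1)) (u (w # X1) (w # X0))" using e1 i2 by simp
              show "ez (v X2 X2) (\<pi> X2)" using e\<pi> X2 by blast
              show "ex (u (w # X2) (w # X2)) (u (r # X2) (w # X2)) (\<pi> X2)" "ex (u (w # X1) (w # X1)) (u (r # X1) (w # X1)) (\<pi> X1)" using ex\<pi> X X2 by blast+
              show "ex (u (r # X2) (r # X2)) (inc u [] r w X2) (u (r # X2) (w # X2))" "ex (u (r # X1) (r # X1)) (inc u [] r w X1) (u (r # X1) (w # X1))" using exr X X2 by blast+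
              show "imex (io u [] r w X1) (u (r # X1) (r # X1)) s2 (inc u [] r w X1) (u (r # X1) (r # X0))" by (rule im)
              have e2: "ex (v X2 X2) (inc v (p' @ [a]) b z q') (v X2 X1)"
                using LEtD[OF LEd, of "p' @ [a]" b z q'] Cons by (simp add: dp X2_def X1_def)
              show "ex (v X2 X2) (\<pi> X2 \<bullet> inc u (w # p' @ [a]) b z q') (v X2 X1)"
              proof (cases q')
                case Nil
                thus ?thesis using e2 by simp
              next
                case (Cons z' q'')
                define X3 where "X3 = p' @ a # b # z # q''"
                have X3: "X3 \<in> ?X" "X3 \<preceq> X2" using sdp dDp Cons \<open>q = z # q'\<close> by (auto simp: X2_def X3_def sl_def sorted_append)
                have [simp]: "inc u (w # p' @ [a]) b z q' = u (w # X3) (w # X2)" "inc v (p' @ [a]) b z q' = v X3 X2"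
                  by (auto simp: Cons X3_def X2_def)
                have "\<pi> X2 \<bullet> u (w # X3) (w # X2) = v X3 X2 \<bullet> \<pi> X3" using v X3 X2 by simp
                moreover have "ex (v X2 X2) (v X3 X2 \<bullet> \<pi> X3) (v X2 X1)"
                  by (rule ex_epi[OF H\<pi>[OF X3(1)] v[OF X3(1) X2(1) X3(2), THEN conjunct1] e\<pi>[OF X3(1)] _ v[OF X2(1) X(1) X2(2), THEN conjunct1]])
                    (use e2 in simp)
                ultimately show ?thesis by simp
              qed
            qed
          qed
          thus ?thesis by (simp add: rp X1_def X0_def)
        next
          \<comment> \<open>Here the vertex \<open>r\<close> itself moves to \<open>b\<close>.
            Replacing \<open>r\<close> or \<open>w\<close> by \<open>b\<close> gives the same list,
            so the last column is the identity of \<open>u (b # q) (b # q)\<close>, and the row of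
            \<open>v\<close> is only followed up to \<open>q\<close>.\<close>
          case Nil
          have ra: "a = r" and dp: "d = b # q" using eq Nil c by auto
          note sdp = sd[unfolded dp sl_def] srd(1,2)[unfolded dp] and dDp = dD[unfolded dp] srd(3)[unfolded dp]
          have X: "q \<in> ?X" using sdp dDp by (auto simp: sl_def)
          have bq: "sl (Suc k) (b # q)" "set (b # q) \<subseteq> ?D" using sdp dDp wD by (auto simp: sl_def)
          note XDq = XD[OF X]
          have HT1: "H (u (r # q) (r # q)) (u (b # q) (b # q)) (u (r # q) (b # q))"
            by (rule dh) (use XDq bq dDp wD in auto)
          have HR1: "H (u (w # q) (w # q)) (u (b # q) (b # q)) (u (w # q) (b # q))"
            by (rule dh) (use XDq bq dDp wD in auto)
          have HT0: "H (u (b # q) (b # q)) (u (b # q) (b # q)) (u (b # q) (b # q))"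
            by (rule dh) (use bq in auto)
          have c1: "u (b # q) (b # q) \<bullet> u (r # q) (b # q) = u (w # q) (b # q) \<bullet> u (r # q) (w # q)"
          proof -
            have "u (w # q) (b # q) \<bullet> u (r # q) (w # q) = u (r # q) (b # q)"
              by (rule dc) (use XDq bq dDp wD in auto)
            thus ?thesis using HD(4)[OF HT1] by simp
          qed
          have e1: "ex (u (w # q) (w # q)) (inc u [] w b q) (u (w # q) (b # q))"
            using LEtD[OF LEw, of "[]" w b q] by (simp add: dp)
          have "ex (u (r # q) (r # q)) (inc u [] r b q) (u (r # q) (b # q))"
          proof (cases q)
            case Nil
            show ?thesis unfolding Nil inc_simps
            proof (rule row_step[where ?R3.0="\<zero>" and ?R2.0="\<zero>" and ?A2.0="\<zero>" and ?T2.0="\<zero>" and ?S2.0="\<zero>" and ?S1.0="\<zero>" and ?\<rho>3.0="\<zero>" and ?\<rho>2.0="\<zero>" and ?\<alpha>2.0="\<zero>" and ?v2.0="\<zero>"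
                  and ?\<pi>2.0="\<zero>" and ?\<kappa>2.0="\<zero>" and ?s2.0="\<zero>" and ?\<kappa>1.0="\<zero>"])
              show "H (u [r] [r]) (u [b] [b]) (u [r] [b])" using HT1 Nil by simp
              show "H (u [w] [w]) (u [b] [b]) (u [w] [b])" using HR1 Nil by simp
              show "H (u [r] [r]) (u [w] [w]) (u [r] [w])" using Hr[OF X] Nil by simp
              show "H (u [b] [b]) (u [b] [b]) (u [b] [b])" using HT0 Nil by simp
              show "H (u [w] [w]) (v [] []) (\<pi> [])" using H\<pi>[OF X] Nil by simp
              show "u [b] [b] \<bullet> u [r] [b] = u [w] [b] \<bullet> u [r] [w]" using c1 Nil by simp
              show "ex (u [w] [w]) \<zero> (u [w] [b])" using e1 Nil by simp
              show "ex (u [w] [w]) (u [r] [w]) (\<pi> [])" using ex\<pi>[OF X] Nil by simp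
              show "ex (u [r] [r]) \<zero> (u [r] [w])" using exr[OF X] Nil by simp
              show "imex \<zero> (u [r] [r]) \<zero> \<zero> (u [r] [b])" using imex_0 HT1 Nil by simp
            qed (use HD[OF HT1] HD[OF HR1] HD[OF H\<pi>[OF X]] Nil ex_000 in \<open>auto simp: ez_def\<close>)
          next
            case (Cons z q')
            define X2 where "X2 = b # q'"
            have X2: "X2 \<in> ?X" "X2 \<preceq> q" using sdp dDp Cons by (auto simp: X2_def sl_def)
            note XD2 = XD[OF X2(1)]
            let ?S = "u (r # w # q') (r # w # q')"
            have i2: "inc u [] r b q = u (r # X2) (r # q)" "inc u [] w b q = u (w # X2) (w # q)" "inc u [] r w q = u (r # w # q') (r # q)" "io u [] r w q = ?S"
              "inc u [] r w X2 = u (r # w # q') (r # X2)" "io u [] r w X2 = ?S"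
              by (simp_all add: Cons X2_def)
            have wq: "sl (Suc k) (r # w # q')" "set (r # w # q') \<subseteq> ?D" using sdp dDp wD Cons by (auto simp: sl_def)
            have Hi1: "H ?S (u (r # q) (r # q)) (u (r # w # q') (r # q))" using Hinc[OF X] i2 by simp
            have Hi2: "H ?S (u (r # X2) (r # X2)) (u (r # w # q') (r # X2))" using Hinc[OF X2(1)] i2 by simp
            have OS: "Ob ?S" using HD[OF Hi1] by simp
            have H\<rho>3: "H (io u [w] b z q') (u (w # X2) (w # X2)) (inc u [w] b z q')"
              using inc_H[OF u, of "[w]" b z q'] sdp dDp wD Cons by (auto simp: X2_def)
            have z0: "u (r # q) (b # q) \<bullet> u (r # X2) (r # q) = \<zero>"
              apply (subst dc, (use XDq bq XD2 X2 dDp wD in auto)[8])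
              by (rule diag_through_0[OF u, of "b # b # q'"]) (use sdp dDp wD Cons in \<open>auto simp: X2_def sl_def\<close>)
            have z1: "u (r # q) (b # q) \<bullet> u (r # w # q') (r # q) = \<zero>"
              apply (subst dc, (use XDq bq wq X2 sdp dDp wD Cons in auto)[8])
              by (rule diag_through_0[OF u, of "w # w # q'"]) (use sdp dDp wD Cons in \<open>auto simp: sl_def\<close>)
            have im: "imex ?S (u (r # q) (r # q)) ?S (u (r # w # q') (r # q)) (u (r # q) (b # q))"
              using imex_base[OF H_id[OF OS] Hi1 HT1] ex_adm[OF Hi1 Hr[OF X]] exr[OF X] i2 z1 ex_zero_right[OF H_id[OF OS]] ez_id[OF OS]
              by simp
            show ?thesis unfolding i2
            proof (rule row_step[OF _ HT1 H\<rho>3 _ HR1])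
              show "H (u (r # X2) (r # X2)) (u (r # q) (r # q)) (u (r # X2) (r # q))" by (rule dh) (use XDq XD2 X2 in auto)
              show "H (u (w # X2) (w # X2)) (u (w # q) (w # q)) (u (w # X2) (w # q))" by (rule dh) (use XDq XD2 X2 in auto)
              show "H (v X2 X2) (v q q) (v X2 q)" using v X X2 by blast
              show "H (u (r # X2) (r # X2)) (u (w # X2) (w # X2)) (u (r # X2) (w # X2))" using Hr X2 by blast
              show "H (u (r # q) (r # q)) (u (w # q) (w # q)) (u (r # q) (w # q))" using Hr X by blast
              show "H (u (b # q) (b # q)) (u (b # q) (b # q)) (u (b # q) (b # q))" by (rule HT0)
              show "H (u (w # X2) (w # X2)) (v X2 X2) (\<pi> X2)" "H (u (w # q) (w # q)) (v q q) (\<pi> q)" using H\<pi> X X2 by blast+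
              show "H ?S ?S ?S" by (rule H_id[OF OS])
              show "H ?S (u (r # X2) (r # X2)) (u (r # w # q') (r # X2))" by (rule Hi2)
              show "H ?S (u (r # q) (r # q)) (u (r # w # q') (r # q))" by (rule Hi1)
              show "u (r # q) (b # q) \<bullet> u (r # X2) (r # q) = \<zero>" by (rule z0)
              show "u (r # q) (w # q) \<bullet> u (r # X2) (r # q) = u (w # X2) (w # q) \<bullet> u (r # X2) (w # X2)"
                by (subst dc, (use XDq XD2 X2 wD in auto)[8], subst dc, (use XDq XD2 X2 wD in auto)[8], rule refl)
              show "u (b # q) (b # q) \<bullet> u (r # q) (b # q) = u (w # q) (b # q) \<bullet> u (r # q) (w # q)" by (rule c1)
              show "\<pi> q \<bullet> u (w # X2) (w # q) = v X2 q \<bullet> \<pi> X2" using v X X2 by simp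
              show "u (r # w # q') (r # q) \<bullet> ?S = u (r # X2) (r # q) \<bullet> u (r # w # q') (r # X2)"
                unfolding HD(3)[OF Hi1]
                by (subst dc) (use sdp dDp wD Cons XDq XD2 in \<open>auto simp: X2_def sl_def\<close>)
              show "ex (u (w # X2) (w # X2)) (inc u [w] b z q') (u (w # X2) (w # q))"
                using LEtD[OF LEw, of "[w]" b z q'] Cons by (simp add: dp X2_def)
              show "ex (u (w # q) (w # q)) (u (w # X2) (w # q)) (u (w # q) (b # q))" using e1 i2 by simp
              show "ez (v X2 X2) (\<pi> X2)" using e\<pi> X2 by blast
              show "ex (u (w # X2) (w # X2)) (u (r # X2) (w # X2)) (\<pi> X2)" "ex (u (w # q) (w # q)) (u (r # q) (w # q)) (\<pi> q)" using ex\<pi> X X2 by blast+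
              show "ex (u (r # X2) (r # X2)) (u (r # w # q') (r # X2)) (u (r # X2) (w # X2))" "ex (u (r # q) (r # q)) (u (r # w # q') (r # q)) (u (r # q) (w # q))" using exr X X2 i2 by fastforce+
              show "imex ?S (u (r # q) (r # q)) ?S (u (r # w # q') (r # q)) (u (r # q) (b # q))" by (rule im)
              have e2: "ex (v X2 X2) (inc v [] b z q') (v X2 q)"
                using LEtD[OF LEd, of "[]" b z q'] Cons by (simp add: dp X2_def)
              show "ex (v X2 X2) (\<pi> X2 \<bullet> inc u [w] b z q') (v X2 q)"
              proof (cases q')
                case Nil
                thus ?thesis using e2 by simp
              next
                case (Cons z' q'')
                define X3 where "X3 = b # z # q''"
                have X3: "X3 \<in> ?X" "X3 \<preceq> X2" using sdp dDp Cons \<open>q = z # q'\<close> by (auto simp: X2_def X3_def sl_def)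
                have [simp]: "inc u [w] b z q' = u (w # X3) (w # X2)" "inc v [] b z q' = v X3 X2"
                  by (auto simp: Cons X3_def X2_def)
                have "\<pi> X2 \<bullet> u (w # X3) (w # X2) = v X3 X2 \<bullet> \<pi> X3" using v X3 X2 by simp
                moreover have "ex (v X2 X2) (v X3 X2 \<bullet> \<pi> X3) (v X2 q)"
                  by (rule ex_epi[OF H\<pi>[OF X3(1)] v[OF X3(1) X2(1) X3(2), THEN conjunct1] e\<pi>[OF X3(1)] _ v[OF X2(1) X X2(2), THEN conjunct1]])
                    (use e2 in simp)
                ultimately show ?thesis by simp
              qed
            qed
          qed
          thus ?thesis by (simp add: Nil ra)
        qed
      qed
    qed
  qed
qed

end

section \<open>Gluing along unit steps\<close>

definition Xs :: "nat \<Rightarrow> nat \<Rightarrow> nat list set" where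
  "Xs k n = {x. sl k x \<and> set x \<subseteq> {0..n}}"

definition step :: "nat \<Rightarrow> nat \<Rightarrow> nat list \<Rightarrow> nat list \<Rightarrow> bool" where
  "step k n x y \<longleftrightarrow> x \<in> Xs k n \<and> y \<in> Xs k n \<and> (\<exists>i<k. y = x[i := Suc (x ! i)])"

lemma XsD: "x \<in> Xs k n \<Longrightarrow> length x = k" "x \<in> Xs k n \<Longrightarrow> sorted x" "x \<in> Xs k n \<Longrightarrow> set x \<subseteq> {0..n}" "x \<in> Xs k n \<Longrightarrow> sl k x"
  by (auto simp: Xs_def sl_def)

lemma list_le_iff: "x \<preceq> y \<longleftrightarrow> length x = length y \<and> (\<forall>i<length x. x ! i \<le> (y ! i :: nat))"
  by (simp add: list_all2_conv_all_nth)

lemma list_le_trans: "x \<preceq> y \<Longrightarrow> y \<preceq> z \<Longrightarrow> x \<preceq> z"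
  by (rule list_all2_trans[of "(\<le>)" "(\<le>)"]) auto

lemma step_X: "step k n x y \<Longrightarrow> x \<in> Xs k n \<and> y \<in> Xs k n"
  unfolding step_def by blast

lemma step_le: "step k n x y \<Longrightarrow> x \<preceq> y"
proof -
  assume "step k n x y"
  then obtain i where i: "i < k" "y = x[i := Suc (x ! i)]" "length x = k" by (auto simp: step_def dest: XsD)
  show ?thesis unfolding list_le_iff i(2) using i by (simp add: nth_list_update)
qed

lemma step_sum: "step k n x y \<Longrightarrow> sum_list y = Suc (sum_list x)"
proof -
  assume "step k n x y"
  then obtain i where i: "i < k" "y = x[i := Suc (x ! i)]" "length x = k" by (auto simp: step_def dest: XsD)
  have "x ! i \<le> sum_list x" using i by (simp add: elem_le_sum_list)
  thus ?thesis unfolding i(2) using i by (simp add: sum_list_update)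
qed

lemma le_sum: "x \<preceq> y \<Longrightarrow> sum_list x \<le> sum_list (y :: nat list)"
  by (induction rule: list_all2_induct) auto

lemma Xs_update:
  assumes "x \<in> Xs k n" "i < k" "Suc (x ! i) \<le> n" "\<And>j. i < j \<Longrightarrow> j < k \<Longrightarrow> Suc (x ! i) \<le> x ! j"
  shows "x[i := Suc (x ! i)] \<in> Xs k n"
proof -
  have "sorted (x[i := Suc (x ! i)])" unfolding sorted_iff_nth_mono
  proof (intro allI impI)
    fix a b assume ab: "a \<le> b" "b < length (x[i := Suc (x ! i)])"
    hence bk: "b < length x" by simp
    have "x ! a \<le> x ! b" using assms(1) ab by (auto simp: Xs_def sl_def sorted_iff_nth_mono)
    thus "x[i := Suc (x ! i)] ! a \<le> x[i := Suc (x ! i)] ! b"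
      using assms bk ab by (cases "a = i"; cases "b = i") (auto simp: XsD nth_list_update)
  qed
  moreover have "set (x[i := Suc (x ! i)]) \<subseteq> insert (Suc (x ! i)) (set x)" by (rule set_update_subset_insert)
  hence "set (x[i := Suc (x ! i)]) \<subseteq> {0..n}" using XsD(3)[OF assms(1)] assms(3) by auto
  ultimately show ?thesis using assms(1) by (simp add: Xs_def sl_def)
qed

lemma Xs_nth: "x \<in> Xs k n \<Longrightarrow> i < k \<Longrightarrow> x ! i \<le> n"
  using subsetD[OF XsD(3) nth_mem] XsD(1)[of x k n] by auto

text \<open>The entry to increase is the last one at which \<open>x\<close> and \<open>z\<close>
  differ: behind it \<open>x\<close> agrees with the sorted list \<open>z\<close>, which leaves room
  for the increment.\<close>

lemma unit_induct [consumes 3, case_names refl step]: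
  assumes "x \<in> Xs k n" "z \<in> Xs k n" "x \<preceq> z"
    and refl: "\<And>x. x \<in> Xs k n \<Longrightarrow> R x x"
    and step: "\<And>x y z. step k n x y \<Longrightarrow> z \<in> Xs k n \<Longrightarrow> y \<preceq> z \<Longrightarrow> R y z \<Longrightarrow> R x z"
  shows "R x z"
  using assms(1-3)
proof (induction "sum_list z - sum_list x" arbitrary: x rule: less_induct)
  case (less x)
  show ?case
  proof (cases "x = z")
    case True
    thus ?thesis using refl less by simp
  next
    case False
    note xz = less.prems
    have le: "\<And>i. i < k \<Longrightarrow> x ! i \<le> z ! i" using xz XsD by (auto simp: list_le_iff)
    let ?I = "{i. i < k \<and> x ! i < z ! i}"
    have "?I \<noteq> {}"
    proof
      assume "?I = {}"
      hence "\<forall>i<k. x ! i = z ! i" using le by (auto simp: order.order_iff_strict)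
      thus False using False XsD(1) xz by (metis nth_equalityI)
    qed
    moreover have fin: "finite ?I" by simp
    ultimately have i: "Max ?I \<in> ?I" using Max_in by blast
    define i where "i = Max ?I"
    have ik: "i < k" "x ! i < z ! i" using i by (auto simp: i_def)
    have eq: "x ! j = z ! j" if "i < j" "j < k" for j
    proof (rule ccontr)
      assume "x ! j \<noteq> z ! j"
      hence "j \<in> ?I" using le that by (auto simp: order.order_iff_strict)
      thus False using Max_ge[OF fin] that by (fastforce simp: i_def)
    qed
    have "Suc (x ! i) \<le> x ! j" if "i < j" "j < k" for j
    proof -
      have "z ! i \<le> z ! j" using xz that XsD(1,2)[of z] by (auto simp: sorted_iff_nth_mono)
      thus ?thesis using eq[OF that] ik by simp
    qed
    hence y: "x[i := Suc (x ! i)] \<in> Xs k n" using Xs_update[OF xz(1) ik(1)] ik Xs_nth[OF xz(2) ik(1)] by auto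
    hence s: "step k n x (x[i := Suc (x ! i)])" using xz ik by (auto simp: step_def)
    have l: "x[i := Suc (x ! i)] \<preceq> z"
      using xz ik le XsD(1) by (auto simp: list_le_iff nth_list_update)
    have "sum_list z - sum_list (x[i := Suc (x ! i)]) < sum_list z - sum_list x"
      using step_sum[OF s] le_sum[OF l] by auto
    thus ?thesis using step[OF s xz(2) l less.hyps[OF _ y xz(2) l]] by blast
  qed
qed

text \<open>Increments at different places commute. That the common result is still sorted is read
  off from \<open>y'\<close>, whose entries behind \<open>j\<close> already leave room for the
  increment at \<open>j\<close>.\<close>

lemma step_diamond:
  assumes "step k n x y" "step k n x y'" "y \<noteq> y'" "y \<preceq> z" "y' \<preceq> z" "z \<in> Xs k n"
  obtains w where "step k n y w" "step k n y' w" "w \<preceq> z"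
proof -
  obtain i j where i: "i < k" "y = x[i := Suc (x ! i)]" and j: "j < k" "y' = x[j := Suc (x ! j)]"
    using assms by (auto simp: step_def)
  have ij: "i \<noteq> j" using i j assms(3) by auto
  have X: "x \<in> Xs k n" "y \<in> Xs k n" "y' \<in> Xs k n" using assms by (auto simp: step_def)
  have lx: "length x = k" "length z = k" using XsD X assms by auto
  define w where "w = y[j := Suc (y ! j)]"
  have w': "w = y'[i := Suc (y' ! i)]" using i j ij by (simp add: w_def list_update_swap)
  have yj: "y ! j = x ! j" using i ij by simp
  have zj: "Suc (x ! j) \<le> z ! j" using assms(5) j lx by (auto simp: list_le_iff)
  have wX: "w \<in> Xs k n" unfolding w_def
  proof (rule Xs_update[OF X(2) j(1)])
    show "Suc (y ! j) \<le> n" using zj yj Xs_nth[OF assms(6) j(1)] by simp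
    fix a assume a: "j < a" "a < k"
    have "y' ! j \<le> y' ! a" using XsD(1,2)[OF X(3)] a by (auto simp: sorted_iff_nth_mono)
    hence "Suc (x ! j) \<le> x ! a" using a j lx by simp
    thus "Suc (y ! j) \<le> y ! a" using yj i lx a by (auto simp: nth_list_update)
  qed
  have "w \<preceq> z"
    using assms(4) zj yj i j lx by (auto simp: w_def list_le_iff nth_list_update)
  moreover have "step k n y w" unfolding step_def
    by (intro conjI X wX exI[of _ j] j(1) w_def)
  moreover have "step k n y' w" unfolding step_def
    by (intro conjI X wX exI[of _ i] i(1) w')
  ultimately show ?thesis using that[of w] by blast
qed

context strin begin

text \<open>A relation and not a function, since many unit paths lead from one list to another; that
  all of them have the same value is proved in \<open>unit_extension\<close>.\<close>

inductive path :: "nat \<Rightarrow> nat \<Rightarrow> (nat list \<Rightarrow> nat list \<Rightarrow> 'a) \<Rightarrow> nat list \<Rightarrow> nat list \<Rightarrow> 'a \<Rightarrow> bool" for k n b where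
  refl: "x \<in> Xs k n \<Longrightarrow> path k n b x x (b x x)"
| step: "step k n x y \<Longrightarrow> path k n b y z f \<Longrightarrow> path k n b x z (f \<bullet> b x y)"

lemma path_X: "path k n b x z f \<Longrightarrow> x \<in> Xs k n \<and> z \<in> Xs k n \<and> x \<preceq> z"
proof (induction rule: path.induct)
  case (step x y z f)
  moreover have "x \<preceq> z" using list_le_trans[OF step_le[OF step(1)]] step(3) by blast
  ultimately show ?case using step_X[OF step(1)] by blast
qed auto

lemma path_ex: "x \<in> Xs k n \<Longrightarrow> z \<in> Xs k n \<Longrightarrow> x \<preceq> z \<Longrightarrow> \<exists>f. path k n b x z f"
proof (induction rule: unit_induct)
  case (refl x)
  thus ?case using path.refl by blast
next
  case (step x y z)
  then obtain f where "path k n b y z f" by blast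
  from path.step[OF step(1) this] show ?case by blast
qed

text \<open>Path independence as in Newman's lemma: two paths with different first steps are
  compared through a common continuation supplied by \<open>step_diamond\<close>, by induction on
  the remaining distance. So commutativity of unit squares is enough.\<close>

lemma unit_extension:
  assumes ob: "\<And>x. x \<in> Xs k n \<Longrightarrow> Ob (b x x)"
    and H: "\<And>x y. step k n x y \<Longrightarrow> H (b x x) (b y y) (b x y)"
    and sq: "\<And>x y y' z. step k n x y \<Longrightarrow> step k n y z \<Longrightarrow> step k n x y' \<Longrightarrow> step k n y' z \<Longrightarrow> b y z \<bullet> b x y = b y' z \<bullet> b x y'"
  obtains u where "\<And>x y. x \<in> Xs k n \<Longrightarrow> y \<in> Xs k n \<Longrightarrow> x \<preceq> y \<Longrightarrow> H (b x x) (b y y) (u x y)"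
    "\<And>x y z. x \<in> Xs k n \<Longrightarrow> y \<in> Xs k n \<Longrightarrow> z \<in> Xs k n \<Longrightarrow> x \<preceq> y \<Longrightarrow> y \<preceq> z \<Longrightarrow> u y z \<bullet> u x y = u x z"
    "\<And>x. x \<in> Xs k n \<Longrightarrow> u x x = b x x"
    "\<And>x y. step k n x y \<Longrightarrow> u x y = b x y"
proof -
  have pH: "H (b x x) (b z z) f" if "path k n b x z f" for x z f
    using that by (induction rule: path.induct) (auto intro: H_id ob H_comp H)
  have uniq: "f = g" if "path k n b x z f" "path k n b x z g" for x z f g
    using that
  proof (induction "sum_list z - sum_list x" arbitrary: x f g rule: less_induct)
    case (less x f g)
    have lt: "sum_list z - sum_list y < sum_list z - sum_list x" if "step k n x y" "y \<preceq> z" for y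
      using step_sum[OF that(1)] le_sum[OF that(2)] by simp
    have no: False if "step k n z y" "y \<preceq> z" for y
      using step_sum[OF that(1)] le_sum[OF that(2)] by simp
    from less.prems(1) show ?case
    proof (cases rule: path.cases)
      case refl
      from less.prems(2) show ?thesis
      proof (cases rule: path.cases)
        case (step y h)
        thus ?thesis using refl no[of y] path_X[OF step(3)] by blast
      qed (use refl in auto)
    next
      case (step y f')
      note s1 = this
      from less.prems(2) show ?thesis
      proof (cases rule: path.cases)
        case refl
        thus ?thesis using s1 no[of y] path_X[OF s1(3)] by blast
      next
        case (step y' g')
        note le = path_X[OF s1(3)] path_X[OF step(3)]
        show ?thesis
        proof (cases "y = y'")
          case True
          thus ?thesis using less.hyps[OF lt[OF s1(2)] s1(3)] step s1 le by auto
        next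
          case False
          obtain w where w: "step k n y w" "step k n y' w" "w \<preceq> z"
            using step_diamond[OF s1(2) step(2) False] le by metis
          have "w \<in> Xs k n" using w step_X by blast
          then obtain h where h: "path k n b w z h" using path_ex w(3) le by blast
          have "f' = h \<bullet> b y w" using less.hyps[OF lt[OF s1(2)] s1(3) path.step[OF w(1) h]] le by blast
          moreover have "g' = h \<bullet> b y' w" using less.hyps[OF lt[OF step(2)] step(3) path.step[OF w(2) h]] le by blast
          ultimately show ?thesis using sq[OF s1(2) w(1) step(2) w(2)] s1 step by (simp add: mul_assoc)
        qed
      qed
    qed
  qed
  have comp: "path k n b x z (g \<bullet> f)" if "path k n b x y f" "path k n b y z g" for x y z f g
    using that
  proof (induction rule: path.induct)
    case (refl x)
    thus ?case using HD(3)[OF pH[OF refl(2)]] by simp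
  next
    case (step x y z' f)
    show ?case using path.step[OF step(1) step(3)[OF step(4)]] by (simp add: mul_assoc)
  qed
  define u where "u x y = (THE f. path k n b x y f)" for x y
  have u: "path k n b x y f \<Longrightarrow> u x y = f" for x y f
    unfolding u_def using uniq by blast
  show ?thesis
  proof (rule that[of u])
    fix x y assume xy: "x \<in> Xs k n" "y \<in> Xs k n" "x \<preceq> y"
    then obtain f where f: "path k n b x y f" using path_ex by blast
    thus "H (b x x) (b y y) (u x y)" using pH u by auto
    fix z assume z: "z \<in> Xs k n" "y \<preceq> z"
    then obtain g where g: "path k n b y z g" using path_ex xy by blast
    show "u y z \<bullet> u x y = u x z" using u[OF f] u[OF g] u[OF comp[OF f g]] by simp
  next
    fix x assume "x \<in> Xs k n" thus "u x x = b x x" using u path.refl by blast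
  next
    fix x y assume s: "step k n x y"
    hence "y \<in> Xs k n" using step_X by blast
    from u[OF path.step[OF s path.refl[OF this]]] show "u x y = b x y" using HD(4)[OF H[OF s]] by simp
  qed
qed

end

section \<open>Combinatorics of coverings by pairs\<close>

lemma cov_mono: "cov k S \<Longrightarrow> T \<subseteq> S \<Longrightarrow> cov k T"
  unfolding cov_def by blast

text \<open>Each element is sent to the lower end of a pair that covers it; two elements with the
  same image are neighbours.\<close>

lemma cov_pigeonhole:
  assumes "cov k S" "finite S" "k < card S"
  obtains e where "e \<in> S" "Suc e \<in> S"
proof -
  obtain W where W: "finite W" "card W \<le> k" "S \<subseteq> W \<union> Suc ` W" using assms(1) by (auto simp: cov_def)
  define f where "f s = (if s \<in> W then s else s - 1)" for s
  have "f ` S \<subseteq> W" using W(3) by (auto simp: f_def)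
  hence "card (f ` S) \<le> k" using card_mono[OF W(1)] W(2) by (meson order.trans)
  hence "\<not> inj_on f S" using card_image[of f S] assms(3) by auto
  then obtain s t where st: "s \<in> S" "t \<in> S" "s \<noteq> t" "f s = f t" by (auto simp: inj_on_def)
  have "s = Suc t \<or> t = Suc s"
    using st W(3) by (auto simp: f_def split: if_splits)
  thus ?thesis using that st by blast
qed

text \<open>A new point has to fit between \<open>a\<close> and \<open>b\<close> without a further
  pair. If there are at most \<open>k\<close> nonzero points, each owns a pair, and the pair of
  \<open>b\<close> is taken to be \<open>{b - 1, b}\<close>. Otherwise there are
  \<open>k + 1\<close> of them, so two neighbours \<open>e\<close> and \<open>Suc e\<close> occur
  and share a pair. This frees a pair: every point other than these two can own one and direct it to
  either side. At least one of \<open>a\<close> and \<open>b\<close> is such a point.\<close>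

lemma cov_insert:
  assumes srt: "sorted (p @ a # b # q)" and len: "length p + length q + 1 = k" and ab: "Suc a < b"
    and c: "cov k (set (p @ a # b # q) - {0})"
  shows "cov k (set (p @ a # Suc a # b # q) - {0}) \<or> cov k (set (p @ a # (b - 1) # b # q) - {0})"
proof -
  define S where "S = set (p @ a # b # q) - {0}"
  have fin: "finite S" and bS: "b \<in> S" using ab by (auto simp: S_def)
  have le: "card S \<le> Suc k"
  proof -
    have "card S \<le> card (set (p @ a # b # q))" unfolding S_def by (intro card_mono) auto
    also have "\<dots> \<le> length (p @ a # b # q)" by (rule card_length)
    finally show ?thesis using len by simp
  qed
  show ?thesis
  proof (cases "card S \<le> k")
    case True
    have "cov k (set (p @ a # (b - 1) # b # q) - {0})" unfolding cov_def
    proof (intro exI conjI)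
      show "finite (insert (b - 1) (S - {b}))" using fin by simp
      have "card (insert (b - 1) (S - {b})) \<le> Suc (card (S - {b}))" by (rule card_insert_le_m1) auto
      thus "card (insert (b - 1) (S - {b})) \<le> k" using True fin bS by (metis card_Suc_Diff1 order.trans)
      show "set (p @ a # (b - 1) # b # q) - {0} \<subseteq> insert (b - 1) (S - {b}) \<union> Suc ` insert (b - 1) (S - {b})"
        using ab by (auto simp: S_def image_iff)
    qed
    thus ?thesis by blast
  next
    case False
    hence cS: "card S = Suc k" using le by simp
    have "card (set (p @ a # b # q)) \<le> Suc k" using card_length[of "p @ a # b # q"] len by simp
    hence "S = set (p @ a # b # q)" using card_subset_eq[of "set (p @ a # b # q)" S] cS
      by (metis List.finite_set S_def Diff_subset card_mono le_antisym)
    hence aS: "a \<in> S" by auto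
    obtain e where e: "e \<in> S" "Suc e \<in> S" using cov_pigeonhole[OF c[folded S_def] fin] cS by auto
    have ae: "a \<noteq> e"
    proof
      assume "a = e"
      hence "Suc a \<in> set (p @ a # b # q)" using e by (auto simp: S_def)
      thus False using srt ab by (fastforce simp: sorted_append)
    qed
    \<comment> \<open>One pair covers \<open>e\<close> and \<open>Suc e\<close>, one covers
      \<open>z\<close> and its new neighbour \<open>y\<close>, and each of the other
      \<open>k - 2\<close> points has its own.\<close>
    have gen: "cov k (insert y S)" if z: "z \<in> S" "z \<noteq> e" "z \<noteq> Suc e" and yw: "y = Suc z \<and> w = z \<or> z = Suc y \<and> w = y" for y z w
      unfolding cov_def
    proof (intro exI conjI)
      show "finite (insert e (insert w (S - {e, Suc e, z})))" using fin by simp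
      have "card (S - {e, Suc e, z}) = Suc k - 3" using e z cS by (subst card_Diff_subset) (auto simp: card_insert_if)
      moreover have "3 \<le> Suc k" unfolding cS[symmetric] using card_mono[OF fin, of "{e, Suc e, z}"] e z by (auto simp: card_insert_if)
      moreover have "card (insert e (insert w (S - {e, Suc e, z}))) \<le> Suc (Suc (card (S - {e, Suc e, z})))"
        by (intro card_insert_le_m1) auto
      ultimately show "card (insert e (insert w (S - {e, Suc e, z}))) \<le> k" by simp
      show "insert y S \<subseteq> insert e (insert w (S - {e, Suc e, z})) \<union> Suc ` insert e (insert w (S - {e, Suc e, z}))"
        using yw by auto
    qed
    show ?thesis
    proof (cases "a = Suc e")
      case True
      have "cov k (insert (b - 1) S)" by (rule gen[OF bS, of _ "b - 1"]) (use True ab in auto)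
      moreover have "set (p @ a # (b - 1) # b # q) - {0} \<subseteq> insert (b - 1) S" by (auto simp: S_def)
      ultimately show ?thesis using cov_mono by blast
    next
      case False
      have "cov k (insert (Suc a) S)" by (rule gen[OF aS, of _ a]) (use False ae in auto)
      moreover have "set (p @ a # Suc a # b # q) - {0} \<subseteq> insert (Suc a) S" by (auto simp: S_def)
      ultimately show ?thesis using cov_mono by blast
    qed
  qed
qed

text \<open>The members of the lower poset, see \<open>lower_poset_iff\<close> below.\<close>

definition locP :: "nat \<Rightarrow> nat \<Rightarrow> nat set \<Rightarrow> bool" where
  "locP n k S \<longleftrightarrow> S \<subseteq> {0..n} \<and> cov k (S - {0})"

lemma locP_mono: "locP n k S \<Longrightarrow> T \<subseteq> S \<Longrightarrow> locP n k T"
  unfolding locP_def by (auto elim: cov_mono)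

lemma locP_insert0: "locP n k S \<Longrightarrow> T \<subseteq> insert 0 S \<Longrightarrow> locP n k T"
  unfolding locP_def by (auto elim: cov_mono)

text \<open>Each of the \<open>k\<close> entries may own a pair, and \<open>0\<close> costs nothing.
  Hence all objects at lists \<open>0 # x\<close> belong to a diagram that is only given on the
  lower poset.\<close>

lemma locP_tl: "x \<in> Xs k n \<Longrightarrow> T \<subseteq> insert 0 (set x) \<Longrightarrow> locP n k T"
proof -
  assume x: "x \<in> Xs k n" and T: "T \<subseteq> insert 0 (set x)"
  have "cov k (T - {0})" by (rule cov_mono[OF cov_set[of x k]]) (use x T in \<open>auto simp: XsD(1)\<close>)
  moreover have "T \<subseteq> {0..n}" using T XsD(3)[OF x] by fastforce
  ultimately show ?thesis by (simp add: locP_def)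
qed

section \<open>Extension of a diagram from the lower poset\<close>

context strin begin

definition FEt :: "(nat list \<Rightarrow> nat list \<Rightarrow> 'a) \<Rightarrow> nat list \<Rightarrow> bool" where
  "FEt A c \<longleftrightarrow> (\<forall>a b q. c = a # b # q \<longrightarrow> ez (A (b # q) (b # q)) (A (a # q) (b # q)))"

text \<open>The monoid form of an object of the \<open>k\<close>-dimensional construction, imposed
  only on simplices whose vertices satisfy \<open>P\<close>. \<open>LEt\<close> and
  \<open>FEt\<close> together express exactness of the whole sequence, including the monomorphism
  and the epimorphism at its ends.\<close>

definition WD :: "nat \<Rightarrow> (nat set \<Rightarrow> bool) \<Rightarrow> (nat list \<Rightarrow> nat list \<Rightarrow> 'a) \<Rightarrow> bool" where
  "WD k P A \<longleftrightarrow> diag (Suc k) P A \<and> (\<forall>c. sl (k + 2) c \<and> P (set c) \<longrightarrow> LEt A c \<and> FEt A c)"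

abbreviation WDn :: "nat \<Rightarrow> nat \<Rightarrow> (nat list \<Rightarrow> nat list \<Rightarrow> 'a) \<Rightarrow> bool" where
  "WDn k n \<equiv> WD k (\<lambda>S. S \<subseteq> {0..n})"

lemma Xs_Cons: "x \<in> Xs k n \<Longrightarrow> 0 # x \<in> Xs (Suc k) n"
  by (auto simp: Xs_def sl_def)

text \<open>The objects \<open>0 # x\<close>, the unit steps and the squares of two different unit
  steps are all local, which is what \<open>unit_extension\<close> consumes. The delicate half is
  that the glued arrows agree with the given ones wherever the latter exist: a local move of one
  entry is cut into shorter local moves, and a local move of several entries is made one entry at a
  time.\<close>

lemma base_extension:
  assumes A: "WD k (locP n k) A"
  obtains u where "diag k (\<lambda>S. S \<subseteq> {0..n}) u"
    "\<And>x y. x \<in> Xs k n \<Longrightarrow> y \<in> Xs k n \<Longrightarrow> x \<preceq> y \<Longrightarrow> locP n k (set x \<union> set y) \<Longrightarrow> u x y = A (0 # x) (0 # y)"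
proof -
  have dA: "diag (Suc k) (locP n k) A" using A by (simp add: WD_def)
  define b where "b x y = A (0 # x) (0 # y)" for x y
  have bH: "H (b x x) (b y y) (b x y)" if "x \<in> Xs k n" "y \<in> Xs k n" "x \<preceq> y" "locP n k (set x \<union> set y)" for x y
    using dA that Xs_Cons[OF that(1)] Xs_Cons[OF that(2)] locP_insert0[OF that(4), of "set (0 # x) \<union> set (0 # y)"]
    unfolding diag_def b_def by (auto simp: XsD)
  have bC: "b y z \<bullet> b x y = b x z" if "x \<in> Xs k n" "y \<in> Xs k n" "z \<in> Xs k n" "x \<preceq> y" "y \<preceq> z" "locP n k (set x \<union> set y \<union> set z)" for x y z
    using dA that Xs_Cons[OF that(1)] Xs_Cons[OF that(2)] Xs_Cons[OF that(3)] locP_insert0[OF that(6), of "set (0 # x) \<union> set (0 # y) \<union> set (0 # z)"]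
    unfolding diag_def b_def by (auto simp: XsD)
  have upd: "set y \<subseteq> set x \<union> Suc ` set x" if "step k n x y" for x y
    using that set_update_subset_insert by (fastforce simp: step_def Xs_def sl_def)
  have locs: "locP n k S" if "x \<in> Xs k n" "S \<subseteq> set x \<union> Suc ` set x" "S \<subseteq> {0..n}" for x S
    unfolding locP_def cov_def using that card_length[of x] by (auto simp: XsD intro!: exI[of _ "set x"])
  have step_loc: "locP n k (set x \<union> set y)" if s: "step k n x y" for x y
    by (rule locs[of x]) (use upd[OF s] step_X[OF s] XsD(3) in \<open>blast+\<close>)
  have b0: "Ob (b x x)" if "x \<in> Xs k n" for x
    using bH[OF that that] locP_tl[OF that] HD(1) by auto
  obtain u where u: "\<And>x y. x \<in> Xs k n \<Longrightarrow> y \<in> Xs k n \<Longrightarrow> x \<preceq> y \<Longrightarrow> H (b x x) (b y y) (u x y)"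
    "\<And>x y z. x \<in> Xs k n \<Longrightarrow> y \<in> Xs k n \<Longrightarrow> z \<in> Xs k n \<Longrightarrow> x \<preceq> y \<Longrightarrow> y \<preceq> z \<Longrightarrow> u y z \<bullet> u x y = u x z"
    "\<And>x. x \<in> Xs k n \<Longrightarrow> u x x = b x x"
    "\<And>x y. step k n x y \<Longrightarrow> u x y = b x y"
  proof (rule unit_extension[of k n b])
    fix x y y' z assume s: "step k n x y" "step k n y z" "step k n x y'" "step k n y' z"
    have X: "x \<in> Xs k n" "y \<in> Xs k n" "y' \<in> Xs k n" "z \<in> Xs k n" using s step_X by blast+
    show "b y z \<bullet> b x y = b y' z \<bullet> b x y'"
    proof (cases "y = y'")
      case False
      \<comment> \<open>\<open>y \<noteq> y'\<close> means that the two increments are made at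
        different places, so no entry is raised twice, and the \<open>k\<close> pairs that start at
        the entries of \<open>x\<close> cover the whole square.\<close>
      have "set z \<subseteq> set x \<union> Suc ` set x"
      proof -
        have "\<exists>i<k. y = x[i := Suc (x ! i)]" "\<exists>j<k. z = y[j := Suc (y ! j)]"
          and i': "\<exists>i'<k. y' = x[i' := Suc (x ! i')]" "\<exists>j'<k. z = y'[j' := Suc (y' ! j')]"
          using s unfolding step_def by blast+
        then obtain i j where i: "i < k" "y = x[i := Suc (x ! i)]" and j: "j < k" "z = y[j := Suc (y ! j)]" by blast
        have lx: "length x = k" using X XsD by auto
        have "i \<noteq> j"
        proof
          assume "i = j"
          hence z: "z = x[i := Suc (Suc (x ! i))]" using i j lx by simp
          obtain i' j' where p: "i' < k" "y' = x[i' := Suc (x ! i')]" "j' < k" "z = y'[j' := Suc (y' ! j')]" using i' by auto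
          have ni: "i' \<noteq> i" using p i False by auto
          have "z ! i' \<ge> Suc (x ! i')" using p lx by (cases "j' = i'") auto
          thus False using z ni by simp
        qed
        hence "z = x[i := Suc (x ! i), j := Suc (x ! j)]" using i j lx by simp
        hence "set z \<subseteq> insert (Suc (x ! j)) (insert (Suc (x ! i)) (set x))"
          using set_update_subset_insert[of "x[i := Suc (x ! i)]" j "Suc (x ! j)"] set_update_subset_insert[of x i "Suc (x ! i)"] by blast
        thus ?thesis using i j lx by auto
      qed
      hence l: "locP n k (set x \<union> set y \<union> set z)" "locP n k (set x \<union> set y' \<union> set z)"
        using upd[OF s(1)] upd[OF s(3)] XsD(3)[OF X(1)] XsD(3)[OF X(2)] XsD(3)[OF X(3)] XsD(3)[OF X(4)]
        by (intro locs[OF X(1)] Un_least; blast)+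
      show ?thesis
        using bC[OF X(1,2,4) step_le[OF s(1)] step_le[OF s(2)] l(1)] bC[OF X(1,3,4) step_le[OF s(3)] step_le[OF s(4)] l(2)] by simp
    qed simp
  next
    fix x assume "x \<in> Xs k n" thus "Ob (b x x)" by (rule b0)
  next
    fix x y assume s: "step k n x y"
    show "H (b x x) (b y y) (b x y)"
      using bH[OF _ _ step_le[OF s] step_loc[OF s]] step_X[OF s] by blast
  qed blast
  have uH: "H (u x x) (u y y) (u x y)" if "x \<in> Xs k n" "y \<in> Xs k n" "x \<preceq> y" for x y
    using u(1)[OF that] u(3) that by simp
  have du: "diag k (\<lambda>S. S \<subseteq> {0..n}) u" unfolding diag_def
  proof (intro conjI allI impI)
    fix x y assume "sl k x" "sl k y" "x \<preceq> y" "set x \<union> set y \<subseteq> {0..n}"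
    thus "H (u x x) (u y y) (u x y)" by (intro uH) (simp_all add: Xs_def)
  next
    fix x y z assume "sl k x" "sl k y" "sl k z" "x \<preceq> y" "y \<preceq> z" "set x \<union> set y \<union> set z \<subseteq> {0..n}"
    thus "u y z \<bullet> u x y = u x z" by (intro u(2)) (simp_all add: Xs_def)
  next
    fix x assume x: "sl k x" "\<not> distinct x" "set x \<subseteq> {0..n}"
    hence X: "x \<in> Xs k n" by (auto simp: Xs_def)
    have "b x x = \<zero>" unfolding b_def
      using dA Xs_Cons[OF X] locP_tl[OF X, of "set (0 # x)"] x unfolding diag_def by (auto simp: XsD)
    thus "u x x = \<zero>" using u(3) X by simp
  qed
  have XI: "x \<in> Xs k n" if "sorted x" "length x = k" "set x \<subseteq> {0..n}" for x using that by (auto simp: Xs_def sl_def)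
  \<comment> \<open>Induction on the length of the move: \<open>cov_insert\<close> supplies a stop
    \<open>c\<close> strictly between \<open>a\<close> and \<open>b'\<close> such that all lists
    involved remain local. Unit moves are values of \<open>b\<close> by construction of
    \<open>u\<close>.\<close>
  have single: "u (p @ a # q) (p @ b' # q) = b (p @ a # q) (p @ b' # q)"
    if "sorted (p @ a # b' # q)" "length p + length q + 1 = k" "locP n k (set (p @ a # b' # q))" for p a b' q
    using that
  proof (induction "b' - a" arbitrary: a b' rule: less_induct)
    case (less a b')
    note prem = less.prems
    have X: "p @ a # q \<in> Xs k n" "p @ b' # q \<in> Xs k n" by (rule XI; use prem in \<open>auto simp: sorted_append locP_def\<close>)+
    have ab: "a \<le> b'" using prem by (auto simp: sorted_append)
    consider "a = b'" | "b' = Suc a" | "Suc a < b'" using ab by linarith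
    thus ?case
    proof cases
      case 1 thus ?thesis using u(3) X by simp
    next
      case 2
      have "step k n (p @ a # q) (p @ b' # q)" unfolding step_def
        using X prem 2 by (auto intro!: exI[of _ "length p"] simp: list_update_append)
      thus ?thesis by (rule u(4))
    next
      case 3
      have "cov k (set (p @ a # b' # q) - {0})" using prem by (simp add: locP_def)
      from cov_insert[OF prem(1,2) 3 this] obtain c where c: "a < c" "c < b'" "cov k (set (p @ a # c # b' # q) - {0})"
        using 3 by (metis Suc_lessD Suc_lessE diff_Suc_1 lessI)
      have l: "locP n k (set (p @ a # c # b' # q))" using prem c by (auto simp: locP_def)
      have s: "sorted (p @ a # c # q)" "sorted (p @ c # b' # q)" using prem c by (auto simp: sorted_append)
      have Xc: "p @ c # q \<in> Xs k n" by (rule XI; use s prem l in \<open>auto simp: sorted_append locP_def\<close>)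
      have l1: "locP n k (set (p @ a # c # q))" by (rule locP_mono[OF l]) auto
      have l2: "locP n k (set (p @ c # b' # q))" by (rule locP_mono[OF l]) auto
      have 1: "u (p @ a # q) (p @ c # q) = b (p @ a # q) (p @ c # q)"
        by (rule less.hyps[OF _ s(1) prem(2) l1]) (use c in simp)
      have 2: "u (p @ c # q) (p @ b' # q) = b (p @ c # q) (p @ b' # q)"
        by (rule less.hyps[OF _ s(2) prem(2) l2]) (use c in simp)
      have "u (p @ c # q) (p @ b' # q) \<bullet> u (p @ a # q) (p @ c # q) = u (p @ a # q) (p @ b' # q)"
        by (rule u(2)) (use X Xc c in auto)
      moreover have "b (p @ c # q) (p @ b' # q) \<bullet> b (p @ a # q) (p @ c # q) = b (p @ a # q) (p @ b' # q)"
        by (rule bC) (use X Xc c in \<open>auto intro!: locP_mono[OF l]\<close>)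
      ultimately show ?thesis using 1 2 by simp
    qed
  qed
  \<comment> \<open>Entries are moved from the last one to the first, so that the intermediate lists
    remain sorted.\<close>
  have multi: "u (us @ v) (us' @ v) = b (us @ v) (us' @ v)"
    if "us @ v \<in> Xs k n" "us' @ v \<in> Xs k n" "us \<preceq> us'" "locP n k (set (us @ v) \<union> set (us' @ v))" for us us' v
    using that
  proof (induction us arbitrary: us' v rule: rev_induct)
    case Nil
    thus ?case using u(3) by auto
  next
    case (snoc a ws)
    obtain ws' c where us': "us' = ws' @ [c]" "ws \<preceq> ws'" "a \<le> c"
      using snoc.prems(3) by (auto simp: list_all2_append1 list_all2_Cons1)
    have Xa: "ws @ a # v \<in> Xs k n" "ws' @ c # v \<in> Xs k n" using snoc.prems us' by auto
    have l: "locP n k (set (ws @ a # v) \<union> set (ws' @ c # v))" using snoc.prems us' by simp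
    have wc: "\<forall>x\<in>set ws. x \<le> c" using Xa(1) us'(3) by (auto simp: Xs_def sl_def sorted_append)
    have s: "sorted (ws @ a # c # v)" using Xa wc us' by (auto simp: Xs_def sl_def sorted_append)
    hence s': "sorted (ws @ c # v)" by (auto simp: sorted_append)
    have len: "length ws + length v + 1 = k" using Xa by (auto simp: Xs_def sl_def)
    have Xm: "ws @ c # v \<in> Xs k n" by (rule XI; use s' len l in \<open>auto simp: locP_def\<close>)
    have 1: "u (ws @ a # v) (ws @ c # v) = b (ws @ a # v) (ws @ c # v)"
      by (rule single[OF s len]) (auto intro!: locP_mono[OF l])
    have 2: "u (ws @ c # v) (ws' @ c # v) = b (ws @ c # v) (ws' @ c # v)"
      by (rule snoc.IH) (use Xm Xa us' in \<open>auto intro!: locP_mono[OF l]\<close>)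
    have "ws @ c # v \<preceq> ws' @ c # v" using us' by (simp add: list_all2_append list_all2_lengthD)
    hence "u (ws @ c # v) (ws' @ c # v) \<bullet> u (ws @ a # v) (ws @ c # v) = u (ws @ a # v) (ws' @ c # v)"
      "b (ws @ c # v) (ws' @ c # v) \<bullet> b (ws @ a # v) (ws @ c # v) = b (ws @ a # v) (ws' @ c # v)"
      using Xm Xa us' by (auto intro!: u(2) bC locP_mono[OF l])
    thus ?case using 1 2 us' by simp
  qed
  show ?thesis
    using that[OF du] multi[of _ "[]"] by (simp add: b_def)
qed

end

lemma set_tl: "set (tl x) \<subseteq> set x"
  by (cases x) auto

context strin begin

lemma diag_H: "diag k P u \<Longrightarrow> sl k x \<Longrightarrow> sl k y \<Longrightarrow> x \<preceq> y \<Longrightarrow> P (set x \<union> set y) \<Longrightarrow> H (u x x) (u y y) (u x y)"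
  unfolding diag_def by blast

lemma WD_D:
  assumes "WD k P A"
  shows "diag (Suc k) P A" "sl (k + 2) c \<Longrightarrow> P (set c) \<Longrightarrow> LEt A c" "sl (k + 2) c \<Longrightarrow> P (set c) \<Longrightarrow> FEt A c"
  using assms by (auto simp: WD_def)

text \<open>These are the last three terms of the exact sequence of the list \<open>0 # x\<close>:
  exactness in the middle comes from \<open>LEt\<close> and the epimorphism at the end from
  \<open>FEt\<close>. So a diagram is determined by its part at lists that start with
  \<open>0\<close>.\<close>

lemma WD_coker:
  assumes A: "WD k P A" and x: "x \<in> Xs (Suc k) n" and P: "P (insert 0 (set x))" and mono: "\<And>S T. P S \<Longrightarrow> T \<subseteq> S \<Longrightarrow> P T"
  shows "coker (A (0 # tl x) (0 # tl x)) (inc A [] 0 (hd x) (tl x)) (A x x) (A (0 # tl x) x)"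
proof -
  obtain b q where xb: "x = b # q" using x by (cases x) (auto simp: Xs_def sl_def)
  have s: "sl (k + 2) (0 # x)" using x by (auto simp: Xs_def sl_def)
  have dA: "diag (Suc k) P A" using A by (rule WD_D)
  have e: "ex (A (0 # q) (0 # q)) (inc A [] 0 b q) (A (0 # q) (b # q))"
    using LEtD[OF WD_D(2)[OF A s], of "[]" 0 b q] P xb by simp
  have z: "ez (A (b # q) (b # q)) (A (0 # q) (b # q))"
    using WD_D(3)[OF A s] P xb by (simp add: FEt_def)
  have H1: "H (A (0 # q) (0 # q)) (A (b # q) (b # q)) (A (0 # q) (b # q))"
    by (rule diag_H[OF dA]) (use s xb in \<open>auto simp: sl_def intro!: mono[OF P]\<close>)
  have "\<exists>s. H s (A (0 # q) (0 # q)) (inc A [] 0 b q)"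
  proof (cases q)
    case Nil thus ?thesis using HD[OF H1] by (intro exI[of _ "\<zero>"]) simp
  next
    case (Cons z q')
    have "H (A (0 # b # q') (0 # b # q')) (A (0 # q) (0 # q)) (A (0 # b # q') (0 # q))"
      by (rule diag_H[OF dA]) (use s xb Cons in \<open>auto simp: sl_def intro!: mono[OF P]\<close>)
    thus ?thesis using Cons by auto
  qed
  then obtain s where "H s (A (0 # q) (0 # q)) (inc A [] 0 b q)" by blast
  from ex_coker_ez[OF this H1 e z] show ?thesis using xb by simp
qed

text \<open>For \<open>k = 0\<close> no pair is available, so \<open>{0}\<close> is the only
  nonempty local set, and the constant diagram with the value at \<open>[0]\<close> extends
  \<open>A\<close>.\<close>

lemma extend_lower_0:
  assumes A: "WD 0 (locP n 0) A"
  obtains A' where "WD 0 (\<lambda>S. S \<subseteq> {0..n}) A'"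
    "\<And>x y. x \<in> Xs (Suc 0) n \<Longrightarrow> y \<in> Xs (Suc 0) n \<Longrightarrow> x \<preceq> y \<Longrightarrow> locP n 0 (set x \<union> set y) \<Longrightarrow> A' x y = A x y"
proof -
  have dA: "diag (Suc 0) (locP n 0) A" using A by (rule WD_D)
  have l0: "locP n 0 {0}" unfolding locP_def cov_def by (auto intro!: exI[of _ "{}"])
  have H0: "H (A [0] [0]) (A [0] [0]) (A [0] [0])" using dA l0 unfolding diag_def by (auto simp: sl_def)
  have idm: "A [0] [0] \<bullet> A [0] [0] = A [0] [0]" using HD[OF H0] by simp
  have Ob: "Ob (A [0] [0])" using HD[OF H0] by simp
  show ?thesis
  proof (rule that[of "\<lambda>x y. A [0] [0]"])
    show "WD 0 (\<lambda>S. S \<subseteq> {0..n}) (\<lambda>x y. A [0] [0])"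
      unfolding WD_def
    proof (intro conjI allI impI)
      show "diag (Suc 0) (\<lambda>S. S \<subseteq> {0..n}) (\<lambda>x y. A [0] [0])"
        unfolding diag_def using H0 idm by (auto simp: sl_def length_Suc_conv)
      fix c :: "nat list" assume c: "sl (0 + 2) c \<and> set c \<subseteq> {0..n}"
      then obtain a b where cab: "c = [a, b]" by (auto simp: sl_def length_Suc_conv numeral_2_eq_2)
      show "LEt (\<lambda>x y. A [0] [0]) c" unfolding LEt_def cab
        using ex_zero_left[OF H0] kz_id[OF Ob] by (auto simp: Cons_eq_append_conv)
      show "FEt (\<lambda>x y. A [0] [0]) c" unfolding FEt_def using ez_id[OF Ob] by simp
    qed
    fix x y assume *: "x \<in> Xs (Suc 0) n" "y \<in> Xs (Suc 0) n" "locP n 0 (set x \<union> set y)"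
    hence "x = [0]" "y = [0]" by (auto simp: Xs_def sl_def length_Suc_conv locP_def cov_def)
    thus "A [0] [0] = A x y" by simp
  qed
qed

text \<open>Gluing gives values \<open>u x\<close> at the lists \<open>0 # x\<close>; the extension at \<open>a # b # q\<close> is the cokernel of
  \<open>u (a # q) \<rightarrow> u (b # q)\<close>.\<close>

lemma extend_lower_pos:
  assumes A: "WD k (locP n k) A" and k: "0 < k"
  obtains A' where "WDn k n A'"
    "\<And>x y. x \<in> Xs (Suc k) n \<Longrightarrow> y \<in> Xs (Suc k) n \<Longrightarrow> x \<preceq> y \<Longrightarrow> locP n k (set x \<union> set y) \<Longrightarrow> A' x y = A x y"
proof -
  have dA: "diag (Suc k) (locP n k) A" using A by (rule WD_D)
  obtain u where u: "diag k (\<lambda>S. S \<subseteq> {0..n}) u"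
    and uA: "\<And>x y. x \<in> Xs k n \<Longrightarrow> y \<in> Xs k n \<Longrightarrow> x \<preceq> y \<Longrightarrow> locP n k (set x \<union> set y) \<Longrightarrow> u x y = A (0 # x) (0 # y)"
    using base_extension[OF A] by blast
  have uH: "H (u x x) (u y y) (u x y)" if "x \<preceq> y" "x \<in> Xs k n" "y \<in> Xs k n" for x y
    by (rule diagH[OF u]) (use that XsD in auto)
  have uC: "u y z \<bullet> u x y = u x z" if "x \<preceq> y" "y \<preceq> z" "x \<in> Xs k n" "y \<in> Xs k n" "z \<in> Xs k n" for x y z
    by (rule diagC[OF u]) (use that XsD in auto)
  \<comment> \<open>At covered lists \<open>c\<close>, exactness of \<open>u\<close> at
    \<open>c\<close> is part of exactness of \<open>A\<close> at \<open>0 # c\<close>;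
    \<open>LE_local_global\<close> spreads it to all \<open>c\<close>.\<close>
  have LEu: "LEt u c" if "sl (Suc k) c" "set c \<subseteq> {0..n}" for c
  proof (rule LE_local_global[OF u _ that])
    fix c assume c: "sl (Suc k) c" "set c \<subseteq> {0..n}" "cov k (set c)"
    have lc: "locP n k (set (0 # c))" unfolding locP_def using c by (auto elim: cov_mono)
    have L: "LEt A (0 # c)" by (rule WD_D(2)[OF A _ lc]) (use c in \<open>auto simp: sl_def\<close>)
    show "LEt u c" unfolding LEt_def
    proof (intro allI impI)
      fix p a b q assume eq: "c = p @ a # b # q"
      have X: "p @ a # q \<in> Xs k n" "p @ b # q \<in> Xs k n" using c by (auto simp: eq Xs_def sl_def sorted_append)
      have le: "a \<le> b" using c by (auto simp: eq sl_def sorted_append)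
      have l: "locP n k S" if "S \<subseteq> set c" for S using locP_mono[OF lc] that by auto
      have 1: "u (p @ a # q) (p @ a # q) = A (0 # p @ a # q) (0 # p @ a # q)"
        by (rule uA) (use X eq in \<open>auto intro!: l\<close>)
      have 2: "u (p @ a # q) (p @ b # q) = A (0 # p @ a # q) (0 # p @ b # q)"
        by (rule uA) (use X le eq in \<open>auto intro!: l\<close>)
      have 3: "inc u p a b q = inc A (0 # p) a b q"
      proof (cases q)
        case (Cons z q')
        have "u (p @ a # b # q') (p @ a # q) = A (0 # p @ a # b # q') (0 # p @ a # q)"
        proof (rule uA)
          show "p @ a # b # q' \<in> Xs k n" using c by (auto simp: eq Cons Xs_def sl_def sorted_append)
          show "p @ a # b # q' \<preceq> p @ a # q" using c by (auto simp: eq Cons sl_def sorted_append)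
        qed (use X eq Cons in \<open>auto intro!: l\<close>)
        thus ?thesis using Cons by simp
      qed simp
      show "ex (u (p @ a # q) (p @ a # q)) (inc u p a b q) (u (p @ a # q) (p @ b # q))"
        unfolding 1 2 3 using LEtD[OF L, of "0 # p" a b q] eq by simp
    qed
  qed
  let ?X = "Xs (Suc k) n"
  \<comment> \<open>\<open>tl x\<close> omits the first vertex of \<open>x\<close> and
    \<open>fr x\<close> the second; the cokernel to be formed is that of the arrow from
    \<open>fr x\<close> to \<open>tl x\<close>.\<close>
  define fr where "fr x = hd x # tl (tl x)" for x :: "nat list"
  have split: "\<exists>a b q. x = a # b # q" if "x \<in> ?X" for x
    using that k by (cases x; cases "tl x") (auto simp: Xs_def sl_def)
  have XX: "tl x \<in> Xs k n" "fr x \<in> Xs k n" "fr x \<preceq> tl x" if "x \<in> ?X" for x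
    using that split[OF that] by (auto simp: Xs_def sl_def fr_def)
  have Hf: "H (u (fr x) (fr x)) (u (tl x) (tl x)) (u (fr x) (tl x))" if "x \<in> ?X" for x
    using uH XX that by blast
  have "\<exists>c p. coker (u (tl x) (tl x)) (u (fr x) (tl x)) c p" if x: "x \<in> ?X" for x
  proof -
    obtain a b q where ab: "x = a # b # q" using split[OF x] by blast
    have e: "ex (u (a # q) (a # q)) (inc u [] a b q) (u (a # q) (b # q))"
      using LEtD[OF LEu[of x], of "[]" a b q] x ab by (auto simp: Xs_def)
    have "H (io u [] a b q) (u (a # q) (a # q)) (inc u [] a b q)"
      using inc_H[OF u, of "[]" a b q] x ab by (auto simp: Xs_def sl_def)
    from ex_adm2[OF this _ e] show ?thesis using Hf[OF x] ab adm_cokerE unfolding fr_def by (metis list.sel)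
  qed
  then obtain c0 p0 where c0: "\<And>x. x \<in> ?X \<Longrightarrow> coker (u (tl x) (tl x)) (u (fr x) (tl x)) (c0 x) (p0 x)" by metis
  \<comment> \<open>At local lists the given object and the given arrow already form a cokernel.
    Choosing them makes the extension restrict to \<open>A\<close> on the nose and not only up to
    isomorphism.\<close>
  define cc where "cc x = (if locP n k (set x) then A x x else c0 x)" for x
  define \<pi> where "\<pi> x = (if locP n k (set x) then A (0 # tl x) x else p0 x)" for x
  have cok: "coker (u (tl x) (tl x)) (u (fr x) (tl x)) (cc x) (\<pi> x)" if x: "x \<in> ?X" for x
  proof (cases "locP n k (set x)")
    case True
    obtain a b q where ab: "x = a # b # q" using split[OF x] by blast
    have l: "locP n k (insert 0 (set x))" by (rule locP_insert0[OF True]) simp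
    note WD_coker[OF A x l locP_mono]
    moreover have "u (tl x) (tl x) = A (0 # tl x) (0 # tl x)"
      by (rule uA) (use XX[OF x] ab in \<open>auto intro!: locP_mono[OF True]\<close>)
    moreover have "u (fr x) (tl x) = A (0 # fr x) (0 # tl x)"
      by (rule uA) (use XX[OF x] ab in \<open>auto simp: fr_def intro!: locP_mono[OF True]\<close>)
    ultimately show ?thesis using True ab by (simp add: cc_def \<pi>_def fr_def)
  next
    case False
    thus ?thesis using c0[OF x] by (simp add: cc_def \<pi>_def)
  qed
  have tl_le: "tl x \<preceq> tl y" "fr x \<preceq> fr y" if "x \<in> ?X" "y \<in> ?X" "x \<preceq> y" for x y
    using that split[OF that(1)] split[OF that(2)] by (auto simp: fr_def)
  obtain w where w0: "\<And>x y. x \<in> ?X \<Longrightarrow> y \<in> ?X \<Longrightarrow> x \<preceq> y \<Longrightarrow> H (cc x) (cc y) (w x y) \<and> w x y \<bullet> \<pi> x = \<pi> y \<bullet> u (tl x) (tl y)"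
    and ww: "\<And>x y z. x \<in> ?X \<Longrightarrow> y \<in> ?X \<Longrightarrow> z \<in> ?X \<Longrightarrow> x \<preceq> y \<Longrightarrow> y \<preceq> z \<Longrightarrow> w y z \<bullet> w x y = w x z"
    and wc: "\<And>x. x \<in> ?X \<Longrightarrow> w x x = cc x"
  proof (rule coker_functor[of ?X "list_all2 (\<le>)" "\<lambda>x y. u (tl x) (tl y)" "\<lambda>x. u (fr x) (tl x)" cc \<pi>])
    fix x y assume xy: "x \<in> ?X" "y \<in> ?X" "x \<preceq> y"
    note t = tl_le[OF xy]
    show "H (u (tl x) (tl x)) (u (tl y) (tl y)) (u (tl x) (tl y))" by (rule uH[OF t(1)]) (use XX xy in auto)
    have "u (tl x) (tl y) \<bullet> u (fr x) (tl x) = u (fr x) (tl y)" by (rule uC[OF _ t(1)]) (use XX xy in auto)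
    moreover have "u (fr y) (tl y) \<bullet> u (fr x) (fr y) = u (fr x) (tl y)" by (rule uC[OF t(2)]) (use XX xy in auto)
    ultimately show "\<exists>g. u (tl x) (tl y) \<bullet> u (fr x) (tl x) = u (fr y) (tl y) \<bullet> g" by metis
    fix z assume z: "z \<in> ?X" "y \<preceq> z"
    show "x \<preceq> z \<and> u (tl y) (tl z) \<bullet> u (tl x) (tl y) = u (tl x) (tl z)"
      using list_le_trans[OF xy(3) z(2)] uC[OF t(1) tl_le(1)[OF xy(2) z]] XX xy z by blast
  qed (use cok in auto)
  have w: "H (w x x) (w y y) (w x y)" "w x y \<bullet> \<pi> x = \<pi> y \<bullet> u (tl x) (tl y)" if "x \<in> ?X" "y \<in> ?X" "x \<preceq> y" for x y
    using w0[OF that] wc that by simp_all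
  have cokw: "coker (u (tl x) (tl x)) (u (fr x) (tl x)) (w x x) (\<pi> x)" if "x \<in> ?X" for x
    using cok wc that by simp
  have XI: "x \<in> ?X" if "sl (Suc k) x" "set x \<subseteq> {0..n}" for x using that by (simp add: Xs_def)
  have wA: "w x y = A x y" if xy: "x \<in> ?X" "y \<in> ?X" "x \<preceq> y" "locP n k (set x \<union> set y)" for x y
  proof -
    have lx: "locP n k (set x)" "locP n k (set y)" using locP_mono[OF that(4)] by auto
    have L: "locP n k (insert 0 (set x \<union> set y))" by (rule locP_insert0[OF that(4)]) simp
    note t = tl_le[OF xy(1-3)]
    have sl0: "sl (Suc k) (0 # tl x)" "sl (Suc k) (0 # tl y)" "sl (Suc k) x" "sl (Suc k) y"
      using XX(1)[OF xy(1)] XX(1)[OF xy(2)] xy by (auto simp: Xs_def sl_def)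
    have st: "set (tl x) \<subseteq> set x" "set (tl y) \<subseteq> set y" by (rule set_tl)+
    obtain a b q a' b' q' where xs: "x = a # b # q" "y = a' # b' # q'" using split xy by meson
    have HA: "H (A x x) (A y y) (A x y)"
      using dA sl0 xy(3) that(4) unfolding diag_def by blast
    have 1: "A x y \<bullet> A (0 # tl x) x = A (0 # tl x) y"
    proof -
      have "locP n k (set (0 # tl x) \<union> set x \<union> set y)" by (rule locP_mono[OF L]) (use st in auto)
      moreover have "0 # tl x \<preceq> x" using xs by auto
      ultimately show ?thesis using dA sl0 xy(3) unfolding diag_def by blast
    qed
    have 2: "A (0 # tl y) y \<bullet> A (0 # tl x) (0 # tl y) = A (0 # tl x) y"
    proof -
      have "locP n k (set (0 # tl x) \<union> set (0 # tl y) \<union> set y)" by (rule locP_mono[OF L]) (use st in auto)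
      moreover have "0 # tl x \<preceq> 0 # tl y" "0 # tl y \<preceq> y" using xs t by auto
      ultimately show ?thesis using dA sl0 unfolding diag_def by blast
    qed
    have 3: "u (tl x) (tl y) = A (0 # tl x) (0 # tl y)"
      by (rule uA) (use XX xy t st in \<open>auto intro!: locP_mono[OF L]\<close>)
    have "w x y \<bullet> \<pi> x = A x y \<bullet> \<pi> x" using w(2)[OF xy(1-3)] 1 2 3 lx by (simp add: \<pi>_def)
    moreover have "w x x = A x x" "w y y = A y y" using wc xy lx by (auto simp: cc_def)
    ultimately show ?thesis
      using epiD[OF coker_epi[OF cokw[OF xy(1)]] w(1)[OF xy(1-3)]] HA by simp
  qed
  have dw: "diag (Suc k) (\<lambda>S. S \<subseteq> {0..n}) w" unfolding diag_def
  proof (intro conjI allI impI)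
    fix x y assume "sl (Suc k) x" "sl (Suc k) y" "x \<preceq> y" "set x \<union> set y \<subseteq> {0..n}"
    thus "H (w x x) (w y y) (w x y)" by (intro w(1) XI) simp_all
  next
    fix x y z assume "sl (Suc k) x" "sl (Suc k) y" "sl (Suc k) z" "x \<preceq> y" "y \<preceq> z" "set x \<union> set y \<union> set z \<subseteq> {0..n}"
    thus "w y z \<bullet> w x y = w x z" by (intro ww XI) simp_all
  next
    fix x assume x: "sl (Suc k) x" "\<not> distinct x" "set x \<subseteq> {0..n}"
    \<comment> \<open>A degenerate list of length \<open>k + 1\<close> has at most \<open>k\<close>
      different entries and is therefore local, and there \<open>A\<close> vanishes.\<close>
    have "card (set x) \<noteq> length x" using x card_distinct by blast
    hence "card (set x) \<le> k" using card_length[of x] x(1) by (simp add: sl_def)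
    hence l: "locP n k (set x)" unfolding locP_def using x(3) cov_mono[OF cov_card[of "set x"]] by auto
    have "A x x = \<zero>" using dA x(1,2) l unfolding diag_def by blast
    thus "w x x = \<zero>" using wA[OF XI XI] x l by simp
  qed
  have wH: "H (w x x) (w y y) (w x y)" if "x \<preceq> y" "x \<in> ?X" "y \<in> ?X" for x y
    using w(1) that by blast
  have "LEt w c \<and> FEt w c" if c: "sl (k + 2) c" "set c \<subseteq> {0..n}" for c
  proof -
    have srt: "sorted c" and len: "length c = k + 2" using c by (auto simp: sl_def)
    \<comment> \<open>Both terms are quotients of the object of \<open>u\<close> at
      \<open>q = z # q'\<close>, by the images of the objects at \<open>a # q'\<close> and at
      \<open>b # q'\<close>. The claim is the third isomorphism theorem for these quotients.\<close>
    have fst: "ex (w (a # q) (a # q)) (inc w [] a b q) (w (a # q) (b # q)) \<and> ez (w (b # q) (b # q)) (w (a # q) (b # q))"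
      if cab: "c = a # b # q" for a b q
    proof -
      obtain z q' where q: "q = z # q'" using len k cab by (cases q) auto
      have X: "a # q \<in> ?X" "b # q \<in> ?X" "a # b # q' \<in> ?X" "a # b # q' \<preceq> a # q" "a # q \<preceq> b # q"
        using c by (auto simp: cab q Xs_def sl_def)
      note H1 = wH[OF X(5,1,2)] and H2 = wH[OF X(4,3,1)]
      note ca = cokw[OF X(1)] and cb = cokw[OF X(2)] and cab' = cokw[OF X(3)]
      have e1: "w (a # q) (b # q) \<bullet> \<pi> (a # q) = \<pi> (b # q)"
        using w(2)[OF X(1,2,5)] HD[OF cokerD(1)[OF cb]] by simp
      have e2: "w (a # b # q') (a # q) \<bullet> \<pi> (a # b # q') = \<pi> (a # q) \<bullet> u (b # q') q"
        using w(2)[OF X(3,1,4)] by simp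
      have ck: "coker (w (a # q) (a # q)) (w (a # b # q') (a # q)) (w (b # q) (b # q)) (w (a # q) (b # q))"
      proof (rule cokerI)
        show "H (w (a # q) (a # q)) (w (b # q) (b # q)) (w (a # q) (b # q))" by (rule H1)
        show "epi (w (b # q) (b # q)) (w (a # q) (b # q))"
          using epi_cancel[OF H1, of "\<pi> (a # q)"] e1 coker_epi[OF cb] by simp
        have "(w (a # q) (b # q) \<bullet> w (a # b # q') (a # q)) \<bullet> \<pi> (a # b # q') = \<pi> (b # q) \<bullet> u (b # q') q"
          using e1 e2 by (metis mul_assoc)
        also have "\<dots> = \<zero>" using cokerD(2)[OF cb] by (simp add: fr_def q)
        finally show "w (a # q) (b # q) \<bullet> w (a # b # q') (a # q) = \<zero>"
          using ezD[OF epi_ez[OF coker_epi[OF cab']] H_comp[OF H2 H1]] by blast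
        fix h assume h: "h \<bullet> w (a # q) (a # q) = h" "h \<bullet> w (a # b # q') (a # q) = \<zero>"
        have "(h \<bullet> \<pi> (a # q)) \<bullet> u (fr (b # q)) (tl (b # q)) = \<zero>"
          using e2 h(2) by (simp add: fr_def q) (metis mul_assoc zero_left)
        moreover have "(h \<bullet> \<pi> (a # q)) \<bullet> u (tl (b # q)) (tl (b # q)) = h \<bullet> \<pi> (a # q)"
          using HD[OF cokerD(1)[OF ca]] by (simp add: mul_assoc)
        ultimately obtain y where y: "y \<bullet> w (b # q) (b # q) = y" "y \<bullet> \<pi> (b # q) = h \<bullet> \<pi> (a # q)"
          using coker_ex[OF cb] by blast
        have "(y \<bullet> w (a # q) (b # q)) \<bullet> \<pi> (a # q) = h \<bullet> \<pi> (a # q)" using y(2) e1 by (simp add: mul_assoc)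
        moreover have "(y \<bullet> w (a # q) (b # q)) \<bullet> w (a # q) (a # q) = y \<bullet> w (a # q) (b # q)" using HD[OF H1] by (simp add: mul_assoc)
        ultimately have "y \<bullet> w (a # q) (b # q) = h" using coker_epi[OF ca] h(1) unfolding epi_def by blast
        thus "\<exists>u. u \<bullet> w (b # q) (b # q) = u \<and> u \<bullet> w (a # q) (b # q) = h" using y(1) by blast
      qed
      show ?thesis using coker_ex_ez[OF ck H2] epi_ez[OF coker_epi[OF ck]] by (simp add: q)
    qed
    have "LEt w c" unfolding LEt_def
    proof (intro allI impI)
      fix p a b q assume eq: "c = p @ a # b # q"
      consider (0) "p = []" | (1) r where "p = [r]" | (2) r v s where "p = r # v # s" by (metis neq_Nil_conv)
      thus "ex (w (p @ a # q) (p @ a # q)) (inc w p a b q) (w (p @ a # q) (p @ b # q))"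
      proof cases
        case 0 thus ?thesis using fst[of a b q] eq by simp
      next
        \<comment> \<open>The terms are the quotients of \<open>u\<close> at \<open>a # q\<close>
          and at \<open>b # q\<close> by the image of \<open>u\<close> at \<open>r # q\<close>. The
          next arrow after \<open>u (a # q) (b # q)\<close> is the projection
          \<open>\<pi> (a # b # q)\<close>; it kills \<open>u\<close> at \<open>r # q\<close>, since
          the move from \<open>r\<close> to \<open>b\<close> passes through \<open>a\<close>. So the
          image row is an identity followed by \<open>\<zero>\<close>.\<close>
        case (1 r)
        have X: "r # a # q \<in> ?X" "r # b # q \<in> ?X" "r # a # q \<preceq> r # b # q" "a # b # q \<in> ?X"
          using c by (auto simp: eq 1 Xs_def sl_def)
        have Y: "a # q \<in> Xs k n" "b # q \<in> Xs k n" "r # q \<in> Xs k n" "a # q \<preceq> b # q" "r # q \<preceq> a # q" "r # q \<preceq> b # q"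
          using c by (auto simp: eq 1 Xs_def sl_def)
        have H\<beta>: "H (u (a # q) (a # q)) (u (b # q) (b # q)) (u (a # q) (b # q))" using uH Y by blast
        have H1: "H (u (r # q) (r # q)) (u (a # q) (a # q)) (u (r # q) (a # q))" using uH Y by blast
        have H0: "H (u (r # q) (r # q)) (u (b # q) (b # q)) (u (r # q) (b # q))" using uH Y by blast
        have OS: "Ob (u (r # q) (r # q))" using HD[OF H1] by simp
        have H\<gamma>: "H (io u [] a b q) (u (a # q) (a # q)) (inc u [] a b q)"
          using inc_H[OF u, of "[]" a b q] X(4) by (auto simp: Xs_def sl_def)
        have comp: "u (a # q) (b # q) \<bullet> u (r # q) (a # q) = u (r # q) (b # q)" using uC Y by blast
        have ca: "coker (u (a # q) (a # q)) (u (r # q) (a # q)) (w (r # a # q) (r # a # q)) (\<pi> (r # a # q))"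
          using cokw[OF X(1)] by (simp add: fr_def)
        have cb: "coker (u (b # q) (b # q)) (u (r # q) (b # q)) (w (r # b # q) (r # b # q)) (\<pi> (r # b # q))"
          using cokw[OF X(2)] by (simp add: fr_def)
        have c2: "coker (u (b # q) (b # q)) (u (a # q) (b # q)) (w (a # b # q) (a # b # q)) (\<pi> (a # b # q))"
          using cokw[OF X(4)] by (simp add: fr_def)
        have e\<beta>: "ex (u (a # q) (a # q)) (inc u [] a b q) (u (a # q) (b # q))"
          using LEtD[OF LEu[of "a # b # q"], of "[]" a b q] X(4) by (simp add: Xs_def)
        have rb: "r # b # q \<in> ?X" by (rule X(2))
        have "ex (u (r # q) (r # q)) (inc u [] r b q) (u (r # q) (b # q))"
          using LEtD[OF LEu[of "r # b # q"], of "[]" r b q] rb by (simp add: Xs_def)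
        moreover have "H (io u [] r b q) (u (r # q) (r # q)) (inc u [] r b q)"
          using inc_H[OF u, of "[]" r b q] rb by (auto simp: Xs_def sl_def)
        ultimately have ad: "adm (u (r # q) (r # q)) (u (b # q) (b # q)) (u (r # q) (b # q))" using ex_adm2 H0 by blast
        have "\<pi> (a # b # q) \<bullet> u (r # q) (b # q) = \<zero>" using cokerD(3)[OF c2] comp by (metis cokerD(2) c2 mul_assoc zero_left)
        hence im: "imex (u (r # q) (r # q)) (u (b # q) (b # q)) (u (r # q) (r # q)) (u (r # q) (b # q)) (\<pi> (a # b # q))"
          using imex_base[OF H_id[OF OS] H0 cokerD(1)[OF c2] ad] ex_zero_right[OF H_id[OF OS]] ez_id[OF OS] by simp
        have t: "H (w (r # a # q) (r # a # q)) (w (r # b # q) (r # b # q)) (w (r # a # q) (r # b # q))"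
          "w (r # a # q) (r # b # q) \<bullet> \<pi> (r # a # q) = \<pi> (r # b # q) \<bullet> u (a # q) (b # q)"
          using w[OF X(1-3)] by simp_all
        have cm: "u (a # q) (b # q) \<bullet> u (r # q) (a # q) = u (r # q) (b # q) \<bullet> u (r # q) (r # q)" using comp HD(3)[OF H0] by simp
        have main: "ex (w (r # a # q) (r # a # q)) (\<pi> (r # a # q) \<bullet> inc u [] a b q) (w (r # a # q) (r # b # q))"
          by (rule imex_coker[OF H\<gamma> H\<beta> cokerD(1)[OF c2] H_id[OF OS] H1 cm e\<beta> coker_ex_ez[OF c2 H\<beta>] im ca cb t])
        show ?thesis
        proof (cases q)
          case Nil thus ?thesis using main 1 by simp
        next
          case (Cons z q')
          have Xe: "r # a # b # q' \<in> ?X" "r # a # b # q' \<preceq> r # a # q" using c by (auto simp: eq 1 Cons Xs_def sl_def)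
          have "\<pi> (r # a # q) \<bullet> u (a # b # q') (a # q) = w (r # a # b # q') (r # a # q) \<bullet> \<pi> (r # a # b # q')"
            using w(2)[OF Xe(1) X(1) Xe(2)] by simp
          hence "ex (w (r # a # q) (r # a # q)) (w (r # a # b # q') (r # a # q) \<bullet> \<pi> (r # a # b # q')) (w (r # a # q) (r # b # q))"
            using main Cons by simp
          from ex_epi_cancel[OF cokerD(1)[OF cokw[OF Xe(1)]] w(1)[OF Xe(1) X(1) Xe(2)] t(1) epi_ez[OF coker_epi[OF cokw[OF Xe(1)]]] this]
          show ?thesis using 1 Cons by simp
        qed
      next
        \<comment> \<open>With the first two entries \<open>r\<close> and \<open>v\<close> kept
          fixed, the terms are cokernels along the move \<open>r\<close> to \<open>v\<close>, which
          is the situation of \<open>coker_row\<close>.\<close>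
        case (2 r v s)
        have cs: "c = r # v # s @ a # b # q" using eq 2 by simp
        have LL: "LEt u e" if "length e = Suc k" "sorted e" "set e \<subseteq> set c" for e
          using LEu[of e] that c by (auto simp: sl_def)
        have "ex ((\<lambda>e f. w (r # v # e) (r # v # f)) (s @ a # q) (s @ a # q)) (inc (\<lambda>e f. w (r # v # e) (r # v # f)) s a b q) ((\<lambda>e f. w (r # v # e) (r # v # f)) (s @ a # q) (s @ b # q))"
        proof (rule coker_row[where r = r and w = v and s = s and x = a and y = b and q = q and \<pi> = "\<lambda>e. \<pi> (r # v # e)", OF u])
          show "sorted (r # v # s @ a # b # q)" "set (r # v # s @ a # b # q) \<subseteq> {0..n}" "length (r # v # s @ a # b # q) = k + 2"
            using c cs by (auto simp: sl_def)
          show "LEt u (v # s @ a # b # q)" using c cs by (intro LL) (auto simp: sl_def)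
          fix e z d assume h: "v # s @ a # b # q = e @ z # d"
          hence ce: "c = r # e @ z # d" using cs by simp
          show "LEt u (r # e @ d)" using c unfolding ce by (intro LL) (auto simp: sl_def sorted_append ce)
        next
          have l: "length (s @ a # q) + 2 = Suc k" using len cs by simp
          have ge: "\<forall>x\<in>set (s @ a # b # q). v \<le> x \<and> r \<le> x" "r \<le> v" using srt cs by auto
          have Xe: "r # v # e \<in> ?X \<and> v # e \<in> Xs k n \<and> r # e \<in> Xs k n" if "sl (length (s @ a # q)) e" "set e \<subseteq> set (s @ a # b # q)" for e
            using that l ge c cs by (auto simp: Xs_def sl_def)
          fix e assume e: "sl (length (s @ a # q)) e" "set e \<subseteq> set (s @ a # b # q)"
          show "coker (u (v # e) (v # e)) (u (r # e) (v # e)) (w (r # v # e) (r # v # e)) (\<pi> (r # v # e))"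
            using cokw[of "r # v # e"] Xe[OF e] by (simp add: fr_def)
          fix f assume f: "sl (length (s @ a # q)) f" "set f \<subseteq> set (s @ a # b # q)" "e \<preceq> f"
          show "H (w (r # v # e) (r # v # e)) (w (r # v # f) (r # v # f)) (w (r # v # e) (r # v # f)) \<and>
            w (r # v # e) (r # v # f) \<bullet> \<pi> (r # v # e) = \<pi> (r # v # f) \<bullet> u (v # e) (v # f)"
            using w[of "r # v # e" "r # v # f"] Xe[OF e] Xe[OF f(1,2)] f(3) by simp
        qed
        thus ?thesis using 2 by (cases q) simp_all
      qed
    qed
    moreover have "FEt w c" unfolding FEt_def using fst by blast
    ultimately show ?thesis by blast
  qed
  hence "WDn k n w" unfolding WD_def using dw by blast
  thus ?thesis using that wA by blast
qed

lemma extend_lower: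
  assumes A: "WD k (locP n k) A"
  obtains A' where "WDn k n A'"
    "\<And>x y. x \<in> Xs (Suc k) n \<Longrightarrow> y \<in> Xs (Suc k) n \<Longrightarrow> x \<preceq> y \<Longrightarrow> locP n k (set x \<union> set y) \<Longrightarrow> A' x y = A x y"
proof (cases "k = 0")
  case True
  show ?thesis using extend_lower_0[OF A[unfolded True]] that[unfolded True] by blast
next
  case False
  show ?thesis using extend_lower_pos[OF A] False that by blast
qed

section \<open>Natural transformations over the lower poset\<close>

definition nat_tr :: "nat \<Rightarrow> nat \<Rightarrow> (nat set \<Rightarrow> bool) \<Rightarrow> (nat list \<Rightarrow> nat list \<Rightarrow> 'a) \<Rightarrow> (nat list \<Rightarrow> nat list \<Rightarrow> 'a) \<Rightarrow> (nat list \<Rightarrow> 'a) \<Rightarrow> bool" where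
  "nat_tr k n P A B \<sigma> \<longleftrightarrow> (\<forall>x\<in>Xs (Suc k) n. P (set x) \<longrightarrow> H (A x x) (B x x) (\<sigma> x)) \<and>
    (\<forall>x\<in>Xs (Suc k) n. \<forall>y\<in>Xs (Suc k) n. x \<preceq> y \<longrightarrow> P (set x \<union> set y) \<longrightarrow> \<sigma> y \<bullet> A x y = B x y \<bullet> \<sigma> x)"

lemma total_coker:
  assumes A: "WDn k n A" and x: "x \<in> Xs (Suc k) n"
  shows "coker (A (0 # tl x) (0 # tl x)) (inc A [] 0 (hd x) (tl x)) (A x x) (A (0 # tl x) x)"
  by (rule WD_coker[OF A x]) (use x XsD(3)[OF x] in auto)

lemma Xs_tl: "x \<in> Xs (Suc k) n \<Longrightarrow> tl x \<in> Xs k n"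
  by (cases x) (auto simp: Xs_def sl_def)

text \<open>The list \<open>0 # tl x\<close> is local, and the arrow from it to \<open>x\<close> is
  an epimorphism; so the component at \<open>x\<close> is determined by naturality.\<close>

lemma nat_tr_lower_unique:
  assumes A: "WDn k n A" and B: "WDn k n B"
    and s: "nat_tr k n (\<lambda>S. True) A B \<sigma>" and t: "nat_tr k n (\<lambda>S. True) A B \<tau>"
    and eq: "\<And>x. x \<in> Xs (Suc k) n \<Longrightarrow> locP n k (set x) \<Longrightarrow> \<sigma> x = \<tau> x" and x: "x \<in> Xs (Suc k) n"
  shows "\<sigma> x = \<tau> x"
proof -
  have X0: "0 # tl x \<in> Xs (Suc k) n" using Xs_Cons[OF Xs_tl[OF x]] .
  have "\<sigma> (0 # tl x) = \<tau> (0 # tl x)" by (rule eq[OF X0 locP_tl[OF Xs_tl[OF x]]]) simp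
  moreover have "0 # tl x \<preceq> x" using x by (cases x) (auto simp: Xs_def sl_def)
  ultimately have "\<sigma> x \<bullet> A (0 # tl x) x = \<tau> x \<bullet> A (0 # tl x) x"
    using s t X0 x unfolding nat_tr_def by metis
  moreover have "H (A x x) (B x x) (\<sigma> x)" "H (A x x) (B x x) (\<tau> x)" using s t x by (auto simp: nat_tr_def)
  ultimately show ?thesis using epiD[OF coker_epi[OF total_coker[OF A x]]] by blast
qed

text \<open>The components at lists that start with \<open>0\<close> are all given; the remaining
  ones are induced on the cokernels of \<open>total_coker\<close>, and their naturality follows by
  cancelling the projections.\<close>

lemma nat_tr_lower_extend:
  assumes A: "WDn k n A" and B: "WDn k n B"
    and s: "nat_tr k n (locP n k) A B \<sigma>"
  obtains \<tau> where "nat_tr k n (\<lambda>S. True) A B \<tau>" "\<And>x. x \<in> Xs (Suc k) n \<Longrightarrow> locP n k (set x) \<Longrightarrow> \<tau> x = \<sigma> x"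
proof -
  let ?X = "Xs (Suc k) n"
  have dA: "diag (Suc k) (\<lambda>S. S \<subseteq> {0..n}) A" and dB: "diag (Suc k) (\<lambda>S. S \<subseteq> {0..n}) B" using A B by (auto simp: WD_def)
  have AH: "H (A x x) (A y y) (A x y)" "H (B x x) (B y y) (B x y)" if "x \<preceq> y" "x \<in> ?X" "y \<in> ?X" for x y
    using diagH[OF dA] diagH[OF dB] that by (auto simp: Xs_def)
  have AC: "A y z \<bullet> A x y = A x z" "B y z \<bullet> B x y = B x z" if "x \<preceq> y" "y \<preceq> z" "x \<in> ?X" "y \<in> ?X" "z \<in> ?X" for x y z
    using diagC[OF dA] diagC[OF dB] that by (auto simp: Xs_def)
  have sH: "H (A x x) (B x x) (\<sigma> x)" if "x \<in> ?X" "locP n k (set x)" for x using s that by (auto simp: nat_tr_def)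
  have sN: "\<sigma> y \<bullet> A x y = B x y \<bullet> \<sigma> x" if "x \<in> ?X" "y \<in> ?X" "x \<preceq> y" "locP n k (set x \<union> set y)" for x y
    using s that by (auto simp: nat_tr_def)
  \<comment> \<open>The arrow from \<open>0 # x\<close> to \<open>0 # y\<close> need not be local
    itself. Naturality along it is composed of naturality along unit steps, which are local.\<close>
  have base: "\<sigma> (0 # y) \<bullet> A (0 # x) (0 # y) = B (0 # x) (0 # y) \<bullet> \<sigma> (0 # x)"
    if xy: "x \<in> Xs k n" "y \<in> Xs k n" "x \<preceq> y" for x y
    using xy
  proof (induction rule: unit_induct)
    case (refl x)
    show ?case by (rule sN) (use Xs_Cons[OF refl] locP_tl[OF refl, of "set (0 # x)"] in auto)
  next
    case (step x y z)
    have x: "x \<in> Xs k n" "y \<in> Xs k n" using step_X[OF step(1)] by auto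
    obtain i where i: "i < k" "y = x[i := Suc (x ! i)]" using step(1) by (auto simp: step_def)
    have lx: "length x = k" using XsD(1)[OF x(1)] .
    have sy: "set y \<subseteq> set x \<union> Suc ` set x" using set_update_subset_insert[of x i "Suc (x ! i)"] i lx by auto
    have "cov k (set (0 # x) \<union> set (0 # y) - {0})" unfolding cov_def
      using sy lx card_length[of x] by (intro exI[of _ "set x"]) auto
    hence l: "locP n k (set (0 # x) \<union> set (0 # y))" unfolding locP_def using XsD(3)[OF x(1)] XsD(3)[OF x(2)] by auto
    have 1: "\<sigma> (0 # y) \<bullet> A (0 # x) (0 # y) = B (0 # x) (0 # y) \<bullet> \<sigma> (0 # x)"
      by (rule sN[OF Xs_Cons[OF x(1)] Xs_Cons[OF x(2)] _ l]) (use step_le[OF step(1)] in simp)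
    note X = Xs_Cons[OF x(1)] Xs_Cons[OF x(2)] Xs_Cons[OF step(2)]
    have le: "0 # x \<preceq> 0 # y" "0 # y \<preceq> 0 # z" using step_le[OF step(1)] step(3) by auto
    show ?case
      using 1 step.IH AC[OF le X] by (metis mul_assoc)
  qed
  note cA = total_coker[OF A] and cB = total_coker[OF B]
  have X0: "0 # tl x \<in> ?X" "0 # tl x \<preceq> x" "locP n k (set (0 # tl x))" if "x \<in> ?X" for x
    using Xs_Cons[OF Xs_tl[OF that]] locP_tl[OF Xs_tl[OF that], of "set (0 # tl x)"] that by (cases x; auto simp: Xs_def sl_def)+
  have "\<exists>t. H (A x x) (B x x) t \<and> t \<bullet> A (0 # tl x) x = B (0 # tl x) x \<bullet> \<sigma> (0 # tl x)" if x: "x \<in> ?X" for x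
  proof -
    have "(B (0 # tl x) x \<bullet> \<sigma> (0 # tl x)) \<bullet> inc A [] 0 (hd x) (tl x) = \<zero>"
    proof (cases "tl x")
      case (Cons z q)
      then obtain b where xb: "x = b # z # q" using x by (cases x) (auto simp: Xs_def sl_def)
      have y: "b # q \<in> Xs k n" "b # q \<preceq> z # q" "z # q \<in> Xs k n" using x by (auto simp: xb Xs_def sl_def)
      have "B (0 # z # q) x \<bullet> B (0 # b # q) (0 # z # q) = \<zero>"
        using cokerD(2)[OF cB[OF x]] by (simp add: xb)
      thus ?thesis using base[OF y(1,3,2)] by (simp add: xb mul_assoc) (metis mul_assoc zero_left)
    qed simp
    thus ?thesis
      using coker_exH[OF cA[OF x] H_comp[OF sH[OF X0(1,3)[OF x]] AH(2)[OF X0(2)[OF x] X0(1)[OF x] x]]] by metis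
  qed
  then obtain \<tau> where \<tau>: "\<And>x. x \<in> ?X \<Longrightarrow> H (A x x) (B x x) (\<tau> x)"
    "\<And>x. x \<in> ?X \<Longrightarrow> \<tau> x \<bullet> A (0 # tl x) x = B (0 # tl x) x \<bullet> \<sigma> (0 # tl x)" by metis
  have nat: "\<tau> y \<bullet> A x y = B x y \<bullet> \<tau> x" if xy: "x \<in> ?X" "y \<in> ?X" "x \<preceq> y" for x y
  proof (rule epiD[OF coker_epi[OF cA[OF xy(1)]]])
    show "H (A x x) (B y y) (\<tau> y \<bullet> A x y)" using H_comp[OF AH(1)[OF xy(3,1,2)] \<tau>(1)[OF xy(2)]] .
    show "H (A x x) (B y y) (B x y \<bullet> \<tau> x)" using H_comp[OF \<tau>(1)[OF xy(1)] AH(2)[OF xy(3,1,2)]] .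
    have tl: "tl x \<preceq> tl y" using xy(3) by (cases x; cases y) auto
    hence le: "0 # tl x \<preceq> 0 # tl y" by simp
    note X = X0[OF xy(1)] and Y = X0[OF xy(2)]
    have "\<tau> y \<bullet> A x y \<bullet> A (0 # tl x) x = \<tau> y \<bullet> A (0 # tl y) y \<bullet> A (0 # tl x) (0 # tl y)"
      using AC(1)[OF X(2) xy(3) X(1) xy(1,2)] AC(1)[OF le Y(2) X(1) Y(1) xy(2)] by simp
    also have "\<dots> = B (0 # tl y) y \<bullet> \<sigma> (0 # tl y) \<bullet> A (0 # tl x) (0 # tl y)" using \<tau>(2)[OF xy(2)] by (metis mul_assoc)
    also have "\<dots> = B (0 # tl y) y \<bullet> B (0 # tl x) (0 # tl y) \<bullet> \<sigma> (0 # tl x)"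
      using base[OF Xs_tl[OF xy(1)] Xs_tl[OF xy(2)] tl] by simp
    also have "\<dots> = B x y \<bullet> B (0 # tl x) x \<bullet> \<sigma> (0 # tl x)"
      using AC(2)[OF X(2) xy(3) X(1) xy(1,2)] AC(2)[OF le Y(2) X(1) Y(1) xy(2)] by (metis mul_assoc)
    also have "\<dots> = B x y \<bullet> \<tau> x \<bullet> A (0 # tl x) x" using \<tau>(2)[OF xy(1)] by simp
    finally show "(\<tau> y \<bullet> A x y) \<bullet> A (0 # tl x) x = (B x y \<bullet> \<tau> x) \<bullet> A (0 # tl x) x" by (simp add: mul_assoc)
  qed
  show ?thesis
  proof (rule that[of \<tau>])
    show "nat_tr k n (\<lambda>S. True) A B \<tau>" unfolding nat_tr_def using \<tau>(1) nat by blast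
    fix x assume x: "x \<in> ?X" "locP n k (set x)"
    have l: "locP n k (set (0 # tl x) \<union> set x)" by (rule locP_insert0[OF x(2)]) (use set_tl[of x] in auto)
    show "\<tau> x = \<sigma> x"
      by (rule epiD[OF coker_epi[OF cA[OF x(1)]] \<tau>(1)[OF x(1)] sH[OF x]])
        (use \<tau>(2)[OF x(1)] sN[OF X0(1)[OF x(1)] x(1) X0(2)[OF x(1)] l] in simp)
  qed
qed

end

section \<open>Duality and the upper poset\<close>

definition revl :: "nat \<Rightarrow> nat list \<Rightarrow> nat list" where
  "revl n x = rev (map (\<lambda>i. n - i) x)"

lemma revl_append [simp]: "revl n (x @ y) = revl n y @ revl n x" and revl_Cons: "revl n (a # x) = revl n x @ [n - a]"
  and revl_Nil [simp]: "revl n [] = []"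
  by (simp_all add: revl_def)

lemma set_revl: "set (revl n x) = (\<lambda>i. n - i) ` set x" and length_revl [simp]: "length (revl n x) = length x"
  by (simp_all add: revl_def)

lemma revl_revl: "set x \<subseteq> {0..n} \<Longrightarrow> revl n (revl n x) = x"
  unfolding revl_def rev_map by (simp add: rev_map[symmetric] map_idI subset_iff)

lemma sorted_revl: "sorted x \<Longrightarrow> sorted (revl n x)"
  by (induction x) (auto simp: revl_Cons sorted_append set_revl diff_le_mono2)

lemma le_revl: "x \<preceq> y \<Longrightarrow> revl n y \<preceq> revl n x"
  by (induction rule: list_all2_induct) (auto simp: revl_Cons list_all2_append list_all2_lengthD diff_le_mono2)

lemma sl_revl: "sl k x \<Longrightarrow> sl k (revl n x)"
  by (simp add: sl_def sorted_revl)

lemma revl_Xs: "x \<in> Xs k n \<Longrightarrow> revl n x \<in> Xs k n"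
  by (auto simp: Xs_def sl_revl set_revl)

lemma refl_image_image: "S \<subseteq> {0..n} \<Longrightarrow> (\<lambda>i. n - i) ` (\<lambda>i. n - i) ` S = (S :: nat set)"
  by (force simp: image_image image_iff)

lemma distinct_revl: "set x \<subseteq> {0..n} \<Longrightarrow> distinct (revl n x) \<longleftrightarrow> distinct x"
  unfolding revl_def by (auto simp: distinct_map inj_on_def subset_iff) (metis diff_diff_cancel)

definition flipP :: "nat \<Rightarrow> (nat set \<Rightarrow> bool) \<Rightarrow> nat set \<Rightarrow> bool" where
  "flipP n P S \<longleftrightarrow> S \<subseteq> {0..n} \<and> P ((\<lambda>i. n - i) ` S)"

context strin begin

text \<open>Restriction from diagrams on all simplices to diagrams on the subsets in \<open>P\<close> is fully faithful and surjective.\<close>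

definition good :: "nat \<Rightarrow> nat \<Rightarrow> (nat set \<Rightarrow> bool) \<Rightarrow> bool" where
  "good k n P \<longleftrightarrow>
    (\<forall>A. WD k P A \<longrightarrow> (\<exists>A'. WDn k n A' \<and>
      (\<forall>x\<in>Xs (Suc k) n. \<forall>y\<in>Xs (Suc k) n. x \<preceq> y \<longrightarrow> P (set x \<union> set y) \<longrightarrow> A' x y = A x y))) \<and>
    (\<forall>A B \<sigma>. WDn k n A \<longrightarrow> WDn k n B \<longrightarrow> nat_tr k n P A B \<sigma> \<longrightarrow>
      (\<exists>\<tau>. nat_tr k n (\<lambda>S. True) A B \<tau> \<and> (\<forall>x\<in>Xs (Suc k) n. P (set x) \<longrightarrow> \<tau> x = \<sigma> x))) \<and>
    (\<forall>A B \<sigma> \<tau>. WDn k n A \<longrightarrow> WDn k n B \<longrightarrow>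
      nat_tr k n (\<lambda>S. True) A B \<sigma> \<longrightarrow> nat_tr k n (\<lambda>S. True) A B \<tau> \<longrightarrow>
      (\<forall>x\<in>Xs (Suc k) n. P (set x) \<longrightarrow> \<sigma> x = \<tau> x) \<longrightarrow> (\<forall>x\<in>Xs (Suc k) n. \<sigma> x = \<tau> x))"

lemma good_lower: "good k n (locP n k)"
  unfolding good_def
proof (intro conjI allI impI)
  fix A assume "WD k (locP n k) A"
  from extend_lower[OF this] show "\<exists>A'. WDn k n A' \<and>
      (\<forall>x\<in>Xs (Suc k) n. \<forall>y\<in>Xs (Suc k) n. x \<preceq> y \<longrightarrow> locP n k (set x \<union> set y) \<longrightarrow> A' x y = A x y)"
    by metis
next
  fix A B \<sigma> assume "WDn k n A" "WDn k n B" "nat_tr k n (locP n k) A B \<sigma>"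
  from nat_tr_lower_extend[OF this]
  show "\<exists>\<tau>. nat_tr k n (\<lambda>S. True) A B \<tau> \<and> (\<forall>x\<in>Xs (Suc k) n. locP n k (set x) \<longrightarrow> \<tau> x = \<sigma> x)" by metis
next
  fix A B \<sigma> \<tau> assume h: "WDn k n A" "WDn k n B"
    "nat_tr k n (\<lambda>S. True) A B \<sigma>" "nat_tr k n (\<lambda>S. True) A B \<tau>" "\<forall>x\<in>Xs (Suc k) n. locP n k (set x) \<longrightarrow> \<sigma> x = \<tau> x"
  show "\<forall>x\<in>Xs (Suc k) n. \<sigma> x = \<tau> x"
    by (intro ballI, rule nat_tr_lower_unique[OF h(1-4)]) (use h(5) in blast)+
qed

lemma diag_C: "diag k P u \<Longrightarrow> sl k x \<Longrightarrow> sl k y \<Longrightarrow> sl k z \<Longrightarrow> x \<preceq> y \<Longrightarrow> y \<preceq> z \<Longrightarrow>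
  P (set x \<union> set y \<union> set z) \<Longrightarrow> u y z \<bullet> u x y = u x z"
  unfolding diag_def by blast

text \<open>Reversing the vertices reverses the sequence attached to a list. Interior exactness is
  self-dual by \<open>dual_ex\<close>, while the ends are exchanged: the case \<open>q = []\<close>
  of \<open>LEt\<close> becomes \<open>FEt\<close>, and conversely.\<close>

lemma WD_dual:
  assumes A: "WD k P A" and P: "\<And>S T. P S \<Longrightarrow> T \<subseteq> S \<Longrightarrow> P T"
  shows "strin.WD (\<lambda>x y. y \<bullet> x) \<zero> Ob k (flipP n P) (\<lambda>x y. A (revl n y) (revl n x))"
proof -
  interpret d: strin "\<lambda>x y. y \<bullet> x" \<zero> Ob by (rule dual_strin)
  let ?A = "\<lambda>x y. A (revl n y) (revl n x)"
  note dA = WD_D(1)[OF A]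
  have flipD: "P (set (revl n x))" if "flipP n P (set x)" for x using that by (simp add: flipP_def set_revl)
  have img: "P (set (revl n x) \<union> set (revl n y))" if "flipP n P (set x \<union> set y)" for x y
    using that by (simp add: flipP_def set_revl image_Un)
  have AH: "H (?A y y) (?A x x) (?A x y)" if "sl (Suc k) x" "sl (Suc k) y" "x \<preceq> y" "flipP n P (set x \<union> set y)" for x y
    by (rule diag_H[OF dA]) (use that sl_revl le_revl img[OF that(4)] in \<open>auto simp: Un_commute\<close>)
  have flipP_mono: "flipP n P T" if "flipP n P S" "T \<subseteq> S" for S T
    using that P[of "(\<lambda>i. n - i) ` S" "(\<lambda>i. n - i) ` T"] by (auto simp: flipP_def)
  have "d.diag (Suc k) (flipP n P) ?A" unfolding d.diag_def dual_simps
  proof (intro conjI allI impI)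
    fix x y z assume h: "sl (Suc k) x" "sl (Suc k) y" "sl (Suc k) z" "x \<preceq> y" "y \<preceq> z" "flipP n P (set x \<union> set y \<union> set z)"
    have "P (set (revl n z) \<union> set (revl n y) \<union> set (revl n x))"
      using h(6) by (simp add: flipP_def set_revl image_Un Un_ac)
    thus "?A x y \<bullet> ?A y z = ?A x z"
      by (rule diag_C[OF dA sl_revl[OF h(3)] sl_revl[OF h(2)] sl_revl[OF h(1)] le_revl[OF h(5)] le_revl[OF h(4)]])
  next
    fix x assume h: "sl (Suc k) x" "\<not> distinct x" "flipP n P (set x)"
    thus "?A x x = \<zero>" using dA flipD[OF h(3)] sl_revl[OF h(1)] distinct_revl[of x n] unfolding diag_def flipP_def by blast
  qed (use AH in blast)
  moreover have "d.LEt ?A c \<and> d.FEt ?A c" if c: "sl (k + 2) c" "flipP n P (set c)" for c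
  proof
    have L: "LEt A (revl n c)" "FEt A (revl n c)" using WD_D(2,3)[OF A sl_revl[OF c(1)] flipD[OF c(2)]] .
    show "d.LEt ?A c" unfolding d.LEt_def
    proof (intro allI impI)
      fix p a b q assume cc: "c = p @ a # b # q"
      have Hg: "H (?A (p @ b # q) (p @ b # q)) (?A (p @ a # q) (p @ a # q)) (?A (p @ a # q) (p @ b # q))"
        by (rule AH) (use c cc in \<open>auto simp: sl_def sorted_append intro: flipP_mono\<close>)
      show "d.ex (?A (p @ a # q) (p @ a # q)) (d.inc ?A p a b q) (?A (p @ a # q) (p @ b # q))"
      proof (cases q)
        case Nil
        have "ez (A ((n - a) # revl n p) ((n - a) # revl n p)) (A ((n - b) # revl n p) ((n - a) # revl n p))"
          using L(2) by (simp add: FEt_def cc Nil revl_Cons)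
        thus ?thesis
          using d.ex_zero_left[unfolded dual_simps, OF Hg] by (simp add: Nil revl_Cons)
      next
        case (Cons z q')
        have Hf: "H (?A (p @ a # q) (p @ a # q)) (?A (p @ a # b # q') (p @ a # b # q')) (?A (p @ a # b # q') (p @ a # q))"
          by (rule AH) (use c cc Cons in \<open>auto simp: sl_def sorted_append intro: flipP_mono\<close>)
        have "ex (?A (p @ a # q) (p @ a # q)) (?A (p @ a # q) (p @ b # q)) (?A (p @ a # b # q') (p @ a # q))"
          using LEtD[OF L(1), of "revl n q'" "n - z" "n - b" "(n - a) # revl n p"] by (simp add: cc Cons revl_Cons)
        thus ?thesis using dual_ex[OF Hg Hf] by (simp add: Cons)
      qed
    qed
    show "d.FEt ?A c" unfolding d.FEt_def dual_simps
    proof (intro allI impI)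
      fix a b q assume cc: "c = a # b # q"
      have Hg: "H (?A (b # q) (b # q)) (?A (a # q) (a # q)) (?A (a # q) (b # q))"
        by (rule AH) (use c cc in \<open>auto simp: sl_def intro: flipP_mono\<close>)
      have "ex (?A (b # q) (b # q)) \<zero> (?A (a # q) (b # q))"
        using LEtD[OF L(1), of "revl n q" "n - b" "n - a" "[]"] by (simp add: cc revl_Cons)
      thus "kz (?A (b # q) (b # q)) (?A (a # q) (b # q))" using ex_zero_left[OF Hg] by simp
    qed
  qed
  ultimately show ?thesis unfolding d.WD_def by blast
qed

lemma nat_tr_dual:
  assumes s: "nat_tr k n P A B \<sigma>"
  shows "strin.nat_tr (\<lambda>x y. y \<bullet> x) Ob k n (\<lambda>S. P ((\<lambda>i. n - i) ` S)) (\<lambda>x y. B (revl n y) (revl n x)) (\<lambda>x y. A (revl n y) (revl n x)) (\<lambda>x. \<sigma> (revl n x))"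
  unfolding strin.nat_tr_def[OF dual_strin] dual_simps
  using s revl_Xs le_revl unfolding nat_tr_def by (simp add: set_revl[symmetric] image_Un Un_commute)

lemma flipP_total: "flipP n (\<lambda>S. S \<subseteq> {0..n}) = (\<lambda>S. S \<subseteq> {0..n})"
  by (rule ext) (auto simp: flipP_def)

text \<open>Reversal of vertices and of arrows is an involution on diagrams over
  \<open>{0..n}\<close>, so each clause of \<open>good\<close> is carried over, applied and carried
  back. A transformation from \<open>A\<close> to \<open>B\<close> becomes one from the reversed
  \<open>B\<close> to the reversed \<open>A\<close>.\<close>

lemma good_flip:
  assumes g: "strin.good (\<lambda>x y. y \<bullet> x) \<zero> Ob k n P" and P: "\<And>S T. P S \<Longrightarrow> T \<subseteq> S \<Longrightarrow> P T"
    and Pn: "\<And>S. P S \<Longrightarrow> S \<subseteq> {0..n}"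
  shows "good k n (flipP n P)"
proof -
  interpret d: strin "\<lambda>x y. y \<bullet> x" \<zero> Ob by (rule dual_strin)
  let ?f = "\<lambda>A x y. A (revl n y) (revl n x)"
  have flip_mono: "flipP n P T" if "flipP n P S" "T \<subseteq> S" for S T
    using that P[of "(\<lambda>i. n - i) ` S" "(\<lambda>i. n - i) ` T"] by (auto simp: flipP_def)
  have flipflip: "flipP n (flipP n P) = P"
    by (rule HOL.ext) (use Pn in \<open>auto simp: flipP_def refl_image_image\<close>)
  have rr: "revl n (revl n x) = x" if "x \<in> Xs (Suc k) n" for x using revl_revl that by (auto simp: Xs_def)
  have tot: "d.WDn k n (?f A)" if "WDn k n A" for A
    using WD_dual[OF that, where n = n] unfolding flipP_total by blast
  have tot': "WDn k n (?f A)" if "d.WDn k n A" for A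
    using d.WD_dual[OF that, where n = n] unfolding flipP_total by auto
  show ?thesis unfolding good_def
  proof (intro conjI allI impI)
    fix A assume A: "WD k (flipP n P) A"
    have "d.WD k (flipP n (flipP n P)) (?f A)" 
    proof (rule WD_dual[OF A])
      fix S T assume "flipP n P S" "T \<subseteq> S" thus "flipP n P T" by (rule flip_mono)
    qed
    hence "d.WD k P (?f A)" unfolding flipflip .
    then obtain A' where A': "d.WDn k n A'"
      "\<forall>x\<in>Xs (Suc k) n. \<forall>y\<in>Xs (Suc k) n. x \<preceq> y \<longrightarrow> P (set x \<union> set y) \<longrightarrow> A' x y = ?f A x y"
      using g[unfolded d.good_def, THEN conjunct1, rule_format] by blast
    show "\<exists>A'. WDn k n A' \<and>
      (\<forall>x\<in>Xs (Suc k) n. \<forall>y\<in>Xs (Suc k) n. x \<preceq> y \<longrightarrow> flipP n P (set x \<union> set y) \<longrightarrow> A' x y = A x y)"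
    proof (intro exI conjI ballI impI)
      show "WDn k n (?f A')" by (rule tot'[OF A'(1)])
      fix x y assume xy: "x \<in> Xs (Suc k) n" "y \<in> Xs (Suc k) n" "x \<preceq> y" "flipP n P (set x \<union> set y)"
      hence "P (set (revl n y) \<union> set (revl n x))" by (simp add: flipP_def set_revl image_Un Un_commute)
      thus "?f A' x y = A x y" using A'(2) revl_Xs[OF xy(1)] revl_Xs[OF xy(2)] le_revl[OF xy(3)] rr[OF xy(1)] rr[OF xy(2)] by simp
    qed
  next
    fix A B \<sigma> assume h: "WDn k n A" "WDn k n B" "nat_tr k n (flipP n P) A B \<sigma>"
    have "d.nat_tr k n P (?f B) (?f A) (\<lambda>x. \<sigma> (revl n x))"
    proof -
      have "d.nat_tr k n (\<lambda>S. flipP n P ((\<lambda>i. n - i) ` S)) (?f B) (?f A) (\<lambda>x. \<sigma> (revl n x))"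
        by (rule nat_tr_dual[OF h(3)])
      moreover have "flipP n P ((\<lambda>i. n - i) ` S)" if "P S" for S
        using that Pn[OF that] by (auto simp: flipP_def refl_image_image)
      ultimately show ?thesis unfolding d.nat_tr_def by blast
    qed
    then obtain \<tau> where \<tau>: "d.nat_tr k n (\<lambda>S. True) (?f B) (?f A) \<tau>" "\<forall>x\<in>Xs (Suc k) n. P (set x) \<longrightarrow> \<tau> x = \<sigma> (revl n x)"
      using g[unfolded d.good_def, THEN conjunct2, THEN conjunct1, rule_format, OF tot[OF h(2)] tot[OF h(1)]] by blast
    have "nat_tr k n (\<lambda>S. True) (?f (?f A)) (?f (?f B)) (\<lambda>x. \<tau> (revl n x))" using d.nat_tr_dual[OF \<tau>(1)] by auto
    hence "nat_tr k n (\<lambda>S. True) A B (\<lambda>x. \<tau> (revl n x))" unfolding nat_tr_def using rr by simp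
    moreover have "\<tau> (revl n x) = \<sigma> x" if "x \<in> Xs (Suc k) n" "flipP n P (set x)" for x
      using that \<tau>(2) revl_Xs[OF that(1)] rr[OF that(1)] by (simp add: flipP_def set_revl)
    ultimately show "\<exists>\<tau>. nat_tr k n (\<lambda>S. True) A B \<tau> \<and> (\<forall>x\<in>Xs (Suc k) n. flipP n P (set x) \<longrightarrow> \<tau> x = \<sigma> x)" by blast
  next
    fix A B \<sigma> \<tau> assume h: "WDn k n A" "WDn k n B"
      "nat_tr k n (\<lambda>S. True) A B \<sigma>" "nat_tr k n (\<lambda>S. True) A B \<tau>" "\<forall>x\<in>Xs (Suc k) n. flipP n P (set x) \<longrightarrow> \<sigma> x = \<tau> x"
    have "\<sigma> (revl n x) = \<tau> (revl n x)" if "x \<in> Xs (Suc k) n" "P (set x)" for x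
    proof -
      have "flipP n P (set (revl n x))" using that Pn[OF that(2)] by (auto simp: flipP_def set_revl refl_image_image)
      thus ?thesis using h(5) revl_Xs[OF that(1)] by blast
    qed
    hence "\<forall>x\<in>Xs (Suc k) n. \<sigma> (revl n x) = \<tau> (revl n x)"
      using g[unfolded d.good_def, THEN conjunct2, THEN conjunct2, rule_format, OF tot[OF h(2)] tot[OF h(1)] nat_tr_dual[OF h(3)] nat_tr_dual[OF h(4)]]
      by blast
    thus "\<forall>x\<in>Xs (Suc k) n. \<sigma> x = \<tau> x" using revl_Xs rr by metis
  qed
qed

lemma good_upper: "good k n (flipP n (locP n k))"
proof (rule good_flip)
  show "strin.good (\<lambda>x y. y \<bullet> x) \<zero> Ob k n (locP n k)" by (rule strin.good_lower[OF dual_strin])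
  show "locP n k S \<Longrightarrow> T \<subseteq> S \<Longrightarrow> locP n k T" for S T by (rule locP_mono)
  show "locP n k S \<Longrightarrow> S \<subseteq> {0..n}" for S by (simp add: locP_def)
qed

end

section \<open>Even and odd subsets as unions of pairs\<close>

text \<open>\<open>?W\<close> consists of the second, fourth, and so on, largest elements of
  \<open>I\<close>. If \<open>i > 0\<close> in \<open>I\<close> has an even number of larger
  elements, then \<open>i - 1\<close> belongs to \<open>I\<close>, since otherwise it would be a gap
  below an odd number of elements, and it then lies in \<open>?W\<close>. So the pairs that start in
  \<open>?W\<close> cover everything except possibly \<open>0\<close>.\<close>

lemma even_cov:
  assumes "even_subset n I" "card I = 2 * k + 1"
  shows "cov k (I - {0})"
proof -
  have In: "I \<subseteq> {0..n}" and gap: "\<And>j. j \<le> n \<Longrightarrow> j \<notin> I \<Longrightarrow> even (card {i \<in> I. i > j})"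
    using assms(1) by (auto simp: even_subset_def gaps_def)
  have fin: "finite I" using In finite_subset by blast
  \<comment> \<open>Removing the minimum changes no other element's number of larger elements, and
    the minimum itself is counted exactly when the remaining number of elements is odd.\<close>
  have cnt: "card {i \<in> J. odd (card {i' \<in> J. i' > i})} = card J div 2" if "finite J" for J :: "nat set"
    using that
  proof (induction "card J" arbitrary: J)
    case 0 thus ?case by simp
  next
    case (Suc c)
    hence ne: "J \<noteq> {}" by auto
    define m where "m = Min J"
    have mJ: "m \<in> J" "\<And>i. i \<in> J \<Longrightarrow> m \<le> i" using Min_in Min_le ne Suc.prems by (auto simp: m_def)
    let ?K = "J - {m}"
    have cK: "card ?K = c" "finite ?K" using Suc mJ by auto
    have eq: "{i' \<in> J. i' > i} = {i' \<in> ?K. i' > i}" if "i \<in> J" for i using mJ(2)[OF that] by auto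
    have top: "{i' \<in> J. i' > m} = ?K" using mJ by fastforce
    have ceq: "card {i' \<in> J. i' > i} = card {i' \<in> ?K. i' > i}" if "i \<in> J" for i by (simp only: eq[OF that])
    have "{i \<in> J. odd (card {i' \<in> J. i' > i})} = {i \<in> ?K. odd (card {i' \<in> J. i' > i})} \<union> {i \<in> {m}. odd (card {i' \<in> J. i' > i})}"
      using mJ(1) by blast
    also have "{i \<in> ?K. odd (card {i' \<in> J. i' > i})} = {i \<in> ?K. odd (card {i' \<in> ?K. i' > i})}"
      by (rule Collect_cong) (use ceq in \<open>metis DiffD1\<close>)
    also have "{i \<in> {m}. odd (card {i' \<in> J. i' > i})} = (if odd c then {m} else {})"
    proof -
      have "card {i' \<in> J. i' > m} = c" using top cK(1) by (simp only:)
      hence "\<And>i. i \<in> {m} \<and> odd (card {i' \<in> J. i' > i}) \<longleftrightarrow> i = m \<and> odd c" by (metis singleton_iff)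
      thus ?thesis by (simp add: set_eq_iff)
    qed
    finally have split: "{i \<in> J. odd (card {i' \<in> J. i' > i})} = {i \<in> ?K. odd (card {i' \<in> ?K. i' > i})} \<union> (if odd c then {m} else {})" .
    have "card {i \<in> J. odd (card {i' \<in> J. i' > i})} = card {i \<in> ?K. odd (card {i' \<in> ?K. i' > i})} + (if odd c then 1 else 0)"
      unfolding split using cK(2) by (subst card_Un_disjoint) auto
    also have "\<dots> = c div 2 + (if odd c then 1 else 0)" using Suc.hyps(1)[of ?K] cK by simp
    also have "\<dots> = card J div 2" using Suc.hyps(2)[symmetric] by (auto elim: oddE)
    finally show ?case .
  qed
  let ?W = "{i \<in> I. odd (card {i' \<in> I. i' > i})}"
  have "card ?W = k" using cnt[OF fin] assms(2) by simp
  moreover have "I - {0} \<subseteq> ?W \<union> Suc ` ?W"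
  proof
    fix i assume i: "i \<in> I - {0}"
    show "i \<in> ?W \<union> Suc ` ?W"
    proof (cases "odd (card {i' \<in> I. i' > i})")
      case False
      have e: "{i' \<in> I. i' > i - 1} = insert i {i' \<in> I. i' > i}" using i by auto
      have "card {i' \<in> I. i' > i - 1} = Suc (card {i' \<in> I. i' > i})" unfolding e using fin by simp
      hence o: "odd (card {i' \<in> I. i' > i - 1})" using False by simp
      hence "i - 1 \<in> I" using gap[of "i - 1"] i In by fastforce
      hence "i - 1 \<in> ?W" using o by simp
      thus ?thesis using i by (auto intro!: image_eqI[of _ _ "i - 1"])
    qed (use i in auto)
  qed
  ultimately show ?thesis unfolding cov_def using fin by (intro exI[of _ ?W]) auto
qed

text \<open>The even set is built from the top. If \<open>N\<close> is not in \<open>S\<close>, it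
  may stay a gap, having no larger elements; if \<open>N\<close> is in \<open>S\<close>, the block
  \<open>{N - 1, N}\<close> is added and one pair is spent. The recursion ends when no pair is left
  or when \<open>N = 2 * m\<close>, where the whole interval is taken; this reaches the exact
  cardinality.\<close>

lemma cov_even_aux:
  assumes "S \<subseteq> {1..N}" "cov m S" "2 * m \<le> N"
  shows "\<exists>I. S \<subseteq> I \<and> I \<subseteq> {1..N} \<and> card I = 2 * m \<and> (\<forall>j \<in> {0..N} - I. even (card {i \<in> I. i > j}))"
  using assms
proof (induction N arbitrary: m S rule: less_induct)
  case (less N)
  show ?case
  proof (cases "N = 2 * m")
    case True
    have "even (card {i \<in> {1..N}. i > j})" if "j \<in> {0..N} - {1..N}" for j
    proof -
      have "{i \<in> {1..N}. i > j} = {1..N}" using that by auto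
      thus ?thesis using True by simp
    qed
    moreover have "card {1..N} = 2 * m" using True by simp
    ultimately show ?thesis using less.prems(1) by blast
  next
    case False
    show ?thesis
    proof (cases "m = 0")
      case True
      hence "S = {}" using less.prems(2) by (auto simp: cov_def)
      thus ?thesis using True by (intro exI[of _ "{}"]) auto
    next
      case m: False
      hence N: "N > 2 * m" "N \<ge> 3" using less.prems False by auto
      show ?thesis
      proof (cases "N \<in> S")
        case False
        have "S \<subseteq> {1..N - 1}"
        proof
          fix x assume "x \<in> S"
          hence "1 \<le> x" "x \<le> N" "x \<noteq> N" using less.prems(1) False by auto
          thus "x \<in> {1..N - 1}" by auto
        qed
        then obtain I where I: "S \<subseteq> I" "I \<subseteq> {1..N - 1}" "card I = 2 * m" "\<forall>j \<in> {0..N - 1} - I. even (card {i \<in> I. i > j})"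
        proof -
          have "N - 1 < N" "2 * m \<le> N - 1" using N by linarith+
          from less.IH[OF this(1) \<open>S \<subseteq> {1..N - 1}\<close> less.prems(2) this(2)] show ?thesis using that by blast
        qed
        have IN: "I \<subseteq> {1..N}" using I(2) by (rule order.trans) auto
        have "{i \<in> I. i > N} = {}" using IN by force
        hence e: "card {i \<in> I. i > N} = 0" by (simp only: card.empty)
        have "even (card {i \<in> I. i > j})" if j: "j \<in> {0..N} - I" for j
        proof (cases "j = N")
          case True thus ?thesis using e by simp
        next
          case False
          hence "j \<in> {0..N - 1} - I" using j by auto
          thus ?thesis using I(4) by blast
        qed
        thus ?thesis using I(1,3) IN by blast
      next
        case True
        obtain W where W: "finite W" "card W \<le> m" "S \<subseteq> W \<union> Suc ` W" using less.prems(2) by (auto simp: cov_def)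
        have w: "N \<in> W \<or> N - 1 \<in> W" using True W(3) by auto
        \<comment> \<open>A pair that covers \<open>N\<close> starts at \<open>N - 1\<close> or at
          \<open>N\<close>. Its points in \<open>S\<close> lie in the block, so it may be
          discarded.\<close>
        have "\<exists>w\<in>W. S - {N, N - 1} \<subseteq> (W - {w}) \<union> Suc ` (W - {w})"
        proof (cases "N - 1 \<in> W")
          case True
          moreover have "x \<in> (W - {N - 1}) \<union> Suc ` (W - {N - 1})" if x: "x \<in> S - {N, N - 1}" for x
          proof -
            have "x \<in> W \<union> Suc ` W" "x \<noteq> Suc (N - 1)" "x \<noteq> N - 1" using x W(3) N by auto
            thus ?thesis by auto
          qed
          ultimately show ?thesis by blast
        next
          case False
          hence NW: "N \<in> W" using w by auto
          have "x \<in> (W - {N}) \<union> Suc ` (W - {N})" if x: "x \<in> S - {N, N - 1}" for x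
          proof -
            have "x \<in> W \<union> Suc ` W" "x \<noteq> Suc N" "x \<noteq> N" using x W(3) less.prems(1) by auto
            thus ?thesis by auto
          qed
          thus ?thesis using NW by blast
        qed
        then obtain w where w: "w \<in> W" "S - {N, N - 1} \<subseteq> (W - {w}) \<union> Suc ` (W - {w})" by blast
        have cv: "cov (m - 1) (S - {N, N - 1})" unfolding cov_def 
          by (rule exI[of _ "W - {w}"]) (use w W(1,2) in simp)
        have "S - {N, N - 1} \<subseteq> {1..N - 2}"
        proof
          fix x assume "x \<in> S - {N, N - 1}"
          hence "1 \<le> x" "x \<le> N" "x \<noteq> N" "x \<noteq> N - 1" using less.prems(1) by auto
          thus "x \<in> {1..N - 2}" by auto
        qed
        then obtain I where I: "S - {N, N - 1} \<subseteq> I" "I \<subseteq> {1..N - 2}" "card I = 2 * (m - 1)" "\<forall>j \<in> {0..N - 2} - I. even (card {i \<in> I. i > j})"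
        proof -
          have "N - 2 < N" "2 * (m - 1) \<le> N - 2" using N by linarith+
          from less.IH[OF this(1) \<open>S - {N, N - 1} \<subseteq> {1..N - 2}\<close> cv this(2)] show ?thesis using that by blast
        qed
        have fI: "finite I" using I(2) finite_subset by blast
        have nI: "N \<notin> I" "N - 1 \<notin> I" "N \<noteq> N - 1"
        proof -
          have "x \<le> N - 2" if "x \<in> I" for x using I(2) that by auto
          moreover have "\<not> N \<le> N - 2" "\<not> N - 1 \<le> N - 2" "N \<noteq> N - 1" using N by linarith+
          ultimately show "N \<notin> I" "N - 1 \<notin> I" "N \<noteq> N - 1" by blast+
        qed
        let ?I = "insert N (insert (N - 1) I)"
        have "even (card {i \<in> ?I. i > j})" if j: "j \<in> {0..N} - ?I" for j
        proof -
          have jN: "j \<le> N - 2" "j \<notin> I" using j N by auto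
          have "{i \<in> ?I. i > j} = insert N (insert (N - 1) {i \<in> I. i > j})" using N jN by auto
          hence "card {i \<in> ?I. i > j} = card {i \<in> I. i > j} + 2" using fI nI by simp
          moreover have "even (card {i \<in> I. i > j})" using I(4) jN by simp
          ultimately show ?thesis by simp
        qed
        moreover have "card ?I = 2 * m" using fI nI m I(3) by simp
        moreover have "?I \<subseteq> {1..N}"
        proof -
          have "{1..N - 2} \<subseteq> {1..N}" by auto
          from order.trans[OF I(2) this] show ?thesis using N by simp
        qed
        moreover have "S \<subseteq> ?I" using I(1) by blast
        ultimately show ?thesis by blast
      qed
    qed
  qed
qed

text \<open>Adding \<open>0\<close> to the set from \<open>cov_even_aux\<close> changes no number of
  larger elements and brings the cardinality to \<open>2 * k + 1\<close>.\<close>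

lemma lower_poset_iff:
  assumes "2 * k \<le> n"
  shows "J \<in> lower_poset n (2 * k) \<longleftrightarrow> J \<noteq> {} \<and> locP n k J"
proof
  assume "J \<in> lower_poset n (2 * k)"
  then obtain I where I: "J \<noteq> {}" "J \<subseteq> {0..n}" "even_subset n I" "card I = 2 * k + 1" "J \<subseteq> I"
    by (auto simp: lower_poset_def)
  have "cov k (J - {0})" by (rule cov_mono[OF even_cov[OF I(3,4)]]) (use I in auto)
  thus "J \<noteq> {} \<and> locP n k J" using I by (simp add: locP_def)
next
  assume J: "J \<noteq> {} \<and> locP n k J"
  hence "J - {0} \<subseteq> {1..n}" "cov k (J - {0})" by (auto simp: locP_def)
  then obtain I where I: "J - {0} \<subseteq> I" "I \<subseteq> {1..n}" "card I = 2 * k" "\<forall>j \<in> {0..n} - I. even (card {i \<in> I. i > j})"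
    using cov_even_aux[OF _ _ assms] by metis
  have fI: "finite I" using I(2) finite_subset by blast
  have "even_subset n (insert 0 I)" unfolding even_subset_def gaps_def
  proof (intro conjI ballI)
    show "insert 0 I \<subseteq> {0..n}" using I(2) by auto
    fix j assume j: "j \<in> {0..n} - insert 0 I"
    have "{i \<in> insert 0 I. i > j} = {i \<in> I. i > j}" by auto
    thus "even (card {i \<in> insert 0 I. i > j})" using I(4) j by simp
  qed
  moreover have "0 \<notin> I" using I(2) by force
  hence "card (insert 0 I) = 2 * k + 1" using I(3) fI by simp
  ultimately show "J \<in> lower_poset n (2 * k)" unfolding lower_poset_def using J I(1)
    by (auto simp: locP_def intro!: exI[of _ "insert 0 I"])
qed

text \<open>For a gap \<open>j\<close>, the numbers of smaller and of larger elements add up to the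
  odd number \<open>2 * k + 1\<close>, so one is odd exactly when the other is even; the flip
  exchanges them.\<close>

lemma odd_flip_even:
  assumes I: "I \<subseteq> {0..n}" and c: "card I = 2 * k + 1"
  shows "odd_subset n I \<longleftrightarrow> even_subset n ((\<lambda>i. n - i) ` I)"
proof -
  let ?f = "\<lambda>i. n - i"
  have fin: "finite I" using I finite_subset by blast
  have key: "odd (card {i \<in> I. i > j}) \<longleftrightarrow> even (card {i \<in> ?f ` I. i > ?f j})" if j: "j \<le> n" "j \<notin> I" for j
  proof -
    have "{i \<in> ?f ` I. i > ?f j} = ?f ` {i \<in> I. i < j}"
      using I j by (auto simp: image_iff)
    moreover have "inj_on ?f {i \<in> I. i < j}" using I by (intro inj_onI) (metis (mono_tags, lifting) atLeastAtMost_iff diff_diff_cancel mem_Collect_eq subsetD)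
    ultimately have a: "card {i \<in> ?f ` I. i > ?f j} = card {i \<in> I. i < j}" by (simp add: card_image)
    have "I = {i \<in> I. i < j} \<union> {i \<in> I. i > j}" 
    proof (rule set_eqI)
      fix x show "x \<in> I \<longleftrightarrow> x \<in> {i \<in> I. i < j} \<union> {i \<in> I. i > j}" using j(2) by (cases x j rule: linorder_cases) auto
    qed
    from arg_cong[OF this, of card]
    have "card I = card ({i \<in> I. i < j} \<union> {i \<in> I. i > j})" .
    also have "\<dots> = card {i \<in> I. i < j} + card {i \<in> I. i > j}"
      by (rule card_Un_disjoint) (use fin in auto)
    finally have "card I = card {i \<in> I. i < j} + card {i \<in> I. i > j}" .
    thus ?thesis using a c by presburger
  qed
  have inj: "inj_on ?f {0..n}" by (auto simp: inj_on_def)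
  have "?f ` {0..n} = {0..n}" using refl_image_image[of "{0..n}" n] by (auto simp: image_iff) (metis diff_diff_cancel diff_le_self atLeastAtMost_iff le0)
  hence g: "gaps n (?f ` I) = ?f ` gaps n I"
    unfolding gaps_def using inj_on_image_set_diff[OF inj, of "{0..n}" I] I by simp
  show ?thesis unfolding odd_subset_def even_subset_def g
    using I key by (auto simp: gaps_def)
qed

lemma upper_poset_iff:
  assumes "2 * k \<le> n"
  shows "J \<in> upper_poset n (2 * k) \<longleftrightarrow> J \<noteq> {} \<and> flipP n (locP n k) J"
proof -
  let ?f = "\<lambda>i. n - i"
  have inj: "inj_on ?f {0..n}" by (auto simp: inj_on_def)
  have cf: "card (?f ` I) = card I" if "I \<subseteq> {0..n}" for I using card_image[OF inj_on_subset[OF inj that]] .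
  have "J \<in> upper_poset n (2 * k) \<longleftrightarrow> J \<subseteq> {0..n} \<and> ?f ` J \<in> lower_poset n (2 * k)"
  proof
    assume "J \<in> upper_poset n (2 * k)"
    then obtain I where I: "J \<noteq> {}" "J \<subseteq> {0..n}" "odd_subset n I" "card I = 2 * k + 1" "J \<subseteq> I"
      by (auto simp: upper_poset_def)
    have "I \<subseteq> {0..n}" using I(3) by (simp add: odd_subset_def)
    thus "J \<subseteq> {0..n} \<and> ?f ` J \<in> lower_poset n (2 * k)"
      unfolding lower_poset_def using I odd_flip_even[of I n k] cf by (auto intro!: exI[of _ "?f ` I"])
  next
    assume h: "J \<subseteq> {0..n} \<and> ?f ` J \<in> lower_poset n (2 * k)"
    then obtain I where I: "J \<noteq> {}" "even_subset n I" "card I = 2 * k + 1" "?f ` J \<subseteq> I"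
      by (auto simp: lower_poset_def)
    have In: "I \<subseteq> {0..n}" using I(2) by (simp add: even_subset_def)
    have "?f ` ?f ` J \<subseteq> ?f ` I" using I(4) by blast
    hence "J \<subseteq> ?f ` I" using h refl_image_image by metis
    moreover have "odd_subset n (?f ` I)" using odd_flip_even[of "?f ` I" n k] I In cf refl_image_image[OF In] by fastforce
    ultimately show "J \<in> upper_poset n (2 * k)"
      unfolding upper_poset_def using I h cf[OF In] by (auto intro!: exI[of _ "?f ` I"])
  qed
  thus ?thesis using lower_poset_iff[OF assms] by (auto simp: flipP_def)
qed

section \<open>The monoid of a stringent category\<close>

lemma homD: "f \<in> hom C a b \<Longrightarrow> f \<in> Arr C" "f \<in> hom C a b \<Longrightarrow> Dom C f = a" "f \<in> hom C a b \<Longrightarrow> Cod C f = b"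
  by (auto simp: hom_def)

lemma homI: "f \<in> Arr C \<Longrightarrow> f \<in> hom C (Dom C f) (Cod C f)"
  by (simp add: hom_def)

context category begin

lemma hom_ob: "f \<in> hom C a b \<Longrightarrow> a \<in> Obj C" "f \<in> hom C a b \<Longrightarrow> b \<in> Obj C"
  using dom_closed cod_closed by (auto simp: hom_def)

lemma zero_arr_comp:
  assumes f: "f \<in> hom C a b" and g: "g \<in> hom C b c" and z: "zero_arr C f \<or> zero_arr C g"
  shows "zero_arr C (g \<cdot> f)"
  using z
proof
  assume "zero_arr C f"
  then obtain z x y where z: "is_zero C z" "x \<in> hom C a z" "y \<in> hom C z b" "f = y \<cdot> x"
    using f by (auto simp: zero_arr_def homD)
  have "g \<cdot> f = (g \<cdot> y) \<cdot> x" using assoc[OF z(2,3) g] z(4) by simp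
  thus ?thesis unfolding zero_arr_def using z comp_closed[OF z(3) g] comp_closed[OF f g] by (auto simp: homD)
next
  assume "zero_arr C g"
  then obtain z x y where z: "is_zero C z" "x \<in> hom C b z" "y \<in> hom C z c" "g = y \<cdot> x"
    using g by (auto simp: zero_arr_def homD)
  have "g \<cdot> f = y \<cdot> (x \<cdot> f)" using assoc[OF f z(2,3)] z(4) by simp
  thus ?thesis unfolding zero_arr_def using z comp_closed[OF f z(2)] comp_closed[OF f g] by (auto simp: homD)
qed

end

text \<open>The form in which stringency is used: factorizations are taken through kernel-cokernel
  pairs, without reference to a chosen proto-exact structure.\<close>

locale kc_cat = category C for C :: "('o, 'm) cat" (structure) +
  fixes z :: 'o
  assumes zero: "is_zero C z"
    and kc: "f \<in> Arr C \<Longrightarrow> (\<exists>m. is_kernel C f m) \<or> (\<exists>e. is_cokernel C f e) \<Longrightarrow>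
      \<exists>m\<in>kc_monos C. \<exists>e\<in>kc_epis C. Dom C m = Cod C e \<and> f = m \<cdot> e"
begin

lemma to_zero: "a \<in> Obj C \<Longrightarrow> \<exists>!f. f \<in> hom C a z" and from_zero: "a \<in> Obj C \<Longrightarrow> \<exists>!f. f \<in> hom C z a"
  and z_ob: "z \<in> Obj C"
  using zero by (auto simp: is_zero_def)

definition za :: "'o \<Rightarrow> 'o \<Rightarrow> 'm" where
  "za a b = (THE f. f \<in> hom C z b) \<cdot> (THE f. f \<in> hom C a z)"

lemma za_eq: "f \<in> hom C a z \<Longrightarrow> g \<in> hom C z b \<Longrightarrow> g \<cdot> f = za a b"
  unfolding za_def using the1_equality[OF to_zero, of a f] the1_equality[OF from_zero, of b g] hom_ob by metis

lemma za_hom: "a \<in> Obj C \<Longrightarrow> b \<in> Obj C \<Longrightarrow> za a b \<in> hom C a b"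
  using to_zero[of a] from_zero[of b] za_eq comp_closed by metis

lemma za_zero: "a \<in> Obj C \<Longrightarrow> b \<in> Obj C \<Longrightarrow> zero_arr C (za a b)"
  using to_zero[of a] from_zero[of b] za_eq za_hom[of a b] zero unfolding zero_arr_def by (metis homD)

text \<open>The identity of any other zero object factors through \<open>z\<close>, so a zero arrow
  can be rerouted through \<open>z\<close>.\<close>

lemma zero_arr_za:
  assumes "f \<in> hom C a b" "zero_arr C f"
  shows "f = za a b"
proof -
  obtain z' x y where z': "is_zero C z'" "x \<in> hom C a z'" "y \<in> hom C z' b" "f = y \<cdot> x"
    using assms by (auto simp: zero_arr_def homD)
  have z'O: "z' \<in> Obj C" using z' by (simp add: is_zero_def)
  obtain t s where t: "t \<in> hom C z' z" and s: "s \<in> hom C z z'" using to_zero[OF z'O] from_zero[OF z'O] by blast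
  have "s \<cdot> t = Id C z'" using z'(1) z'O comp_closed[OF t s] id_closed[OF z'O] unfolding is_zero_def by blast
  hence "y \<cdot> x = y \<cdot> ((s \<cdot> t) \<cdot> x)" using id_left[OF z'(2)] by simp
  also have "\<dots> = (y \<cdot> s) \<cdot> (t \<cdot> x)"
    using assoc[OF z'(2) t s] assoc[OF comp_closed[OF z'(2) t] s z'(3)] by simp
  also have "\<dots> = za a b" by (rule za_eq[OF comp_closed[OF z'(2) t] comp_closed[OF s z'(3)]])
  finally show ?thesis using z'(4) by simp
qed

lemma zero_id_iff: "a \<in> Obj C \<Longrightarrow> zero_arr C (Id C a) \<longleftrightarrow> is_zero C a"
proof
  assume a: "a \<in> Obj C" and "is_zero C a"
  thus "zero_arr C (Id C a)" unfolding zero_arr_def using id_closed[OF a] id_left[OF id_closed[OF a]] by (metis homD)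
next
  assume a: "a \<in> Obj C" and za: "zero_arr C (Id C a)"
  show "is_zero C a" unfolding is_zero_def
  proof (intro conjI ballI)
    show "a \<in> Obj C" by fact
    fix b assume b: "b \<in> Obj C"
    have "f = za a b" if "f \<in> hom C a b" for f
      using zero_arr_za[OF that] zero_arr_comp[OF id_closed[OF a] that] za id_right[OF that] by simp
    thus "\<exists>!f. f \<in> hom C a b" using za_hom[OF a b] by blast
    have "f = za b a" if "f \<in> hom C b a" for f
      using zero_arr_za[OF that] zero_arr_comp[OF that id_closed[OF a]] za id_left[OF that] by simp
    thus "\<exists>!f. f \<in> hom C b a" using za_hom[OF b a] by blast
  qed
qed

text \<open>Only the source and the target of zero arrows are forgotten; on each hom set
  \<open>lift\<close> is injective, see \<open>lift_inj\<close>. This is why equations proved in the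
  monoid can be brought back to the category.\<close>

definition lift :: "'m \<Rightarrow> 'm option" where
  "lift f = (if f \<in> Arr C \<and> \<not> zero_arr C f then Some f else None)"

definition mmul :: "'m option \<Rightarrow> 'm option \<Rightarrow> 'm option" where
  "mmul y x = (case (y, x) of (Some g, Some f) \<Rightarrow>
     if f \<in> Arr C \<and> g \<in> Arr C \<and> Dom C g = Cod C f then lift (g \<cdot> f) else None | _ \<Rightarrow> None)"

definition ob :: "'o \<Rightarrow> 'm option" where
  "ob a = lift (Id C a)"

definition mOb :: "'m option \<Rightarrow> bool" where
  "mOb i \<longleftrightarrow> (\<exists>a\<in>Obj C. i = ob a)"

lemma ob_None: "a \<in> Obj C \<Longrightarrow> ob a = None \<longleftrightarrow> is_zero C a"
proof -
  assume a: "a \<in> Obj C"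
  have "Id C a \<in> Arr C" using homD(1)[OF id_closed[OF a]] .
  thus ?thesis using zero_id_iff[OF a] by (simp add: ob_def lift_def)
qed

lemma ob_z [simp]: "ob z = None"
  using ob_None[OF z_ob] zero by simp

lemma lift_None: "f \<in> Arr C \<Longrightarrow> lift f = None \<longleftrightarrow> zero_arr C f"
  by (simp add: lift_def)

lemma lift_za: "a \<in> Obj C \<Longrightarrow> b \<in> Obj C \<Longrightarrow> lift (za a b) = None"
  by (simp add: lift_def za_zero)

lemma lift_inj: "f \<in> hom C a b \<Longrightarrow> g \<in> hom C a b \<Longrightarrow> lift f = lift g \<Longrightarrow> f = g"
  unfolding lift_def using zero_arr_za[of f a b] zero_arr_za[of g a b] by (auto simp: homD split: if_splits)

lemma mmul_lift:
  assumes f: "f \<in> hom C a b" and g: "g \<in> hom C b c"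
  shows "mmul (lift g) (lift f) = lift (g \<cdot> f)"
  using zero_arr_comp[OF f g] f g comp_closed[OF f g] by (auto simp: mmul_def lift_def homD)

lemma mmul_None [simp]: "mmul None x = None" "mmul x None = None"
  by (auto simp: mmul_def split: option.splits)

lemma mmul_SomeD:
  assumes "mmul y x = Some h"
  obtains f g where "x = Some f" "y = Some g" "f \<in> Arr C" "g \<in> Arr C" "Dom C g = Cod C f" "h = g \<cdot> f" "\<not> zero_arr C h"
  using assms by (auto simp: mmul_def lift_def split: option.splits if_splits)

lemma mmul_Some: "f \<in> hom C a b \<Longrightarrow> g \<in> hom C b c \<Longrightarrow> mmul (Some g) (Some f) = lift (g \<cdot> f)"
  by (simp add: mmul_def homD)

lemma mmul_lift_Some:
  assumes f: "f \<in> hom C a b" and g: "g \<in> hom C b c"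
  shows "mmul (lift g) (Some f) = lift (g \<cdot> f)"
proof (cases "zero_arr C g")
  case True
  hence "lift g = None" "lift (g \<cdot> f) = None" using zero_arr_comp[OF f g] by (simp_all add: lift_def)
  thus ?thesis by simp
next
  case False
  hence "lift g = Some g" using homD(1)[OF g] by (simp add: lift_def)
  thus ?thesis using mmul_Some[OF f g] by simp
qed

lemma mmul_Some_lift:
  assumes f: "f \<in> hom C a b" and g: "g \<in> hom C b c"
  shows "mmul (Some g) (lift f) = lift (g \<cdot> f)"
proof (cases "zero_arr C f")
  case True
  hence "lift f = None" "lift (g \<cdot> f) = None" using zero_arr_comp[OF f g] by (simp_all add: lift_def)
  thus ?thesis by simp
next
  case False
  hence "lift f = Some f" using homD(1)[OF f] by (simp add: lift_def)
  thus ?thesis using mmul_Some[OF f g] by simp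
qed

text \<open>A nonzero product keeps the source of its right factor and the target of its left
  factor, so a triple that is not composable has product \<open>None\<close> in both
  bracketings.\<close>

lemma mmul_assoc: "mmul (mmul x y) w = mmul x (mmul y w)"
proof -
  consider (N) "x = None \<or> y = None \<or> w = None"
    | (S) h g f where "x = Some h" "y = Some g" "w = Some f" by (cases x; cases y; cases w) auto
  thus ?thesis
  proof cases
    case (S h g f)
    show ?thesis
    proof (cases "f \<in> Arr C \<and> g \<in> Arr C \<and> h \<in> Arr C \<and> Dom C g = Cod C f \<and> Dom C h = Cod C g")
      case True
      have t: "f \<in> hom C (Dom C f) (Cod C f)" "g \<in> hom C (Cod C f) (Cod C g)" "h \<in> hom C (Cod C g) (Cod C h)"
        using True by (auto simp: hom_def)
      note gf = comp_closed[OF t(1,2)] and hg = comp_closed[OF t(2,3)]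
      have "mmul (mmul x y) w = lift ((h \<cdot> g) \<cdot> f)"
        unfolding S mmul_Some[OF t(2,3)] by (rule mmul_lift_Some[OF t(1) hg])
      moreover have "mmul x (mmul y w) = lift (h \<cdot> (g \<cdot> f))"
        unfolding S mmul_Some[OF t(1,2)] by (rule mmul_Some_lift[OF gf t(3)])
      ultimately show ?thesis using assoc[OF t] by simp
    next
      case False
      have "mmul (mmul x y) w = None"
      proof (rule ccontr)
        assume "\<not> ?thesis"
        then obtain v where "mmul (mmul x y) w = Some v" by blast
        then obtain a b where ab: "w = Some a" "mmul x y = Some b" "a \<in> Arr C" "Dom C b = Cod C a" by (blast elim: mmul_SomeD)
        from ab(2) obtain g' h' where "y = Some g'" "x = Some h'" and c': "g' \<in> Arr C" "h' \<in> Arr C" "Dom C h' = Cod C g'" "b = h' \<cdot> g'"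
          by (rule mmul_SomeD)
        hence c: "g \<in> Arr C" "h \<in> Arr C" "Dom C h = Cod C g" "b = h \<cdot> g" using S by auto
        have "h \<cdot> g \<in> hom C (Dom C g) (Cod C h)" using c by (intro comp_closed[of _ _ "Cod C g"]) (auto simp: hom_def)
        thus False using False ab c S by (auto simp: homD)
      qed
      moreover have "mmul x (mmul y w) = None"
      proof (rule ccontr)
        assume "\<not> ?thesis"
        then obtain v where "mmul x (mmul y w) = Some v" by blast
        then obtain a b where ab: "x = Some b" "mmul y w = Some a" "b \<in> Arr C" "Dom C b = Cod C a" by (blast elim: mmul_SomeD)
        from ab(2) obtain f' g' where "w = Some f'" "y = Some g'" and c': "f' \<in> Arr C" "g' \<in> Arr C" "Dom C g' = Cod C f'" "a = g' \<cdot> f'"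
          by (rule mmul_SomeD)
        hence c: "f \<in> Arr C" "g \<in> Arr C" "Dom C g = Cod C f" "a = g \<cdot> f" using S by auto
        have "g \<cdot> f \<in> hom C (Dom C f) (Cod C g)" using c by (intro comp_closed[of _ _ "Cod C f"]) (auto simp: hom_def)
        thus False using False ab c S by (auto simp: homD)
      qed
      ultimately show ?thesis by simp
    qed
  qed (auto)
qed

lemma ob_lift: "f \<in> hom C a b \<Longrightarrow> mmul (ob b) (lift f) = lift f" "f \<in> hom C a b \<Longrightarrow> mmul (lift f) (ob a) = lift f"
proof -
  assume f: "f \<in> hom C a b"
  note O = hom_ob[OF f]
  show "mmul (ob b) (lift f) = lift f" "mmul (lift f) (ob a) = lift f"
    unfolding ob_def using mmul_lift[OF f id_closed[OF O(2)]] mmul_lift[OF id_closed[OF O(1)] f] id_left[OF f] id_right[OF f] by simp_all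
qed

lemma ob_left: 
  assumes "b \<in> Obj C" "mmul (ob b) x = x"
  obtains a f where "f \<in> hom C a b" "x = lift f"
proof (cases x)
  case None
  thus ?thesis using that[OF za_hom[OF assms(1) assms(1)]] lift_za[OF assms(1) assms(1)] by simp
next
  case (Some h)
  then obtain f g where f: "x = Some f" "ob b = Some g" "f \<in> Arr C" "Dom C g = Cod C f" "h = g \<cdot> f" "\<not> zero_arr C h"
    using assms(2) by (auto elim: mmul_SomeD)
  have "g = Id C b" using f(2) by (auto simp: ob_def lift_def split: if_splits)
  hence "Cod C f = b" using f(4) id_closed[OF assms(1)] by (auto simp: homD)
  thus ?thesis using that[of f "Dom C f"] f Some by (auto simp: lift_def hom_def)
qed

lemma ob_right: 
  assumes "a \<in> Obj C" "mmul x (ob a) = x"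
  obtains b f where "f \<in> hom C a b" "x = lift f"
proof (cases x)
  case None
  thus ?thesis using that[OF za_hom[OF assms(1) assms(1)]] lift_za[OF assms(1) assms(1)] by simp
next
  case (Some h)
  then obtain f g where f: "x = Some g" "ob a = Some f" "g \<in> Arr C" "Dom C g = Cod C f" "h = g \<cdot> f" "\<not> zero_arr C h"
    using assms(2) by (auto elim: mmul_SomeD)
  have "f = Id C a" using f(2) by (auto simp: ob_def lift_def split: if_splits)
  hence "Dom C g = a" using f(4) id_closed[OF assms(1)] by (auto simp: homD)
  thus ?thesis using that[of g "Cod C g"] f Some by (auto simp: lift_def hom_def)
qed

sublocale m: zero_cat mmul None mOb
proof
  show "mOb None" unfolding mOb_def using z_ob ob_z by metis
  show "mmul i i = i" if "mOb i" for i
    using that ob_lift(1)[OF id_closed] unfolding mOb_def ob_def by blast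
qed (simp_all add: mmul_assoc)

lemma H_iff:
  assumes "a \<in> Obj C" "b \<in> Obj C"
  shows "m.H (ob a) (ob b) x \<longleftrightarrow> (\<exists>f\<in>hom C a b. x = lift f)"
proof
  assume "\<exists>f\<in>hom C a b. x = lift f"
  thus "m.H (ob a) (ob b) x" unfolding m.H_def mOb_def using ob_lift assms by auto
next
  assume h: "m.H (ob a) (ob b) x"
  show "\<exists>f\<in>hom C a b. x = lift f"
  proof (cases x)
    case None
    thus ?thesis using za_hom[OF assms] lift_za[OF assms] by metis
  next
    case (Some f)
    have hb: "mmul (ob b) x = x" "mmul x (ob a) = x" using h by (auto simp: m.H_def)
    obtain c f1 where 1: "f1 \<in> hom C c b" "x = lift f1" using ob_left[OF assms(2) hb(1)] .
    obtain d f2 where 2: "f2 \<in> hom C a d" "x = lift f2" using ob_right[OF assms(1) hb(2)] .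
    have "f1 = f" "f2 = f" using 1 2 Some by (auto simp: lift_def split: if_splits)
    thus ?thesis using 1 2 by (auto simp: hom_def)
  qed
qed

lemma lift_H: "f \<in> hom C a b \<Longrightarrow> m.H (ob a) (ob b) (lift f)"
  using H_iff hom_ob by blast

text \<open>The monoid tests cancellation also on arrows with different sources. If the common
  product is nonzero, the sources agree and uniqueness of the factorization applies; if it is zero,
  that same uniqueness forces both arrows to be zero.\<close>

lemma ker_iff:
  assumes f: "f \<in> hom C a b" and k: "k \<in> hom C c a"
  shows "m.ker (ob a) (lift f) (ob c) (lift k) \<longleftrightarrow> is_kernel C f k"
proof
  assume K: "is_kernel C f k"
  have zfk: "zero_arr C (f \<cdot> k)" and un: "\<And>h. h \<in> Arr C \<Longrightarrow> Cod C h = a \<Longrightarrow> zero_arr C (f \<cdot> h) \<Longrightarrow> \<exists>!u. u \<in> hom C (Dom C h) c \<and> k \<cdot> u = h"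
    using K f k by (auto simp: is_kernel_def homD)
  have uniq: "u = v" if uv: "u \<in> hom C d c" "v \<in> hom C d c" "k \<cdot> u = k \<cdot> v" for u v d
  proof -
    have ku: "k \<cdot> u \<in> hom C d a" using comp_closed[OF uv(1) k] .
    have "f \<cdot> (k \<cdot> u) = (f \<cdot> k) \<cdot> u" using assoc[OF uv(1) k f] by simp
    hence "zero_arr C (f \<cdot> (k \<cdot> u))" using zero_arr_comp[OF uv(1) comp_closed[OF k f]] zfk by simp
    thus ?thesis using un[of "k \<cdot> u"] ku uv by (auto simp: homD)
  qed
  show "m.ker (ob a) (lift f) (ob c) (lift k)" unfolding m.ker_def m.mon_def
  proof (intro conjI allI impI)
    show "m.H (ob c) (ob a) (lift k)" by (rule lift_H[OF k])
    show "mmul (lift f) (lift k) = None" using mmul_lift[OF k f] zfk comp_closed[OF k f] by (simp add: lift_None homD)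
  next
    fix u v assume uv: "mmul (ob c) u = u" "mmul (ob c) v = v" "mmul (lift k) u = mmul (lift k) v"
    obtain d u' where u: "u' \<in> hom C d c" "u = lift u'" using ob_left[OF hom_ob(1)[OF k] uv(1)] .
    obtain e v' where v: "v' \<in> hom C e c" "v = lift v'" using ob_left[OF hom_ob(1)[OF k] uv(2)] .
    have eq: "lift (k \<cdot> u') = lift (k \<cdot> v')" using uv(3) u v mmul_lift[OF u(1) k] mmul_lift[OF v(1) k] by simp
    have kill: "w = za d c" if w: "w \<in> hom C d c" "zero_arr C (k \<cdot> w)" for w d
    proof (rule uniq[OF w(1)])
      have O: "d \<in> Obj C" "c \<in> Obj C" using hom_ob[OF w(1)] by auto
      show "za d c \<in> hom C d c" using za_hom[OF O] .
      have "zero_arr C (k \<cdot> za d c)" using zero_arr_comp[OF za_hom[OF O] k] za_zero[OF O] by simp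
      thus "k \<cdot> w = k \<cdot> za d c"
        using zero_arr_za[OF comp_closed[OF w(1) k] w(2)] zero_arr_za[OF comp_closed[OF za_hom[OF O] k]] by simp
    qed
    show "u = v"
    proof (cases "lift (k \<cdot> u')")
      case None
      hence "zero_arr C (k \<cdot> u')" "zero_arr C (k \<cdot> v')"
        using eq comp_closed[OF u(1) k] comp_closed[OF v(1) k] by (auto simp: lift_None[symmetric] homD)
      hence "u' = za d c" "v' = za e c" using kill u(1) v(1) by auto
      thus ?thesis using u v lift_za hom_ob by metis
    next
      case (Some w)
      hence "k \<cdot> u' = k \<cdot> v'" using eq by (auto simp: lift_def split: if_splits)
      moreover from this have "d = e" using comp_closed[OF u(1) k] comp_closed[OF v(1) k] by (auto simp: hom_def)
      ultimately show ?thesis using uniq u v by blast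
    qed
  next
    fix h assume h: "mmul (ob a) h = h" "mmul (lift f) h = None"
    obtain d h' where h': "h' \<in> hom C d a" "h = lift h'" using ob_left[OF hom_ob(1)[OF f] h(1)] .
    have "zero_arr C (f \<cdot> h')" using h(2) h' mmul_lift[OF h'(1) f] comp_closed[OF h'(1) f] by (simp add: lift_None homD)
    then obtain u where u: "u \<in> hom C d c" "k \<cdot> u = h'" using un[of h'] h'(1) by (auto simp: homD)
    show "\<exists>u. mmul (ob c) u = u \<and> mmul (lift k) u = h"
      using u h' mmul_lift[OF u(1) k] ob_lift(1)[OF u(1)] by (intro exI[of _ "lift u"]) simp
  qed
next
  assume K: "m.ker (ob a) (lift f) (ob c) (lift k)"
  show "is_kernel C f k" unfolding is_kernel_def
  proof (intro conjI ballI impI)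
    show "f \<in> Arr C" "k \<in> Arr C" "Cod C k = Dom C f" using f k by (auto simp: homD)
    show "zero_arr C (f \<cdot> k)" using m.kerD(2)[OF K] mmul_lift[OF k f] comp_closed[OF k f] by (simp add: lift_None homD)
    fix h assume h: "h \<in> Arr C" "Cod C h = Dom C f \<and> zero_arr C (f \<cdot> h)"
    have hh: "h \<in> hom C (Dom C h) a" using h f by (auto simp: hom_def)
    have "mmul (lift f) (lift h) = None" using mmul_lift[OF hh f] h comp_closed[OF hh f] by (simp add: lift_None homD)
    then obtain u where u: "m.H (ob (Dom C h)) (ob c) u" "mmul (lift k) u = lift h" using m.ker_exH[OF K lift_H[OF hh]] by blast
    then obtain u' where u': "u' \<in> hom C (Dom C h) c" "u = lift u'" using H_iff hom_ob[OF hh] hom_ob[OF k] by blast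
    have ku: "k \<cdot> u' = h" using u(2) u' mmul_lift[OF u'(1) k] lift_inj[OF comp_closed[OF u'(1) k] hh] by simp
    show "\<exists>!u. u \<in> hom C (Dom C h) (Dom C k) \<and> k \<cdot> u = h"
    proof (rule ex1I[of _ u'])
      show "u' \<in> hom C (Dom C h) (Dom C k) \<and> k \<cdot> u' = h" using u' ku k by (simp add: homD)
      fix v assume "v \<in> hom C (Dom C h) (Dom C k) \<and> k \<cdot> v = h"
      hence v: "v \<in> hom C (Dom C h) c" "k \<cdot> v = h" using k by (auto simp: homD)
      have "lift v = lift u'"
        using m.monD[OF m.ker_mon[OF K] lift_H[OF v(1)] lift_H[OF u'(1)]] mmul_lift[OF v(1) k] mmul_lift[OF u'(1) k] v ku by simp
      thus "v = u'" using lift_inj[OF v(1) u'(1)] by simp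
    qed
  qed
qed

lemma coker_iff:
  assumes f: "f \<in> hom C b a" and k: "k \<in> hom C a c"
  shows "m.coker (ob a) (lift f) (ob c) (lift k) \<longleftrightarrow> is_cokernel C f k"
proof
  assume K: "is_cokernel C f k"
  have zfk: "zero_arr C (k \<cdot> f)" and un: "\<And>h. h \<in> Arr C \<Longrightarrow> Dom C h = a \<Longrightarrow> zero_arr C (h \<cdot> f) \<Longrightarrow> \<exists>!u. u \<in> hom C c (Cod C h) \<and> u \<cdot> k = h"
    using K f k by (auto simp: is_cokernel_def homD)
  have uniq: "u = v" if uv: "u \<in> hom C c d" "v \<in> hom C c d" "u \<cdot> k = v \<cdot> k" for u v d
  proof -
    have ku: "u \<cdot> k \<in> hom C a d" using comp_closed[OF k uv(1)] .
    have "(u \<cdot> k) \<cdot> f = u \<cdot> (k \<cdot> f)" using assoc[OF f k uv(1)] by simp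
    hence "zero_arr C ((u \<cdot> k) \<cdot> f)" using zero_arr_comp[OF comp_closed[OF f k] uv(1)] zfk by simp
    thus ?thesis using un[of "u \<cdot> k"] ku uv by (auto simp: homD)
  qed
  show "m.coker (ob a) (lift f) (ob c) (lift k)" unfolding m.coker_def m.epi_def
  proof (intro conjI allI impI)
    show "m.H (ob a) (ob c) (lift k)" by (rule lift_H[OF k])
    show "mmul (lift k) (lift f) = None" using mmul_lift[OF f k] zfk comp_closed[OF f k] by (simp add: lift_None homD)
  next
    fix u v assume uv: "mmul u (ob c) = u" "mmul v (ob c) = v" "mmul u (lift k) = mmul v (lift k)"
    obtain d u' where u: "u' \<in> hom C c d" "u = lift u'" using ob_right[OF hom_ob(2)[OF k] uv(1)] .
    obtain e v' where v: "v' \<in> hom C c e" "v = lift v'" using ob_right[OF hom_ob(2)[OF k] uv(2)] .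
    have eq: "lift (u' \<cdot> k) = lift (v' \<cdot> k)" using uv(3) u v mmul_lift[OF k u(1)] mmul_lift[OF k v(1)] by simp
    have kill: "w = za c d" if w: "w \<in> hom C c d" "zero_arr C (w \<cdot> k)" for w d
    proof (rule uniq[OF w(1)])
      have O: "d \<in> Obj C" "c \<in> Obj C" using hom_ob[OF w(1)] by auto
      show "za c d \<in> hom C c d" using za_hom O by blast
      have "zero_arr C (za c d \<cdot> k)" using zero_arr_comp[OF k za_hom[OF O(2,1)]] za_zero[OF O(2,1)] by simp
      thus "w \<cdot> k = za c d \<cdot> k"
        using zero_arr_za[OF comp_closed[OF k w(1)] w(2)] zero_arr_za[OF comp_closed[OF k za_hom[OF O(2,1)]]] by simp
    qed
    show "u = v"
    proof (cases "lift (u' \<cdot> k)")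
      case None
      hence "zero_arr C (u' \<cdot> k)" "zero_arr C (v' \<cdot> k)"
        using eq comp_closed[OF k u(1)] comp_closed[OF k v(1)] by (auto simp: lift_None[symmetric] homD)
      hence "u' = za c d" "v' = za c e" using kill u(1) v(1) by auto
      thus ?thesis using u v lift_za hom_ob by metis
    next
      case (Some w)
      hence "u' \<cdot> k = v' \<cdot> k" using eq by (auto simp: lift_def split: if_splits)
      moreover from this have "d = e" using comp_closed[OF k u(1)] comp_closed[OF k v(1)] by (auto simp: hom_def)
      ultimately show ?thesis using uniq u v by blast
    qed
  next
    fix h assume h: "mmul h (ob a) = h" "mmul h (lift f) = None"
    obtain d h' where h': "h' \<in> hom C a d" "h = lift h'" using ob_right[OF hom_ob(2)[OF f] h(1)] .
    have "zero_arr C (h' \<cdot> f)" using h(2) h' mmul_lift[OF f h'(1)] comp_closed[OF f h'(1)] by (simp add: lift_None homD)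
    then obtain u where u: "u \<in> hom C c d" "u \<cdot> k = h'" using un[of h'] h'(1) by (auto simp: homD)
    show "\<exists>u. mmul u (ob c) = u \<and> mmul u (lift k) = h"
      using u h' mmul_lift[OF k u(1)] ob_lift(2)[OF u(1)] by (intro exI[of _ "lift u"]) simp
  qed
next
  assume K: "m.coker (ob a) (lift f) (ob c) (lift k)"
  show "is_cokernel C f k" unfolding is_cokernel_def
  proof (intro conjI ballI impI)
    show "f \<in> Arr C" "k \<in> Arr C" "Dom C k = Cod C f" using f k by (auto simp: homD)
    show "zero_arr C (k \<cdot> f)" using m.cokerD(2)[OF K] mmul_lift[OF f k] comp_closed[OF f k] by (simp add: lift_None homD)
    fix h assume h: "h \<in> Arr C" "Dom C h = Cod C f \<and> zero_arr C (h \<cdot> f)"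
    have hh: "h \<in> hom C a (Cod C h)" using h f by (auto simp: hom_def)
    have "mmul (lift h) (lift f) = None" using mmul_lift[OF f hh] h comp_closed[OF f hh] by (simp add: lift_None homD)
    then obtain u where u: "m.H (ob c) (ob (Cod C h)) u" "mmul u (lift k) = lift h" using m.coker_exH[OF K lift_H[OF hh]] by blast
    then obtain u' where u': "u' \<in> hom C c (Cod C h)" "u = lift u'" using H_iff hom_ob[OF hh] hom_ob[OF k] by blast
    have ku: "u' \<cdot> k = h" using u(2) u' mmul_lift[OF k u'(1)] lift_inj[OF comp_closed[OF k u'(1)] hh] by simp
    show "\<exists>!u. u \<in> hom C (Cod C k) (Cod C h) \<and> u \<cdot> k = h"
    proof (rule ex1I[of _ u'])
      show "u' \<in> hom C (Cod C k) (Cod C h) \<and> u' \<cdot> k = h" using u' ku k by (simp add: homD)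
      fix v assume "v \<in> hom C (Cod C k) (Cod C h) \<and> v \<cdot> k = h"
      hence v: "v \<in> hom C c (Cod C h)" "v \<cdot> k = h" using k by (auto simp: homD)
      have "lift v = lift u'"
        using m.epiD[OF m.coker_epi[OF K] lift_H[OF v(1)] lift_H[OF u'(1)]] mmul_lift[OF k v(1)] mmul_lift[OF k u'(1)] v ku by simp
      thus "v = u'" using lift_inj[OF v(1) u'(1)] by simp
    qed
  qed
qed

lemma m_strin: "strin mmul None mOb"
proof
  fix a' b' x
  assume H: "m.H a' b' x" and kx: "(\<exists>c k. m.ker a' x c k) \<or> (\<exists>c e. m.coker b' x c e)"
  obtain a b where ab: "a \<in> Obj C" "a' = ob a" "b \<in> Obj C" "b' = ob b" using m.HD(1,2)[OF H] by (auto simp: mOb_def)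
  then obtain f where f: "f \<in> hom C a b" "x = lift f" using H H_iff by blast
  have "(\<exists>k. is_kernel C f k) \<or> (\<exists>e. is_cokernel C f e)"
    using kx
  proof
    assume "\<exists>c k. m.ker a' x c k"
    then obtain c' k' where k': "m.ker a' x c' k'" by blast
    then obtain c where c: "c \<in> Obj C" "c' = ob c" using m.HD(1)[OF m.kerD(1)[OF k']] unfolding mOb_def by blast
    then obtain k where "k \<in> hom C c a" "k' = lift k" using m.kerD(1)[OF k'] H_iff ab by blast
    thus ?thesis using ker_iff[OF f(1)] k' c f ab by blast
  next
    assume "\<exists>c k. m.coker b' x c k"
    then obtain c' k' where k': "m.coker b' x c' k'" by blast
    then obtain c where c: "c \<in> Obj C" "c' = ob c" using m.HD(2)[OF m.cokerD(1)[OF k']] unfolding mOb_def by blast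
    then obtain k where "k \<in> hom C b c" "k' = lift k" using m.cokerD(1)[OF k'] H_iff ab by blast
    thus ?thesis using coker_iff[OF f(1)] k' c f ab by blast
  qed
  then obtain k e where ke: "k \<in> kc_monos C" "e \<in> kc_epis C" "Dom C k = Cod C e" "f = k \<cdot> e"
    using kc[of f] f(1) by (auto simp: homD)
  obtain g where g: "is_kernel C g k" "is_cokernel C k g" using ke(1) by (auto simp: kc_monos_def kernel_cokernel_pair_def)
  obtain l where l: "is_kernel C e l" "is_cokernel C l e" using ke(2) by (auto simp: kc_epis_def kernel_cokernel_pair_def)
  define c where "c = Dom C k"
  have kA: "k \<in> Arr C" "e \<in> Arr C" using g l by (auto simp: is_kernel_def)
  have "e \<in> hom C (Dom C e) c" "k \<in> hom C c (Cod C k)" using kA ke by (auto simp: hom_def c_def)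
  from comp_closed[OF this] have "Dom C e = a" "Cod C k = b" using f(1) ke(4) by (auto simp: hom_def)
  hence e: "e \<in> hom C a c" and k: "k \<in> hom C c b" using kA ke by (auto simp: hom_def c_def)
  have gh: "g \<in> hom C b (Cod C g)" using g k by (auto simp: is_kernel_def hom_def)
  have lh: "l \<in> hom C (Dom C l) a" using l e by (auto simp: is_kernel_def hom_def)
  show "\<exists>c k e d g d' l. x = mmul k e \<and> m.ker b' g c k \<and> m.coker b' k d g \<and> m.ker a' e d' l \<and> m.coker a' l c e"
  proof (intro exI conjI)
    show "x = mmul (lift k) (lift e)" using mmul_lift[OF e k] f ke by simp
    show "m.ker b' (lift g) (ob c) (lift k)" using ker_iff[OF gh k] g ab by simp
    show "m.coker b' (lift k) (ob (Cod C g)) (lift g)" using coker_iff[OF k gh] g ab by simp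
    show "m.ker a' (lift e) (ob (Dom C l)) (lift l)" using ker_iff[OF e lh] l ab by simp
    show "m.coker a' (lift l) (ob c) (lift e)" using coker_iff[OF lh e] l ab by simp
  qed
qed

sublocale m: strin mmul None mOb by (rule m_strin)

end

section \<open>From stringency to kernel-cokernel pairs\<close>

lemma zero_arr_unique:
  assumes "category C" "f \<in> hom C a b" "f' \<in> hom C a b" "zero_arr C f" "zero_arr C f'"
  shows "f = f'"
proof -
  interpret category C by fact
  obtain z x y where z: "is_zero C z" "x \<in> hom C a z" "y \<in> hom C z b" "f = y \<cdot>\<^bsub>C\<^esub> x"
    using assms by (auto simp: zero_arr_def homD)
  obtain z' x' y' where z': "is_zero C z'" "x' \<in> hom C a z'" "y' \<in> hom C z' b" "f' = y' \<cdot>\<^bsub>C\<^esub> x'"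
    using assms by (auto simp: zero_arr_def homD)
  obtain t where t: "t \<in> hom C z z'" using z z' by (auto simp: is_zero_def)
  have O: "a \<in> Obj C" "b \<in> Obj C" using hom_ob[OF assms(2)] by auto
  have "t \<cdot>\<^bsub>C\<^esub> x = x'" using comp_closed[OF z(2) t] z'(1,2) O unfolding is_zero_def by blast
  moreover have "y' \<cdot>\<^bsub>C\<^esub> t = y" using comp_closed[OF t z'(3)] z(1,3) O unfolding is_zero_def by blast
  ultimately show ?thesis using assoc[OF z(2) t z'(3)] z(4) z'(4) by simp
qed

text \<open>Over a zero corner one leg of a cone is forced, so a cone is the same as an arrow killed
  by \<open>e\<close>.\<close>

lemma bicartesian_zero_ker:
  assumes "category C" and z: "is_zero C z" "Cod C g = z" and c: "cartesian C m g e k"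
  shows "is_kernel C e m"
proof -
  interpret category C by fact
  note u = zero_arr_unique[OF category_axioms]
  have sq: "m \<in> Arr C" "g \<in> Arr C" "e \<in> Arr C" "k \<in> Arr C" "Dom C m = Dom C g" "Cod C m = Dom C e" "Cod C g = Dom C k" "Cod C e = Cod C k" "e \<cdot>\<^bsub>C\<^esub> m = k \<cdot>\<^bsub>C\<^esub> g"
    using c by (auto simp: cartesian_def comm_square_def)
  have t: "g \<in> hom C (Dom C m) z" "k \<in> hom C z (Cod C e)" "m \<in> hom C (Dom C m) (Dom C e)" "e \<in> hom C (Dom C e) (Cod C e)"
    using sq z by (auto simp: hom_def)
  have zz: "zero_arr C (y \<cdot>\<^bsub>C\<^esub> x)" if "x \<in> hom C a z" "y \<in> hom C z b" for x y a b
    using comp_closed[OF that] that z(1) unfolding zero_arr_def by (metis homD)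
  show ?thesis unfolding is_kernel_def
  proof (intro conjI ballI impI)
    show "zero_arr C (e \<cdot>\<^bsub>C\<^esub> m)" using zz[OF t(1,2)] sq(9) by simp
    fix h assume h: "h \<in> Arr C" "Cod C h = Dom C e \<and> zero_arr C (e \<cdot>\<^bsub>C\<^esub> h)"
    have hh: "h \<in> hom C (Dom C h) (Dom C e)" using h by (simp add: hom_def)
    obtain v where v: "v \<in> hom C (Dom C h) z" using z(1) hom_ob[OF hh] by (auto simp: is_zero_def)
    have vu: "w = v" if "w \<in> hom C (Dom C h) z" for w using that v z(1) hom_ob[OF hh] unfolding is_zero_def by blast
    have "e \<cdot>\<^bsub>C\<^esub> h = k \<cdot>\<^bsub>C\<^esub> v" using u[OF comp_closed[OF hh t(4)] comp_closed[OF v t(2)]] h zz[OF v t(2)] by simp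
    hence "comm_square C h v e k" using h v sq z(2) by (auto simp: comm_square_def homD)
    then obtain w where w: "w \<in> hom C (Dom C h) (Dom C m)" "m \<cdot>\<^bsub>C\<^esub> w = h" and
      wu: "\<And>w'. w' \<in> hom C (Dom C h) (Dom C m) \<Longrightarrow> m \<cdot>\<^bsub>C\<^esub> w' = h \<Longrightarrow> g \<cdot>\<^bsub>C\<^esub> w' = v \<Longrightarrow> w' = w"
      using c unfolding cartesian_def by metis
    show "\<exists>!w. w \<in> hom C (Dom C h) (Dom C m) \<and> m \<cdot>\<^bsub>C\<^esub> w = h"
      using w wu vu comp_closed[OF _ t(1)] by metis
  qed (use sq in auto)
qed

lemma bicartesian_zero_coker:
  assumes "category C" and z: "is_zero C z" "Cod C g = z" and c: "cocartesian C m g e k"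
  shows "is_cokernel C m e"
proof -
  interpret category C by fact
  note u = zero_arr_unique[OF category_axioms]
  have sq: "m \<in> Arr C" "g \<in> Arr C" "e \<in> Arr C" "k \<in> Arr C" "Dom C m = Dom C g" "Cod C m = Dom C e" "Cod C g = Dom C k" "Cod C e = Cod C k" "e \<cdot>\<^bsub>C\<^esub> m = k \<cdot>\<^bsub>C\<^esub> g"
    using c by (auto simp: cocartesian_def comm_square_def)
  have t: "g \<in> hom C (Dom C m) z" "k \<in> hom C z (Cod C e)" "m \<in> hom C (Dom C m) (Dom C e)" "e \<in> hom C (Dom C e) (Cod C e)"
    using sq z by (auto simp: hom_def)
  have zz: "zero_arr C (y \<cdot>\<^bsub>C\<^esub> x)" if "x \<in> hom C a z" "y \<in> hom C z b" for x y a b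
    using comp_closed[OF that] that z(1) unfolding zero_arr_def by (metis homD)
  show ?thesis unfolding is_cokernel_def
  proof (intro conjI ballI impI)
    show "zero_arr C (e \<cdot>\<^bsub>C\<^esub> m)" using zz[OF t(1,2)] sq(9) by simp
    fix h assume h: "h \<in> Arr C" "Dom C h = Cod C m \<and> zero_arr C (h \<cdot>\<^bsub>C\<^esub> m)"
    have hh: "h \<in> hom C (Dom C e) (Cod C h)" using h sq by (simp add: hom_def)
    obtain v where v: "v \<in> hom C z (Cod C h)" using z(1) hom_ob[OF hh] by (auto simp: is_zero_def)
    have vu: "w = v" if "w \<in> hom C z (Cod C h)" for w using that v z(1) hom_ob[OF hh] unfolding is_zero_def by blast
    have "h \<cdot>\<^bsub>C\<^esub> m = v \<cdot>\<^bsub>C\<^esub> g" using u[OF comp_closed[OF t(3) hh] comp_closed[OF t(1) v]] h zz[OF t(1) v] by simp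
    hence "comm_square C m g h v" using h v sq z(2) by (auto simp: comm_square_def homD)
    then obtain w where w: "w \<in> hom C (Cod C e) (Cod C h)" "w \<cdot>\<^bsub>C\<^esub> e = h" and
      wu: "\<And>w'. w' \<in> hom C (Cod C e) (Cod C h) \<Longrightarrow> w' \<cdot>\<^bsub>C\<^esub> e = h \<Longrightarrow> w' \<cdot>\<^bsub>C\<^esub> k = v \<Longrightarrow> w' = w"
      using c unfolding cocartesian_def by metis
    show "\<exists>!w. w \<in> hom C (Cod C e) (Cod C h) \<and> w \<cdot>\<^bsub>C\<^esub> e = h"
      using w wu vu comp_closed[OF t(2)] by metis
  qed (use sq in auto)
qed

text \<open>An admissible monomorphism and the arrow from its source to \<open>0\<close>, or an
  admissible epimorphism and the arrow from \<open>0\<close> to its target, can be completed to a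
  bicartesian square. It displays a kernel-cokernel pair, so admissible factorizations are
  factorizations through such pairs.\<close>

lemma stringent_kc_cat:
  assumes "stringent C"
  obtains z where "kc_cat C z"
proof -
  obtain M E where pe: "proto_exact C M E" and adm: "\<forall>f \<in> Arr C. (\<exists>m. is_kernel C f m) \<or> (\<exists>e. is_cokernel C f e) \<longrightarrow> admissible C M E f"
    using assms by (auto simp: stringent_def)
  interpret p: proto_exact C M E by fact
  obtain z where z: "is_zero C z" and cat: "category C" using p.pointed by (auto simp: pointed_category_def)
  interpret category C by fact
  have M: "M \<subseteq> kc_monos C"
  proof
    fix m assume m: "m \<in> M"
    have mA: "m \<in> Arr C" using m p.M_arr by blast
    obtain g where g: "g \<in> hom C (Dom C m) z" using z dom_closed[OF mA] by (auto simp: is_zero_def)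
    have "g \<in> E" using p.zero_in_E[OF z] g by (auto simp: homD)
    then obtain h k where h: "bicartesian C m g h k" using p.complete_span[OF m, of g] homD(2)[OF g] by auto
    have "is_kernel C h m" "is_cokernel C m h"
      using bicartesian_zero_ker[OF cat z homD(3)[OF g]] bicartesian_zero_coker[OF cat z homD(3)[OF g]] h by (auto simp: bicartesian_def)
    thus "m \<in> kc_monos C" by (auto simp: kc_monos_def kernel_cokernel_pair_def)
  qed
  have E: "E \<subseteq> kc_epis C"
  proof
    fix e assume e: "e \<in> E"
    have eA: "e \<in> Arr C" using e p.E_arr by blast
    obtain k where k: "k \<in> hom C z (Cod C e)" using z cod_closed[OF eA] by (auto simp: is_zero_def)
    have "k \<in> M" using p.zero_in_M[OF z] k by (auto simp: homD)
    then obtain f g where h: "bicartesian C f g e k" using p.complete_cospan[OF _ e, of k] homD(3)[OF k] by auto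
    have cg: "Cod C g = z" using h k by (auto simp: bicartesian_def cartesian_def comm_square_def homD)
    have "is_kernel C e f" "is_cokernel C f e"
      using bicartesian_zero_ker[OF cat z cg] bicartesian_zero_coker[OF cat z cg] h by (auto simp: bicartesian_def)
    thus "e \<in> kc_epis C" by (auto simp: kc_epis_def kernel_cokernel_pair_def)
  qed
  have "kc_cat C z"
  proof
    show "is_zero C z" by fact
    fix f assume "f \<in> Arr C" "(\<exists>m. is_kernel C f m) \<or> (\<exists>e. is_cokernel C f e)"
    hence "admissible C M E f" using adm by blast
    thus "\<exists>m\<in>kc_monos C. \<exists>e\<in>kc_epis C. Dom C m = Cod C e \<and> f = m \<cdot>\<^bsub>C\<^esub> e"
      using M E unfolding admissible_def by blast
  qed
  thus ?thesis using that by blast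
qed

context strin begin

text \<open>Images are unique up to isomorphism, so the factorization hidden in \<open>ex\<close>
  may be replaced by any given one.\<close>

lemma ex_factor:
  assumes f: "H x y f" and g: "H y w g" and e: "ex y f g"
    and fm: "H x c e1" "ez c e1" "H c y m1" "kz c m1" "f = m1 \<bullet> e1"
  shows "ker y g c m1"
proof -
  obtain d m e where d: "ker y g d m" "H x d e" "H d y m" "mon d m" "epi d e" "f = m \<bullet> e"
    using ex_kerE[OF f g e] .
  have "(g \<bullet> m1) \<bullet> e1 = \<zero>" using ex_zero[OF e] fm(5) by (simp add: mul_assoc)
  hence "g \<bullet> m1 = \<zero>" using ezD[OF fm(2) H_comp[OF fm(3) g]] by blast
  then obtain t where t: "H c d t" "m \<bullet> t = m1" using ker_exH[OF d(1) fm(3)] by blast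
  have "m \<bullet> (t \<bullet> e1) = m \<bullet> e" using t(2) fm(5) d(6) by (metis mul_assoc)
  hence te: "t \<bullet> e1 = e" using monD[OF d(4) H_comp[OF fm(1) t(1)] d(2)] by blast
  have "ez d t" using ez_cancel[OF t(1), of e1] te epi_ez[OF d(5)] by simp
  moreover have "kz c t" using kz_cancel[OF t(1), of m] t(2) fm(4) by simp
  ultimately obtain s where s: "H d c s" "t \<bullet> s = d" using iso_if[OF t(1)] by blast
  show ?thesis
  proof (rule kerI)
    show "H c y m1" by fact
    show "g \<bullet> m1 = \<zero>" by fact
    show "mon c m1" using kz_mon fm by blast
    fix h assume h: "y \<bullet> h = h" "g \<bullet> h = \<zero>"
    then obtain v where v: "d \<bullet> v = v" "m \<bullet> v = h" using ker_ex[OF d(1)] by blast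
    have "m1 \<bullet> (s \<bullet> v) = h" using t(2) s(2) v by (metis mul_assoc)
    moreover have "c \<bullet> (s \<bullet> v) = s \<bullet> v" using HD[OF s(1)] by simp
    ultimately show "\<exists>u. c \<bullet> u = u \<and> m1 \<bullet> u = h" by blast
  qed
qed

end

section \<open>Exact sequences in the category and in the monoid\<close>

context kc_cat begin

lemma kc_monos_iff:
  assumes f: "f \<in> hom C a b"
  shows "f \<in> kc_monos C \<longleftrightarrow> m.kz (ob a) (lift f)"
proof
  assume "f \<in> kc_monos C"
  then obtain e where e: "is_kernel C e f" by (auto simp: kc_monos_def kernel_cokernel_pair_def)
  hence "e \<in> hom C b (Cod C e)" using f by (auto simp: is_kernel_def hom_def)
  from ker_iff[OF this f] e show "m.kz (ob a) (lift f)" using m.ker_mon m.mon_kz by blast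
next
  assume "m.kz (ob a) (lift f)"
  then obtain d' g' where d: "m.H (ob b) d' g'" "m.coker (ob b) (lift f) d' g'" "m.ker (ob b) g' (ob a) (lift f)"
    using m.kz_coker[OF lift_H[OF f]] by metis
  then obtain d where d': "d \<in> Obj C" "d' = ob d" using m.HD(2)[OF d(1)] by (auto simp: mOb_def)
  then obtain g where g: "g \<in> hom C b d" "g' = lift g" using d(1) H_iff hom_ob[OF f] by blast
  have "is_kernel C g f" "is_cokernel C f g" using ker_iff[OF g(1) f] coker_iff[OF f g(1)] d d' g by auto
  thus "f \<in> kc_monos C" by (auto simp: kc_monos_def kernel_cokernel_pair_def)
qed

lemma kc_epis_iff:
  assumes f: "f \<in> hom C a b"
  shows "f \<in> kc_epis C \<longleftrightarrow> m.ez (ob b) (lift f)"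
proof
  assume "f \<in> kc_epis C"
  then obtain e where e: "is_cokernel C e f" by (auto simp: kc_epis_def kernel_cokernel_pair_def)
  hence "e \<in> hom C (Dom C e) a" using f by (auto simp: is_cokernel_def hom_def)
  from coker_iff[OF this f] e show "m.ez (ob b) (lift f)" using m.coker_epi m.epi_ez by blast
next
  assume "m.ez (ob b) (lift f)"
  then obtain d' g' where d: "m.H d' (ob a) g'" "m.ker (ob a) (lift f) d' g'" "m.coker (ob a) g' (ob b) (lift f)"
    using m.ez_ker[OF lift_H[OF f]] by metis
  then obtain d where d': "d \<in> Obj C" "d' = ob d" using m.HD(1)[OF d(1)] by (auto simp: mOb_def)
  then obtain g where g: "g \<in> hom C d a" "g' = lift g" using d(1) H_iff hom_ob[OF f] by blast
  have "is_kernel C f g" "is_cokernel C g f" using ker_iff[OF f g(1)] coker_iff[OF g(1) f] d d' g by auto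
  thus "f \<in> kc_epis C" by (auto simp: kc_epis_def kernel_cokernel_pair_def)
qed

text \<open>The required square is built on the zero object \<open>z\<close>; since arrows to and
  from \<open>z\<close> are unique, its two universal properties are those of the kernel and of the
  cokernel.\<close>

lemma short_exact_iff:
  assumes k: "k \<in> hom C a b" and e: "e \<in> hom C b c"
  shows "short_exact C (kc_monos C) (kc_epis C) k e \<longleftrightarrow> m.ez (ob c) (lift e) \<and> m.ker (ob b) (lift e) (ob a) (lift k)"
proof
  assume s: "short_exact C (kc_monos C) (kc_epis C) k e"
  then obtain g h where "is_zero C (Cod C g)" "bicartesian C k g e h" "e \<in> kc_epis C" by (auto simp: short_exact_def)
  thus "m.ez (ob c) (lift e) \<and> m.ker (ob b) (lift e) (ob a) (lift k)"
    using bicartesian_zero_ker[OF category_axioms _ refl] kc_epis_iff[OF e] ker_iff[OF e k]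
    by (auto simp: bicartesian_def)
next
  assume h: "m.ez (ob c) (lift e) \<and> m.ker (ob b) (lift e) (ob a) (lift k)"
  hence K: "is_kernel C e k" and "m.coker (ob b) (lift k) (ob c) (lift e)"
    using ker_iff[OF e k] m.coker_of_ker[OF _ lift_H[OF e]] by auto
  hence Q: "is_cokernel C k e" using coker_iff[OF k e] by blast
  have O: "a \<in> Obj C" "b \<in> Obj C" "c \<in> Obj C" using hom_ob[OF k] hom_ob[OF e] by auto
  obtain g where g: "g \<in> hom C a z" using to_zero[OF O(1)] by blast
  obtain l where l: "l \<in> hom C z c" using from_zero[OF O(3)] by blast
  have ek: "e \<cdot> k = l \<cdot> g" using zero_arr_za[OF comp_closed[OF k e]] za_eq[OF g l] K by (simp add: is_kernel_def)
  have sq: "comm_square C k g e l" using k e g l ek by (simp add: comm_square_def homD)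
  have "cartesian C k g e l" unfolding cartesian_def
  proof (intro conjI sq allI impI)
    fix u v assume uv: "comm_square C u v e l"
    hence t: "u \<in> hom C (Dom C u) b" "v \<in> hom C (Dom C u) z" "e \<cdot> u = l \<cdot> v" using e l by (auto simp: comm_square_def hom_def)
    have "zero_arr C (e \<cdot> u)" using t(3) za_eq[OF t(2) l] za_zero hom_ob[OF t(1)] O by simp
    then obtain w where w: "w \<in> hom C (Dom C u) a" "k \<cdot> w = u" and wu: "\<And>w'. w' \<in> hom C (Dom C u) a \<Longrightarrow> k \<cdot> w' = u \<Longrightarrow> w' = w"
      using K t(1) e k unfolding is_kernel_def by (metis homD)
    have "g \<cdot> w = v" using to_zero[OF hom_ob(1)[OF t(1)]] comp_closed[OF w(1) g] t(2) by blast
    thus "\<exists>!w. w \<in> hom C (Dom C u) (Dom C k) \<and> k \<cdot> w = u \<and> g \<cdot> w = v" using w wu k by (metis homD(2))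
  qed
  moreover have "cocartesian C k g e l" unfolding cocartesian_def
  proof (intro conjI sq allI impI)
    fix u v assume uv: "comm_square C k g u v"
    hence t: "u \<in> hom C b (Cod C u)" "v \<in> hom C z (Cod C u)" "u \<cdot> k = v \<cdot> g" using k g by (auto simp: comm_square_def hom_def)
    have "zero_arr C (u \<cdot> k)" using t(3) za_eq[OF g t(2)] za_zero hom_ob[OF t(1)] O by simp
    then obtain w where w: "w \<in> hom C c (Cod C u)" "w \<cdot> e = u" and wu: "\<And>w'. w' \<in> hom C c (Cod C u) \<Longrightarrow> w' \<cdot> e = u \<Longrightarrow> w' = w"
      using Q t(1) e k unfolding is_cokernel_def by (metis homD)
    have "w \<cdot> l = v" using from_zero[OF hom_ob(2)[OF t(1)]] comp_closed[OF l w(1)] t(2) by blast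
    thus "\<exists>!w. w \<in> hom C (Cod C e) (Cod C u) \<and> w \<cdot> e = u \<and> w \<cdot> l = v" using w wu e by (metis homD(3))
  qed
  moreover have "g \<in> kc_epis C" using kc_epis_iff[OF g] by (simp add: m.ez_def)
  moreover have "l \<in> kc_monos C" using kc_monos_iff[OF l] by (simp add: m.kz_def)
  moreover have "k \<in> kc_monos C" "e \<in> kc_epis C" using K Q by (auto simp: kc_monos_def kc_epis_def kernel_cokernel_pair_def)
  ultimately show "short_exact C (kc_monos C) (kc_epis C) k e"
    unfolding short_exact_def bicartesian_def using g zero by (metis homD(3))
qed

text \<open>\<open>acyclic_seq\<close> asks for one family of factorizations that works at all
  places at once. By \<open>ex_factor\<close> any choice of factorizations works, so the condition
  splits into independent conditions at the single terms.\<close>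

lemma exact_seq_iff:
  assumes f: "\<And>i. i \<in> {1..r} \<Longrightarrow> f i \<in> hom C (X i) (X (i - 1))" and r: "1 \<le> r"
  shows "exact_seq C (kc_monos C) (kc_epis C) r f \<longleftrightarrow>
    m.kz (ob (X r)) (lift (f r)) \<and> m.ez (ob (X 0)) (lift (f 1)) \<and>
    (\<forall>i. 0 < i \<and> i < r \<longrightarrow> m.ex (ob (X i)) (lift (f (Suc i))) (lift (f i)))"
proof -
  have fr: "f r \<in> kc_monos C \<longleftrightarrow> m.kz (ob (X r)) (lift (f r))" using kc_monos_iff[OF f[of r]] r by simp
  have f1: "f 1 \<in> kc_epis C \<longleftrightarrow> m.ez (ob (X 0)) (lift (f 1))" using kc_epis_iff[OF f[of 1]] r by simp
  have fH: "m.H (ob (X i)) (ob (X (i - 1))) (lift (f i))" if "i \<in> {1..r}" for i using lift_H[OF f[OF that]] .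
  show ?thesis
  proof
    assume "exact_seq C (kc_monos C) (kc_epis C) r f"
    then obtain e k where ek: "\<forall>i \<in> {1..r}. e i \<in> kc_epis C \<and> k i \<in> kc_monos C \<and> Dom C (k i) = Cod C (e i) \<and> f i = k i \<cdot> e i"
      "\<forall>i. 0 < i \<and> i < r \<longrightarrow> short_exact C (kc_monos C) (kc_epis C) (k (i + 1)) (e i)" "f r \<in> kc_monos C" "f 1 \<in> kc_epis C"
      by (auto simp: exact_seq_def acyclic_seq_def)
    have t: "e i \<in> hom C (X i) (Cod C (e i))" "k i \<in> hom C (Cod C (e i)) (X (i - 1))" if i: "i \<in> {1..r}" for i
    proof -
      have "e i \<in> Arr C" "k i \<in> Arr C" using ek(1) i by (auto simp: kc_epis_def kc_monos_def kernel_cokernel_pair_def is_kernel_def)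
      hence 1: "e i \<in> hom C (Dom C (e i)) (Cod C (e i))" "k i \<in> hom C (Cod C (e i)) (Cod C (k i))" using ek(1) i by (auto simp: hom_def)
      from comp_closed[OF this] have "Dom C (e i) = X i" "Cod C (k i) = X (i - 1)" using ek(1) i f[OF i] by (auto simp: hom_def)
      thus "e i \<in> hom C (X i) (Cod C (e i))" "k i \<in> hom C (Cod C (e i)) (X (i - 1))" using 1 by auto
    qed
    have "m.ex (ob (X i)) (lift (f (Suc i))) (lift (f i))" if i: "0 < i" "i < r" for i
    proof -
      have ii: "i \<in> {1..r}" "Suc i \<in> {1..r}" using i by auto
      note ti = t[OF ii(1)] and ts = t[OF ii(2), simplified]
      have "m.ker (ob (X i)) (lift (e i)) (ob (Cod C (e (Suc i)))) (lift (k (Suc i)))"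
        using short_exact_iff[OF ts(2) ti(1)] ek(2) i by auto
      moreover have "m.kz (ob (Cod C (e i))) (lift (k i))" using kc_monos_iff[OF ti(2)] ek(1) ii by blast
      ultimately have "m.ker (ob (X i)) (mmul (lift (k i)) (lift (e i))) (ob (Cod C (e (Suc i)))) (lift (k (Suc i)))"
        using m.ker_mono_comp[OF _ lift_H[OF ti(1)]] by blast
      hence K: "m.ker (ob (X i)) (lift (f i)) (ob (Cod C (e (Suc i)))) (lift (k (Suc i)))"
        using mmul_lift[OF ti] ek(1) ii by simp
      show ?thesis
      proof (rule m.exI_ker[OF K])
        show "mmul (ob (Cod C (e (Suc i)))) (lift (e (Suc i))) = lift (e (Suc i))" using ob_lift(1)[OF ts(1)] .
        show "m.epi (ob (Cod C (e (Suc i)))) (lift (e (Suc i)))"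
          using m.ez_epi[OF lift_H[OF ts(1)]] kc_epis_iff[OF ts(1)] ek(1) ii by blast
        show "lift (f (Suc i)) = mmul (lift (k (Suc i))) (lift (e (Suc i)))" using mmul_lift[OF ts] ek(1) ii by simp
      qed
    qed
    thus "m.kz (ob (X r)) (lift (f r)) \<and> m.ez (ob (X 0)) (lift (f 1)) \<and>
      (\<forall>i. 0 < i \<and> i < r \<longrightarrow> m.ex (ob (X i)) (lift (f (Suc i))) (lift (f i)))"
      using fr f1 ek by blast
  next
    assume h: "m.kz (ob (X r)) (lift (f r)) \<and> m.ez (ob (X 0)) (lift (f 1)) \<and>
      (\<forall>i. 0 < i \<and> i < r \<longrightarrow> m.ex (ob (X i)) (lift (f (Suc i))) (lift (f i)))"
    have "\<exists>e k c. e \<in> hom C (X i) c \<and> k \<in> hom C c (X (i - 1)) \<and> m.ez (ob c) (lift e) \<and> m.kz (ob c) (lift k) \<and> f i = k \<cdot> e"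
      if i: "i \<in> {1..r}" for i
    proof -
      have "m.adm (ob (X i)) (ob (X (i - 1))) (lift (f i))"
      proof (cases "i = r")
        \<comment> \<open>The arrow \<open>f r\<close> is a monomorphism, hence admissible through
          the identity of its source; the other arrows are admissible because of exactness at their
          sources.\<close>
        case True
        thus ?thesis unfolding m.adm_def using h fH[OF i] m.HD[OF fH[OF i]] m.H_id m.ez_id by metis
      next
        case False
        hence ir: "0 < i" "i < r" using i by auto
        have "m.H (ob (X (Suc i))) (ob (X i)) (lift (f (Suc i)))" using fH[of "Suc i"] ir by simp
        from m.ex_adm2[OF this fH[OF i]] show ?thesis using h ir by blast
      qed
      then obtain c' k' e' where c': "m.H (ob (X i)) c' e'" "m.ez c' e'" "m.H c' (ob (X (i - 1))) k'" "m.kz c' k'" "lift (f i) = mmul k' e'"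
        by (auto simp: m.adm_def)
      obtain c where c: "c \<in> Obj C" "c' = ob c" using m.HD(2)[OF c'(1)] by (auto simp: mOb_def)
      have O: "X i \<in> Obj C" "X (i - 1) \<in> Obj C" using hom_ob[OF f[OF i]] by auto
      obtain e where e: "e \<in> hom C (X i) c" "e' = lift e" using c'(1) c H_iff[OF O(1) c(1)] by blast
      obtain k where k: "k \<in> hom C c (X (i - 1))" "k' = lift k" using c'(3) c H_iff[OF c(1) O(2)] by blast
      have "f i = k \<cdot> e" using lift_inj[OF f[OF i] comp_closed[OF e(1) k(1)]] c'(5) e k mmul_lift[OF e(1) k(1)] by simp
      thus ?thesis using e k c c' by blast
    qed
    then obtain e k c where ekc: "\<And>i. i \<in> {1..r} \<Longrightarrow> e i \<in> hom C (X i) (c i) \<and> k i \<in> hom C (c i) (X (i - 1)) \<and> m.ez (ob (c i)) (lift (e i)) \<and> m.kz (ob (c i)) (lift (k i)) \<and> f i = k i \<cdot> e i"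
      by metis
    have "acyclic_seq C (kc_monos C) (kc_epis C) r f" unfolding acyclic_seq_def
    proof (rule exI[of _ e], rule exI[of _ k], intro conjI ballI allI impI)
      fix i assume i: "i \<in> {1..r}"
      show "e i \<in> kc_epis C" "k i \<in> kc_monos C" "Dom C (k i) = Cod C (e i)" "f i = k i \<cdot> e i"
        using ekc[OF i] kc_epis_iff kc_monos_iff by (auto simp: homD)
    next
      fix i assume i: "0 < i \<and> i < r"
      hence ii: "i \<in> {1..r}" "Suc i \<in> {1..r}" by auto
      note ei = ekc[OF ii(1)] and es = ekc[OF ii(2), simplified]
      have Hs: "m.H (ob (X (Suc i))) (ob (X i)) (lift (f (Suc i)))" using fH[OF ii(2)] by simp
      have "m.ker (ob (X i)) (lift (f i)) (ob (c (Suc i))) (lift (k (Suc i)))"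
      proof (rule m.ex_factor[OF Hs fH[OF ii(1)]])
        show "m.ex (ob (X i)) (lift (f (Suc i))) (lift (f i))" using h i by blast
        show "m.H (ob (X (Suc i))) (ob (c (Suc i))) (lift (e (Suc i)))" "m.H (ob (c (Suc i))) (ob (X i)) (lift (k (Suc i)))"
          using es lift_H by auto
        show "lift (f (Suc i)) = mmul (lift (k (Suc i))) (lift (e (Suc i)))"
          using es mmul_lift[of "e (Suc i)" "X (Suc i)" "c (Suc i)" "k (Suc i)" "X i"] by simp
        show "m.ez (ob (c (Suc i))) (lift (e (Suc i)))" "m.kz (ob (c (Suc i))) (lift (k (Suc i)))" using es by blast+
      qed
      hence "m.ker (ob (X i)) (mmul (lift (k i)) (lift (e i))) (ob (c (Suc i))) (lift (k (Suc i)))"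
        using mmul_lift ei by metis
      hence "m.ker (ob (X i)) (lift (e i)) (ob (c (Suc i))) (lift (k (Suc i)))"
        using m.ker_mono_cancel[OF _ lift_H] ei by metis
      thus "short_exact C (kc_monos C) (kc_epis C) (k (i + 1)) (e i)" using short_exact_iff[of "k (Suc i)" "c (Suc i)" "X i" "e i" "c i"] ei es by simp
    qed
    thus "exact_seq C (kc_monos C) (kc_epis C) r f" unfolding exact_seq_def using fr f1 h by blast
  qed
qed

end

section \<open>Functor categories and pseudo-limits\<close>

lemma functorD:
  assumes "is_functor A B F"
  shows "a \<in> Obj A \<Longrightarrow> obj_map F a \<in> Obj B"
    "f \<in> Arr A \<Longrightarrow> arr_map F f \<in> hom B (obj_map F (Dom A f)) (obj_map F (Cod A f))"
    "a \<in> Obj A \<Longrightarrow> arr_map F (Id A a) = Id B (obj_map F a)"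
    "f \<in> Arr A \<Longrightarrow> g \<in> Arr A \<Longrightarrow> Dom A g = Cod A f \<Longrightarrow> arr_map F (g \<cdot>\<^bsub>A\<^esub> f) = arr_map F g \<cdot>\<^bsub>B\<^esub> arr_map F f"
    "f \<in> hom A a b \<Longrightarrow> arr_map F f \<in> hom B (obj_map F a) (obj_map F b)"
    "f \<in> hom A a b \<Longrightarrow> g \<in> hom A b c \<Longrightarrow> arr_map F (g \<cdot>\<^bsub>A\<^esub> f) = arr_map F g \<cdot>\<^bsub>B\<^esub> arr_map F f"
  using assms by (auto simp: is_functor_def hom_def)

lemma iso_arrI: "f \<in> hom C a b \<Longrightarrow> g \<in> hom C b a \<Longrightarrow> g \<cdot>\<^bsub>C\<^esub> f = Id C a \<Longrightarrow> f \<cdot>\<^bsub>C\<^esub> g = Id C b \<Longrightarrow> iso_arr C f"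
  unfolding iso_arr_def by (auto simp: hom_def)

lemma iso_arrE:
  assumes "iso_arr C f" "f \<in> hom C a b"
  obtains g where "g \<in> hom C b a" "g \<cdot>\<^bsub>C\<^esub> f = Id C a" "f \<cdot>\<^bsub>C\<^esub> g = Id C b"
  using assms unfolding iso_arr_def by (auto simp: homD)

lemma equivalence_if:
  assumes A: "category A" and D: "category D" and F: "is_functor A D F"
    and full: "\<And>a b g. a \<in> Obj A \<Longrightarrow> b \<in> Obj A \<Longrightarrow> g \<in> hom D (obj_map F a) (obj_map F b) \<Longrightarrow> \<exists>f\<in>hom A a b. arr_map F f = g"
    and faith: "\<And>a b f f'. f \<in> hom A a b \<Longrightarrow> f' \<in> hom A a b \<Longrightarrow> arr_map F f = arr_map F f' \<Longrightarrow> f = f'"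
    and ess: "\<And>y. y \<in> Obj D \<Longrightarrow> \<exists>a\<in>Obj A. \<exists>e\<in>hom D (obj_map F a) y. iso_arr D e"
  shows "is_equivalence A D F"
proof -
  interpret A: category A by fact
  interpret D: category D by fact
  have "\<exists>a e e'. a \<in> Obj A \<and> e \<in> hom D (obj_map F a) y \<and> e' \<in> hom D y (obj_map F a) \<and>
      e' \<cdot>\<^bsub>D\<^esub> e = Id D (obj_map F a) \<and> e \<cdot>\<^bsub>D\<^esub> e' = Id D y" if "y \<in> Obj D" for y
    using ess[OF that] iso_arrE by metis
  then obtain g e e' where g: "\<And>y. y \<in> Obj D \<Longrightarrow> g y \<in> Obj A" and e: "\<And>y. y \<in> Obj D \<Longrightarrow> e y \<in> hom D (obj_map F (g y)) y"
    and e': "\<And>y. y \<in> Obj D \<Longrightarrow> e' y \<in> hom D y (obj_map F (g y))"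
    and ee: "\<And>y. y \<in> Obj D \<Longrightarrow> e' y \<cdot>\<^bsub>D\<^esub> e y = Id D (obj_map F (g y))" "\<And>y. y \<in> Obj D \<Longrightarrow> e y \<cdot>\<^bsub>D\<^esub> e' y = Id D y"
    by metis
  \<comment> \<open>\<open>h\<close> conjugated with the chosen isomorphisms; its preimage under
    \<open>F\<close> will be the value of the quasi-inverse at \<open>h\<close>.\<close>
  define T where "T h = e' (Cod D h) \<cdot>\<^bsub>D\<^esub> (h \<cdot>\<^bsub>D\<^esub> e (Dom D h))" for h
  have TH: "T h \<in> hom D (obj_map F (g a)) (obj_map F (g b))" if "h \<in> hom D a b" for h a b
    unfolding T_def using D.comp_closed[OF D.comp_closed[OF e that] e'] D.hom_ob[OF that] that by (simp add: homD)
  define G where "G h = (SOME f. f \<in> hom A (g (Dom D h)) (g (Cod D h)) \<and> arr_map F f = T h)" for h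
  have G: "G h \<in> hom A (g a) (g b) \<and> arr_map F (G h) = T h" if h: "h \<in> hom D a b" for h a b
  proof -
    have "\<exists>f. f \<in> hom A (g a) (g b) \<and> arr_map F f = T h" using full[OF g g TH[OF h]] D.hom_ob[OF h] by blast
    from someI_ex[OF this] show ?thesis unfolding G_def homD(2)[OF h] homD(3)[OF h] .
  qed
  have Tid: "T (Id D a) = Id D (obj_map F (g a))" if a: "a \<in> Obj D" for a
    unfolding T_def using D.id_closed[OF a] ee(1)[OF a] D.id_left[OF e[OF a]] by (simp add: homD)
  have Tcomp: "T (k \<cdot>\<^bsub>D\<^esub> h) = T k \<cdot>\<^bsub>D\<^esub> T h" if h: "h \<in> hom D a b" and k: "k \<in> hom D b c" for h k a b c
  proof -
    have O: "a \<in> Obj D" "b \<in> Obj D" "c \<in> Obj D" using D.hom_ob h k by auto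
    note he = D.comp_closed[OF e[OF O(1)] h] and ke = D.comp_closed[OF e[OF O(2)] k]
    have "T k \<cdot>\<^bsub>D\<^esub> T h = (e' c \<cdot>\<^bsub>D\<^esub> (k \<cdot>\<^bsub>D\<^esub> e b)) \<cdot>\<^bsub>D\<^esub> (e' b \<cdot>\<^bsub>D\<^esub> (h \<cdot>\<^bsub>D\<^esub> e a))"
      unfolding T_def using h k by (simp add: homD)
    also have "\<dots> = e' c \<cdot>\<^bsub>D\<^esub> ((k \<cdot>\<^bsub>D\<^esub> e b) \<cdot>\<^bsub>D\<^esub> (e' b \<cdot>\<^bsub>D\<^esub> (h \<cdot>\<^bsub>D\<^esub> e a)))"
      by (rule D.assoc[OF D.comp_closed[OF he e'[OF O(2)]] ke e'[OF O(3)]])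
    also have "(k \<cdot>\<^bsub>D\<^esub> e b) \<cdot>\<^bsub>D\<^esub> (e' b \<cdot>\<^bsub>D\<^esub> (h \<cdot>\<^bsub>D\<^esub> e a)) = k \<cdot>\<^bsub>D\<^esub> (e b \<cdot>\<^bsub>D\<^esub> (e' b \<cdot>\<^bsub>D\<^esub> (h \<cdot>\<^bsub>D\<^esub> e a)))"
      by (rule D.assoc[OF D.comp_closed[OF he e'[OF O(2)]] e[OF O(2)] k])
    also have "e b \<cdot>\<^bsub>D\<^esub> (e' b \<cdot>\<^bsub>D\<^esub> (h \<cdot>\<^bsub>D\<^esub> e a)) = h \<cdot>\<^bsub>D\<^esub> e a"
      using D.assoc[OF he e'[OF O(2)] e[OF O(2)]] ee(2)[OF O(2)] D.id_left[OF he] by simp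
    also have "k \<cdot>\<^bsub>D\<^esub> (h \<cdot>\<^bsub>D\<^esub> e a) = (k \<cdot>\<^bsub>D\<^esub> h) \<cdot>\<^bsub>D\<^esub> e a" using D.assoc[OF e[OF O(1)] h k] by simp
    also have "e' c \<cdot>\<^bsub>D\<^esub> \<dots> = T (k \<cdot>\<^bsub>D\<^esub> h)" unfolding T_def using D.comp_closed[OF h k] by (simp add: homD)
    finally show ?thesis by simp
  qed
  define GG where "GG = \<lparr>obj_map = g, arr_map = G\<rparr>"
  have GF: "is_functor D A GG" unfolding is_functor_def GG_def
  proof (intro conjI ballI impI; simp)
    fix a assume a: "a \<in> Obj D"
    show "g a \<in> Obj A" using g a .
    show "G (Id D a) = Id A (g a)"
      using faith[of "G (Id D a)" "g a" "g a" "Id A (g a)"] G[OF D.id_closed[OF a]] A.id_closed[OF g[OF a]] Tid[OF a] functorD(3)[OF F g[OF a]] by simp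
  next
    fix f assume f: "f \<in> Arr D"
    show "G f \<in> hom A (g (Dom D f)) (g (Cod D f))" using G[OF homI[OF f]] by blast
    fix h assume h: "h \<in> Arr D" "Dom D h = Cod D f"
    have ff: "f \<in> hom D (Dom D f) (Cod D f)" and hh: "h \<in> hom D (Cod D f) (Cod D h)" using f h by (auto simp: hom_def)
    note Gf = G[OF ff] and Gh = G[OF hh] and Ghf = G[OF D.comp_closed[OF ff hh]]
    show "G (h \<cdot>\<^bsub>D\<^esub> f) = G h \<cdot>\<^bsub>A\<^esub> G f"
      using faith[OF Ghf[THEN conjunct1] A.comp_closed[OF Gf[THEN conjunct1] Gh[THEN conjunct1]]]
        functorD(6)[OF F Gf[THEN conjunct1] Gh[THEN conjunct1]] Gf Gh Ghf Tcomp[OF ff hh] by simp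
  qed
  have n2: "naturally_isomorphic D D (comp_ftr F GG) id_ftr"
    unfolding naturally_isomorphic_def
  proof (intro exI[of _ e] conjI ballI)
    show "natural D D (comp_ftr F GG) id_ftr e" unfolding natural_def
    proof (intro conjI ballI)
      fix a assume "a \<in> Obj D" thus "e a \<in> hom D (obj_map (comp_ftr F GG) a) (obj_map id_ftr a)"
        using e by (simp add: comp_ftr_def GG_def id_ftr_def)
    next
      fix f assume f: "f \<in> Arr D"
      let ?a = "Dom D f" and ?b = "Cod D f"
      note ff = homI[OF f]
      have O: "?a \<in> Obj D" "?b \<in> Obj D" using D.hom_ob[OF ff] by auto
      note fe = D.comp_closed[OF e[OF O(1)] ff]
      have "e ?b \<cdot>\<^bsub>D\<^esub> T f = f \<cdot>\<^bsub>D\<^esub> e ?a"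
        unfolding T_def using D.assoc[OF fe e'[OF O(2)] e[OF O(2)]] ee(2)[OF O(2)] D.id_left[OF fe] by simp
      thus "e ?b \<cdot>\<^bsub>D\<^esub> arr_map (comp_ftr F GG) f = arr_map id_ftr f \<cdot>\<^bsub>D\<^esub> e ?a"
        using G[OF ff] by (simp add: comp_ftr_def GG_def id_ftr_def)
    qed
    fix a assume "a \<in> Obj D" thus "iso_arr D (e a)" using iso_arrI[OF e e' ee] by blast
  qed
  have "\<exists>h. h \<in> hom A (g (obj_map F a)) a \<and> arr_map F h = e (obj_map F a)" if a: "a \<in> Obj A" for a
    using full[OF g a e] functorD(1)[OF F a] by blast
  then obtain \<eta> where \<eta>: "\<And>a. a \<in> Obj A \<Longrightarrow> \<eta> a \<in> hom A (g (obj_map F a)) a" "\<And>a. a \<in> Obj A \<Longrightarrow> arr_map F (\<eta> a) = e (obj_map F a)" by metis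
  have "\<exists>h. h \<in> hom A a (g (obj_map F a)) \<and> arr_map F h = e' (obj_map F a)" if a: "a \<in> Obj A" for a
    using full[OF a g e'] functorD(1)[OF F a] by blast
  then obtain \<eta>' where \<eta>': "\<And>a. a \<in> Obj A \<Longrightarrow> \<eta>' a \<in> hom A a (g (obj_map F a))" "\<And>a. a \<in> Obj A \<Longrightarrow> arr_map F (\<eta>' a) = e' (obj_map F a)" by metis
  have n1: "naturally_isomorphic A A (comp_ftr GG F) id_ftr"
    unfolding naturally_isomorphic_def
  proof (intro exI[of _ \<eta>] conjI ballI)
    show "natural A A (comp_ftr GG F) id_ftr \<eta>" unfolding natural_def
    proof (intro conjI ballI)
      fix a assume "a \<in> Obj A" thus "\<eta> a \<in> hom A (obj_map (comp_ftr GG F) a) (obj_map id_ftr a)"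
        using \<eta> by (simp add: comp_ftr_def GG_def id_ftr_def)
    next
      fix f assume f: "f \<in> Arr A"
      let ?a = "Dom A f" and ?b = "Cod A f"
      note ff = homI[OF f]
      have O: "?a \<in> Obj A" "?b \<in> Obj A" using A.hom_ob[OF ff] by auto
      note Ff = functorD(5)[OF F ff]
      have O': "obj_map F ?a \<in> Obj D" "obj_map F ?b \<in> Obj D" using functorD(1)[OF F] O by auto
      note fe = D.comp_closed[OF e[OF O'(1)] Ff]
      note GFf = G[OF Ff]
      have "e (obj_map F ?b) \<cdot>\<^bsub>D\<^esub> T (arr_map F f) = arr_map F f \<cdot>\<^bsub>D\<^esub> e (obj_map F ?a)"
        unfolding T_def using D.assoc[OF fe e'[OF O'(2)] e[OF O'(2)]] ee(2)[OF O'(2)] D.id_left[OF fe] Ff by (simp add: homD)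
      hence "arr_map F (\<eta> ?b \<cdot>\<^bsub>A\<^esub> G (arr_map F f)) = arr_map F (f \<cdot>\<^bsub>A\<^esub> \<eta> ?a)"
        using functorD(6)[OF F GFf[THEN conjunct1] \<eta>(1)[OF O(2)]] functorD(6)[OF F \<eta>(1)[OF O(1)] ff] GFf \<eta>(2) O by simp
      from faith[OF A.comp_closed[OF GFf[THEN conjunct1] \<eta>(1)[OF O(2)]] A.comp_closed[OF \<eta>(1)[OF O(1)] ff] this]
      show "\<eta> ?b \<cdot>\<^bsub>A\<^esub> arr_map (comp_ftr GG F) f = arr_map id_ftr f \<cdot>\<^bsub>A\<^esub> \<eta> ?a"
        by (simp add: comp_ftr_def GG_def id_ftr_def)
    qed
    fix a assume a: "a \<in> Obj A"
    have Fa: "obj_map F a \<in> Obj D" using functorD(1)[OF F a] .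
    show "iso_arr A (\<eta> a)"
    proof (rule iso_arrI[OF \<eta>(1)[OF a] \<eta>'(1)[OF a]])
      show "\<eta>' a \<cdot>\<^bsub>A\<^esub> \<eta> a = Id A (g (obj_map F a))"
        by (rule faith[OF A.comp_closed[OF \<eta>(1)[OF a] \<eta>'(1)[OF a]] A.id_closed[OF g[OF Fa]]])
          (use functorD(6)[OF F \<eta>(1)[OF a] \<eta>'(1)[OF a]] functorD(3)[OF F g[OF Fa]] \<eta>(2)[OF a] \<eta>'(2)[OF a] ee(1)[OF Fa] in simp)
      show "\<eta> a \<cdot>\<^bsub>A\<^esub> \<eta>' a = Id A a"
        by (rule faith[OF A.comp_closed[OF \<eta>'(1)[OF a] \<eta>(1)[OF a]] A.id_closed[OF a]])
          (use functorD(6)[OF F \<eta>'(1)[OF a] \<eta>(1)[OF a]] functorD(3)[OF F a] \<eta>(2)[OF a] \<eta>'(2)[OF a] ee(2)[OF Fa] in simp)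
    qed
  qed
  show ?thesis unfolding is_equivalence_def using F GF n1 n2 by blast
qed

lemma functor_cat_hom:
  "\<sigma> \<in> hom (functor_cat B D) F G \<longleftrightarrow> nt_src \<sigma> = F \<and> nt_tgt \<sigma> = G \<and> is_functor B D F \<and> extensional_ftr B F \<and>
    is_functor B D G \<and> extensional_ftr B G \<and> natural B D F G (nt_comp \<sigma>) \<and> nt_comp \<sigma> \<in> extensional (Obj B)"
  by (auto simp: hom_def functor_cat_def)

lemma nat_trans_eqI:
  "nt_src \<sigma> = nt_src \<tau> \<Longrightarrow> nt_tgt \<sigma> = nt_tgt \<tau> \<Longrightarrow> nt_comp \<sigma> = nt_comp \<tau> \<Longrightarrow> \<sigma> = (\<tau> :: ('a,'b,'c,'d) nat_trans)"
  by (cases \<sigma>; cases \<tau>) simp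

lemma ftr_eqI: "obj_map F = obj_map G \<Longrightarrow> arr_map F = arr_map G \<Longrightarrow> F = (G :: ('a,'b,'c,'d) ftr)"
  by (cases F; cases G) simp

lemma functor_cat_simps [simp]:
  "Dom (functor_cat B D) = nt_src" "Cod (functor_cat B D) = nt_tgt"
  "Obj (functor_cat B D) = {F. is_functor B D F \<and> extensional_ftr B F}"
  "Id (functor_cat B D) F = \<lparr>nt_src = F, nt_tgt = F, nt_comp = (\<lambda>a \<in> Obj B. Id D (obj_map F a))\<rparr>"
  "\<tau> \<cdot>\<^bsub>functor_cat B D\<^esub> \<sigma> = \<lparr>nt_src = nt_src \<sigma>, nt_tgt = nt_tgt \<tau>, nt_comp = (\<lambda>a \<in> Obj B. nt_comp \<tau> a \<cdot>\<^bsub>D\<^esub> nt_comp \<sigma> a)\<rparr>"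
  by (simp_all add: functor_cat_def)

lemma natD:
  assumes "natural B D F G \<eta>"
  shows "a \<in> Obj B \<Longrightarrow> \<eta> a \<in> hom D (obj_map F a) (obj_map G a)"
    "f \<in> Arr B \<Longrightarrow> \<eta> (Cod B f) \<cdot>\<^bsub>D\<^esub> arr_map F f = arr_map G f \<cdot>\<^bsub>D\<^esub> \<eta> (Dom B f)"
  using assms by (auto simp: natural_def)

lemma category_functor_cat:
  assumes B: "category B" and D: "category D"
  shows "category (functor_cat B D)"
proof -
  interpret B: category B by fact
  interpret D: category D by fact
  show ?thesis
  proof
    fix f assume "f \<in> Arr (functor_cat B D)"
    thus "Dom (functor_cat B D) f \<in> Obj (functor_cat B D)" "Cod (functor_cat B D) f \<in> Obj (functor_cat B D)"
      by (auto simp: functor_cat_def)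
  next
    fix F assume F: "F \<in> Obj (functor_cat B D)"
    hence FF: "is_functor B D F" by simp
    have "natural B D F F (\<lambda>a \<in> Obj B. Id D (obj_map F a))" unfolding natural_def
      using functorD(1,2)[OF FF] B.dom_closed B.cod_closed D.id_closed D.id_left D.id_right by fastforce
    thus "Id (functor_cat B D) F \<in> hom (functor_cat B D) F F" using F unfolding functor_cat_hom by auto
  next
    fix \<sigma> \<tau> F G K assume s: "\<sigma> \<in> hom (functor_cat B D) F G" and t: "\<tau> \<in> hom (functor_cat B D) G K"
    have ns: "natural B D F G (nt_comp \<sigma>)" and nt: "natural B D G K (nt_comp \<tau>)"
      and fF: "is_functor B D F" and fG: "is_functor B D G" and fK: "is_functor B D K" using s t by (auto simp: functor_cat_hom)
    have "natural B D F K (\<lambda>a \<in> Obj B. nt_comp \<tau> a \<cdot>\<^bsub>D\<^esub> nt_comp \<sigma> a)" unfolding natural_def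
    proof (intro conjI ballI)
      fix a assume a: "a \<in> Obj B"
      show "(\<lambda>a \<in> Obj B. nt_comp \<tau> a \<cdot>\<^bsub>D\<^esub> nt_comp \<sigma> a) a \<in> hom D (obj_map F a) (obj_map K a)"
        using D.comp_closed[OF natD(1)[OF ns a] natD(1)[OF nt a]] a by simp
    next
      fix f assume f: "f \<in> Arr B"
      let ?a = "Dom B f" and ?b = "Cod B f"
      have O: "?a \<in> Obj B" "?b \<in> Obj B" using f B.dom_closed B.cod_closed by auto
      note h = natD(1)[OF ns O(1)] natD(1)[OF ns O(2)] natD(1)[OF nt O(1)] natD(1)[OF nt O(2)]
        and Ff = functorD(2)[OF fF f] and Gf = functorD(2)[OF fG f] and Kf = functorD(2)[OF fK f]
      have "(nt_comp \<tau> ?b \<cdot>\<^bsub>D\<^esub> nt_comp \<sigma> ?b) \<cdot>\<^bsub>D\<^esub> arr_map F f = nt_comp \<tau> ?b \<cdot>\<^bsub>D\<^esub> (arr_map G f \<cdot>\<^bsub>D\<^esub> nt_comp \<sigma> ?a)"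
        using D.assoc[OF Ff h(2,4)] natD(2)[OF ns f] by simp
      also have "\<dots> = arr_map K f \<cdot>\<^bsub>D\<^esub> (nt_comp \<tau> ?a \<cdot>\<^bsub>D\<^esub> nt_comp \<sigma> ?a)"
        using D.assoc[OF h(1) Gf h(4)] D.assoc[OF h(1,3) Kf] natD(2)[OF nt f] by simp
      finally show "(\<lambda>a \<in> Obj B. nt_comp \<tau> a \<cdot>\<^bsub>D\<^esub> nt_comp \<sigma> a) ?b \<cdot>\<^bsub>D\<^esub> arr_map F f =
        arr_map K f \<cdot>\<^bsub>D\<^esub> (\<lambda>a \<in> Obj B. nt_comp \<tau> a \<cdot>\<^bsub>D\<^esub> nt_comp \<sigma> a) ?a" using O by simp
    qed
    thus "\<tau> \<cdot>\<^bsub>functor_cat B D\<^esub> \<sigma> \<in> hom (functor_cat B D) F K" using s t unfolding functor_cat_hom by auto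
  next
    fix \<sigma> F G assume s: "\<sigma> \<in> hom (functor_cat B D) F G"
    hence ns: "natural B D F G (nt_comp \<sigma>)" and ex: "nt_comp \<sigma> \<in> extensional (Obj B)" by (auto simp: functor_cat_hom)
    show "Id (functor_cat B D) G \<cdot>\<^bsub>functor_cat B D\<^esub> \<sigma> = \<sigma>" "\<sigma> \<cdot>\<^bsub>functor_cat B D\<^esub> Id (functor_cat B D) F = \<sigma>"
      using s D.id_left[OF natD(1)[OF ns]] D.id_right[OF natD(1)[OF ns]]
      by (auto intro!: nat_trans_eqI extensionalityI[OF _ ex] simp: functor_cat_hom)
  next
    fix \<sigma> \<tau> \<rho> F G K L assume s: "\<sigma> \<in> hom (functor_cat B D) F G" and t: "\<tau> \<in> hom (functor_cat B D) G K" and r: "\<rho> \<in> hom (functor_cat B D) K L"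
    have ns: "natural B D F G (nt_comp \<sigma>)" and nt: "natural B D G K (nt_comp \<tau>)" and nr: "natural B D K L (nt_comp \<rho>)"
      using s t r by (auto simp: functor_cat_hom)
    show "(\<rho> \<cdot>\<^bsub>functor_cat B D\<^esub> \<tau>) \<cdot>\<^bsub>functor_cat B D\<^esub> \<sigma> = \<rho> \<cdot>\<^bsub>functor_cat B D\<^esub> (\<tau> \<cdot>\<^bsub>functor_cat B D\<^esub> \<sigma>)"
      using D.assoc[OF natD(1)[OF ns] natD(1)[OF nt] natD(1)[OF nr]] by (auto intro!: nat_trans_eqI restrict_ext)
  qed
qed

lemma full_hom: "f \<in> hom (full_subcategory C P) a b \<longleftrightarrow> f \<in> hom C a b \<and> P a \<and> P b"
  by (auto simp: hom_def full_subcategory_def)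

lemma full_simps [simp]:
  "Dom (full_subcategory C P) = Dom C" "Cod (full_subcategory C P) = Cod C" "Id (full_subcategory C P) = Id C"
  "Comp (full_subcategory C P) = Comp C" "Obj (full_subcategory C P) = {a \<in> Obj C. P a}"
  "Arr (full_subcategory C P) = {f \<in> Arr C. P (Dom C f) \<and> P (Cod C f)}"
  by (simp_all add: full_subcategory_def)

lemma category_full: "category C \<Longrightarrow> category (full_subcategory C P)"
proof -
  assume "category C"
  then interpret category C .
  show ?thesis
    by unfold_locales (auto simp: full_hom dom_closed cod_closed id_closed comp_closed id_left id_right assoc
      intro: comp_closed)
qed

lemma functor_full:
  assumes "is_functor C D F" "\<And>a. a \<in> Obj C \<Longrightarrow> P a \<Longrightarrow> Q (obj_map F a)" "category C"
  shows "is_functor (full_subcategory C P) (full_subcategory D Q) F"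
  using functorD[OF assms(1)] assms(2) category.dom_closed[OF assms(3)] category.cod_closed[OF assms(3)]
  unfolding is_functor_def full_hom by (auto simp: full_subcategory_def hom_def)

lemma pullback_functor:
  assumes B: "category B" and U: "is_functor B C U" and F: "is_functor C D F"
  shows "is_functor B D (pullback_ftr B U F)" "extensional_ftr B (pullback_ftr B U F)"
proof -
  interpret B: category B by fact
  show "extensional_ftr B (pullback_ftr B U F)" by (simp add: extensional_ftr_def pullback_ftr_def)
  show "is_functor B D (pullback_ftr B U F)" unfolding is_functor_def
  proof (intro conjI ballI impI)
    fix a assume a: "a \<in> Obj B"
    show "obj_map (pullback_ftr B U F) a \<in> Obj D"
      using functorD(1)[OF F functorD(1)[OF U a]] a by (simp add: pullback_ftr_def)
    show "arr_map (pullback_ftr B U F) (Id B a) = Id D (obj_map (pullback_ftr B U F) a)"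
      using homD(1)[OF B.id_closed[OF a]] functorD(3)[OF U a] functorD(3)[OF F functorD(1)[OF U a]] a by (simp add: pullback_ftr_def)
  next
    fix f assume f: "f \<in> Arr B"
    note Uf = functorD(2)[OF U f]
    show "arr_map (pullback_ftr B U F) f \<in> hom D (obj_map (pullback_ftr B U F) (Dom B f)) (obj_map (pullback_ftr B U F) (Cod B f))"
      using functorD(5)[OF F Uf] B.dom_closed[OF f] B.cod_closed[OF f] f by (simp add: pullback_ftr_def)
    fix g assume g: "g \<in> Arr B" "Dom B g = Cod B f"
    have "g \<cdot>\<^bsub>B\<^esub> f \<in> Arr B" using B.comp_closed[of f "Dom B f" "Cod B f" g "Cod B g"] f g by (auto simp: hom_def)
    moreover have "arr_map U g \<in> hom C (obj_map U (Cod B f)) (obj_map U (Cod B g))" using functorD(2)[OF U g(1)] g(2) by simp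
    ultimately show "arr_map (pullback_ftr B U F) (g \<cdot>\<^bsub>B\<^esub> f) = arr_map (pullback_ftr B U F) g \<cdot>\<^bsub>D\<^esub> arr_map (pullback_ftr B U F) f"
      using functorD(4)[OF U f g] functorD(6)[OF F Uf] f g by (simp add: pullback_ftr_def)
  qed
qed

lemma precomp_functor:
  assumes B: "category B" and C: "category C" and D: "category D" and U: "is_functor B C U"
  shows "is_functor (functor_cat C D) (functor_cat B D) (precomp_ftr B U)"
proof -
  interpret B: category B by fact
  interpret C: category C by fact
  interpret D: category D by fact
  have nat: "natural B D (pullback_ftr B U F) (pullback_ftr B U G) (restrict (\<eta> \<circ> obj_map U) (Obj B))"
    if n: "natural C D F G \<eta>" for F G \<eta>
    unfolding natural_def
  proof (intro conjI ballI)
    fix a assume a: "a \<in> Obj B"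
    thus "restrict (\<eta> \<circ> obj_map U) (Obj B) a \<in> hom D (obj_map (pullback_ftr B U F) a) (obj_map (pullback_ftr B U G) a)"
      using natD(1)[OF n functorD(1)[OF U a]] by (simp add: pullback_ftr_def)
  next
    fix f assume f: "f \<in> Arr B"
    note Uf = functorD(2)[OF U f]
    show "restrict (\<eta> \<circ> obj_map U) (Obj B) (Cod B f) \<cdot>\<^bsub>D\<^esub> arr_map (pullback_ftr B U F) f =
      arr_map (pullback_ftr B U G) f \<cdot>\<^bsub>D\<^esub> restrict (\<eta> \<circ> obj_map U) (Obj B) (Dom B f)"
      using natD(2)[OF n homD(1)[OF Uf]] f B.dom_closed[OF f] B.cod_closed[OF f] homD(2,3)[OF Uf] by (simp add: pullback_ftr_def)
  qed
  show ?thesis unfolding is_functor_def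
  proof (intro conjI ballI impI)
    fix F assume F: "F \<in> Obj (functor_cat C D)"
    hence FF: "is_functor C D F" by simp
    show "obj_map (precomp_ftr B U) F \<in> Obj (functor_cat B D)"
      using pullback_functor[OF B U FF] by (simp add: precomp_ftr_def)
    show "arr_map (precomp_ftr B U) (Id (functor_cat C D) F) = Id (functor_cat B D) (obj_map (precomp_ftr B U) F)"
      using functorD(1)[OF U] by (auto simp: precomp_ftr_def pullback_ftr_def intro!: restrict_ext)
  next
    fix \<sigma> assume s: "\<sigma> \<in> Arr (functor_cat C D)"
    hence s': "\<sigma> \<in> hom (functor_cat C D) (nt_src \<sigma>) (nt_tgt \<sigma>)" by (simp add: hom_def)
    thus "arr_map (precomp_ftr B U) \<sigma> \<in> hom (functor_cat B D) (obj_map (precomp_ftr B U) (Dom (functor_cat C D) \<sigma>)) (obj_map (precomp_ftr B U) (Cod (functor_cat C D) \<sigma>))"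
      using nat pullback_functor[OF B U] by (auto simp: precomp_ftr_def functor_cat_hom)
    fix \<tau> assume "\<tau> \<in> Arr (functor_cat C D)"
    show "arr_map (precomp_ftr B U) (\<tau> \<cdot>\<^bsub>functor_cat C D\<^esub> \<sigma>) = arr_map (precomp_ftr B U) \<tau> \<cdot>\<^bsub>functor_cat B D\<^esub> arr_map (precomp_ftr B U) \<sigma>"
      using functorD(1)[OF U] by (auto simp: precomp_ftr_def intro!: restrict_ext)
  qed
qed

section \<open>The simplicial structure of the Waldhausen construction\<close>

lemma poset_category:
  assumes "\<And>x. x \<in> S \<Longrightarrow> le x x" "\<And>x y z. x \<in> S \<Longrightarrow> y \<in> S \<Longrightarrow> z \<in> S \<Longrightarrow> le x y \<Longrightarrow> le y z \<Longrightarrow> le x z"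
  shows "category (poset_cat S le)"
  by unfold_locales (auto simp: poset_cat_def hom_def intro: assms)

lemma simplices_Xs: "simplices k n = Xs (Suc k) n"
  by (auto simp: simplices_def Xs_def sl_def)

lemma category_simplex: "category (simplex_cat k n)"
  unfolding simplex_cat_def by (rule poset_category) (auto intro: list_le_trans)

lemma simplex_simps [simp]:
  "Obj (simplex_cat k n) = simplices k n" "Dom (simplex_cat k n) = fst" "Cod (simplex_cat k n) = snd"
  "(a, b) \<in> Arr (simplex_cat k n) \<longleftrightarrow> a \<in> simplices k n \<and> b \<in> simplices k n \<and> a \<preceq> b"
  "Id (simplex_cat k n) a = (a, a)" "g \<cdot>\<^bsub>simplex_cat k n\<^esub> f = (fst f, snd g)"
  by (auto simp: simplex_cat_def poset_cat_def)

lemma comp_mono_simplices: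
  assumes t: "\<theta> \<in> simplices m n" and b: "\<beta> \<in> simplices k m"
  shows "comp_mono \<theta> \<beta> \<in> simplices k n"
proof -
  have l: "length \<theta> = Suc m" "sorted \<theta>" "set \<theta> \<subseteq> {0..n}" using t by (auto simp: simplices_def)
  have bb: "length \<beta> = Suc k" "sorted \<beta>" "\<And>x. x \<in> set \<beta> \<Longrightarrow> x < length \<theta>" using b l by (auto simp: simplices_def)
  have "sorted (map (\<lambda>i. \<theta> ! i) \<beta>)"
    using bb(2,3) by (induction \<beta>) (auto simp: sorted_nth_mono[OF l(2)])
  moreover have "set (map (\<lambda>i. \<theta> ! i) \<beta>) \<subseteq> {0..n}" using bb(3) l(3) nth_mem by fastforce
  ultimately show ?thesis using bb by (simp add: simplices_def comp_mono_def)
qed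

lemma comp_mono_le:
  assumes t: "\<theta> \<in> simplices m n" and b: "\<beta> \<in> simplices k m" "\<alpha> \<in> simplices k m" "\<alpha> \<preceq> \<beta>"
  shows "comp_mono \<theta> \<alpha> \<preceq> comp_mono \<theta> \<beta>"
proof -
  have l: "length \<theta> = Suc m" "sorted \<theta>" using t by (auto simp: simplices_def)
  have "set \<beta> \<subseteq> {0..m}" using b by (simp add: simplices_def)
  show ?thesis using b(3) \<open>set \<beta> \<subseteq> {0..m}\<close> unfolding comp_mono_def
    by (induction rule: list_all2_induct) (auto intro!: sorted_nth_mono[OF l(2)] simp: l)
qed

lemma postcomp_functor: "\<theta> \<in> simplices m n \<Longrightarrow> is_functor (simplex_cat k m) (simplex_cat k n) (postcomp_ftr \<theta>)"
  unfolding is_functor_def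
  by (auto simp: postcomp_ftr_def comp_mono_simplices comp_mono_le hom_def simplex_cat_def poset_cat_def)

lemma exact_seq_cong:
  assumes "\<And>i. i \<in> {1..r} \<Longrightarrow> f i = g i" "1 \<le> r"
  shows "exact_seq C M E r f = exact_seq C M E r g"
  unfolding exact_seq_def acyclic_seq_def using assms by simp

lemma face_append:
  "\<gamma> = p @ a # q \<Longrightarrow> length p = i \<Longrightarrow> face i \<gamma> = p @ q"
  by (simp add: face_def)

lemma simplex_split:
  assumes "\<gamma> \<in> simplices (Suc k) n" "i \<in> {1..Suc k}"
  obtains p a b q where "\<gamma> = p @ a # b # q" "length p = i - 1" "length q = Suc k - i" "face i \<gamma> = p @ a # q" "face (i - 1) \<gamma> = p @ b # q"
proof -
  have l: "length \<gamma> = Suc (Suc k)" using assms by (simp add: simplices_def)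
  define p a b q where "p = take (i - 1) \<gamma>" and "a = \<gamma> ! (i - 1)" and "b = \<gamma> ! i" and "q = drop (Suc i) \<gamma>"
  have i: "Suc (i - 1) = i" "i - 1 < length \<gamma>" using l assms by auto
  have "drop (i - 1) \<gamma> = a # drop i \<gamma>" using Cons_nth_drop_Suc[OF i(2)] unfolding i(1) a_def by simp
  moreover have "drop i \<gamma> = b # q" using Cons_nth_drop_Suc[of i \<gamma>] l assms by (simp add: b_def q_def)
  ultimately have g: "\<gamma> = p @ a # b # q" unfolding p_def by (metis append_take_drop_id)
  have lp: "length p = i - 1" using i(2) by (simp add: p_def)
  have "face (i - 1) \<gamma> = p @ b # q" using face_append[OF g lp] .
  moreover have "face i \<gamma> = p @ a # q" using face_append[of \<gamma> "p @ [a]" b q i] g lp assms by simp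
  moreover have "length q = Suc k - i" using l by (simp add: q_def)
  ultimately show ?thesis using that g lp by blast
qed

lemma face_arr:
  assumes "\<gamma> \<in> simplices (Suc k) n" "i \<in> {1..Suc k}"
  shows "face i \<gamma> \<in> simplices k n" "face (i - 1) \<gamma> \<in> simplices k n" "face i \<gamma> \<preceq> face (i - 1) \<gamma>"
proof -
  obtain p a b q where g: "\<gamma> = p @ a # b # q" "length p = i - 1" "face i \<gamma> = p @ a # q" "face (i - 1) \<gamma> = p @ b # q"
    using simplex_split[OF assms] by metis
  show "face i \<gamma> \<in> simplices k n" "face (i - 1) \<gamma> \<in> simplices k n" "face i \<gamma> \<preceq> face (i - 1) \<gamma>"
    using assms unfolding g(3,4) by (auto simp: g(1) simplices_def sorted_append)
qed

lemma face_comp_mono: "face i (comp_mono \<theta> \<gamma>) = comp_mono \<theta> (face i \<gamma>)"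
  by (simp add: face_def comp_mono_def take_map drop_map)

lemma degenerate_comp_mono: "degenerate \<beta> \<Longrightarrow> degenerate (comp_mono \<theta> \<beta>)"
  unfolding degenerate_def comp_mono_def by (metis Suc_lessD length_map nth_map)

lemma pullback_postcomp:
  assumes "\<theta> \<in> simplices m n"
  shows "\<beta> \<in> simplices k m \<Longrightarrow> obj_map (pullback_ftr (simplex_cat k m) (postcomp_ftr \<theta>) F) \<beta> = obj_map F (comp_mono \<theta> \<beta>)"
    "\<alpha> \<in> simplices k m \<Longrightarrow> \<beta> \<in> simplices k m \<Longrightarrow> \<alpha> \<preceq> \<beta> \<Longrightarrow>
      arr_map (pullback_ftr (simplex_cat k m) (postcomp_ftr \<theta>) F) (\<alpha>, \<beta>) = arr_map F (comp_mono \<theta> \<alpha>, comp_mono \<theta> \<beta>)"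
  by (auto simp: pullback_ftr_def postcomp_ftr_def)

lemma waldhausen_pullback:
  assumes t: "\<theta> \<in> simplices m n" and F: "waldhausen_diagram C M E k n F"
  shows "waldhausen_diagram C M E k m (pullback_ftr (simplex_cat k m) (postcomp_ftr \<theta>) F)"
  unfolding waldhausen_diagram_def
proof (intro conjI ballI impI)
  fix \<beta> assume "\<beta> \<in> simplices k m" "degenerate \<beta>"
  thus "is_zero C (obj_map (pullback_ftr (simplex_cat k m) (postcomp_ftr \<theta>) F) \<beta>)"
    using F comp_mono_simplices[OF t, of \<beta> k] degenerate_comp_mono[of \<beta>]
    unfolding waldhausen_diagram_def by (simp add: pullback_postcomp(1)[OF t, of \<beta>])
next
  fix \<gamma> assume g: "\<gamma> \<in> simplices (k + 1) m"
  have "exact_seq C M E (k + 1) (\<lambda>i. arr_map F (face i (comp_mono \<theta> \<gamma>), face (i - 1) (comp_mono \<theta> \<gamma>)))"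
    using F comp_mono_simplices[OF t g] by (simp add: waldhausen_diagram_def)
  moreover have "arr_map (pullback_ftr (simplex_cat k m) (postcomp_ftr \<theta>) F) (face i \<gamma>, face (i - 1) \<gamma>) =
    arr_map F (face i (comp_mono \<theta> \<gamma>), face (i - 1) (comp_mono \<theta> \<gamma>))" if "i \<in> {1..k + 1}" for i
    using pullback_postcomp(2)[OF t] face_arr[of \<gamma> k m i] g that by (simp add: face_comp_mono)
  ultimately show "exact_seq C M E (k + 1) (\<lambda>i. arr_map (pullback_ftr (simplex_cat k m) (postcomp_ftr \<theta>) F) (face i \<gamma>, face (i - 1) \<gamma>))"
    using exact_seq_cong[of "k + 1"] by (smt (verit) le_add2)
qed

lemma comp_mono_assoc:
  assumes "\<phi> \<in> simplices l m" "\<beta> \<in> simplices k l"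
  shows "comp_mono (comp_mono \<theta> \<phi>) \<beta> = comp_mono \<theta> (comp_mono \<phi> \<beta>)"
proof -
  have "x < length \<phi>" if "x \<in> set \<beta>" for x using assms that by (auto simp: simplices_def)
  thus ?thesis by (auto simp: comp_mono_def)
qed

lemma comp_mono_id: "\<beta> \<in> simplices k n \<Longrightarrow> comp_mono [0..<Suc n] \<beta> = \<beta>"
  unfolding comp_mono_def simplices_def by (intro map_idI) (auto simp del: upt_Suc)

text \<open>Restriction is strictly functorial, and not only up to isomorphism: functors and
  components are \<open>undefined\<close> outside their domains, so their equality can be tested on
  simplices and comparable pairs of simplices.\<close>

lemma waldhausen_simplicial:
  assumes C: "category C"
  shows "is_simplicial_cat (waldhausen k C M E)"
proof -
  let ?S = "simplex_cat k"
  have ext: "F = G" if "extensional_ftr (?S n) F" "extensional_ftr (?S n) G" "\<And>\<beta>. \<beta> \<in> simplices k n \<Longrightarrow> obj_map F \<beta> = obj_map G \<beta>"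
    "\<And>\<alpha> \<beta>. \<alpha> \<in> simplices k n \<Longrightarrow> \<beta> \<in> simplices k n \<Longrightarrow> \<alpha> \<preceq> \<beta> \<Longrightarrow> arr_map F (\<alpha>, \<beta>) = arr_map G (\<alpha>, \<beta>)"
    for F G :: "(nat list, nat list \<times> nat list, 'a, 'b) ftr" and n
    using that by (intro ftr_eqI; intro extensionalityI[of _ "Obj (?S n)"] extensionalityI[of _ "Arr (?S n)"])
      (auto simp: extensional_ftr_def)
  have pid: "pullback_ftr (?S n) (postcomp_ftr [0..<Suc n]) F = F" if "extensional_ftr (?S n) F" for F :: "(nat list, nat list \<times> nat list, 'a, 'b) ftr" and n
  proof -
    have t: "[0..<Suc n] \<in> simplices n n" by (auto simp: simplices_def simp del: upt_Suc)
    show ?thesis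
    proof (rule ext[OF _ that])
      show "extensional_ftr (?S n) (pullback_ftr (?S n) (postcomp_ftr [0..<Suc n]) F)" by (simp add: extensional_ftr_def pullback_ftr_def)
    qed (simp_all add: pullback_postcomp[OF t] comp_mono_id del: upt_Suc)
  qed
  have pcomp: "pullback_ftr (?S l) (postcomp_ftr (comp_mono \<theta> \<phi>)) F = pullback_ftr (?S l) (postcomp_ftr \<phi>) (pullback_ftr (?S m) (postcomp_ftr \<theta>) F)"
    if t: "\<theta> \<in> simplices m n" and p: "\<phi> \<in> simplices l m" for F :: "(nat list, nat list \<times> nat list, 'a, 'b) ftr" and \<theta> \<phi> l m n
  proof (rule ext)
    show "extensional_ftr (?S l) (pullback_ftr (?S l) (postcomp_ftr (comp_mono \<theta> \<phi>)) F)"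
      "extensional_ftr (?S l) (pullback_ftr (?S l) (postcomp_ftr \<phi>) (pullback_ftr (?S m) (postcomp_ftr \<theta>) F))"
      by (auto simp: extensional_ftr_def pullback_ftr_def)
  qed (use comp_mono_simplices[OF p] comp_mono_le[OF p] in \<open>auto simp: pullback_postcomp[OF comp_mono_simplices[OF t p]] pullback_postcomp[OF t] pullback_postcomp[OF p] comp_mono_assoc[OF p]\<close>)
  show ?thesis unfolding is_simplicial_cat_def
  proof (intro conjI allI ballI)
    fix n show "category (scat (waldhausen k C M E) n)"
      by (simp add: waldhausen_def category_full category_functor_cat category_simplex C)
  next
    fix m n \<theta> assume t: "\<theta> \<in> simplices m n"
    show "is_functor (scat (waldhausen k C M E) n) (scat (waldhausen k C M E) m) (sact (waldhausen k C M E) m n \<theta>)"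
      unfolding waldhausen_def simplicial_cat.simps
      by (rule functor_full[OF precomp_functor[OF category_simplex category_simplex C postcomp_functor[OF t]] _ category_functor_cat[OF category_simplex C]])
        (simp add: precomp_ftr_def waldhausen_pullback[OF t])
  next
    fix n
    show "functor_eq_on (scat (waldhausen k C M E) n) (sact (waldhausen k C M E) n n [0..<Suc n]) id_ftr"
      unfolding functor_eq_on_def waldhausen_def simplicial_cat.simps
    proof (intro conjI ballI)
      fix F assume "F \<in> Obj (full_subcategory (functor_cat (?S n) C) (waldhausen_diagram C M E k n))"
      thus "obj_map (precomp_ftr (?S n) (postcomp_ftr [0..<Suc n])) F = obj_map id_ftr F"
        using pid by (simp add: precomp_ftr_def id_ftr_def del: upt_Suc)
    next
      fix \<sigma> assume "\<sigma> \<in> Arr (full_subcategory (functor_cat (?S n) C) (waldhausen_diagram C M E k n))"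
      hence s: "extensional_ftr (?S n) (nt_src \<sigma>)" "extensional_ftr (?S n) (nt_tgt \<sigma>)" "nt_comp \<sigma> \<in> extensional (simplices k n)"
        by (auto simp: full_subcategory_def functor_cat_def)
      have "restrict (nt_comp \<sigma> \<circ> obj_map (postcomp_ftr [0..<Suc n])) (simplices k n) = nt_comp \<sigma>"
        by (rule extensionalityI[OF _ s(3)]) (auto simp: postcomp_ftr_def comp_mono_id simp del: upt_Suc)
      thus "arr_map (precomp_ftr (?S n) (postcomp_ftr [0..<Suc n])) \<sigma> = arr_map id_ftr \<sigma>"
        using pid s by (auto simp: precomp_ftr_def id_ftr_def simp del: upt_Suc intro!: nat_trans_eqI)
    qed
  next
    fix l m n \<theta> \<phi> assume t: "\<theta> \<in> simplices m n" and p: "\<phi> \<in> simplices l m"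
    have "restrict (nt_comp \<sigma> \<circ> obj_map (postcomp_ftr (comp_mono \<theta> \<phi>))) (simplices k l) =
      restrict (restrict (nt_comp \<sigma> \<circ> obj_map (postcomp_ftr \<theta>)) (simplices k m) \<circ> obj_map (postcomp_ftr \<phi>)) (simplices k l)"
      for \<sigma> :: "(nat list, nat list \<times> nat list, 'a, 'b) nat_trans"
      by (rule restrict_ext) (use comp_mono_simplices[OF p] in \<open>auto simp: postcomp_ftr_def comp_mono_assoc[OF p]\<close>)
    thus "functor_eq_on (scat (waldhausen k C M E) n) (sact (waldhausen k C M E) l n (comp_mono \<theta> \<phi>))
        (comp_ftr (sact (waldhausen k C M E) l m \<phi>) (sact (waldhausen k C M E) m n \<theta>))"
      using pcomp[OF t p] by (simp add: functor_eq_on_def waldhausen_def precomp_ftr_def comp_ftr_def)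
  qed
qed

section \<open>Pseudo-limits and functors into them\<close>

lemma pl_hom:
  "f \<in> hom (pseudo_limit P D R) x y \<longleftrightarrow> pl_src f = x \<and> pl_tgt f = y \<and> x \<in> pl_objects P D R \<and> y \<in> pl_objects P D R \<and>
     pl_comp f \<in> (\<Pi>\<^sub>E i \<in> P. hom (D i) (pl_val x i) (pl_val y i)) \<and>
     (\<forall>i \<in> P. \<forall>j \<in> P. j \<le> i \<longrightarrow> pl_comp f j \<cdot>\<^bsub>D j\<^esub> pl_iso x j i = pl_iso y j i \<cdot>\<^bsub>D j\<^esub> arr_map (R j i) (pl_comp f i))"
  by (auto simp: hom_def pseudo_limit_def pl_arrows_def)

lemma pl_simps [simp]:
  "Obj (pseudo_limit P D R) = pl_objects P D R" "Dom (pseudo_limit P D R) = pl_src" "Cod (pseudo_limit P D R) = pl_tgt"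
  "Id (pseudo_limit P D R) x = \<lparr>pl_src = x, pl_tgt = x, pl_comp = (\<lambda>i \<in> P. Id (D i) (pl_val x i))\<rparr>"
  "g \<cdot>\<^bsub>pseudo_limit P D R\<^esub> f = \<lparr>pl_src = pl_src f, pl_tgt = pl_tgt g, pl_comp = (\<lambda>i \<in> P. pl_comp g i \<cdot>\<^bsub>D i\<^esub> pl_comp f i)\<rparr>"
  by (simp_all add: pseudo_limit_def)

lemma pl_arr_eqI: "pl_src f = pl_src g \<Longrightarrow> pl_tgt f = pl_tgt g \<Longrightarrow> pl_comp f = pl_comp g \<Longrightarrow> f = (g :: ('i,'o,'m) pl_arr)"
  by (cases f; cases g) simp

lemma pl_objD:
  assumes "x \<in> pl_objects P D R"
  shows "i \<in> P \<Longrightarrow> pl_val x i \<in> Obj (D i)"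
    "i \<in> P \<Longrightarrow> j \<in> P \<Longrightarrow> j \<le> i \<Longrightarrow> pl_iso x j i \<in> hom (D j) (obj_map (R j i) (pl_val x i)) (pl_val x j)"
    "i \<in> P \<Longrightarrow> j \<in> P \<Longrightarrow> j \<le> i \<Longrightarrow> iso_arr (D j) (pl_iso x j i)"
    "i \<in> P \<Longrightarrow> pl_iso x i i = Id (D i) (pl_val x i)"
    "i \<in> P \<Longrightarrow> j \<in> P \<Longrightarrow> l \<in> P \<Longrightarrow> l \<le> j \<Longrightarrow> j \<le> i \<Longrightarrow> pl_iso x l i = pl_iso x l j \<cdot>\<^bsub>D l\<^esub> arr_map (R l j) (pl_iso x j i)"
proof -
  note x = assms[unfolded pl_objects_def mem_Collect_eq]
  note * = x[THEN conjunct1] x[THEN conjunct2, THEN conjunct1] x[THEN conjunct2, THEN conjunct2, THEN conjunct2, THEN conjunct1]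
    x[THEN conjunct2, THEN conjunct2, THEN conjunct2, THEN conjunct2]
  show "i \<in> P \<Longrightarrow> pl_val x i \<in> Obj (D i)" using PiE_mem[OF *(1)] .
  show "i \<in> P \<Longrightarrow> j \<in> P \<Longrightarrow> j \<le> i \<Longrightarrow> pl_iso x j i \<in> hom (D j) (obj_map (R j i) (pl_val x i)) (pl_val x j)"
    "i \<in> P \<Longrightarrow> j \<in> P \<Longrightarrow> j \<le> i \<Longrightarrow> iso_arr (D j) (pl_iso x j i)" using *(2) by blast+
  show "i \<in> P \<Longrightarrow> pl_iso x i i = Id (D i) (pl_val x i)" using *(3) by blast
  show "i \<in> P \<Longrightarrow> j \<in> P \<Longrightarrow> l \<in> P \<Longrightarrow> l \<le> j \<Longrightarrow> j \<le> i \<Longrightarrow> pl_iso x l i = pl_iso x l j \<cdot>\<^bsub>D l\<^esub> arr_map (R l j) (pl_iso x j i)"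
    using *(4) by blast
qed

lemma category_pseudo_limit:
  assumes D: "\<And>i. i \<in> P \<Longrightarrow> category (D i)" and R: "\<And>i j. i \<in> P \<Longrightarrow> j \<in> P \<Longrightarrow> j \<le> i \<Longrightarrow> is_functor (D i) (D j) (R j i)"
  shows "category (pseudo_limit P D R)"
proof
  fix f assume "f \<in> Arr (pseudo_limit P D R)"
  thus "Dom (pseudo_limit P D R) f \<in> Obj (pseudo_limit P D R)" "Cod (pseudo_limit P D R) f \<in> Obj (pseudo_limit P D R)"
    by (auto simp: pseudo_limit_def pl_arrows_def)
next
  fix x assume "x \<in> Obj (pseudo_limit P D R)"
  hence x: "x \<in> pl_objects P D R" by simp
  have "Id (D j) (pl_val x j) \<cdot>\<^bsub>D j\<^esub> pl_iso x j i = pl_iso x j i \<cdot>\<^bsub>D j\<^esub> arr_map (R j i) (Id (D i) (pl_val x i))"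
    if "i \<in> P" "j \<in> P" "j \<le> i" for i j
    using category.id_left[OF D[OF that(2)] pl_objD(2)[OF x that]] category.id_right[OF D[OF that(2)] pl_objD(2)[OF x that]]
      functorD(3)[OF R[OF that] pl_objD(1)[OF x that(1)]] by simp
  thus "Id (pseudo_limit P D R) x \<in> hom (pseudo_limit P D R) x x"
    using x category.id_closed[OF D pl_objD(1)[OF x]] by (auto simp: pl_hom)
next
  fix f g x y z assume f: "f \<in> hom (pseudo_limit P D R) x y" and g: "g \<in> hom (pseudo_limit P D R) y z"
  have X: "x \<in> pl_objects P D R" "y \<in> pl_objects P D R" "z \<in> pl_objects P D R" using f g by (auto simp: pl_hom)
  have fh: "pl_comp f i \<in> hom (D i) (pl_val x i) (pl_val y i)" and gh: "pl_comp g i \<in> hom (D i) (pl_val y i) (pl_val z i)" if "i \<in> P" for i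
    using f g that by (auto simp: pl_hom)
  have "(pl_comp g j \<cdot>\<^bsub>D j\<^esub> pl_comp f j) \<cdot>\<^bsub>D j\<^esub> pl_iso x j i = pl_iso z j i \<cdot>\<^bsub>D j\<^esub> arr_map (R j i) (pl_comp g i \<cdot>\<^bsub>D i\<^esub> pl_comp f i)"
    if ij: "i \<in> P" "j \<in> P" "j \<le> i" for i j
  proof -
    interpret Dj: category "D j" using D ij by blast
    note ix = pl_objD(2)[OF X(1) ij] and iy = pl_objD(2)[OF X(2) ij] and iz = pl_objD(2)[OF X(3) ij]
    note Rf = functorD(5)[OF R[OF ij] fh[OF ij(1)]] and Rg = functorD(5)[OF R[OF ij] gh[OF ij(1)]]
    have nf: "pl_comp f j \<cdot>\<^bsub>D j\<^esub> pl_iso x j i = pl_iso y j i \<cdot>\<^bsub>D j\<^esub> arr_map (R j i) (pl_comp f i)"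
      and ng: "pl_comp g j \<cdot>\<^bsub>D j\<^esub> pl_iso y j i = pl_iso z j i \<cdot>\<^bsub>D j\<^esub> arr_map (R j i) (pl_comp g i)" using f g ij by (auto simp: pl_hom)
    have "(pl_comp g j \<cdot>\<^bsub>D j\<^esub> pl_comp f j) \<cdot>\<^bsub>D j\<^esub> pl_iso x j i = (pl_comp g j \<cdot>\<^bsub>D j\<^esub> pl_iso y j i) \<cdot>\<^bsub>D j\<^esub> arr_map (R j i) (pl_comp f i)"
      using Dj.assoc[OF ix fh[OF ij(2)] gh[OF ij(2)]] Dj.assoc[OF Rf iy gh[OF ij(2)]] nf by simp
    also have "\<dots> = pl_iso z j i \<cdot>\<^bsub>D j\<^esub> (arr_map (R j i) (pl_comp g i) \<cdot>\<^bsub>D j\<^esub> arr_map (R j i) (pl_comp f i))"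
      using Dj.assoc[OF Rf Rg iz] ng by simp
    finally show ?thesis using functorD(6)[OF R[OF ij] fh[OF ij(1)] gh[OF ij(1)]] by simp
  qed
  moreover have "pl_comp g i \<cdot>\<^bsub>D i\<^esub> pl_comp f i \<in> hom (D i) (pl_val x i) (pl_val z i)" if "i \<in> P" for i
    using category.comp_closed[OF D[OF that] fh[OF that] gh[OF that]] .
  ultimately show "g \<cdot>\<^bsub>pseudo_limit P D R\<^esub> f \<in> hom (pseudo_limit P D R) x z" using f g by (auto simp: pl_hom)
next
  fix f x y assume f: "f \<in> hom (pseudo_limit P D R) x y"
  have fh: "pl_comp f i \<in> hom (D i) (pl_val x i) (pl_val y i)" if "i \<in> P" for i using f that by (auto simp: pl_hom)
  have ex: "pl_comp f \<in> extensional P" using f by (auto simp: pl_hom PiE_def)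
  show "Id (pseudo_limit P D R) y \<cdot>\<^bsub>pseudo_limit P D R\<^esub> f = f" "f \<cdot>\<^bsub>pseudo_limit P D R\<^esub> Id (pseudo_limit P D R) x = f"
    using f category.id_left[OF D fh] category.id_right[OF D fh]
    by (auto intro!: pl_arr_eqI extensionalityI[OF _ ex] simp: pl_hom)
next
  fix f g h x y z w assume f: "f \<in> hom (pseudo_limit P D R) x y" and g: "g \<in> hom (pseudo_limit P D R) y z" and h: "h \<in> hom (pseudo_limit P D R) z w"
  have fh: "pl_comp f i \<in> hom (D i) (pl_val x i) (pl_val y i)" "pl_comp g i \<in> hom (D i) (pl_val y i) (pl_val z i)"
    "pl_comp h i \<in> hom (D i) (pl_val z i) (pl_val w i)" if "i \<in> P" for i
    using f g h that by (auto simp: pl_hom)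
  show "(h \<cdot>\<^bsub>pseudo_limit P D R\<^esub> g) \<cdot>\<^bsub>pseudo_limit P D R\<^esub> f = h \<cdot>\<^bsub>pseudo_limit P D R\<^esub> (g \<cdot>\<^bsub>pseudo_limit P D R\<^esub> f)"
    using category.assoc[OF D fh] by (auto intro!: pl_arr_eqI restrict_ext)
qed

lemma pl_val_of: "i \<in> P \<Longrightarrow> pl_val (pl_obj_of P D Q x) i = obj_map (Q i) x"
  by (simp add: pl_obj_of_def)

lemma pl_induced_functor:
  assumes A: "category A" and D: "\<And>i. i \<in> P \<Longrightarrow> category (D i)" and R: "\<And>i j. i \<in> P \<Longrightarrow> j \<in> P \<Longrightarrow> j \<le> i \<Longrightarrow> is_functor (D i) (D j) (R j i)"
    and Q: "\<And>i. i \<in> P \<Longrightarrow> is_functor A (D i) (Q i)"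
    and RQ: "\<And>i j a. i \<in> P \<Longrightarrow> j \<in> P \<Longrightarrow> j \<le> i \<Longrightarrow> a \<in> Obj A \<Longrightarrow> obj_map (R j i) (obj_map (Q i) a) = obj_map (Q j) a"
      "\<And>i j f. i \<in> P \<Longrightarrow> j \<in> P \<Longrightarrow> j \<le> i \<Longrightarrow> f \<in> Arr A \<Longrightarrow> arr_map (R j i) (arr_map (Q i) f) = arr_map (Q j) f"
  shows "is_functor A (pseudo_limit P D R) (pl_induced A P D Q)"
proof -
  interpret A: category A by fact
  have idh: "Id (D i) (obj_map (Q i) a) \<in> hom (D i) (obj_map (Q i) a) (obj_map (Q i) a)" if "i \<in> P" "a \<in> Obj A" for i a
    using category.id_closed[OF D[OF that(1)] functorD(1)[OF Q[OF that(1)] that(2)]] .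
  have idl: "Id (D i) (obj_map (Q i) a) \<cdot>\<^bsub>D i\<^esub> Id (D i) (obj_map (Q i) a) = Id (D i) (obj_map (Q i) a)" if "i \<in> P" "a \<in> Obj A" for i a
    using category.id_left[OF D[OF that(1)] idh[OF that]] .
  have ob: "pl_obj_of P D Q a \<in> pl_objects P D R" if a: "a \<in> Obj A" for a
    unfolding pl_objects_def
  proof (intro CollectI conjI ballI allI impI)
    show "pl_val (pl_obj_of P D Q a) \<in> (\<Pi>\<^sub>E i \<in> P. Obj (D i))" using functorD(1)[OF Q] a by (auto simp: pl_obj_of_def)
  next
    fix i j assume ij: "i \<in> P" "j \<in> P" "j \<le> i"
    show "pl_iso (pl_obj_of P D Q a) j i \<in> hom (D j) (obj_map (R j i) (pl_val (pl_obj_of P D Q a) i)) (pl_val (pl_obj_of P D Q a) j)"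
      using idh[OF ij(2) a] RQ(1)[OF ij a] ij by (simp add: pl_obj_of_def)
    show "iso_arr (D j) (pl_iso (pl_obj_of P D Q a) j i)"
      using iso_arrI[OF idh[OF ij(2) a] idh[OF ij(2) a] idl[OF ij(2) a] idl[OF ij(2) a]] ij by (simp add: pl_obj_of_def)
  next
    fix i j l assume *: "i \<in> P" "j \<in> P" "l \<in> P" "l \<le> j \<and> j \<le> i"
    hence li: "l \<le> i" by (auto intro: order.trans)
    have "arr_map (R l j) (Id (D j) (obj_map (Q j) a)) = Id (D l) (obj_map (Q l) a)"
      using functorD(3)[OF R[of j l] functorD(1)[OF Q a]] RQ(1)[of j l a] * a by simp
    thus "pl_iso (pl_obj_of P D Q a) l i = pl_iso (pl_obj_of P D Q a) l j \<cdot>\<^bsub>D l\<^esub> arr_map (R l j) (pl_iso (pl_obj_of P D Q a) j i)"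
      using * li idl[OF *(3) a] by (simp add: pl_obj_of_def)
  qed (auto simp: pl_obj_of_def)
  show ?thesis unfolding is_functor_def
  proof (intro conjI ballI impI)
    fix a assume a: "a \<in> Obj A"
    show "obj_map (pl_induced A P D Q) a \<in> Obj (pseudo_limit P D R)" using ob[OF a] by (simp add: pl_induced_def)
    show "arr_map (pl_induced A P D Q) (Id A a) = Id (pseudo_limit P D R) (obj_map (pl_induced A P D Q) a)"
      using homD(2,3)[OF A.id_closed[OF a]] functorD(3)[OF Q a] by (auto simp: pl_induced_def pl_val_of intro!: restrict_ext)
  next
    fix f assume f: "f \<in> Arr A"
    have O: "Dom A f \<in> Obj A" "Cod A f \<in> Obj A" using f A.dom_closed A.cod_closed by auto
    have "Id (D j) (obj_map (Q j) (Cod A f)) \<cdot>\<^bsub>D j\<^esub> arr_map (Q j) f = arr_map (Q j) f"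
      "arr_map (Q j) f \<cdot>\<^bsub>D j\<^esub> Id (D j) (obj_map (Q j) (Dom A f)) = arr_map (Q j) f" if "j \<in> P" for j
      using category.id_left[OF D[OF that] functorD(2)[OF Q[OF that] f]] category.id_right[OF D[OF that] functorD(2)[OF Q[OF that] f]] by auto
    thus "arr_map (pl_induced A P D Q) f \<in> hom (pseudo_limit P D R) (obj_map (pl_induced A P D Q) (Dom A f)) (obj_map (pl_induced A P D Q) (Cod A f))"
      using ob O functorD(2)[OF Q f] RQ(2)[OF _ _ _ f] by (auto simp: pl_hom pl_induced_def pl_obj_of_def)
    fix g assume g: "g \<in> Arr A" "Dom A g = Cod A f"
    have "Dom A (g \<cdot>\<^bsub>A\<^esub> f) = Dom A f" "Cod A (g \<cdot>\<^bsub>A\<^esub> f) = Cod A g"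
      using A.comp_closed[of f "Dom A f" "Cod A f" g "Cod A g"] f g by (auto simp: hom_def)
    thus "arr_map (pl_induced A P D Q) (g \<cdot>\<^bsub>A\<^esub> f) = arr_map (pl_induced A P D Q) g \<cdot>\<^bsub>pseudo_limit P D R\<^esub> arr_map (pl_induced A P D Q) f"
      using functorD(4)[OF Q f g] by (auto simp: pl_induced_def intro!: restrict_ext)
  qed
qed

section \<open>Coordinates on subsets\<close>

text \<open>The simplex with vertices \<open>\<beta>\<close> in \<open>J\<close> as a simplex of \<open>\<Delta>\<^sup>p\<close>, where \<open>p = set_dim J\<close>.\<close>

definition rkl :: "nat set \<Rightarrow> nat list \<Rightarrow> nat list" where
  "rkl J \<beta> = map (\<lambda>x. card {y \<in> J. y < x}) \<beta>"

lemma rank_nth: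
  assumes "finite J" "i < card J"
  shows "card {y \<in> J. y < sorted_list_of_set J ! i} = i"
proof -
  let ?l = "sorted_list_of_set J"
  have l: "sorted_wrt (<) ?l" "length ?l = card J" "set ?l = J" using assms by (auto simp: strict_sorted_iff)
  have "{y \<in> J. y < ?l ! i} = (!) ?l ` {..<i}"
  proof (intro equalityI subsetI)
    fix y assume "y \<in> {y \<in> J. y < ?l ! i}"
    then obtain j where j: "j < length ?l" "y = ?l ! j" "?l ! j < ?l ! i" using l(3) by (metis (lifting) in_set_conv_nth mem_Collect_eq)
    have "j < i"
    proof (rule ccontr)
      assume "\<not> j < i"
      hence "?l ! i \<le> ?l ! j" using sorted_nth_mono[of ?l i j] j(1) l(1) by (simp add: strict_sorted_iff)
      thus False using j(3) by simp
    qed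
    thus "y \<in> (!) ?l ` {..<i}" using j by auto
  next
    fix y assume "y \<in> (!) ?l ` {..<i}"
    then obtain j where j: "j < i" "y = ?l ! j" by auto
    thus "y \<in> {y \<in> J. y < ?l ! i}" using sorted_wrt_nth_less[OF l(1) j(1)] assms l(2) nth_mem[of j ?l] l(3) by auto
  qed
  moreover have "inj_on ((!) ?l) {..<i}" using l assms(2) by (intro inj_on_nth) auto
  ultimately show ?thesis by (simp add: card_image)
qed

lemma nth_rank:
  assumes "finite J" "x \<in> J"
  shows "card {y \<in> J. y < x} < card J" "sorted_list_of_set J ! card {y \<in> J. y < x} = x"
proof -
  obtain i where "i < card J" "sorted_list_of_set J ! i = x"
    using assms by (metis in_set_conv_nth set_sorted_list_of_set length_sorted_list_of_set)
  thus "card {y \<in> J. y < x} < card J" "sorted_list_of_set J ! card {y \<in> J. y < x} = x"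
    using rank_nth[OF assms(1)] by auto
qed

lemma rank_mono: "finite J \<Longrightarrow> x \<le> x' \<Longrightarrow> card {y \<in> J. y < x} \<le> card {y \<in> J. y < (x'::nat)}"
  by (rule card_mono) auto

lemma comp_rkl: "finite J \<Longrightarrow> set \<beta> \<subseteq> J \<Longrightarrow> comp_mono (sorted_list_of_set J) (rkl J \<beta>) = \<beta>"
  unfolding comp_mono_def rkl_def by (auto simp: nth_rank intro!: map_idI)

lemma set_dim_card: "finite J \<Longrightarrow> J \<noteq> {} \<Longrightarrow> Suc (set_dim J) = card J"
  by (simp add: set_dim_def card_gt_0_iff)

lemma set_dim_full [simp]: "set_dim {0..n} = n"
  by (simp add: set_dim_def)

lemma rkl_comp:
  assumes "finite J" "J \<noteq> {}" "\<beta> \<in> simplices k (set_dim J)"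
  shows "rkl J (comp_mono (sorted_list_of_set J) \<beta>) = \<beta>"
proof -
  have "i < card J" if "i \<in> set \<beta>" for i using assms(3) that set_dim_card[OF assms(1,2)] by (force simp: simplices_def)
  thus ?thesis unfolding comp_mono_def rkl_def by (auto simp: rank_nth[OF assms(1)] intro!: map_idI)
qed

lemma enum_simplex: "finite J \<Longrightarrow> J \<noteq> {} \<Longrightarrow> J \<subseteq> {0..n} \<Longrightarrow> sorted_list_of_set J \<in> simplices (set_dim J) n"
  by (auto simp: simplices_def set_dim_card)

lemma enum_set:
  assumes "finite J" "J \<noteq> {}" "\<beta> \<in> simplices k (set_dim J)"
  shows "set (comp_mono (sorted_list_of_set J) \<beta>) \<subseteq> J"
proof -
  have "i < length (sorted_list_of_set J)" if "i \<in> set \<beta>" for i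
    using assms(3) that set_dim_card[OF assms(1,2)] by (force simp: simplices_def)
  thus ?thesis using nth_mem[of _ "sorted_list_of_set J"] assms(1) by (auto simp: comp_mono_def)
qed

lemma rkl_simplices:
  assumes "finite J" "set \<beta> \<subseteq> J" "sl (Suc k) \<beta>"
  shows "rkl J \<beta> \<in> simplices k (set_dim J)"
proof -
  have "sorted \<gamma> \<Longrightarrow> sorted (rkl J \<gamma>)" for \<gamma> unfolding rkl_def by (induction \<gamma>) (auto intro: rank_mono[OF assms(1)])
  hence "sorted (rkl J \<beta>)" using assms(3) by (simp add: sl_def)
  moreover have "set (rkl J \<beta>) \<subseteq> {0..set_dim J}"
    using nth_rank(1)[OF assms(1)] assms(2) by (force simp: rkl_def set_dim_def)
  ultimately show ?thesis using assms(3) by (simp add: simplices_def rkl_def sl_def)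
qed

lemma rkl_le: "finite J \<Longrightarrow> x \<preceq> y \<Longrightarrow> rkl J x \<preceq> rkl J y"
  unfolding rkl_def by (auto simp: list_all2_conv_all_nth rank_mono)

lemma rkl_full: "set \<beta> \<subseteq> {0..n} \<Longrightarrow> rkl {0..n} \<beta> = \<beta>"
  unfolding rkl_def
proof (intro map_idI)
  fix x assume "set \<beta> \<subseteq> {0..n}" "x \<in> set \<beta>"
  hence "{y \<in> {0..n}. y < x} = {..<x}" by auto
  thus "card {y \<in> {0..n}. y < x} = x" by simp
qed

lemma incl_rkl: "finite J \<Longrightarrow> set \<beta> \<subseteq> J \<Longrightarrow> comp_mono (incl J I) (rkl J \<beta>) = rkl I \<beta>"
  unfolding comp_mono_def rkl_def incl_def by (auto simp: nth_rank)

lemma incl_simplex: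
  assumes "finite I" "J \<subseteq> I" "J \<noteq> {}"
  shows "incl J I \<in> simplices (set_dim J) (set_dim I)"
proof -
  have J: "finite J" using assms finite_subset by blast
  have "incl J I = rkl I (sorted_list_of_set J)" by (simp add: incl_def rkl_def)
  thus ?thesis using rkl_simplices[OF assms(1), of "sorted_list_of_set J" "set_dim J"] J assms set_dim_card[OF J] by (simp add: sl_def)
qed

lemma incl_trans:
  assumes "finite I" "J \<subseteq> I"
  shows "comp_mono (incl I N) (incl J I) = incl J N"
proof -
  have J: "finite J" using assms finite_subset by blast
  have "incl J I = rkl I (sorted_list_of_set J)" "incl J N = rkl N (sorted_list_of_set J)" by (simp_all add: incl_def rkl_def)
  thus ?thesis using incl_rkl[OF assms(1), of "sorted_list_of_set J" N] J assms(2) by simp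
qed

lemma degenerate_iff: "sorted \<beta> \<Longrightarrow> degenerate \<beta> \<longleftrightarrow> \<not> distinct \<beta>"
proof -
  assume s: "sorted \<beta>"
  have "distinct \<beta> \<longleftrightarrow> sorted_wrt (<) \<beta>" using s by (simp add: strict_sorted_iff)
  also have "\<dots> \<longleftrightarrow> (\<forall>i. Suc i < length \<beta> \<longrightarrow> \<beta> ! i < \<beta> ! Suc i)" by (rule sorted_wrt_iff_nth_Suc_transp) simp
  also have "\<dots> \<longleftrightarrow> \<not> degenerate \<beta>"
    unfolding degenerate_def using sorted_nth_mono[OF s] by (metis lessI less_imp_le_nat nat_neq_iff not_le)
  finally show ?thesis by blast
qed

section \<open>Transport of exact diagrams\<close>

context strin begin

lemma WD_cong:
  assumes "WD k P A" "\<And>x y. sl (Suc k) x \<Longrightarrow> sl (Suc k) y \<Longrightarrow> x \<preceq> y \<Longrightarrow> P (set x \<union> set y) \<Longrightarrow> B x y = A x y"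
    and P: "\<And>S T. P S \<Longrightarrow> T \<subseteq> S \<Longrightarrow> P T"
  shows "WD k P B"
proof -
  have sub: "B x y = A x y" if "sl (Suc k) x" "sl (Suc k) y" "P S" "x \<preceq> y" "set x \<union> set y \<subseteq> S" for x y S
    using assms(2)[OF that(1,2,4)] P[OF that(3,5)] .
  have "diag (Suc k) P B" unfolding diag_def
  proof (intro conjI allI impI)
    fix x y assume h: "sl (Suc k) x" "sl (Suc k) y" "x \<preceq> y" "P (set x \<union> set y)"
    thus "H (B x x) (B y y) (B x y)" using diag_H[OF WD_D(1)[OF assms(1)] h] sub[OF _ _ h(4)] by simp
  next
    fix x y z assume h: "sl (Suc k) x" "sl (Suc k) y" "sl (Suc k) z" "x \<preceq> y" "y \<preceq> z" "P (set x \<union> set y \<union> set z)"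
    hence "A y z \<bullet> A x y = A x z" using WD_D(1)[OF assms(1)] unfolding diag_def by blast
    moreover have "B x y = A x y" "B y z = A y z" "B x z = A x z" using h list_le_trans[OF h(4,5)] by (auto intro!: sub[OF _ _ h(6)])
    ultimately show "B y z \<bullet> B x y = B x z" by simp
  next
    fix x assume h: "sl (Suc k) x" "\<not> distinct x" "P (set x)"
    thus "B x x = \<zero>" using WD_D(1)[OF assms(1)] sub[OF h(1) h(1) h(3)] unfolding diag_def by simp
  qed
  moreover have "LEt B c \<and> FEt B c" if c: "sl (k + 2) c" "P (set c)" for c
  proof
    show "LEt B c" unfolding LEt_def
    proof (intro allI impI)
      fix p a b q assume cc: "c = p @ a # b # q"
      have 1: "B (p @ a # q) (p @ a # q) = A (p @ a # q) (p @ a # q)" "B (p @ a # q) (p @ b # q) = A (p @ a # q) (p @ b # q)"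
        by (rule sub[OF _ _ c(2)]; use c(1) cc in \<open>auto simp: sl_def sorted_append\<close>)+
      have 2: "inc B p a b q = inc A p a b q"
      proof (cases q)
        case (Cons z q')
        have "B (p @ a # b # q') (p @ a # q) = A (p @ a # b # q') (p @ a # q)"
          by (rule sub[OF _ _ c(2)]; use c(1) cc Cons in \<open>auto simp: sl_def sorted_append\<close>)
        thus ?thesis using Cons by simp
      qed simp
      show "ex (B (p @ a # q) (p @ a # q)) (inc B p a b q) (B (p @ a # q) (p @ b # q))"
        unfolding 1 2 using LEtD[OF WD_D(2)[OF assms(1) c] cc] .
    qed
    show "FEt B c" unfolding FEt_def
    proof (intro allI impI)
      fix a b q assume cc: "c = a # b # q"
      have 1: "B (b # q) (b # q) = A (b # q) (b # q)" "B (a # q) (b # q) = A (a # q) (b # q)"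
        by (rule sub[OF _ _ c(2)]; use c(1) cc in \<open>auto simp: sl_def\<close>)+
      show "ez (B (b # q) (b # q)) (B (a # q) (b # q))" using WD_D(3)[OF assms(1) c] unfolding FEt_def 1 cc by simp
    qed
  qed
  ultimately show ?thesis unfolding WD_def by blast
qed

lemma kz_iso: "H a b c \<Longrightarrow> d \<bullet> c = a \<Longrightarrow> kz a c"
  unfolding kz_def by (metis mul_assoc zero_right)

lemma ez_iso: "H a b c \<Longrightarrow> c \<bullet> d = b \<Longrightarrow> ez b c"
  unfolding ez_def by (metis mul_assoc zero_left)

lemma ex_iso:
  assumes f: "H x y f" and g: "H y z g" and e: "ex y f g"
    and C: "H y y' C" "H y' y D" "D \<bullet> C = y" "C \<bullet> D = y'"
    and L: "H z z' L" "L' \<bullet> L = z" and R: "H x' x R" "R \<bullet> R' = x"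
  shows "ex y' (C \<bullet> f \<bullet> R) (L \<bullet> g \<bullet> D)"
proof -
  have DC: "D \<bullet> (C \<bullet> u) = y \<bullet> u" "C \<bullet> (D \<bullet> u) = y' \<bullet> u" for u using C(3,4) by (simp_all flip: mul_assoc)
  obtain c m e' where K: "ker y g c m" "H x c e'" "H c y m" "mon c m" "epi c e'" "f = m \<bullet> e'" using ex_kerE[OF f g e] .
  have "ker y' (g \<bullet> D) c (C \<bullet> m)"
  proof (rule kerI)
    show "H c y' (C \<bullet> m)" using H_comp[OF K(3) C(1)] .
    show "(g \<bullet> D) \<bullet> C \<bullet> m = \<zero>" using kerD[OF K(1)] HD[OF K(3)] HD[OF g] by (simp add: mul_assoc DC)
    show "mon c (C \<bullet> m)" unfolding mon_def
    proof (intro allI impI)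
      fix u v assume uv: "c \<bullet> u = u" "c \<bullet> v = v" "(C \<bullet> m) \<bullet> u = (C \<bullet> m) \<bullet> v"
      hence "D \<bullet> (C \<bullet> (m \<bullet> u)) = D \<bullet> (C \<bullet> (m \<bullet> v))" by (simp add: mul_assoc)
      hence "m \<bullet> u = m \<bullet> v" unfolding DC HD(5)[OF K(3)] .
      thus "u = v" using K(4) uv unfolding mon_def by blast
    qed
  next
    fix h assume h: "y' \<bullet> h = h" "(g \<bullet> D) \<bullet> h = \<zero>"
    have "y \<bullet> D \<bullet> h = D \<bullet> h" using HD[OF C(2)] by simp
    moreover have "g \<bullet> D \<bullet> h = \<zero>" using h by (simp add: mul_assoc)
    ultimately obtain u where u: "c \<bullet> u = u" "m \<bullet> u = D \<bullet> h" using ker_ex[OF K(1)] by blast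
    have "(C \<bullet> m) \<bullet> u = h" using u h DC by (simp add: mul_assoc)
    thus "\<exists>u. c \<bullet> u = u \<and> (C \<bullet> m) \<bullet> u = h" using u by blast
  qed
  hence "ex y' (C \<bullet> f) (g \<bullet> D)" by (rule exI_ker) (use K HD[OF K(2)] in \<open>auto simp: mul_assoc\<close>)
  hence "ex y' ((C \<bullet> f) \<bullet> R) (g \<bullet> D)"
    using ex_epi[OF R(1) H_comp[OF f C(1)] ez_iso[OF R]] H_comp[OF C(2) g] by blast
  thus ?thesis
    using ex_mono[OF H_comp[OF C(2) g] kz_iso[OF L]] by (simp add: mul_assoc)
qed

text \<open>\<open>C x\<close> and \<open>D x\<close> are inverse isomorphisms between the object at
  \<open>x\<close> and the prescribed object \<open>v x\<close>, so the conjugated diagram has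
  exactly the prescribed objects. This serves to make objects of the pseudo-limit strict.\<close>

lemma WD_iso:
  assumes A: "WD k P A" and P: "\<And>S T. P S \<Longrightarrow> T \<subseteq> S \<Longrightarrow> P T"
    and C: "\<And>x. sl (Suc k) x \<Longrightarrow> P (set x) \<Longrightarrow> H (A x x) (v x) (C x)"
    and D: "\<And>x. sl (Suc k) x \<Longrightarrow> P (set x) \<Longrightarrow> H (v x) (A x x) (D x)"
    and DC: "\<And>x. sl (Suc k) x \<Longrightarrow> P (set x) \<Longrightarrow> D x \<bullet> C x = A x x" "\<And>x. sl (Suc k) x \<Longrightarrow> P (set x) \<Longrightarrow> C x \<bullet> D x = v x"
  shows "WD k P (\<lambda>x y. C y \<bullet> A x y \<bullet> D x)"
proof -
  note dA = WD_D(1)[OF A]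
  let ?B = "\<lambda>x y. C y \<bullet> A x y \<bullet> D x"
  have AH: "H (A x x) (A y y) (A x y)" if "sl (Suc k) x" "sl (Suc k) y" "x \<preceq> y" "P (set x \<union> set y)" for x y
    using diag_H[of "Suc k" P A x y] dA that by blast
  have v: "?B x x = v x" if "sl (Suc k) x" "P (set x)" for x
    using HD[OF D[OF that]] DC(2)[OF that] by (simp add: mul_assoc)
  have BH: "H (v x) (v y) (?B x y)" if "sl (Suc k) x" "sl (Suc k) y" "x \<preceq> y" "P (set x \<union> set y)" for x y
  proof -
    have "P (set x)" "P (set y)" using P[OF that(4)] by auto
    thus ?thesis using H_comp[OF H_comp[OF D AH] C] that by blast
  qed
  have diag: "diag (Suc k) P ?B" unfolding diag_def
  proof (intro conjI allI impI)
    fix x y assume h: "sl (Suc k) x" "sl (Suc k) y" "x \<preceq> y" "P (set x \<union> set y)"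
    have "P (set x)" "P (set y)" using P[OF h(4)] by auto
    thus "H (?B x x) (?B y y) (?B x y)" using BH[OF h] v h by simp
  next
    fix x y z assume h: "sl (Suc k) x" "sl (Suc k) y" "sl (Suc k) z" "x \<preceq> y" "y \<preceq> z" "P (set x \<union> set y \<union> set z)"
    have p: "P (set y)" "P (set x \<union> set y)" using P[OF h(6)] by auto
    have "A y z \<bullet> A x y = A x z" using diag_C[OF dA h(1-6)] .
    moreover have "(D y \<bullet> C y) \<bullet> (A x y \<bullet> D x) = A x y \<bullet> D x" unfolding DC(1)[OF h(2) p(1)] using HD[OF AH[OF h(1,2,4) p(2)]] by simp
    ultimately show "?B y z \<bullet> ?B x y = ?B x z" by (metis mul_assoc)
  next
    fix x assume h: "sl (Suc k) x" "\<not> distinct x" "P (set x)"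
    hence "A x x = \<zero>" using dA unfolding diag_def by blast
    thus "?B x x = \<zero>" by simp
  qed
  show ?thesis unfolding WD_def
  proof (intro conjI allI impI diag)
    fix c assume c: "sl (k + 2) c \<and> P (set c)"
    have sub: "P S" if "S \<subseteq> set c" for S using P that c by blast
    show "LEt ?B c" unfolding LEt_def
    proof (intro allI impI)
      fix p a b q assume ce: "c = p @ a # b # q"
      have sl: "sl (Suc k) (p @ a # q)" "sl (Suc k) (p @ b # q)" using c by (auto simp: ce sl_def sorted_append)
      have le: "p @ a # q \<preceq> p @ b # q" using c by (auto simp: ce sl_def sorted_append)
      have p: "P (set (p @ a # q))" "P (set (p @ b # q))" "P (set (p @ a # q) \<union> set (p @ b # q))" by (rule sub; auto simp: ce)+
      have e: "ex (A (p @ a # q) (p @ a # q)) (inc A p a b q) (A (p @ a # q) (p @ b # q))"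
        using LEtD[OF WD_D(2)[OF A] ce] c by blast
      note g = AH[OF sl le p(3)]
      show "ex (?B (p @ a # q) (p @ a # q)) (inc ?B p a b q) (?B (p @ a # q) (p @ b # q))"
      proof (cases q)
        case Nil
        have "kz (A (p @ [a]) (p @ [a])) (A (p @ [a]) (p @ [b]))" using e ex_zero_left g unfolding Nil by (simp add: inc_def)
        hence "kz (v (p @ [a])) (?B (p @ [a]) (p @ [b]))"
          using kz_comp[OF H_comp[OF D[OF sl(1) p(1)] g, unfolded Nil] kz_comp[OF D[OF sl(1) p(1), unfolded Nil] kz_iso[OF D[OF sl(1) p(1), unfolded Nil] DC(2)[OF sl(1) p(1), unfolded Nil]]]
            kz_iso[OF C[OF sl(2) p(2), unfolded Nil] DC(1)[OF sl(2) p(2), unfolded Nil]]] by simp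
        thus ?thesis using ex_zero_left[OF BH[OF sl le p(3)]] v[OF sl(1) p(1)] unfolding Nil by (simp add: inc_def)
      next
        case (Cons w q')
        let ?x = "p @ a # b # q'" and ?y = "p @ a # q"
        have sx: "sl (Suc k) ?x" "?x \<preceq> ?y" using c by (auto simp: ce Cons sl_def sorted_append)
        have px: "P (set ?x)" "P (set ?x \<union> set ?y)" by (rule sub; auto simp: ce Cons)+
        have "ex (v ?y) (C ?y \<bullet> A ?x ?y \<bullet> D ?x) (C (p @ b # q) \<bullet> A ?y (p @ b # q) \<bullet> D ?y)"
          by (rule ex_iso[OF AH[OF sx(1) sl(1) sx(2) px(2)] g _ C[OF sl(1) p(1)] D[OF sl(1) p(1)] DC(1)[OF sl(1) p(1)] DC(2)[OF sl(1) p(1)]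
            C[OF sl(2) p(2)] DC(1)[OF sl(2) p(2)] D[OF sx(1) px(1)] DC(1)[OF sx(1) px(1)]]) (use e in \<open>simp add: inc_def Cons\<close>)
        thus ?thesis using v[OF sl(1) p(1)] by (simp add: inc_def Cons)
      qed
    qed
    show "FEt ?B c" unfolding FEt_def
    proof (intro allI impI)
      fix a b q assume ce: "c = a # b # q"
      have sl: "sl (Suc k) (a # q)" "sl (Suc k) (b # q)" using c by (auto simp: ce sl_def)
      have le: "a # q \<preceq> b # q" using c by (auto simp: ce sl_def)
      have p: "P (set (a # q))" "P (set (b # q))" "P (set (a # q) \<union> set (b # q))" by (rule sub; auto simp: ce)+
      have e: "ez (A (b # q) (b # q)) (A (a # q) (b # q))" using WD_D(3)[OF A, of c] c ce unfolding FEt_def by blast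
      note g = AH[OF sl le p(3)]
      have "ez (v (b # q)) (?B (a # q) (b # q))"
        using ez_comp[OF C[OF sl(2) p(2)] ez_iso[OF C[OF sl(2) p(2)] DC(2)[OF sl(2) p(2)]]
          ez_comp[OF g e ez_iso[OF D[OF sl(1) p(1)] DC(1)[OF sl(1) p(1)]]]] by simp
      thus "ez (?B (b # q) (b # q)) (?B (a # q) (b # q))" using v[OF sl(2) p(2)] by simp
    qed
  qed
qed

text \<open>Each clause speaks of finitely many vertices, and their set can itself be taken as the
  ambient set \<open>S\<close>.\<close>

lemma WD_local:
  assumes "\<And>S. P S \<Longrightarrow> S \<noteq> {} \<Longrightarrow> WD k (\<lambda>T. T \<subseteq> S) A"
  shows "WD k P A"
  unfolding WD_def
proof (intro conjI allI impI)
  have ne: "set x \<noteq> {}" if "sl (Suc k) x" for x using that by (auto simp: sl_def)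
  show "diag (Suc k) P A" unfolding diag_def
  proof (intro conjI allI impI)
    fix x y assume h: "sl (Suc k) x" "sl (Suc k) y" "x \<preceq> y" "P (set x \<union> set y)"
    thus "H (A x x) (A y y) (A x y)" using diag_H[OF WD_D(1)[OF assms[OF h(4)]] h(1-3)] ne by blast
  next
    fix x y z assume h: "sl (Suc k) x" "sl (Suc k) y" "sl (Suc k) z" "x \<preceq> y" "y \<preceq> z" "P (set x \<union> set y \<union> set z)"
    thus "A y z \<bullet> A x y = A x z" using diag_C[OF WD_D(1)[OF assms[OF h(6)]] h(1-5)] ne by blast
  next
    fix x assume h: "sl (Suc k) x" "\<not> distinct x" "P (set x)"
    thus "A x x = \<zero>" using WD_D(1)[OF assms[OF h(3) ne[OF h(1)]]] unfolding diag_def by blast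
  qed
next
  fix c assume c: "sl (k + 2) c \<and> P (set c)"
  have "set c \<noteq> {}" using c by (auto simp: sl_def)
  thus "LEt A c" "FEt A c" using WD_D(2,3)[OF assms[of "set c"], of c] c by auto
qed

text \<open>Pullback along a monotone map of vertices. With \<open>f\<close> the rank function of
  \<open>J\<close>, it turns a diagram on a standard simplex into one on the vertices in
  \<open>J\<close>.\<close>

lemma WD_map:
  assumes A: "WD k (\<lambda>S. S \<subseteq> T) A" and f: "mono_on J f" "f ` J \<subseteq> T"
  shows "WD k (\<lambda>S. S \<subseteq> J) (\<lambda>x y. A (map f x) (map f y))"
proof -
  have m: "f x \<le> f y" if "x \<in> J" "y \<in> J" "x \<le> y" for x y using f(1) that by (auto simp: mono_on_def)
  have so: "sorted x \<Longrightarrow> set x \<subseteq> J \<Longrightarrow> sorted (map f x)" for x by (induction x) (auto intro: m)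
  have sl: "sl l (map f x)" if "sl l x" "set x \<subseteq> J" for l x using that so unfolding sl_def by simp
  have le: "map f x \<preceq> map f y" if "x \<preceq> y" "set x \<subseteq> J" "set y \<subseteq> J" for x y
    using that by (induction rule: list_all2_induct) (auto intro: m)
  have st: "set (map f x) \<subseteq> T" if "set x \<subseteq> J" for x using that f(2) by auto
  show ?thesis unfolding WD_def
  proof (intro conjI allI impI)
    show "diag (Suc k) (\<lambda>S. S \<subseteq> J) (\<lambda>x y. A (map f x) (map f y))" unfolding diag_def
    proof (intro conjI allI impI)
      fix x y assume h: "sl (Suc k) x" "sl (Suc k) y" "x \<preceq> y" "set x \<union> set y \<subseteq> J"
      show "H (A (map f x) (map f x)) (A (map f y) (map f y)) (A (map f x) (map f y))"
        by (rule diag_H[OF WD_D(1)[OF A]]) (use h sl le st in auto)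
    next
      fix x y z assume h: "sl (Suc k) x" "sl (Suc k) y" "sl (Suc k) z" "x \<preceq> y" "y \<preceq> z" "set x \<union> set y \<union> set z \<subseteq> J"
      show "A (map f y) (map f z) \<bullet> A (map f x) (map f y) = A (map f x) (map f z)"
        by (rule diag_C[OF WD_D(1)[OF A]]) (use h sl le st in auto)
    next
      fix x assume h: "sl (Suc k) x" "\<not> distinct x" "set x \<subseteq> J"
      have "\<not> distinct (map f x)" using h(2) by (simp add: distinct_map)
      thus "A (map f x) (map f x) = \<zero>" using WD_D(1)[OF A] sl[OF h(1,3)] st[OF h(3)] unfolding diag_def by blast
    qed
  next
    fix c assume c: "sl (k + 2) c \<and> set c \<subseteq> J"
    have L: "LEt A (map f c)" "FEt A (map f c)" using WD_D(2,3)[OF A, of "map f c"] sl st c by auto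
    show "LEt (\<lambda>x y. A (map f x) (map f y)) c" unfolding LEt_def
    proof (intro allI impI)
      fix p a b q assume "c = p @ a # b # q"
      hence e: "map f c = map f p @ f a # f b # map f q" by simp
      have "inc (\<lambda>x y. A (map f x) (map f y)) p a b q = inc A (map f p) (f a) (f b) (map f q)"
        by (cases q) simp_all
      thus "ex (A (map f (p @ a # q)) (map f (p @ a # q))) (inc (\<lambda>x y. A (map f x) (map f y)) p a b q) (A (map f (p @ a # q)) (map f (p @ b # q)))"
        using LEtD[OF L(1) e] by simp
    qed
    show "FEt (\<lambda>x y. A (map f x) (map f y)) c" unfolding FEt_def
    proof (intro allI impI)
      fix a b q assume "c = a # b # q"
      hence "map f c = f a # f b # map f q" by simp
      thus "ez (A (map f (b # q)) (map f (b # q))) (A (map f (a # q)) (map f (b # q)))" using L(2) unfolding FEt_def by simp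
    qed
  qed
qed

end

section \<open>Waldhausen diagrams in the monoid\<close>

context kc_cat begin

text \<open>Functoriality of \<open>F\<close> accounts for the first two clauses of
  \<open>diag\<close> and the vanishing at degenerate simplices for the third. A splitting
  \<open>\<gamma> = p @ a # b # q\<close> corresponds to the arrow with index
  \<open>i = length p + 1\<close>: \<open>face i\<close> omits \<open>b\<close> and
  \<open>face (i - 1)\<close> omits \<open>a\<close>.\<close>

lemma waldhausen_iff:
  assumes F: "is_functor (simplex_cat k n) C F"
  shows "waldhausen_diagram C (kc_monos C) (kc_epis C) k n F \<longleftrightarrow> m.WDn k n (\<lambda>x y. lift (arr_map F (x, y)))"
    (is "?W \<longleftrightarrow> m.WD k _ ?A")
proof -
  have sx: "x \<in> simplices k n \<longleftrightarrow> sl (Suc k) x \<and> set x \<subseteq> {0..n}" for x by (simp add: simplices_Xs Xs_def)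
  have O: "obj_map F x \<in> Obj C" if "x \<in> simplices k n" for x using functorD(1)[OF F] that by simp
  have Ah: "arr_map F (x, y) \<in> hom C (obj_map F x) (obj_map F y)" if "x \<in> simplices k n" "y \<in> simplices k n" "x \<preceq> y" for x y
    using functorD(2)[OF F, of "(x, y)"] that by simp
  have Ax: "?A x x = ob (obj_map F x)" if "x \<in> simplices k n" for x using functorD(3)[OF F, of x] that by (simp add: ob_def)
  have AH: "m.H (?A x x) (?A y y) (?A x y)" if "x \<in> simplices k n" "y \<in> simplices k n" "x \<preceq> y" for x y
    unfolding Ax[OF that(1)] Ax[OF that(2)] using lift_H[OF Ah[OF that]] .
  have d: "m.diag (Suc k) (\<lambda>S. S \<subseteq> {0..n}) ?A \<longleftrightarrow> (\<forall>\<beta>\<in>simplices k n. degenerate \<beta> \<longrightarrow> is_zero C (obj_map F \<beta>))"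
  proof
    assume "m.diag (Suc k) (\<lambda>S. S \<subseteq> {0..n}) ?A"
    hence z: "?A x x = None" if "sl (Suc k) x" "\<not> distinct x" "set x \<subseteq> {0..n}" for x using that unfolding m.diag_def by blast
    show "\<forall>\<beta>\<in>simplices k n. degenerate \<beta> \<longrightarrow> is_zero C (obj_map F \<beta>)"
    proof (intro ballI impI)
      fix \<beta> assume b: "\<beta> \<in> simplices k n" "degenerate \<beta>"
      hence "?A \<beta> \<beta> = None" using z[of \<beta>] degenerate_iff[of \<beta>] by (auto simp: sx sl_def)
      thus "is_zero C (obj_map F \<beta>)" unfolding Ax[OF b(1)] using ob_None[OF O[OF b(1)]] by blast
    qed
  next
    assume z: "\<forall>\<beta>\<in>simplices k n. degenerate \<beta> \<longrightarrow> is_zero C (obj_map F \<beta>)"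
    show "m.diag (Suc k) (\<lambda>S. S \<subseteq> {0..n}) ?A" unfolding m.diag_def
    proof (intro conjI allI impI)
      fix x y assume "sl (Suc k) x" "sl (Suc k) y" "x \<preceq> y" "set x \<union> set y \<subseteq> {0..n}"
      thus "m.H (?A x x) (?A y y) (?A x y)" using AH by (simp add: sx)
    next
      fix x y w assume "sl (Suc k) x" "sl (Suc k) y" "sl (Suc k) w" "x \<preceq> y" "y \<preceq> w" "set x \<union> set y \<union> set w \<subseteq> {0..n}"
      hence h: "x \<in> simplices k n" "y \<in> simplices k n" "w \<in> simplices k n" "x \<preceq> y" "y \<preceq> w" by (auto simp: sx)
      show "mmul (?A y w) (?A x y) = ?A x w"
        unfolding mmul_lift[OF Ah[OF h(1,2,4)] Ah[OF h(2,3,5)]] using functorD(4)[OF F, of "(x, y)" "(y, w)"] h by simp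
    next
      fix x assume "sl (Suc k) x" "\<not> distinct x" "set x \<subseteq> {0..n}"
      hence x: "x \<in> simplices k n" "degenerate x" using degenerate_iff[of x] by (auto simp: sx sl_def)
      thus "?A x x = None" unfolding Ax[OF x(1)] using z ob_None[OF O[OF x(1)]] by blast
    qed
  qed
  have e: "exact_seq C (kc_monos C) (kc_epis C) (k + 1) (\<lambda>i. arr_map F (face i \<gamma>, face (i - 1) \<gamma>)) \<longleftrightarrow> m.LEt ?A \<gamma> \<and> m.FEt ?A \<gamma>"
    if g: "\<gamma> \<in> simplices (k + 1) n" for \<gamma>
  proof -
    have fa: "face i \<gamma> \<in> simplices k n" "face (i - 1) \<gamma> \<in> simplices k n" "face i \<gamma> \<preceq> face (i - 1) \<gamma>" if "i \<in> {1..Suc k}" for i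
      using face_arr[of \<gamma> k n i] g that by auto
    have f0: "face i \<gamma> \<in> simplices k n" if "i \<le> Suc k" for i using fa[of i] fa(2)[of 1] that by (cases i) auto
    \<comment> \<open>For \<open>i = Suc k\<close> there is no incoming arrow, and exactness against
      \<open>None\<close> encodes the monomorphism at the left end.\<close>
    let ?E = "\<lambda>i. m.ex (?A (face i \<gamma>) (face i \<gamma>)) (if i = Suc k then None else ?A (face (Suc i) \<gamma>) (face i \<gamma>)) (?A (face i \<gamma>) (face (i - 1) \<gamma>))"
    have lg: "length \<gamma> = Suc (Suc k)" using g by (simp add: simplices_def)
    have pieces: "face (Suc (length p)) \<gamma> = p @ a # q" "face (length p) \<gamma> = p @ b # q" "length q = k - length p" "length p \<le> k"
      "m.inc ?A p a b q = (if Suc (length p) = Suc k then None else ?A (face (Suc (Suc (length p))) \<gamma>) (face (Suc (length p)) \<gamma>))"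
      if ge: "\<gamma> = p @ a # b # q" for p a b q
    proof -
      show 1: "face (Suc (length p)) \<gamma> = p @ a # q" using face_append[of \<gamma> "p @ [a]" b q] ge by simp
      show "face (length p) \<gamma> = p @ b # q" using face_append[OF ge] by simp
      show 2: "length q = k - length p" "length p \<le> k" using lg ge by auto
      show "m.inc ?A p a b q = (if Suc (length p) = Suc k then None else ?A (face (Suc (Suc (length p))) \<gamma>) (face (Suc (length p)) \<gamma>))"
      proof (cases q)
        case Nil
        thus ?thesis using 2 by (simp add: m.inc_def)
      next
        case (Cons w q')
        have "face (Suc (Suc (length p))) \<gamma> = p @ a # b # q'" using face_append[of \<gamma> "p @ [a, b]" w q'] ge Cons by simp
        thus ?thesis using 1 2 Cons by (auto simp: m.inc_def)
      qed
    qed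
    have L: "m.LEt ?A \<gamma> \<longleftrightarrow> (\<forall>i\<in>{1..Suc k}. ?E i)"
    proof
      assume L: "m.LEt ?A \<gamma>"
      show "\<forall>i\<in>{1..Suc k}. ?E i"
      proof
        fix i assume i: "i \<in> {1..Suc k}"
        have g': "\<gamma> \<in> simplices (Suc k) n" using g by simp
        obtain p a b q where s: "\<gamma> = p @ a # b # q" "length p = i - 1" by (rule simplex_split[OF g' i])
        have lp: "Suc (length p) = i" using s i by auto
        show "?E i" using m.LEtD[OF L s(1)] pieces[OF s(1)] unfolding lp[symmetric] by simp
      qed
    next
      assume E: "\<forall>i\<in>{1..Suc k}. ?E i"
      show "m.LEt ?A \<gamma>" unfolding m.LEt_def
      proof (intro allI impI)
        fix p a b q assume ge: "\<gamma> = p @ a # b # q"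
        note pc = pieces[OF ge]
        have "?E (Suc (length p))" by (rule bspec[OF E]) (use pc(4) in simp)
        thus "m.ex (?A (p @ a # q) (p @ a # q)) (m.inc ?A p a b q) (?A (p @ a # q) (p @ b # q))"
          using pc by simp
      qed
    qed
    have kz: "?E (Suc k) \<longleftrightarrow> m.kz (?A (face (Suc k) \<gamma>) (face (Suc k) \<gamma>)) (?A (face (Suc k) \<gamma>) (face k \<gamma>))"
      using m.ex_zero_left[OF AH[OF fa[of "Suc k"]]] by simp
    have Fe: "m.FEt ?A \<gamma> \<longleftrightarrow> m.ez (?A (face 0 \<gamma>) (face 0 \<gamma>)) (?A (face 1 \<gamma>) (face 0 \<gamma>))"
    proof -
      obtain a b q where ge: "\<gamma> = a # b # q" using lg by (metis length_Suc_conv)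
      thus ?thesis using pieces[of "[]" a b q] by (auto simp: m.FEt_def)
    qed
    have "exact_seq C (kc_monos C) (kc_epis C) (k + 1) (\<lambda>i. arr_map F (face i \<gamma>, face (i - 1) \<gamma>)) \<longleftrightarrow>
      m.kz (ob (obj_map F (face (k + 1) \<gamma>))) (?A (face (k + 1) \<gamma>) (face (k + 1 - 1) \<gamma>)) \<and>
      m.ez (ob (obj_map F (face 0 \<gamma>))) (?A (face 1 \<gamma>) (face (1 - 1) \<gamma>)) \<and>
      (\<forall>i. 0 < i \<and> i < k + 1 \<longrightarrow> m.ex (ob (obj_map F (face i \<gamma>))) (?A (face (Suc i) \<gamma>) (face (Suc i - 1) \<gamma>)) (?A (face i \<gamma>) (face (i - 1) \<gamma>)))"
      by (rule exact_seq_iff) (use Ah fa in auto)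
    also have "\<dots> \<longleftrightarrow> ?E (Suc k) \<and> m.FEt ?A \<gamma> \<and> (\<forall>i. 0 < i \<and> i < k + 1 \<longrightarrow> ?E i)"
      unfolding kz Fe using Ax[OF f0] by simp
    also have "\<dots> \<longleftrightarrow> m.LEt ?A \<gamma> \<and> m.FEt ?A \<gamma>"
    proof -
      have "{1..Suc k} = insert (Suc k) {i. 0 < i \<and> i < k + 1}" by auto
      hence S: "(\<forall>i\<in>{1..Suc k}. R i) \<longleftrightarrow> R (Suc k) \<and> (\<forall>i. 0 < i \<and> i < k + 1 \<longrightarrow> R i)" for R by simp
      show ?thesis unfolding L S[of ?E] by (intro iffI conjI; elim conjE; assumption)
    qed
    finally show ?thesis .
  qed
  have s2: "c \<in> simplices (k + 1) n \<longleftrightarrow> sl (k + 2) c \<and> set c \<subseteq> {0..n}" for c by (simp add: simplices_Xs Xs_def)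
  show ?thesis unfolding waldhausen_diagram_def m.WD_def d using e s2 by blast
qed

text \<open>The monoid does not remember which zero object stands at a vertex, so the objects
  \<open>w x\<close> have to be supplied. The arrows between them are then unique by
  \<open>lift_inj\<close>, which gives functoriality.\<close>

lemma realize:
  assumes A: "m.WDn k n A" and w: "\<And>x. x \<in> simplices k n \<Longrightarrow> w x \<in> Obj C \<and> ob (w x) = A x x"
  obtains G where "is_functor (simplex_cat k n) C G" "extensional_ftr (simplex_cat k n) G" "waldhausen_diagram C (kc_monos C) (kc_epis C) k n G"
    "\<And>x. x \<in> simplices k n \<Longrightarrow> obj_map G x = w x"
    "\<And>x y. x \<in> simplices k n \<Longrightarrow> y \<in> simplices k n \<Longrightarrow> x \<preceq> y \<Longrightarrow> lift (arr_map G (x, y)) = A x y"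
proof -
  have sx: "x \<in> simplices k n \<longleftrightarrow> sl (Suc k) x \<and> set x \<subseteq> {0..n}" for x by (simp add: simplices_Xs Xs_def)
  have "\<exists>f\<in>hom C (w x) (w y). lift f = A x y" if h: "x \<in> simplices k n" "y \<in> simplices k n" "x \<preceq> y" for x y
  proof -
    have "m.H (A x x) (A y y) (A x y)" by (rule m.diag_H[OF m.WD_D(1)[OF A]]) (use h in \<open>auto simp: sx\<close>)
    thus ?thesis using H_iff[of "w x" "w y" "A x y"] w[OF h(1)] w[OF h(2)] by auto
  qed
  then obtain t where t: "\<And>x y. x \<in> simplices k n \<Longrightarrow> y \<in> simplices k n \<Longrightarrow> x \<preceq> y \<Longrightarrow> t x y \<in> hom C (w x) (w y) \<and> lift (t x y) = A x y"
    by metis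
  define G :: "(nat list, nat list \<times> nat list, 'o, 'm) ftr" where
    "G = \<lparr>obj_map = restrict w (simplices k n), arr_map = restrict (\<lambda>(x, y). t x y) (Arr (simplex_cat k n))\<rparr>"
  have go: "obj_map G x = w x" if "x \<in> simplices k n" for x using that by (simp add: G_def)
  have ga: "arr_map G (x, y) = t x y" if "x \<in> simplices k n" "y \<in> simplices k n" "x \<preceq> y" for x y using that by (simp add: G_def)
  have ex: "extensional_ftr (simplex_cat k n) G" by (simp add: extensional_ftr_def G_def)
  have fG: "is_functor (simplex_cat k n) C G" unfolding is_functor_def
  proof (intro conjI ballI impI)
    fix x assume "x \<in> Obj (simplex_cat k n)"
    hence x: "x \<in> simplices k n" by simp
    show "obj_map G x \<in> Obj C" using go[OF x] w[OF x] by simp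
    have tx: "t x x \<in> hom C (w x) (w x)" "lift (t x x) = A x x" using t[OF x x] by auto
    have "lift (t x x) = lift (Id C (w x))" using tx(2) w[OF x] by (simp add: ob_def)
    hence "t x x = Id C (w x)" using lift_inj[OF tx(1) id_closed] w[OF x] by blast
    thus "arr_map G (Id (simplex_cat k n) x) = Id C (obj_map G x)" using ga[OF x x] go[OF x] by simp
  next
    fix f assume f: "f \<in> Arr (simplex_cat k n)"
    obtain x y where xy: "f = (x, y)" by (cases f)
    have h: "x \<in> simplices k n" "y \<in> simplices k n" "x \<preceq> y" using f xy by auto
    show "arr_map G f \<in> hom C (obj_map G (Dom (simplex_cat k n) f)) (obj_map G (Cod (simplex_cat k n) f))"
      using t[OF h] ga[OF h] go[OF h(1)] go[OF h(2)] xy by simp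
    fix g assume g: "g \<in> Arr (simplex_cat k n)" "Dom (simplex_cat k n) g = Cod (simplex_cat k n) f"
    then obtain v where v: "g = (y, v)" using xy by (cases g) simp
    have h': "v \<in> simplices k n" "y \<preceq> v" using g v by auto
    have xv: "x \<preceq> v" using list_le_trans[OF h(3) h'(2)] .
    note t1 = t[OF h] and t2 = t[OF h(2) h'] and t3 = t[OF h(1) h'(1) xv]
    have "mmul (A y v) (A x y) = A x v" by (rule m.diag_C[OF m.WD_D(1)[OF A]]) (use h h' in \<open>auto simp: sx\<close>)
    hence "lift (t y v \<cdot> t x y) = lift (t x v)" using mmul_lift[of "t x y" "w x" "w y" "t y v" "w v"] t1 t2 t3 by simp
    hence "t x v = t y v \<cdot> t x y" using lift_inj[OF conjunct1[OF t3] comp_closed[OF conjunct1[OF t1] conjunct1[OF t2]]] by simp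
    thus "arr_map G (g \<cdot>\<^bsub>simplex_cat k n\<^esub> f) = arr_map G g \<cdot> arr_map G f"
      using ga[OF h] ga[OF h(2) h'] ga[OF h(1) h'(1) xv] xy v by simp
  qed
  have la: "lift (arr_map G (x, y)) = A x y" if h: "x \<in> simplices k n" "y \<in> simplices k n" "x \<preceq> y" for x y
    using t[OF h] ga[OF h] by simp
  have "m.WDn k n (\<lambda>x y. lift (arr_map G (x, y)))"
    by (rule m.WD_cong[OF A]) (auto simp: la sx)
  thus ?thesis using that[OF fG ex] waldhausen_iff[OF fG] go la by blast
qed

end

section \<open>The Segal condition\<close>

lemma pl_homD:
  assumes f: "f \<in> hom (pseudo_limit P D R) x y"
  shows "pl_src f = x" "pl_tgt f = y" "pl_comp f \<in> extensional P"
    "i \<in> P \<Longrightarrow> pl_comp f i \<in> hom (D i) (pl_val x i) (pl_val y i)"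
    "i \<in> P \<Longrightarrow> j \<in> P \<Longrightarrow> j \<le> i \<Longrightarrow> pl_comp f j \<cdot>\<^bsub>D j\<^esub> pl_iso x j i = pl_iso y j i \<cdot>\<^bsub>D j\<^esub> arr_map (R j i) (pl_comp f i)"
proof -
  note p = f[unfolded pl_hom]
  note q = p[THEN conjunct2, THEN conjunct2, THEN conjunct2, THEN conjunct2]
  show "pl_src f = x" "pl_tgt f = y" by (rule p[THEN conjunct1], rule p[THEN conjunct2, THEN conjunct1])
  show "pl_comp f \<in> extensional P" using q[THEN conjunct1] by (simp add: PiE_def)
  show "i \<in> P \<Longrightarrow> pl_comp f i \<in> hom (D i) (pl_val x i) (pl_val y i)" using PiE_mem[OF q[THEN conjunct1]] .
  show "i \<in> P \<Longrightarrow> j \<in> P \<Longrightarrow> j \<le> i \<Longrightarrow> pl_comp f j \<cdot>\<^bsub>D j\<^esub> pl_iso x j i = pl_iso y j i \<cdot>\<^bsub>D j\<^esub> arr_map (R j i) (pl_comp f i)"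
    using q[THEN conjunct2] by blast
qed

lemma pl_isoI:
  assumes D: "\<And>i. i \<in> P \<Longrightarrow> category (D i)" and R: "\<And>i j. i \<in> P \<Longrightarrow> j \<in> P \<Longrightarrow> j \<le> i \<Longrightarrow> is_functor (D i) (D j) (R j i)"
    and f: "f \<in> hom (pseudo_limit P D R) x y" and iso: "\<And>i. i \<in> P \<Longrightarrow> iso_arr (D i) (pl_comp f i)"
  shows "iso_arr (pseudo_limit P D R) f"
proof -
  have x: "x \<in> pl_objects P D R" and y: "y \<in> pl_objects P D R" using f by (auto simp: pl_hom)
  have src: "pl_src f = x" "pl_tgt f = y" using pl_homD(1,2)[OF f] .
  have fi: "pl_comp f i \<in> hom (D i) (pl_val x i) (pl_val y i)" if "i \<in> P" for i using pl_homD(4)[OF f that] .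
  have "\<exists>g. g \<in> hom (D i) (pl_val y i) (pl_val x i) \<and> g \<cdot>\<^bsub>D i\<^esub> pl_comp f i = Id (D i) (pl_val x i) \<and> pl_comp f i \<cdot>\<^bsub>D i\<^esub> g = Id (D i) (pl_val y i)" if "i \<in> P" for i
    using iso_arrE[OF iso[OF that] fi[OF that]] by metis
  then obtain g where g: "\<And>i. i \<in> P \<Longrightarrow> g i \<in> hom (D i) (pl_val y i) (pl_val x i)"
    and gf: "\<And>i. i \<in> P \<Longrightarrow> g i \<cdot>\<^bsub>D i\<^esub> pl_comp f i = Id (D i) (pl_val x i)" and fg: "\<And>i. i \<in> P \<Longrightarrow> pl_comp f i \<cdot>\<^bsub>D i\<^esub> g i = Id (D i) (pl_val y i)"
    by metis
  have gc: "g j \<cdot>\<^bsub>D j\<^esub> pl_iso y j i = pl_iso x j i \<cdot>\<^bsub>D j\<^esub> arr_map (R j i) (g i)" if ij: "i \<in> P" "j \<in> P" "j \<le> i" for i j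
  proof -
    interpret Dj: category "D j" using D ij by blast
    note Rij = R[OF ij]
    note ix = pl_objD(2)[OF x ij] and iy = pl_objD(2)[OF y ij]
    note Rf = functorD(5)[OF Rij fi[OF ij(1)]] and Rg = functorD(5)[OF Rij g[OF ij(1)]]
    have n: "pl_comp f j \<cdot>\<^bsub>D j\<^esub> pl_iso x j i = pl_iso y j i \<cdot>\<^bsub>D j\<^esub> arr_map (R j i) (pl_comp f i)" using pl_homD(5)[OF f ij] .
    have RR: "arr_map (R j i) (pl_comp f i) \<cdot>\<^bsub>D j\<^esub> arr_map (R j i) (g i) = Id (D j) (obj_map (R j i) (pl_val y i))"
      using functorD(6)[OF Rij g[OF ij(1)] fi[OF ij(1)]] fg[OF ij(1)] functorD(3)[OF Rij pl_objD(1)[OF y ij(1)]] by simp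
    have "pl_iso y j i = pl_iso y j i \<cdot>\<^bsub>D j\<^esub> (arr_map (R j i) (pl_comp f i) \<cdot>\<^bsub>D j\<^esub> arr_map (R j i) (g i))"
      unfolding RR using Dj.id_right[OF iy] by simp
    also have "\<dots> = (pl_comp f j \<cdot>\<^bsub>D j\<^esub> pl_iso x j i) \<cdot>\<^bsub>D j\<^esub> arr_map (R j i) (g i)"
      using Dj.assoc[OF Rg Rf iy] n by simp
    also have "\<dots> = pl_comp f j \<cdot>\<^bsub>D j\<^esub> (pl_iso x j i \<cdot>\<^bsub>D j\<^esub> arr_map (R j i) (g i))"
      by (rule Dj.assoc[OF Rg ix fi[OF ij(2)]])
    finally have "g j \<cdot>\<^bsub>D j\<^esub> pl_iso y j i = g j \<cdot>\<^bsub>D j\<^esub> (pl_comp f j \<cdot>\<^bsub>D j\<^esub> (pl_iso x j i \<cdot>\<^bsub>D j\<^esub> arr_map (R j i) (g i)))" by simp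
    also have "\<dots> = (g j \<cdot>\<^bsub>D j\<^esub> pl_comp f j) \<cdot>\<^bsub>D j\<^esub> (pl_iso x j i \<cdot>\<^bsub>D j\<^esub> arr_map (R j i) (g i))"
      using Dj.assoc[OF Dj.comp_closed[OF Rg ix] fi[OF ij(2)] g[OF ij(2)]] by simp
    finally show ?thesis unfolding gf[OF ij(2)] Dj.id_left[OF Dj.comp_closed[OF Rg ix]] .
  qed
  define h where "h = \<lparr>pl_src = y, pl_tgt = x, pl_comp = restrict g P\<rparr>"
  have h: "h \<in> hom (pseudo_limit P D R) y x" using x y g gc by (auto simp: pl_hom h_def)
  show ?thesis
    by (rule iso_arrI[OF f h]) (use src gf fg in \<open>auto simp: h_def intro!: pl_arr_eqI restrict_ext\<close>)
qed

lemma natural_simplex: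
  "natural (simplex_cat k p) C F G \<eta> \<longleftrightarrow> (\<forall>x\<in>simplices k p. \<eta> x \<in> hom C (obj_map F x) (obj_map G x)) \<and>
    (\<forall>x\<in>simplices k p. \<forall>y\<in>simplices k p. x \<preceq> y \<longrightarrow> \<eta> y \<cdot>\<^bsub>C\<^esub> arr_map F (x, y) = arr_map G (x, y) \<cdot>\<^bsub>C\<^esub> \<eta> x)"
proof -
  have "(\<forall>f\<in>Arr (simplex_cat k p). Q (fst f) (snd f)) \<longleftrightarrow> (\<forall>x\<in>simplices k p. \<forall>y\<in>simplices k p. x \<preceq> y \<longrightarrow> Q x y)" for Q
    by (auto simp: simplex_cat_def poset_cat_def)
  from this[of "\<lambda>x y. \<eta> y \<cdot>\<^bsub>C\<^esub> arr_map F (x, y) = arr_map G (x, y) \<cdot>\<^bsub>C\<^esub> \<eta> x"] show ?thesis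
    unfolding natural_def by simp
qed

section \<open>Waldhausen categories and restriction to subsets\<close>

context kc_cat begin

abbreviation W :: "nat \<Rightarrow> ((nat list, nat list \<times> nat list, 'o, 'm) ftr, (nat list, nat list \<times> nat list, 'o, 'm) nat_trans) simplicial_cat" where
  "W k \<equiv> waldhausen k C (kc_monos C) (kc_epis C)"

lemma W_obj: "F \<in> Obj (scat (W k) p) \<longleftrightarrow> is_functor (simplex_cat k p) C F \<and> extensional_ftr (simplex_cat k p) F \<and>
    waldhausen_diagram C (kc_monos C) (kc_epis C) k p F"
  by (simp add: waldhausen_def)

lemma W_hom: "\<sigma> \<in> hom (scat (W k) p) F G \<longleftrightarrow> F \<in> Obj (scat (W k) p) \<and> G \<in> Obj (scat (W k) p) \<and> nt_src \<sigma> = F \<and> nt_tgt \<sigma> = G \<and>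
    natural (simplex_cat k p) C F G (nt_comp \<sigma>) \<and> nt_comp \<sigma> \<in> extensional (simplices k p)"
  unfolding W_obj by (auto simp: waldhausen_def full_hom functor_cat_hom)

lemma W_simps:
  "Id (scat (W k) p) F = \<lparr>nt_src = F, nt_tgt = F, nt_comp = (\<lambda>x\<in>simplices k p. Id C (obj_map F x))\<rparr>"
  "\<tau> \<cdot>\<^bsub>scat (W k) p\<^esub> \<sigma> = \<lparr>nt_src = nt_src \<sigma>, nt_tgt = nt_tgt \<tau>, nt_comp = (\<lambda>x\<in>simplices k p. nt_comp \<tau> x \<cdot> nt_comp \<sigma> x)\<rparr>"
  by (simp_all add: waldhausen_def)

lemma W_natD:
  assumes "\<sigma> \<in> hom (scat (W k) p) F G"
  shows "x \<in> simplices k p \<Longrightarrow> nt_comp \<sigma> x \<in> hom C (obj_map F x) (obj_map G x)"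
    "x \<in> simplices k p \<Longrightarrow> y \<in> simplices k p \<Longrightarrow> x \<preceq> y \<Longrightarrow> nt_comp \<sigma> y \<cdot> arr_map F (x, y) = arr_map G (x, y) \<cdot> nt_comp \<sigma> x"
  using assms unfolding W_hom natural_simplex by blast+

lemma W_isoI:
  assumes s: "\<sigma> \<in> hom (scat (W k) p) F G" and iso: "\<And>x. x \<in> simplices k p \<Longrightarrow> iso_arr C (nt_comp \<sigma> x)"
  shows "iso_arr (scat (W k) p) \<sigma>"
proof -
  note n = W_natD[OF s]
  have FG: "F \<in> Obj (scat (W k) p)" "G \<in> Obj (scat (W k) p)" and src: "nt_src \<sigma> = F" "nt_tgt \<sigma> = G" using s by (auto simp: W_hom)
  have Fh: "arr_map F (x, y) \<in> hom C (obj_map F x) (obj_map F y)" "arr_map G (x, y) \<in> hom C (obj_map G x) (obj_map G y)"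
    if "x \<in> simplices k p" "y \<in> simplices k p" "x \<preceq> y" for x y
    using functorD(2)[of "simplex_cat k p" C F "(x, y)"] functorD(2)[of "simplex_cat k p" C G "(x, y)"] FG that by (auto simp: W_obj)
  have "\<exists>g. g \<in> hom C (obj_map G x) (obj_map F x) \<and> g \<cdot> nt_comp \<sigma> x = Id C (obj_map F x) \<and> nt_comp \<sigma> x \<cdot> g = Id C (obj_map G x)"
    if "x \<in> simplices k p" for x using iso_arrE[OF iso[OF that] n(1)[OF that]] by metis
  then obtain g where g: "\<And>x. x \<in> simplices k p \<Longrightarrow> g x \<in> hom C (obj_map G x) (obj_map F x)"
    and gs: "\<And>x. x \<in> simplices k p \<Longrightarrow> g x \<cdot> nt_comp \<sigma> x = Id C (obj_map F x)" and sg: "\<And>x. x \<in> simplices k p \<Longrightarrow> nt_comp \<sigma> x \<cdot> g x = Id C (obj_map G x)"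
    by metis
  have gn: "g y \<cdot> arr_map G (x, y) = arr_map F (x, y) \<cdot> g x" if h: "x \<in> simplices k p" "y \<in> simplices k p" "x \<preceq> y" for x y
  proof -
    note Fxy = Fh[OF h]
    have "arr_map F (x, y) \<cdot> g x = (g y \<cdot> nt_comp \<sigma> y) \<cdot> (arr_map F (x, y) \<cdot> g x)"
      unfolding gs[OF h(2)] id_left[OF comp_closed[OF g[OF h(1)] Fxy(1)]] ..
    also have "\<dots> = g y \<cdot> (nt_comp \<sigma> y \<cdot> (arr_map F (x, y) \<cdot> g x))"
      by (rule assoc[OF comp_closed[OF g[OF h(1)] Fxy(1)] n(1)[OF h(2)] g[OF h(2)]])
    also have "nt_comp \<sigma> y \<cdot> (arr_map F (x, y) \<cdot> g x) = (arr_map G (x, y) \<cdot> nt_comp \<sigma> x) \<cdot> g x"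
      using assoc[OF g[OF h(1)] Fxy(1) n(1)[OF h(2)]] n(2)[OF h] by simp
    also have "\<dots> = arr_map G (x, y)" using assoc[OF g[OF h(1)] n(1)[OF h(1)] Fxy(2)] sg[OF h(1)] id_right[OF Fxy(2)] by simp
    finally show ?thesis by simp
  qed
  define t where "t = \<lparr>nt_src = G, nt_tgt = F, nt_comp = restrict g (simplices k p)\<rparr>"
  have t: "t \<in> hom (scat (W k) p) G F" using FG g gn by (auto simp: W_hom natural_simplex t_def)
  show ?thesis
    by (rule iso_arrI[OF s t]) (use src gs sg in \<open>auto simp: W_simps t_def intro!: restrict_ext\<close>)
qed

lemma W_isoD:
  assumes i: "iso_arr (scat (W k) p) \<sigma>" and s: "\<sigma> \<in> hom (scat (W k) p) F G" and x: "x \<in> simplices k p"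
  shows "iso_arr C (nt_comp \<sigma> x)"
proof -
  obtain t where t: "t \<in> hom (scat (W k) p) G F" "t \<cdot>\<^bsub>scat (W k) p\<^esub> \<sigma> = Id (scat (W k) p) F" "\<sigma> \<cdot>\<^bsub>scat (W k) p\<^esub> t = Id (scat (W k) p) G"
    using iso_arrE[OF i s] .
  have "nt_comp (t \<cdot>\<^bsub>scat (W k) p\<^esub> \<sigma>) x = nt_comp (Id (scat (W k) p) F) x" "nt_comp (\<sigma> \<cdot>\<^bsub>scat (W k) p\<^esub> t) x = nt_comp (Id (scat (W k) p) G) x"
    unfolding t(2,3) by simp_all
  thus ?thesis using iso_arrI[OF W_natD(1)[OF s x] W_natD(1)[OF t(1) x]] x by (simp add: W_simps)
qed

text \<open>In vertex coordinates restriction changes nothing: \<open>incl J I\<close> sends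
  positions in \<open>J\<close> to positions in \<open>I\<close> of the same vertices.\<close>

lemma restr_simps:
  assumes I: "finite I" "J \<subseteq> I" "J \<noteq> {}"
  shows "sl (Suc k) x \<Longrightarrow> set x \<subseteq> J \<Longrightarrow> obj_map (obj_map (restr_at (W k) J I) F) (rkl J x) = obj_map F (rkl I x)"
    "sl (Suc k) x \<Longrightarrow> set x \<subseteq> J \<Longrightarrow> sl (Suc k) y \<Longrightarrow> set y \<subseteq> J \<Longrightarrow> x \<preceq> y \<Longrightarrow>
      arr_map (obj_map (restr_at (W k) J I) F) (rkl J x, rkl J y) = arr_map F (rkl I x, rkl I y)"
    "sl (Suc k) x \<Longrightarrow> set x \<subseteq> J \<Longrightarrow> nt_comp (arr_map (restr_at (W k) J I) \<sigma>) (rkl J x) = nt_comp \<sigma> (rkl I x)"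
proof -
  have J: "finite J" using I finite_subset by blast
  have e: "obj_map (restr_at (W k) J I) F = pullback_ftr (simplex_cat k (set_dim J)) (postcomp_ftr (incl J I)) F"
    by (simp add: restr_at_def waldhausen_def precomp_ftr_def)
  note pp = pullback_postcomp[OF incl_simplex[OF I]]
  show "obj_map (obj_map (restr_at (W k) J I) F) (rkl J x) = obj_map F (rkl I x)" if "sl (Suc k) x" "set x \<subseteq> J"
    unfolding e pp(1)[OF rkl_simplices[OF J that(2,1)]] incl_rkl[OF J that(2)] ..
  show "arr_map (obj_map (restr_at (W k) J I) F) (rkl J x, rkl J y) = arr_map F (rkl I x, rkl I y)"
    if "sl (Suc k) x" "set x \<subseteq> J" "sl (Suc k) y" "set y \<subseteq> J" "x \<preceq> y"
    unfolding e pp(2)[OF rkl_simplices[OF J that(2,1)] rkl_simplices[OF J that(4,3)] rkl_le[OF J that(5)]] incl_rkl[OF J that(2)] incl_rkl[OF J that(4)] ..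
  show "nt_comp (arr_map (restr_at (W k) J I) \<sigma>) (rkl J x) = nt_comp \<sigma> (rkl I x)" if "sl (Suc k) x" "set x \<subseteq> J"
    using rkl_simplices[OF J that(2,1)] incl_rkl[OF J that(2), of I] by (simp add: restr_at_def waldhausen_def precomp_ftr_def postcomp_ftr_def)
qed

lemma restr_src: "nt_src (arr_map (restr_at (W k) J I) \<sigma>) = obj_map (restr_at (W k) J I) (nt_src \<sigma>)"
    "nt_tgt (arr_map (restr_at (W k) J I) \<sigma>) = obj_map (restr_at (W k) J I) (nt_tgt \<sigma>)"
  by (simp_all add: restr_at_def waldhausen_def precomp_ftr_def)

lemma W_category: "category (scat (W k) p)"
  using waldhausen_simplicial[OF category_axioms] unfolding is_simplicial_cat_def by blast

lemma restr_functor: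
  assumes "finite I" "J \<subseteq> I" "J \<noteq> {}"
  shows "is_functor (val_at (W k) I) (val_at (W k) J) (restr_at (W k) J I)"
  using waldhausen_simplicial[OF category_axioms, of k "kc_monos C" "kc_epis C"] incl_simplex[OF assms]
  unfolding is_simplicial_cat_def val_at_def restr_at_def by blast

lemma restr_restr:
  assumes "finite N" "I \<subseteq> N" "J \<subseteq> I" "J \<noteq> {}"
  shows "F \<in> Obj (val_at (W k) N) \<Longrightarrow> obj_map (restr_at (W k) J I) (obj_map (restr_at (W k) I N) F) = obj_map (restr_at (W k) J N) F"
    "\<sigma> \<in> Arr (val_at (W k) N) \<Longrightarrow> arr_map (restr_at (W k) J I) (arr_map (restr_at (W k) I N) \<sigma>) = arr_map (restr_at (W k) J N) \<sigma>"
proof -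
  have I: "finite I" "I \<noteq> {}" using assms finite_subset by blast+
  have "functor_eq_on (scat (W k) (set_dim N)) (sact (W k) (set_dim J) (set_dim N) (comp_mono (incl I N) (incl J I)))
          (comp_ftr (sact (W k) (set_dim J) (set_dim I) (incl J I)) (sact (W k) (set_dim I) (set_dim N) (incl I N)))"
    using waldhausen_simplicial[OF category_axioms, of k "kc_monos C" "kc_epis C"]
      incl_simplex[OF assms(1,2) I(2)] incl_simplex[OF I(1) assms(3,4)] unfolding is_simplicial_cat_def by blast
  thus "F \<in> Obj (val_at (W k) N) \<Longrightarrow> obj_map (restr_at (W k) J I) (obj_map (restr_at (W k) I N) F) = obj_map (restr_at (W k) J N) F"
    "\<sigma> \<in> Arr (val_at (W k) N) \<Longrightarrow> arr_map (restr_at (W k) J I) (arr_map (restr_at (W k) I N) \<sigma>) = arr_map (restr_at (W k) J N) \<sigma>"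
    unfolding incl_trans[OF I(1) assms(3)] functor_eq_on_def by (simp_all add: val_at_def restr_at_def comp_ftr_def)
qed

lemma W_WD:
  assumes "F \<in> Obj (scat (W k) n)"
  shows "m.WDn k n (\<lambda>x y. lift (arr_map F (x, y)))" "x \<in> simplices k n \<Longrightarrow> obj_map F x \<in> Obj C"
    "x \<in> simplices k n \<Longrightarrow> arr_map F (x, x) = Id C (obj_map F x)"
    "x \<in> simplices k n \<Longrightarrow> y \<in> simplices k n \<Longrightarrow> x \<preceq> y \<Longrightarrow> arr_map F (x, y) \<in> hom C (obj_map F x) (obj_map F y)"
proof -
  have F: "is_functor (simplex_cat k n) C F" "waldhausen_diagram C (kc_monos C) (kc_epis C) k n F" using assms by (auto simp: W_obj)
  show "m.WDn k n (\<lambda>x y. lift (arr_map F (x, y)))" using waldhausen_iff[OF F(1)] F(2) by blast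
  show "x \<in> simplices k n \<Longrightarrow> obj_map F x \<in> Obj C" "x \<in> simplices k n \<Longrightarrow> arr_map F (x, x) = Id C (obj_map F x)"
    "x \<in> simplices k n \<Longrightarrow> y \<in> simplices k n \<Longrightarrow> x \<preceq> y \<Longrightarrow> arr_map F (x, y) \<in> hom C (obj_map F x) (obj_map F y)"
    using functorD(1)[OF F(1), of x] functorD(3)[OF F(1), of x] functorD(2)[OF F(1), of "(x, y)"] by auto
qed

lemma nat_trI:
  assumes F: "F \<in> Obj (scat (W k) n)" and G: "G \<in> Obj (scat (W k) n)"
    and s: "\<And>x. x \<in> simplices k n \<Longrightarrow> P (set x) \<Longrightarrow> s x \<in> hom C (obj_map F x) (obj_map G x)"
    and n: "\<And>x y. x \<in> simplices k n \<Longrightarrow> y \<in> simplices k n \<Longrightarrow> x \<preceq> y \<Longrightarrow> P (set x \<union> set y) \<Longrightarrow> s y \<cdot> arr_map F (x, y) = arr_map G (x, y) \<cdot> s x"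
    and P: "\<And>S T. P S \<Longrightarrow> T \<subseteq> S \<Longrightarrow> P T"
  shows "m.nat_tr k n P (\<lambda>x y. lift (arr_map F (x, y))) (\<lambda>x y. lift (arr_map G (x, y))) (\<lambda>x. lift (s x))"
  unfolding m.nat_tr_def simplices_Xs[symmetric]
proof (intro conjI ballI impI)
  fix x assume x: "x \<in> simplices k n" "P (set x)"
  show "m.H (lift (arr_map F (x, x))) (lift (arr_map G (x, x))) (lift (s x))"
    using lift_H[OF s[OF x]] W_WD(3)[OF F x(1)] W_WD(3)[OF G x(1)] by (simp add: ob_def)
next
  fix x y assume h: "x \<in> simplices k n" "y \<in> simplices k n" "x \<preceq> y" "P (set x \<union> set y)"
  have p: "P (set x)" "P (set y)" using P[OF h(4)] by auto
  show "mmul (lift (s y)) (lift (arr_map F (x, y))) = mmul (lift (arr_map G (x, y))) (lift (s x))"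
    unfolding mmul_lift[OF W_WD(4)[OF F h(1-3)] s[OF h(2) p(2)]] mmul_lift[OF s[OF h(1) p(1)] W_WD(4)[OF G h(1-3)]] n[OF h] ..
qed

section \<open>Comparison with the pseudo-limit for a family of subsets\<close>

context
  fixes k n :: nat and P :: "nat set set" and P' :: "nat set \<Rightarrow> bool"
  assumes good: "m.good k n P'" and P: "\<And>J. J \<in> P \<longleftrightarrow> J \<noteq> {} \<and> P' J"
    and mono: "\<And>S T. P' S \<Longrightarrow> T \<subseteq> S \<Longrightarrow> P' T" and sub: "\<And>S. P' S \<Longrightarrow> S \<subseteq> {0..n}"
begin

lemma good_extend:
  assumes "m.WD k P' A"
  obtains E where "m.WDn k n E"
    "\<And>x y. x \<in> simplices k n \<Longrightarrow> y \<in> simplices k n \<Longrightarrow> x \<preceq> y \<Longrightarrow> P' (set x \<union> set y) \<Longrightarrow> E x y = A x y"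
  using good[unfolded m.good_def, THEN conjunct1, rule_format, OF assms] unfolding simplices_Xs by (elim exE conjE) metis

lemma good_tr:
  assumes "m.WDn k n A" "m.WDn k n B" "m.nat_tr k n P' A B \<sigma>"
  obtains \<tau> where "m.nat_tr k n (\<lambda>S. True) A B \<tau>" "\<And>x. x \<in> simplices k n \<Longrightarrow> P' (set x) \<Longrightarrow> \<tau> x = \<sigma> x"
  using good[unfolded m.good_def, THEN conjunct2, THEN conjunct1, rule_format, OF assms] unfolding simplices_Xs by (elim exE conjE) metis

lemma good_unique:
  assumes "m.WDn k n A" "m.WDn k n B"
    "m.nat_tr k n (\<lambda>S. True) A B \<sigma>" "m.nat_tr k n (\<lambda>S. True) A B \<tau>"
    "\<And>x. x \<in> simplices k n \<Longrightarrow> P' (set x) \<Longrightarrow> \<sigma> x = \<tau> x" "x \<in> simplices k n"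
  shows "\<sigma> x = \<tau> x"
  using good[unfolded m.good_def, THEN conjunct2, THEN conjunct2, rule_format, OF assms(1-4)] assms(5,6) unfolding simplices_Xs by blast

abbreviation "Q I \<equiv> restr_at (W k) I {0..n}"
abbreviation "PL \<equiv> pseudo_limit P (val_at (W k)) (restr_at (W k))"

lemma PD: "J \<in> P \<Longrightarrow> finite J" "J \<in> P \<Longrightarrow> J \<noteq> {}" "J \<in> P \<Longrightarrow> J \<subseteq> {0..n}" "J \<in> P \<Longrightarrow> P' J"
  using P sub finite_subset[of J "{0..n}"] by auto

lemma sl_simplex: "sl (Suc k) x \<Longrightarrow> set x \<subseteq> J \<Longrightarrow> J \<in> P \<Longrightarrow> x \<in> simplices k n"
  using PD(3) by (auto simp: simplices_def sl_def)

lemma set_P: "x \<in> simplices k n \<Longrightarrow> P' (set x) \<Longrightarrow> set x \<in> P"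
  using P by (auto simp: simplices_def)

lemma simplex_sl: "x \<in> simplices k n \<Longrightarrow> sl (Suc k) x"
  by (simp add: simplices_def sl_def)

lemma val_category: "category (val_at (W k) J)"
  unfolding val_at_def by (rule W_category)

lemma P_functor: "I \<in> P \<Longrightarrow> J \<in> P \<Longrightarrow> J \<le> I \<Longrightarrow> is_functor (val_at (W k) I) (val_at (W k) J) (restr_at (W k) J I)"
  by (rule restr_functor) (auto simp: PD)

lemma val_full: "val_at (W k) {0..n} = scat (W k) n"
  by (simp add: val_at_def)

lemma Q_functor: "I \<in> P \<Longrightarrow> is_functor (scat (W k) n) (val_at (W k) I) (Q I)"
  using restr_functor[of "{0..n}" I k] PD unfolding val_full by blast

lemma segal_functor: "is_functor (scat (W k) n) PL (pl_induced (scat (W k) n) P (val_at (W k)) Q)"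
proof (rule pl_induced_functor[OF W_category val_category P_functor Q_functor])
  fix I J F assume "I \<in> P" "J \<in> P" "J \<le> I" "F \<in> Obj (scat (W k) n)"
  thus "obj_map (restr_at (W k) J I) (obj_map (Q I) F) = obj_map (Q J) F"
    using restr_restr(1)[of "{0..n}" I J F k] PD unfolding val_full by blast
next
  fix I J \<sigma> assume "I \<in> P" "J \<in> P" "J \<le> I" "\<sigma> \<in> Arr (scat (W k) n)"
  thus "arr_map (restr_at (W k) J I) (arr_map (Q I) \<sigma>) = arr_map (Q J) \<sigma>"
    using restr_restr(2)[of "{0..n}" I J \<sigma> k] PD unfolding val_full by blast
qed

lemma Q_simps:
  assumes "J \<in> P" "sl (Suc k) x" "set x \<subseteq> J"
  shows "obj_map (obj_map (Q J) F) (rkl J x) = obj_map F x"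
    "sl (Suc k) y \<Longrightarrow> set y \<subseteq> J \<Longrightarrow> x \<preceq> y \<Longrightarrow> arr_map (obj_map (Q J) F) (rkl J x, rkl J y) = arr_map F (x, y)"
    "nt_comp (arr_map (Q J) \<sigma>) (rkl J x) = nt_comp \<sigma> x"
proof -
  have f: "rkl {0..n} y = y" if "set y \<subseteq> J" for y by (rule rkl_full) (use that PD(3)[OF assms(1)] in blast)
  note r = restr_simps[of "{0..n}" J k, OF _ PD(3)[OF assms(1)] PD(2)[OF assms(1)]]
  show "obj_map (obj_map (Q J) F) (rkl J x) = obj_map F x" "nt_comp (arr_map (Q J) \<sigma>) (rkl J x) = nt_comp \<sigma> x"
    using r(1)[of x F] r(3)[of x \<sigma>] assms f by auto
  show "sl (Suc k) y \<Longrightarrow> set y \<subseteq> J \<Longrightarrow> x \<preceq> y \<Longrightarrow> arr_map (obj_map (Q J) F) (rkl J x, rkl J y) = arr_map F (x, y)"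
    using r(2)[of x y F] assms f by auto
qed

text \<open>Between the images of \<open>F\<close> and \<open>G\<close> the comparison isomorphisms
  are identities, so the components on different \<open>J\<close> restrict to each other strictly.
  The component at \<open>x\<close> may thus be read off at any \<open>J\<close> that contains its
  vertices, in particular at \<open>set x\<close>; the transformation so obtained is extended by
  \<open>good\<close> and lifted back from the monoid.\<close>

lemma segal_full:
  assumes F: "F \<in> Obj (scat (W k) n)" and G: "G \<in> Obj (scat (W k) n)"
    and f: "f \<in> hom PL (pl_obj_of P (val_at (W k)) Q F) (pl_obj_of P (val_at (W k)) Q G)"
  shows "\<exists>t\<in>hom (scat (W k) n) F G. arr_map (pl_induced (scat (W k) n) P (val_at (W k)) Q) t = f"
proof -
  have fJ: "pl_comp f J \<in> hom (scat (W k) (set_dim J)) (obj_map (Q J) F) (obj_map (Q J) G)" if J: "J \<in> P" for J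
    using pl_homD(4)[OF f J] J by (simp add: pl_val_of val_at_def)
  have comp: "pl_comp f J = arr_map (restr_at (W k) J I) (pl_comp f I)" if IJ: "I \<in> P" "J \<in> P" "J \<subseteq> I" for I J
  proof -
    have "pl_comp f J \<cdot>\<^bsub>val_at (W k) J\<^esub> Id (val_at (W k) J) (obj_map (Q J) F) =
        Id (val_at (W k) J) (obj_map (Q J) G) \<cdot>\<^bsub>val_at (W k) J\<^esub> arr_map (restr_at (W k) J I) (pl_comp f I)"
      using pl_homD(5)[OF f IJ] IJ by (simp add: pl_obj_of_def)
    moreover have "arr_map (restr_at (W k) J I) (pl_comp f I) \<in> hom (val_at (W k) J) (obj_map (Q J) F) (obj_map (Q J) G)"
      using functorD(5)[OF P_functor[OF IJ] fJ[OF IJ(1), folded val_at_def]]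
        restr_restr(1)[of "{0..n}" I J F k, OF _ PD(3)[OF IJ(1)] IJ(3) PD(2)[OF IJ(2)]]
        restr_restr(1)[of "{0..n}" I J G k, OF _ PD(3)[OF IJ(1)] IJ(3) PD(2)[OF IJ(2)]] F G unfolding val_full by simp
    ultimately show ?thesis
      using category.id_left[OF val_category] category.id_right[OF val_category fJ[OF IJ(2), folded val_at_def]] by simp
  qed
  define s where "s J x = nt_comp (pl_comp f J) (rkl J x)" for J x
  have sJI: "s J x = s I x" if "I \<in> P" "J \<in> P" "J \<subseteq> I" "sl (Suc k) x" "set x \<subseteq> J" for I J x
    unfolding s_def comp[OF that(1-3)] using restr_simps(3)[OF PD(1)[OF that(1)] that(3) PD(2)[OF that(2)] that(4,5)] .
  have sh: "s J x \<in> hom C (obj_map F x) (obj_map G x)" if "J \<in> P" "sl (Suc k) x" "set x \<subseteq> J" for J x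
    using W_natD(1)[OF fJ[OF that(1)] rkl_simplices[OF PD(1)[OF that(1)] that(3,2)]] Q_simps(1)[OF that] by (simp add: s_def)
  have sn: "s J y \<cdot> arr_map F (x, y) = arr_map G (x, y) \<cdot> s J x"
    if "J \<in> P" "sl (Suc k) x" "set x \<subseteq> J" "sl (Suc k) y" "set y \<subseteq> J" "x \<preceq> y" for J x y
    using W_natD(2)[OF fJ[OF that(1)] rkl_simplices[OF PD(1)[OF that(1)] that(3,2)] rkl_simplices[OF PD(1)[OF that(1)] that(5,4)] rkl_le[OF PD(1)[OF that(1)] that(6)]]
      Q_simps(2)[OF that(1-6)] by (simp add: s_def)
  have "m.nat_tr k n P' (\<lambda>x y. lift (arr_map F (x, y))) (\<lambda>x y. lift (arr_map G (x, y))) (\<lambda>x. lift (s (set x) x))"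
  proof (rule nat_trI[OF F G _ _ mono])
    fix x assume x: "x \<in> simplices k n" "P' (set x)"
    show "s (set x) x \<in> hom C (obj_map F x) (obj_map G x)" using sh[OF set_P[OF x] simplex_sl[OF x(1)]] by blast
  next
    fix x y assume h: "x \<in> simplices k n" "y \<in> simplices k n" "x \<preceq> y" "P' (set x \<union> set y)"
    have J: "set x \<union> set y \<in> P" using h(1,4) P by (auto simp: simplices_def)
    have p: "P' (set x)" "P' (set y)" using mono[OF h(4)] by auto
    note sx = simplex_sl[OF h(1)] and sy = simplex_sl[OF h(2)]
    have "s (set x) x = s (set x \<union> set y) x" "s (set y) y = s (set x \<union> set y) y"
      using sJI[OF J set_P[OF h(1) p(1)] _ sx] sJI[OF J set_P[OF h(2) p(2)] _ sy] by auto
    thus "s (set y) y \<cdot> arr_map F (x, y) = arr_map G (x, y) \<cdot> s (set x) x" using sn[OF J sx _ sy _ h(3)] by simp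
  qed
  from good_tr[OF W_WD(1)[OF F] W_WD(1)[OF G] this]
  obtain \<tau> where \<tau>: "m.nat_tr k n (\<lambda>S. True) (\<lambda>x y. lift (arr_map F (x, y))) (\<lambda>x y. lift (arr_map G (x, y))) \<tau>"
    "\<And>x. x \<in> simplices k n \<Longrightarrow> P' (set x) \<Longrightarrow> \<tau> x = lift (s (set x) x)"
    by blast
  have "\<exists>g\<in>hom C (obj_map F x) (obj_map G x). \<tau> x = lift g" if x: "x \<in> simplices k n" for x
  proof -
    have "m.H (lift (arr_map F (x, x))) (lift (arr_map G (x, x))) (\<tau> x)"
      using \<tau>(1) x unfolding m.nat_tr_def simplices_Xs by blast
    thus ?thesis using H_iff[OF W_WD(2)[OF F x] W_WD(2)[OF G x]] W_WD(3)[OF F x] W_WD(3)[OF G x] by (simp add: ob_def)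
  qed
  then obtain t where t: "\<And>x. x \<in> simplices k n \<Longrightarrow> t x \<in> hom C (obj_map F x) (obj_map G x)" "\<And>x. x \<in> simplices k n \<Longrightarrow> \<tau> x = lift (t x)"
    by metis
  have tn: "t y \<cdot> arr_map F (x, y) = arr_map G (x, y) \<cdot> t x" if h: "x \<in> simplices k n" "y \<in> simplices k n" "x \<preceq> y" for x y
  proof (rule lift_inj[OF comp_closed[OF W_WD(4)[OF F h] t(1)[OF h(2)]] comp_closed[OF t(1)[OF h(1)] W_WD(4)[OF G h]]])
    have "mmul (\<tau> y) (lift (arr_map F (x, y))) = mmul (lift (arr_map G (x, y))) (\<tau> x)"
      using \<tau>(1) h unfolding m.nat_tr_def simplices_Xs by blast
    thus "lift (t y \<cdot> arr_map F (x, y)) = lift (arr_map G (x, y) \<cdot> t x)"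
      unfolding t(2)[OF h(1)] t(2)[OF h(2)] mmul_lift[OF W_WD(4)[OF F h] t(1)[OF h(2)]] mmul_lift[OF t(1)[OF h(1)] W_WD(4)[OF G h]] .
  qed
  define T where "T = \<lparr>nt_src = F, nt_tgt = G, nt_comp = restrict t (simplices k n)\<rparr>"
  have T: "T \<in> hom (scat (W k) n) F G" using F G t(1) tn by (auto simp: W_hom natural_simplex T_def)
  have "arr_map (Q J) T = pl_comp f J" if J: "J \<in> P" for J
  proof (rule nat_trans_eqI)
    note TQ = functorD(5)[OF Q_functor[OF J] T, unfolded val_at_def]
    show "nt_src (arr_map (Q J) T) = nt_src (pl_comp f J)" "nt_tgt (arr_map (Q J) T) = nt_tgt (pl_comp f J)"
      using TQ fJ[OF J] by (auto simp: W_hom)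
    show "nt_comp (arr_map (Q J) T) = nt_comp (pl_comp f J)"
    proof (rule extensionalityI)
      show "nt_comp (arr_map (Q J) T) \<in> extensional (simplices k (set_dim J))" "nt_comp (pl_comp f J) \<in> extensional (simplices k (set_dim J))"
        using TQ fJ[OF J] by (auto simp: W_hom)
      fix x' assume x': "x' \<in> simplices k (set_dim J)"
      define x where "x = comp_mono (sorted_list_of_set J) x'"
      have x: "x \<in> simplices k n" "rkl J x = x'" "set x \<subseteq> J"
        using comp_mono_simplices[OF enum_simplex[OF PD(1,2,3)[OF J]] x'] rkl_comp[OF PD(1,2)[OF J] x'] enum_set[OF PD(1,2)[OF J] x'] by (auto simp: x_def)
      have px: "P' (set x)" using mono[OF PD(4)[OF J] x(3)] .
      note sx = simplex_sl[OF x(1)]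
      have "lift (t x) = lift (s J x)" using \<tau>(2)[OF x(1) px] t(2)[OF x(1)] sJI[OF J set_P[OF x(1) px] x(3) sx] by simp
      hence "t x = s J x" using lift_inj[OF t(1)[OF x(1)] sh[OF J sx x(3)]] by blast
      thus "nt_comp (arr_map (Q J) T) x' = nt_comp (pl_comp f J) x'"
        using Q_simps(3)[OF J sx x(3), of T] x by (simp add: T_def s_def)
    qed
  qed
  hence "arr_map (pl_induced (scat (W k) n) P (val_at (W k)) Q) T = f"
  proof -
    assume TJ: "\<And>J. J \<in> P \<Longrightarrow> arr_map (Q J) T = pl_comp f J"
    have d: "Dom (scat (W k) n) T = F" "Cod (scat (W k) n) T = G" using T by (auto simp: hom_def)
    have fe: "pl_comp f \<in> extensional P" "pl_src f = pl_obj_of P (val_at (W k)) Q F" "pl_tgt f = pl_obj_of P (val_at (W k)) Q G"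
      using pl_homD(1-3)[OF f] by auto
    have "(\<lambda>J\<in>P. arr_map (Q J) T) = pl_comp f" by (rule extensionalityI[OF _ fe(1)]) (auto simp: TJ)
    thus ?thesis using d fe(2,3) by (intro pl_arr_eqI) (simp_all add: pl_induced_def)
  qed
  thus ?thesis using T by blast
qed

lemma segal_faithful:
  assumes s: "s \<in> hom (scat (W k) n) F G" and t: "t \<in> hom (scat (W k) n) F G"
    and e: "arr_map (pl_induced (scat (W k) n) P (val_at (W k)) Q) s = arr_map (pl_induced (scat (W k) n) P (val_at (W k)) Q) t"
  shows "s = t"
proof -
  have F: "F \<in> Obj (scat (W k) n)" and G: "G \<in> Obj (scat (W k) n)" using s by (auto simp: W_hom)
  have eJ: "arr_map (Q J) s = arr_map (Q J) t" if "J \<in> P" for J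
    using arg_cong[OF e, of "\<lambda>f. pl_comp f J"] that by (simp add: pl_induced_def)
  have "\<forall>x\<in>simplices k n. lift (nt_comp s x) = lift (nt_comp t x)"
  proof -
    have nt: "m.nat_tr k n (\<lambda>S. True) (\<lambda>x y. lift (arr_map F (x, y))) (\<lambda>x y. lift (arr_map G (x, y))) (\<lambda>x. lift (nt_comp u x))"
      if "u \<in> hom (scat (W k) n) F G" for u by (rule nat_trI[OF F G]) (use W_natD[OF that] in auto)
    have "lift (nt_comp s x) = lift (nt_comp t x)" if x: "x \<in> simplices k n" "P' (set x)" for x
      using Q_simps(3)[OF set_P[OF x] simplex_sl[OF x(1)], of s] Q_simps(3)[OF set_P[OF x] simplex_sl[OF x(1)], of t] eJ[OF set_P[OF x]] by simp
    from good_unique[OF W_WD(1)[OF F] W_WD(1)[OF G] nt[OF s] nt[OF t] this] show ?thesis by blast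
  qed
  hence "nt_comp s x = nt_comp t x" if "x \<in> simplices k n" for x
    using lift_inj[OF W_natD(1)[OF s that] W_natD(1)[OF t that]] that by blast
  moreover have "nt_comp s \<in> extensional (simplices k n)" "nt_comp t \<in> extensional (simplices k n)" "nt_src s = nt_src t" "nt_tgt s = nt_tgt t"
    using s t by (auto simp: W_hom)
  ultimately show ?thesis using extensionalityI[of "nt_comp s" "simplices k n" "nt_comp t"] by (intro nat_trans_eqI) auto
qed

text \<open>An object of the pseudo-limit is made strict by transporting the diagram on each \<open>J\<close> along the isomorphisms \<open>c J x\<close>
  to the values at \<open>x\<close> of the diagram on \<open>set x\<close>.\<close>

lemma segal_ess:
  assumes y: "y \<in> pl_objects P (val_at (W k)) (restr_at (W k))"
  shows "\<exists>G\<in>Obj (scat (W k) n). \<exists>e\<in>hom PL (pl_obj_of P (val_at (W k)) Q G) y. iso_arr PL e"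
proof -
  let ?V = "pl_val y"
  define o' where "o' J x = obj_map (?V J) (rkl J x)" for J x
  define a where "a J u v = arr_map (?V J) (rkl J u, rkl J v)" for J u v
  define \<phi> where "\<phi> J I x = nt_comp (pl_iso y J I) (rkl J x)" for J I x
  have V: "?V J \<in> Obj (scat (W k) (set_dim J))" if "J \<in> P" for J using pl_objD(1)[OF y that] unfolding val_at_def .
  have rs: "rkl J x \<in> simplices k (set_dim J)" if "J \<in> P" "sl (Suc k) x" "set x \<subseteq> J" for J x
    using rkl_simplices[OF PD(1)[OF that(1)] that(3,2)] .
  have oO: "o' J x \<in> Obj C" if "J \<in> P" "sl (Suc k) x" "set x \<subseteq> J" for J x
    unfolding o'_def using W_WD(2)[OF V[OF that(1)] rs[OF that]] .
  have ah: "a J u v \<in> hom C (o' J u) (o' J v)" if "J \<in> P" "sl (Suc k) u" "set u \<subseteq> J" "sl (Suc k) v" "set v \<subseteq> J" "u \<preceq> v" for J u v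
    unfolding a_def o'_def using W_WD(4)[OF V[OF that(1)] rs[OF that(1-3)] rs[OF that(1,4,5)] rkl_le[OF PD(1)[OF that(1)] that(6)]] .
  have aid: "a J x x = Id C (o' J x)" if "J \<in> P" "sl (Suc k) x" "set x \<subseteq> J" for J x
    unfolding a_def o'_def using W_WD(3)[OF V[OF that(1)] rs[OF that]] .
  have ph: "pl_iso y J I \<in> hom (scat (W k) (set_dim J)) (obj_map (restr_at (W k) J I) (?V I)) (?V J)" if "I \<in> P" "J \<in> P" "J \<subseteq> I" for I J
    using pl_objD(2)[OF y that] unfolding val_at_def .
  have \<phi>h: "\<phi> J I x \<in> hom C (o' I x) (o' J x)" if "I \<in> P" "J \<in> P" "J \<subseteq> I" "sl (Suc k) x" "set x \<subseteq> J" for I J x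
    using W_natD(1)[OF ph[OF that(1-3)] rs[OF that(2,4,5)]] restr_simps(1)[OF PD(1)[OF that(1)] that(3) PD(2)[OF that(2)] that(4,5)]
    by (simp add: \<phi>_def o'_def)
  have \<phi>i: "iso_arr C (\<phi> J I x)" if "I \<in> P" "J \<in> P" "J \<subseteq> I" "sl (Suc k) x" "set x \<subseteq> J" for I J x
    unfolding \<phi>_def by (rule W_isoD[OF pl_objD(3)[OF y that(1-3), unfolded val_at_def] ph[OF that(1-3)] rs[OF that(2,4,5)]])
  have \<phi>n: "\<phi> J I v \<cdot> a I u v = a J u v \<cdot> \<phi> J I u"
    if "I \<in> P" "J \<in> P" "J \<subseteq> I" "sl (Suc k) u" "set u \<subseteq> J" "sl (Suc k) v" "set v \<subseteq> J" "u \<preceq> v" for I J u v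
    using W_natD(2)[OF ph[OF that(1-3)] rs[OF that(2,4,5)] rs[OF that(2,6,7)] rkl_le[OF PD(1)[OF that(2)] that(8)]]
      restr_simps(2)[OF PD(1)[OF that(1)] that(3) PD(2)[OF that(2)] that(4-8)]
    by (simp add: \<phi>_def a_def)
  have \<phi>c: "\<phi> L I x = \<phi> L J x \<cdot> \<phi> J I x" if "I \<in> P" "J \<in> P" "L \<in> P" "L \<subseteq> J" "J \<subseteq> I" "sl (Suc k) x" "set x \<subseteq> L" for L I J x
    using pl_objD(5)[OF y that(1-5)] rs[OF that(3,6,7)] restr_simps(3)[OF PD(1)[OF that(2)] that(4) PD(2)[OF that(3)] that(6,7)]
    by (simp add: \<phi>_def val_at_def W_simps)
  have Pset: "set x \<in> P" if "J \<in> P" "sl (Suc k) x" "set x \<subseteq> J" for J x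
    using that P mono[OF PD(4)[OF that(1)] that(3)] by (auto simp: sl_def)
  \<comment> \<open>\<open>set x\<close> is the smallest member of \<open>P\<close> that contains
    the vertices of \<open>x\<close>; every larger member is compared with it, so its value serves
    as the common representative.\<close>
  define c where "c J x = \<phi> (set x) J x" for J x
  have ch: "c J x \<in> hom C (o' J x) (o' (set x) x)" and ci: "iso_arr C (c J x)" if "J \<in> P" "sl (Suc k) x" "set x \<subseteq> J" for J x
    unfolding c_def using \<phi>h[OF that(1) Pset[OF that] that(3,2)] \<phi>i[OF that(1) Pset[OF that] that(3,2)] by auto
  have "\<exists>d. d \<in> hom C (o' (set x) x) (o' J x) \<and> d \<cdot> c J x = Id C (o' J x) \<and> c J x \<cdot> d = Id C (o' (set x) x)"
    if "J \<in> P" "sl (Suc k) x" "set x \<subseteq> J" for J x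
    using iso_arrE[OF ci[OF that] ch[OF that]] by metis
  note dex = this
  define d where "d J x = (SOME d. d \<in> hom C (o' (set x) x) (o' J x) \<and> d \<cdot> c J x = Id C (o' J x) \<and> c J x \<cdot> d = Id C (o' (set x) x))" for J x
  have dh: "d J x \<in> hom C (o' (set x) x) (o' J x)" and dc: "d J x \<cdot> c J x = Id C (o' J x)"
    and cd: "c J x \<cdot> d J x = Id C (o' (set x) x)" if "J \<in> P" "sl (Suc k) x" "set x \<subseteq> J" for J x
    using someI_ex[OF dex[OF that], folded d_def] by blast+
  have di: "iso_arr C (d J x)" if "J \<in> P" "sl (Suc k) x" "set x \<subseteq> J" for J x
    by (rule iso_arrI[OF dh[OF that] ch[OF that] cd[OF that] dc[OF that]])
  let ?c = "\<lambda>J x. lift (c J x)" and ?d = "\<lambda>J x. lift (d J x)" and ?a = "\<lambda>J u v. lift (a J u v)" and ?f = "\<lambda>J I x. lift (\<phi> J I x)"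
  have DC: "mmul (?d J x) (?c J x) = ob (o' J x)" "mmul (?c J x) (?d J x) = ob (o' (set x) x)" if "J \<in> P" "sl (Suc k) x" "set x \<subseteq> J" for J x
    unfolding mmul_lift[OF ch[OF that] dh[OF that]] mmul_lift[OF dh[OF that] ch[OF that]] dc[OF that] cd[OF that] ob_def by simp_all
  have cH: "m.H (ob (o' J x)) (ob (o' (set x) x)) (?c J x)" "m.H (ob (o' (set x) x)) (ob (o' J x)) (?d J x)" if "J \<in> P" "sl (Suc k) x" "set x \<subseteq> J" for J x
    using lift_H[OF ch[OF that]] lift_H[OF dh[OF that]] by auto
  have fH: "m.H (ob (o' I x)) (ob (o' J x)) (?f J I x)" if "I \<in> P" "J \<in> P" "J \<subseteq> I" "sl (Suc k) x" "set x \<subseteq> J" for I J x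
    using lift_H[OF \<phi>h[OF that]] .
  have aH: "m.H (ob (o' J u)) (ob (o' J v)) (?a J u v)" if "J \<in> P" "sl (Suc k) u" "set u \<subseteq> J" "sl (Suc k) v" "set v \<subseteq> J" "u \<preceq> v" for J u v
    using lift_H[OF ah[OF that]] .
  \<comment> \<open>The cocycle condition for \<open>set x\<close>, \<open>J\<close> and
    \<open>I\<close>.\<close>
  have cc: "?c I x = mmul (?c J x) (?f J I x)" if "I \<in> P" "J \<in> P" "J \<subseteq> I" "sl (Suc k) x" "set x \<subseteq> J" for I J x
    unfolding mmul_lift[OF \<phi>h[OF that] ch[OF that(2,4,5)]] using \<phi>c[OF that(1,2) Pset[OF that(2,4,5)] that(5,3,4)] by (simp add: c_def)
  have dd: "?d J x = mmul (?f J I x) (?d I x)" if h: "I \<in> P" "J \<in> P" "J \<subseteq> I" "sl (Suc k) x" "set x \<subseteq> J" for I J x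
  proof -
    have xI: "set x \<subseteq> I" using h by auto
    have "?d J x = mmul (?d J x) (mmul (?c I x) (?d I x))" using DC(2)[OF h(1,4) xI] m.HD(3)[OF cH(2)[OF h(2,4,5)]] by simp
    also have "\<dots> = mmul (mmul (?d J x) (?c J x)) (mmul (?f J I x) (?d I x))" unfolding cc[OF h] m.mul_assoc ..
    also have "\<dots> = mmul (?f J I x) (?d I x)" unfolding DC(1)[OF h(2,4,5)] using m.HD(5)[OF fH[OF h]] .
    finally show ?thesis .
  qed
  \<comment> \<open>The diagram on \<open>J\<close>, conjugated so that its object at
    \<open>x\<close> no longer depends on \<open>J\<close>.\<close>
  define B where "B J u v = mmul (?c J v) (mmul (?a J u v) (?d J u))" for J u v
  have BWD: "m.WD k (\<lambda>S. S \<subseteq> J) (B J)" if J: "J \<in> P" for J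
  proof -
    have "m.WD k (\<lambda>S. S \<subseteq> J) (\<lambda>u v. lift (arr_map (?V J) (map (\<lambda>x. card {y \<in> J. y < x}) u, map (\<lambda>x. card {y \<in> J. y < x}) v)))"
    proof (rule m.WD_map[OF W_WD(1)[OF V[OF J]]])
      show "mono_on J (\<lambda>x. card {y \<in> J. y < x})" using rank_mono[OF PD(1)[OF J]] by (auto simp: mono_on_def)
      show "(\<lambda>x. card {y \<in> J. y < x}) ` J \<subseteq> {0..set_dim J}"
        using nth_rank(1)[OF PD(1)[OF J]] set_dim_card[OF PD(1,2)[OF J]] by fastforce
    qed
    hence "m.WD k (\<lambda>S. S \<subseteq> J) (?a J)" unfolding a_def rkl_def .
    thus ?thesis unfolding B_def
    proof (rule m.WD_iso[where v = "\<lambda>x. ob (o' (set x) x)"])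
      fix x assume x: "sl (Suc k) x" "set x \<subseteq> J"
      have e: "?a J x x = ob (o' J x)" using aid[OF J x] by (simp add: ob_def)
      show "m.H (?a J x x) (ob (o' (set x) x)) (?c J x)" "m.H (ob (o' (set x) x)) (?a J x x) (?d J x)"
        "mmul (?d J x) (?c J x) = ?a J x x" "mmul (?c J x) (?d J x) = ob (o' (set x) x)"
        unfolding e using cH[OF J x] DC[OF J x] by auto
    qed auto
  qed
  \<comment> \<open>The union of the two vertex sets is the smallest member of \<open>P\<close> on
    which the arrow is visible. Naturality of \<open>\<phi>\<close> and the cocycle condition show
    in \<open>AB\<close> that every larger member gives the same arrow.\<close>
  define A where "A u v = B (set u \<union> set v) u v" for u v
  have AB: "A u v = B J u v" if J: "J \<in> P" and u: "sl (Suc k) u" "set u \<subseteq> J" and v: "sl (Suc k) v" "set v \<subseteq> J" and uv: "u \<preceq> v" for J u v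
  proof -
    let ?K = "set u \<union> set v"
    have KJ: "?K \<subseteq> J" using u v by blast
    have K: "?K \<in> P" using P u(1) mono[OF PD(4)[OF J] KJ] by (auto simp: sl_def)
    have uK: "set u \<subseteq> ?K" "set v \<subseteq> ?K" by auto
    have n: "mmul (?f ?K J v) (?a J u v) = mmul (?a ?K u v) (?f ?K J u)"
      unfolding mmul_lift[OF ah[OF J u v uv] \<phi>h[OF J K KJ v(1) uK(2)]] mmul_lift[OF \<phi>h[OF J K KJ u(1) uK(1)] ah[OF K u(1) uK(1) v(1) uK(2) uv]]
        \<phi>n[OF J K KJ u(1) uK(1) v(1) uK(2) uv] ..
    have "B J u v = mmul (?c ?K v) (mmul (mmul (?f ?K J v) (?a J u v)) (?d J u))"
      unfolding B_def cc[OF J K KJ v(1) uK(2)] m.mul_assoc ..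
    also have "\<dots> = mmul (?c ?K v) (mmul (?a ?K u v) (mmul (?f ?K J u) (?d J u)))" unfolding n m.mul_assoc ..
    also have "\<dots> = A u v" unfolding A_def B_def dd[OF J K KJ u(1) uK(1), symmetric] ..
    finally show ?thesis by simp
  qed
  have "m.WD k P' A"
  proof (rule m.WD_local)
    fix S assume "P' S" "S \<noteq> {}"
    hence S: "S \<in> P" using P by blast
    show "m.WD k (\<lambda>T. T \<subseteq> S) A" by (rule m.WD_cong[OF BWD[OF S]]) (use AB[OF S] in auto)
  qed
  from good_extend[OF this] obtain E where E: "m.WDn k n E"
    "\<And>u v. u \<in> simplices k n \<Longrightarrow> v \<in> simplices k n \<Longrightarrow> u \<preceq> v \<Longrightarrow> P' (set u \<union> set v) \<Longrightarrow> E u v = A u v"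
    by blast
  have Axx: "A x x = ob (o' (set x) x)" if "J \<in> P" "sl (Suc k) x" "set x \<subseteq> J" for J x
  proof -
    have "A x x = mmul (?c J x) (mmul (ob (o' J x)) (?d J x))" using AB[OF that that(2,3)] aid[OF that] by (simp add: B_def ob_def)
    also have "mmul (ob (o' J x)) (?d J x) = ?d J x" using m.HD(4)[OF cH(2)[OF that]] .
    finally show ?thesis using DC(2)[OF that] by simp
  qed
  \<comment> \<open>At simplices in \<open>P'\<close> the object must be \<open>o' (set x) x\<close>
    itself, so that \<open>d J x\<close> can serve as a component of the comparison; an object with
    the same image in the monoid could be a different zero object.\<close>
  have "\<exists>w. w \<in> Obj C \<and> ob w = E x x \<and> (P' (set x) \<longrightarrow> w = o' (set x) x)" if x: "x \<in> simplices k n" for x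
  proof (cases "P' (set x)")
    case True
    have "E x x = ob (o' (set x) x)" using E(2)[OF x x list_le_refl] True Axx[OF set_P[OF x True] simplex_sl[OF x]] by simp
    thus ?thesis using oO[OF set_P[OF x True] simplex_sl[OF x]] by auto
  next
    case False
    have "m.H (E x x) (E x x) (E x x)" by (rule m.diag_H[OF m.WD_D(1)[OF E(1)]]) (use x in \<open>auto simp: simplices_def sl_def\<close>)
    from m.HD(1)[OF this] show ?thesis using False by (auto simp: mOb_def)
  qed
  then obtain w where w: "\<And>x. x \<in> simplices k n \<Longrightarrow> w x \<in> Obj C \<and> ob (w x) = E x x \<and> (P' (set x) \<longrightarrow> w x = o' (set x) x)" by metis
  obtain G where G: "is_functor (simplex_cat k n) C G" "extensional_ftr (simplex_cat k n) G" "waldhausen_diagram C (kc_monos C) (kc_epis C) k n G"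
    and Go: "\<And>x. x \<in> simplices k n \<Longrightarrow> obj_map G x = w x"
    and Ga: "\<And>x y. x \<in> simplices k n \<Longrightarrow> y \<in> simplices k n \<Longrightarrow> x \<preceq> y \<Longrightarrow> lift (arr_map G (x, y)) = E x y"
    using realize[OF E(1), of w] w by metis
  have GO: "G \<in> Obj (scat (W k) n)" using G by (simp add: W_obj)
  \<comment> \<open>The comparison undoes the conjugation: its components are the inverses
    \<open>d\<close> of the isomorphisms \<open>c\<close>.\<close>
  define e' where "e' J = \<lparr>nt_src = obj_map (Q J) G, nt_tgt = ?V J,
    nt_comp = (\<lambda>x\<in>simplices k (set_dim J). d J (comp_mono (sorted_list_of_set J) x))\<rparr>" for J
  have ec: "nt_comp (e' J) (rkl J x) = d J x" if "J \<in> P" "sl (Suc k) x" "set x \<subseteq> J" for J x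
    using rs[OF that] comp_rkl[OF PD(1)[OF that(1)] that(3)] by (simp add: e'_def)
  have un: "\<exists>x. x' = rkl J x \<and> sl (Suc k) x \<and> set x \<subseteq> J \<and> x = comp_mono (sorted_list_of_set J) x'" if J: "J \<in> P" and x': "x' \<in> simplices k (set_dim J)" for J x'
    using comp_mono_simplices[OF enum_simplex[OF PD(1,2,3)[OF J]] x'] rkl_comp[OF PD(1,2)[OF J] x'] enum_set[OF PD(1,2)[OF J] x']
    by (auto simp: simplices_def sl_def)
  have eh: "e' J \<in> hom (scat (W k) (set_dim J)) (obj_map (Q J) G) (?V J)" if J: "J \<in> P" for J
  proof -
    have Gx: "obj_map (obj_map (Q J) G) (rkl J x) = o' (set x) x" if x: "sl (Suc k) x" "set x \<subseteq> J" for x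
    proof -
      have "P' (set x)" using mono[OF PD(4)[OF J] x(2)] .
      thus ?thesis using Q_simps(1)[OF J x, of G] Go[OF sl_simplex[OF x J]] w[OF sl_simplex[OF x J]] by simp
    qed
    have "natural (simplex_cat k (set_dim J)) C (obj_map (Q J) G) (?V J) (nt_comp (e' J))"
      unfolding natural_simplex
    proof (intro conjI ballI impI)
      fix x' assume "x' \<in> simplices k (set_dim J)"
      then obtain x where x: "x' = rkl J x" "sl (Suc k) x" "set x \<subseteq> J" using un[OF J] by blast
      show "nt_comp (e' J) x' \<in> hom C (obj_map (obj_map (Q J) G) x') (obj_map (?V J) x')"
        unfolding x(1) ec[OF J x(2,3)] Gx[OF x(2,3)] using dh[OF J x(2,3)] unfolding o'_def .
    next
      fix u' v' assume uv': "u' \<in> simplices k (set_dim J)" "v' \<in> simplices k (set_dim J)" "u' \<preceq> v'"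
      obtain u where u: "u' = rkl J u" "sl (Suc k) u" "set u \<subseteq> J" "u = comp_mono (sorted_list_of_set J) u'" using un[OF J uv'(1)] by blast
      obtain v where v: "v' = rkl J v" "sl (Suc k) v" "set v \<subseteq> J" "v = comp_mono (sorted_list_of_set J) v'" using un[OF J uv'(2)] by blast
      have le: "u \<preceq> v" unfolding u(4) v(4) by (rule comp_mono_le[OF enum_simplex[OF PD(1,2,3)[OF J]] uv'(2,1,3)])
      note us = sl_simplex[OF u(2,3) J] and vs = sl_simplex[OF v(2,3) J]
      have p: "P' (set u \<union> set v)" "P' (set u)" "P' (set v)" using mono[OF PD(4)[OF J]] u(3) v(3) by auto
      have gh: "arr_map G (u, v) \<in> hom C (o' (set u) u) (o' (set v) v)"
        using W_WD(4)[OF GO us vs le] Go[OF us] Go[OF vs] w[OF us] w[OF vs] p by simp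
      have "lift (d J v \<cdot> arr_map G (u, v)) = mmul (?d J v) (B J u v)"
        unfolding mmul_lift[OF gh dh[OF J v(2,3)], symmetric] Ga[OF us vs le] E(2)[OF us vs le p(1)] AB[OF J u(2,3) v(2,3) le] ..
      also have "\<dots> = mmul (mmul (?d J v) (?c J v)) (mmul (?a J u v) (?d J u))" unfolding B_def m.mul_assoc ..
      also have "\<dots> = mmul (?a J u v) (?d J u)" unfolding DC(1)[OF J v(2,3)] using m.HD(5)[OF aH[OF J u(2,3) v(2,3) le]] .
      also have "\<dots> = lift (a J u v \<cdot> d J u)" by (rule mmul_lift[OF dh[OF J u(2,3)] ah[OF J u(2,3) v(2,3) le]])
      finally have "d J v \<cdot> arr_map G (u, v) = a J u v \<cdot> d J u"
        using lift_inj[OF comp_closed[OF gh dh[OF J v(2,3)]] comp_closed[OF dh[OF J u(2,3)] ah[OF J u(2,3) v(2,3) le]]] by blast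
      thus "nt_comp (e' J) v' \<cdot> arr_map (obj_map (Q J) G) (u', v') = arr_map (?V J) (u', v') \<cdot> nt_comp (e' J) u'"
        unfolding u(1) v(1) ec[OF J u(2,3)] ec[OF J v(2,3)] Q_simps(2)[OF J u(2,3) v(2,3) le] a_def .
    qed
    moreover have "nt_comp (e' J) \<in> extensional (simplices k (set_dim J))" by (simp add: e'_def)
    moreover have "obj_map (Q J) G \<in> Obj (scat (W k) (set_dim J))" using functorD(1)[OF Q_functor[OF J] GO] unfolding val_at_def .
    ultimately show ?thesis using V[OF J] by (simp add: W_hom e'_def)
  qed
  have ei: "iso_arr (scat (W k) (set_dim J)) (e' J)" if J: "J \<in> P" for J
  proof (rule W_isoI[OF eh[OF J]])
    fix x' assume "x' \<in> simplices k (set_dim J)"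
    then obtain x where x: "x' = rkl J x" "sl (Suc k) x" "set x \<subseteq> J" using un[OF J] by blast
    show "iso_arr C (nt_comp (e' J) x')" unfolding x(1) ec[OF J x(2,3)] by (rule di[OF J x(2,3)])
  qed
  have comp: "e' J \<cdot>\<^bsub>val_at (W k) J\<^esub> Id (val_at (W k) J) (obj_map (Q J) G) = pl_iso y J I \<cdot>\<^bsub>val_at (W k) J\<^esub> arr_map (restr_at (W k) J I) (e' I)"
    if IJ: "I \<in> P" "J \<in> P" "J \<subseteq> I" for I J
  proof -
    have "e' J = pl_iso y J I \<cdot>\<^bsub>scat (W k) (set_dim J)\<^esub> arr_map (restr_at (W k) J I) (e' I)"
    proof (rule nat_trans_eqI)
      show "nt_src (e' J) = nt_src (pl_iso y J I \<cdot>\<^bsub>scat (W k) (set_dim J)\<^esub> arr_map (restr_at (W k) J I) (e' I))"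
        using restr_restr(1)[of "{0..n}" I J G k, OF _ PD(3)[OF IJ(1)] IJ(3) PD(2)[OF IJ(2)]] GO unfolding val_full
        by (simp add: W_simps restr_src e'_def)
      show "nt_tgt (e' J) = nt_tgt (pl_iso y J I \<cdot>\<^bsub>scat (W k) (set_dim J)\<^esub> arr_map (restr_at (W k) J I) (e' I))"
        using ph[OF IJ] by (simp add: W_simps W_hom e'_def)
      show "nt_comp (e' J) = nt_comp (pl_iso y J I \<cdot>\<^bsub>scat (W k) (set_dim J)\<^esub> arr_map (restr_at (W k) J I) (e' I))"
      proof (rule extensionalityI[of _ "simplices k (set_dim J)"])
        fix x' assume x': "x' \<in> simplices k (set_dim J)"
        then obtain x where x: "x' = rkl J x" "sl (Suc k) x" "set x \<subseteq> J" using un[OF IJ(2)] by blast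
        have xI: "set x \<subseteq> I" using x(3) IJ(3) by blast
        have "lift (d J x) = lift (\<phi> J I x \<cdot> d I x)"
          unfolding mmul_lift[OF dh[OF IJ(1) x(2) xI] \<phi>h[OF IJ x(2,3)], symmetric] by (rule dd[OF IJ x(2,3)])
        hence "d J x = \<phi> J I x \<cdot> d I x"
          using lift_inj[OF dh[OF IJ(2) x(2,3)] comp_closed[OF dh[OF IJ(1) x(2) xI] \<phi>h[OF IJ x(2,3)]]] by blast
        moreover have "nt_comp (arr_map (restr_at (W k) J I) (e' I)) (rkl J x) = d I x"
          using restr_simps(3)[OF PD(1)[OF IJ(1)] IJ(3) PD(2)[OF IJ(2)] x(2,3)] ec[OF IJ(1) x(2) xI] by simp
        ultimately show "nt_comp (e' J) x' = nt_comp (pl_iso y J I \<cdot>\<^bsub>scat (W k) (set_dim J)\<^esub> arr_map (restr_at (W k) J I) (e' I)) x'"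
          unfolding x(1) ec[OF IJ(2) x(2,3)] using rs[OF IJ(2) x(2,3)] by (simp add: W_simps \<phi>_def)
      qed (simp_all add: e'_def W_simps)
    qed
    thus ?thesis using category.id_right[OF W_category eh[OF IJ(2)]] by (simp add: val_at_def)
  qed
  define e where "e = \<lparr>pl_src = pl_obj_of P (val_at (W k)) Q G, pl_tgt = y, pl_comp = restrict e' P\<rparr>"
  have Gp: "pl_obj_of P (val_at (W k)) Q G \<in> pl_objects P (val_at (W k)) (restr_at (W k))"
    using functorD(1)[OF segal_functor GO] by (simp add: pl_induced_def)
  have eH: "e \<in> hom PL (pl_obj_of P (val_at (W k)) Q G) y"
    unfolding pl_hom
  proof (intro conjI ballI impI)
    show "pl_comp e \<in> (\<Pi>\<^sub>E i \<in> P. hom (val_at (W k) i) (pl_val (pl_obj_of P (val_at (W k)) Q G) i) (pl_val y i))"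
      using eh by (auto simp: e_def pl_val_of val_at_def)
    fix I J assume IJ: "I \<in> P" "J \<in> P" "J \<le> I"
    show "pl_comp e J \<cdot>\<^bsub>val_at (W k) J\<^esub> pl_iso (pl_obj_of P (val_at (W k)) Q G) J I =
      pl_iso y J I \<cdot>\<^bsub>val_at (W k) J\<^esub> arr_map (restr_at (W k) J I) (pl_comp e I)"
      using comp[OF IJ] IJ by (simp add: e_def pl_obj_of_def)
  qed (use y Gp in \<open>simp_all add: e_def\<close>)
  have "iso_arr PL e"
    by (rule pl_isoI[OF val_category P_functor eH]) (use ei in \<open>simp_all add: e_def val_at_def\<close>)
  thus ?thesis using GO eH by blast
qed

lemma segal: "segal_for (W k) n P"
  unfolding segal_for_def
proof (rule equivalence_if[OF W_category category_pseudo_limit[OF val_category P_functor] segal_functor])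
  fix F G f assume "F \<in> Obj (scat (W k) n)" "G \<in> Obj (scat (W k) n)"
    "f \<in> hom PL (obj_map (pl_induced (scat (W k) n) P (val_at (W k)) Q) F) (obj_map (pl_induced (scat (W k) n) P (val_at (W k)) Q) G)"
  thus "\<exists>t\<in>hom (scat (W k) n) F G. arr_map (pl_induced (scat (W k) n) P (val_at (W k)) Q) t = f"
    using segal_full[of F G f] by (simp add: pl_induced_def)
next
  fix y assume "y \<in> Obj PL"
  thus "\<exists>G\<in>Obj (scat (W k) n). \<exists>e\<in>hom PL (obj_map (pl_induced (scat (W k) n) P (val_at (W k)) Q) G) y. iso_arr PL e"
    using segal_ess[of y] by (simp add: pl_induced_def)
qed (assumption | rule segal_faithful)+

end

theorem fully_segal: "fully_segal_category (2 * k) (W k)"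
  unfolding fully_segal_category_def lower_segal_def upper_segal_def
proof (intro conjI allI impI)
  show "is_simplicial_cat (W k)" by (rule waldhausen_simplicial[OF category_axioms])
next
  fix n assume n: "2 * k \<le> n"
  show "segal_for (W k) n (lower_poset n (2 * k))"
  proof (rule segal[OF m.good_lower lower_poset_iff[OF n]])
    show "locP n k S \<Longrightarrow> T \<subseteq> S \<Longrightarrow> locP n k T" for S T by (rule locP_mono)
  qed (simp add: locP_def)
next
  fix n assume n: "2 * k \<le> n"
  show "segal_for (W k) n (upper_poset n (2 * k))"
  proof (rule segal[OF m.good_upper upper_poset_iff[OF n]])
    fix S T assume "flipP n (locP n k) S" "T \<subseteq> S"
    thus "flipP n (locP n k) T" unfolding flipP_def using locP_mono[of n k _ "(\<lambda>i. n - i) ` T"] by blast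
  qed (simp add: flipP_def)
qed

end

theorem theorem5p6:
  fixes k :: nat and C :: "('o, 'm) cat"
  assumes "stringent C"
  shows "fully_segal_category (2 * k) (waldhausen k C (kc_monos C) (kc_epis C))"
proof -
  obtain z where "kc_cat C z" using stringent_kc_cat[OF assms] .
  thus ?thesis by (rule kc_cat.fully_segal)
qed

end
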